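(* Let $\mathbb{B}$ and $\mathbb{B}'$ be finite relational structures over finite vocabularies $L$ and $L'$ such that $\mathbb{B}'$ is obtained from $\mathbb{B}$ by a finite sequence of the following constructions: (a) passing to a structure pp-interpretable in the current one; (b) passing to a homomorphically equivalent structure; (c) if the current structure $\mathbb{C}$ is a core, passing to the expansion of $\mathbb{C}$ by the unary relations $\{c\}$ for all $c$ in its domain. Then there is a polynomial-time computable map $\mathbb{A}\mapsto\mathbb{A}'$ from finite $L'$-structures to finite $L$-structures, with $\mathbb{A}'$ of size linear in the size of $\mathbb{A}$ and with $\mathbb{A}'\to\mathbb{B}$ iff $\mathbb{A}\to\mathbb{B}'$, such that for any local propositional encoding schemes $E$ for $\mathrm{CSP}(\mathbb{B})$ and $E'$ for $\mathrm{CSP}(\mathbb{B}')$ the following holds: for any positive integers $t$, $k$, $s$ and any finite $L'$-structure $\mathbb{A}$, if there is a Frege refutation of $E(\mathbb{A}')$ of depth $t$, bottom fan-in $k$ and size $s$, then there is a Frege refutation of $E'(\mathbb{A})$ of depth $t$, bottom fan-in polynomial in $k$, and size polynomial in $2^k$, $s$ and the size of $\mathbb{A}$.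
   Context: Structures: an $L$-structure has a domain and relations $R(\mathbb{A})\subseteq A^r$ for $R\in L$ of arity $r$; a homomorphism preserves all relations; $\mathbb{A}\to\mathbb{B}$ means a homomorphism exists. The size of $\mathbb{A}$ is $|A|$ plus the number of tuples in its relations. A pp-formula is a first-order formula using only relation symbols, equality, conjunction and existential quantification. $\mathbb{B}'$ is pp-interpretable in $\mathbb{B}$ if there are $n\ge1$ and a surjective partial map $f:B^n\to B'$ such that the domain of $f$, the preimage under $f$ of the equality relation on $B'$, and the preimage of every relation of $\mathbb{B}'$ (all viewed as relations on $B$ of the appropriate arity) are definable in $\mathbb{B}$ by pp-formulas. Two structures over the same vocabulary are homomorphically equivalent if there are homomorphisms both ways. A finite structure is a core if all its endomorphisms are surjective. Encodings: $V(A,B)$ is the set of variables $X(a,b)$, $a\in A,b\in B$; truth assignments correspond to relations $\subseteq A\times B$. A propositional encoding scheme $E$ for $\mathrm{CSP}(\mathbb{B})$ assigns to each finite $L$-structure $\mathbb{A}$ a set of clauses over $V(A,B)$ whose satisfying assignments are exactly those corresponding to homomorphisms $\mathbb{A}\to\mathbb{B}$. It is local if it is invariant under isomorphisms (renaming $X(a,b)\mapsto X(f(a),b)$ along an isomorphism $f$) and $E(\mathbb{A})$ is the union of $E(a)$, $a\in A$ (encoding of the one-point structure with empty relations), and $E(R(a_1,\dots,a_r))$, $(a_1,\dots,a_r)\in R(\mathbb{A})$ (encoding of the structure on $\{a_1,\dots,a_r\}$ whose only non-empty relation is $R=\{(a_1,\dots,a_r)\}$). Frege (Tait-style, negation normal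 form): axiom $A\vee\overline A$; cut $C\vee A,\ D\vee\overline A\vdash C\vee D$; $C\vee A,\ D\vee B\vdash C\vee D\vee(A\wedge B)$; weakening $C\vdash C\vee D$. A refutation derives the empty formula; size is the sum of formula sizes. $\Sigma_{1,k}$ = $k$-DNFs, $\Pi_{1,k}$ = $k$-CNFs, $\Sigma_{t,k}$ = disjunctions of $\Pi_{t-1,k}$-formulas, $\Pi_{t,k}$ = conjunctions of $\Sigma_{t-1,k}$-formulas; depth $t$ and bottom fan-in $k$ means all formulas are $\Sigma_{t,k}$. *)

theory Defs
  imports
    "HOL-Library.FSet"
    "HOL-Computational_Algebra.Polynomial"
begin

section \<open>Relational structures\<close>

text \<open>A vocabulary maps each of its relation symbols to its arity. Symbols are natural numbers.\<close>

type_synonym vocabulary = "nat \<Rightarrow> nat option"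

record 'a struct =
  univ :: "'a set"
  rel :: "nat \<Rightarrow> 'a list set"

definition tuples :: "nat \<Rightarrow> 'a set \<Rightarrow> 'a list set" where
  "tuples r A = {t. length t = r \<and> set t \<subseteq> A}"

text \<open>
  The condition on symbols outside \<open>L\<close> makes the representation of an \<open>L\<close>-structure unique.
  Empty domains and relation symbols of arity 0 are allowed.
\<close>

definition fin_struct :: "vocabulary \<Rightarrow> 'a struct \<Rightarrow> bool" where
  "fin_struct L A \<longleftrightarrow> finite (dom L) \<and> finite (univ A) \<and>
     (\<forall>R. case L R of None \<Rightarrow> rel A R = {} | Some r \<Rightarrow> rel A R \<subseteq> tuples r (univ A))"

definition struct_size :: "vocabulary \<Rightarrow> 'a struct \<Rightarrow> nat" where
  "struct_size L A = card (univ A) + (\<Sum>R\<in>dom L. card (rel A R))"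

definition is_hom :: "('a \<Rightarrow> 'b) \<Rightarrow> 'a struct \<Rightarrow> 'b struct \<Rightarrow> bool" where
  "is_hom h A B \<longleftrightarrow> h ` univ A \<subseteq> univ B \<and> (\<forall>R. \<forall>t\<in>rel A R. map h t \<in> rel B R)"

definition maps_to :: "'a struct \<Rightarrow> 'b struct \<Rightarrow> bool" where
  "maps_to A B \<longleftrightarrow> (\<exists>h. is_hom h A B)"

definition is_iso :: "('a \<Rightarrow> 'b) \<Rightarrow> 'a struct \<Rightarrow> 'b struct \<Rightarrow> bool" where
  "is_iso f A B \<longleftrightarrow> bij_betw f (univ A) (univ B) \<and> (\<forall>R. rel B R = map f ` rel A R)"

definition hom_equiv :: "'a struct \<Rightarrow> 'b struct \<Rightarrow> bool" where
  "hom_equiv A B \<longleftrightarrow> maps_to A B \<and> maps_to B A"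

definition is_core :: "'a struct \<Rightarrow> bool" where
  "is_core C \<longleftrightarrow> (\<forall>h. is_hom h C C \<longrightarrow> h ` univ C = univ C)"


section \<open>Primitive positive interpretations\<close>

datatype pp =
    PAtom nat "nat list"
  | PEq nat nat
  | PAnd pp pp
  | PEx nat pp

primrec pp_wf :: "vocabulary \<Rightarrow> pp \<Rightarrow> bool" where
  "pp_wf L (PAtom R xs) \<longleftrightarrow> L R = Some (length xs)"
| "pp_wf L (PEq x y) \<longleftrightarrow> True"
| "pp_wf L (PAnd \<phi> \<psi>) \<longleftrightarrow> pp_wf L \<phi> \<and> pp_wf L \<psi>"
| "pp_wf L (PEx x \<phi>) \<longleftrightarrow> pp_wf L \<phi>"

primrec pp_fv :: "pp \<Rightarrow> nat set" where
  "pp_fv (PAtom R xs) = set xs"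
| "pp_fv (PEq x y) = {x, y}"
| "pp_fv (PAnd \<phi> \<psi>) = pp_fv \<phi> \<union> pp_fv \<psi>"
| "pp_fv (PEx x \<phi>) = pp_fv \<phi> - {x}"

primrec pp_sat :: "'a struct \<Rightarrow> (nat \<Rightarrow> 'a) \<Rightarrow> pp \<Rightarrow> bool" where
  "pp_sat B v (PAtom R xs) \<longleftrightarrow> map v xs \<in> rel B R"
| "pp_sat B v (PEq x y) \<longleftrightarrow> v x = v y"
| "pp_sat B v (PAnd \<phi> \<psi>) \<longleftrightarrow> pp_sat B v \<phi> \<and> pp_sat B v \<psi>"
| "pp_sat B v (PEx x \<phi>) \<longleftrightarrow> (\<exists>b\<in>univ B. pp_sat B (v(x := b)) \<phi>)"

definition pp_definable :: "vocabulary \<Rightarrow> 'a struct \<Rightarrow> nat \<Rightarrow> 'a list set \<Rightarrow> bool" where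
  "pp_definable L B m D \<longleftrightarrow>
     (\<exists>\<phi>. pp_wf L \<phi> \<and> pp_fv \<phi> \<subseteq> {..<m} \<and> D = {t \<in> tuples m (univ B). pp_sat B ((!) t) \<phi>})"

text \<open>
  The preimage of a relation \<open>T\<close> under a partial map \<open>f\<close> on \<open>n\<close>-tuples, where an \<open>r\<close>-tuple of
  \<open>n\<close>-tuples is read as one tuple of length \<open>r * n\<close>.
\<close>

definition preimage :: "('a list \<Rightarrow> 'b option) \<Rightarrow> 'b list set \<Rightarrow> 'a list set" where
  "preimage f T = {concat xss |xss. \<exists>t\<in>T. map f xss = map Some t}"

definition pp_interpretable ::
    "vocabulary \<Rightarrow> 'a struct \<Rightarrow> vocabulary \<Rightarrow> 'b struct \<Rightarrow> bool" where
  "pp_interpretable L B L' B' \<longleftrightarrow>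
     (\<exists>n \<ge> 1. \<exists>f :: 'a list \<Rightarrow> 'b option.
        dom f \<subseteq> tuples n (univ B) \<and> ran f = univ B' \<and>
        pp_definable L B n (dom f) \<and>
        pp_definable L B (2 * n) (preimage f {[b, b] |b. b \<in> univ B'}) \<and>
        (\<forall>R r. L' R = Some r \<longrightarrow> pp_definable L B (r * n) (preimage f (rel B' R))))"


section \<open>The constructions\<close>

text \<open>
  Expansion by singleton unary relations: \<open>p c\<close> is the new symbol that denotes \<open>{c}\<close>.
\<close>

definition expand_voc :: "(nat \<Rightarrow> nat) \<Rightarrow> nat struct \<Rightarrow> vocabulary \<Rightarrow> vocabulary" where
  "expand_voc p C L = (\<lambda>R. if R \<in> p ` univ C then Some 1 else L R)"

definition expand_struct :: "(nat \<Rightarrow> nat) \<Rightarrow> nat struct \<Rightarrow> nat struct" where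
  "expand_struct p C =
     \<lparr>univ = univ C, rel = (\<lambda>R. rel C R \<union> {[c] |c. c \<in> univ C \<and> p c = R})\<rparr>"

text \<open>
  All structures in a sequence of constructions are finite, so up to isomorphism
  their domains are sets of natural numbers.
\<close>

inductive construction ::
    "vocabulary \<times> nat struct \<Rightarrow> vocabulary \<times> nat struct \<Rightarrow> bool" where
  pp_interpretation: "fin_struct L' B' \<Longrightarrow> pp_interpretable L B L' B' \<Longrightarrow> construction (L, B) (L', B')"
| hom_equivalence: "fin_struct L B' \<Longrightarrow> hom_equiv B B' \<Longrightarrow> construction (L, B) (L, B')"
| constants: "is_core C \<Longrightarrow> inj_on p (univ C) \<Longrightarrow> p ` univ C \<inter> dom L = {} \<Longrightarrow>
    construction (L, C) (expand_voc p C L, expand_struct p C)"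


section \<open>Local propositional encoding schemes\<close>

datatype 'v lit = Pos 'v | Neg 'v

type_synonym 'v clause = "'v lit fset"

primrec lit_var :: "'v lit \<Rightarrow> 'v" where
  "lit_var (Pos v) = v"
| "lit_var (Neg v) = v"

primrec lit_sat :: "'v set \<Rightarrow> 'v lit \<Rightarrow> bool" where
  "lit_sat H (Pos v) \<longleftrightarrow> v \<in> H"
| "lit_sat H (Neg v) \<longleftrightarrow> v \<notin> H"

definition clauses_sat :: "'v set \<Rightarrow> 'v clause set \<Rightarrow> bool" where
  "clauses_sat H F \<longleftrightarrow> (\<forall>C\<in>F. \<exists>l. l |\<in>| C \<and> lit_sat H l)"

text \<open>
  The variable \<open>X(a,b)\<close> is the pair \<open>(a, b)\<close>; a truth assignment is the set of its true variables.
\<close>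

definition encoding_scheme ::
    "vocabulary \<Rightarrow> 'b struct \<Rightarrow> ('a struct \<Rightarrow> ('a \<times> 'b) clause set) \<Rightarrow> bool" where
  "encoding_scheme L B E \<longleftrightarrow> (\<forall>A. fin_struct L A \<longrightarrow>
     (\<forall>C\<in>E A. \<forall>l. l |\<in>| C \<longrightarrow> lit_var l \<in> univ A \<times> univ B) \<and>
     (\<forall>H \<subseteq> univ A \<times> univ B.
        clauses_sat H (E A) \<longleftrightarrow> (\<exists>h. is_hom h A B \<and> H = {(a, h a) |a. a \<in> univ A})))"

definition point_struct :: "'a \<Rightarrow> 'a struct" where
  "point_struct a = \<lparr>univ = {a}, rel = (\<lambda>_. {})\<rparr>"

definition tuple_struct :: "nat \<Rightarrow> 'a list \<Rightarrow> 'a struct" where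
  "tuple_struct R t = \<lparr>univ = set t, rel = (\<lambda>_. {})(R := {t})\<rparr>"

definition local_scheme ::
    "vocabulary \<Rightarrow> ('a struct \<Rightarrow> ('a \<times> 'b) clause set) \<Rightarrow> bool" where
  "local_scheme L E \<longleftrightarrow>
     (\<forall>A A' f. fin_struct L A \<and> fin_struct L A' \<and> is_iso f A A' \<longrightarrow>
        E A' = fimage (map_lit (\<lambda>(a, b). (f a, b))) ` E A) \<and>
     (\<forall>A. fin_struct L A \<longrightarrow>
        E A = (\<Union>a\<in>univ A. E (point_struct a)) \<union>
              (\<Union>R\<in>dom L. \<Union>t\<in>rel A R. E (tuple_struct R t)))"


section \<open>Frege proofs\<close>

text \<open>
  Formulas in negation normal form with conjunctions and disjunctions of finite sets of formulas.
  The binary connectives of the inference rules are associative, commutative and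
  idempotent and have the empty disjunction and the empty conjunction as units: \<open>disj_fm\<close> and
  \<open>conj_fm\<close> below merge the two sets of disjuncts (conjuncts) and identify the disjunction
  (conjunction) of a single formula with that formula. The side formulas \<open>C\<close> and \<open>D\<close> of a
  rule may thus be empty.
\<close>

datatype 'v fm = Lit "'v lit" | Conj "'v fm fset" | Disj "'v fm fset"

abbreviation empty_fm :: "'v fm" where
  "empty_fm \<equiv> Disj {||}"

primrec lit_neg :: "'v lit \<Rightarrow> 'v lit" where
  "lit_neg (Pos v) = Neg v"
| "lit_neg (Neg v) = Pos v"

primrec fm_neg :: "'v fm \<Rightarrow> 'v fm" where
  "fm_neg (Lit l) = Lit (lit_neg l)"
| "fm_neg (Conj S) = Disj (fm_neg |`| S)"
| "fm_neg (Disj S) = Conj (fm_neg |`| S)"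

lemma size_fset_member [termination_simp]:
  "x |\<in>| S \<Longrightarrow> f x < Suc (\<Sum>x\<in>fset S. Suc (f x))" for f :: "'a \<Rightarrow> nat"
  by (rule le_less_trans[OF _ less_Suc_eq_le[THEN iffD2, OF member_le_sum[where f = "\<lambda>x. Suc (f x)"]]]) auto

fun fm_size :: "'v fm \<Rightarrow> nat" where
  "fm_size (Lit l) = 1"
| "fm_size (Conj S) = 1 + (\<Sum>F\<in>fset S. fm_size F)"
| "fm_size (Disj S) = 1 + (\<Sum>F\<in>fset S. fm_size F)"

fun disjuncts :: "'v fm \<Rightarrow> 'v fm fset" where
  "disjuncts (Disj S) = S"
| "disjuncts F = {|F|}"

fun conjuncts :: "'v fm \<Rightarrow> 'v fm fset" where
  "conjuncts (Conj S) = S"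
| "conjuncts F = {|F|}"

definition mk_disj :: "'v fm fset \<Rightarrow> 'v fm" where
  "mk_disj S = (if \<exists>F. S = {|F|} then (THE F. S = {|F|}) else Disj S)"

definition mk_conj :: "'v fm fset \<Rightarrow> 'v fm" where
  "mk_conj S = (if \<exists>F. S = {|F|} then (THE F. S = {|F|}) else Conj S)"

definition disj_fm :: "'v fm \<Rightarrow> 'v fm \<Rightarrow> 'v fm" where
  "disj_fm F G = mk_disj (disjuncts F |\<union>| disjuncts G)"

definition conj_fm :: "'v fm \<Rightarrow> 'v fm \<Rightarrow> 'v fm" where
  "conj_fm F G = mk_conj (conjuncts F |\<union>| conjuncts G)"

text \<open>
  The canonical representatives: conjunctions and disjunctions alternate, and none has
  exactly one member.
\<close>

fun fm_nf :: "'v fm \<Rightarrow> bool" where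
  "fm_nf (Lit l) \<longleftrightarrow> True"
| "fm_nf (Conj S) \<longleftrightarrow> fcard S \<noteq> 1 \<and> (\<forall>F\<in>fset S. fm_nf F \<and> (\<nexists>T. F = Conj T))"
| "fm_nf (Disj S) \<longleftrightarrow> fcard S \<noteq> 1 \<and> (\<forall>F\<in>fset S. fm_nf F \<and> (\<nexists>T. F = Disj T))"

definition clause_fm :: "'v clause \<Rightarrow> 'v fm" where
  "clause_fm C = mk_disj (Lit |`| C)"

inductive frege_rule :: "'v fm list \<Rightarrow> 'v fm \<Rightarrow> bool" where
  axiom: "frege_rule [] (disj_fm A (fm_neg A))"
| cut: "frege_rule [disj_fm C A, disj_fm D (fm_neg A)] (disj_fm C D)"
| conj_intro: "frege_rule [disj_fm C A, disj_fm D B] (disj_fm (disj_fm C D) (conj_fm A B))"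
| weakening: "frege_rule [C] (disj_fm C D)"

definition frege_proof :: "'v fm set \<Rightarrow> 'v fm list \<Rightarrow> bool" where
  "frege_proof \<Gamma> \<pi> \<longleftrightarrow> (\<forall>i<length \<pi>. fm_nf (\<pi> ! i) \<and>
     (\<pi> ! i \<in> \<Gamma> \<or> (\<exists>Fs. set Fs \<subseteq> set (take i \<pi>) \<and> frege_rule Fs (\<pi> ! i))))"

definition frege_refutation :: "'v clause set \<Rightarrow> 'v fm list \<Rightarrow> bool" where
  "frege_refutation F \<pi> \<longleftrightarrow> frege_proof (clause_fm ` F) \<pi> \<and> \<pi> \<noteq> [] \<and> last \<pi> = empty_fm"

definition proof_size :: "'v fm list \<Rightarrow> nat" where
  "proof_size \<pi> = sum_list (map fm_size \<pi>)"

text \<open>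
  \<open>Sigma_fm t k\<close> and \<open>Pi_fm t k\<close> are the classes \<open>\<Sigma>\<^sub>t\<^sub>,\<^sub>k\<close> and \<open>\<Pi>\<^sub>t\<^sub>,\<^sub>k\<close> for \<open>t \<ge> 1\<close>; at level 0 they are the
  \<open>k\<close>-clauses and the \<open>k\<close>-terms. As a formula is the disjunction, and also the conjunction, of
  itself, the classes are cumulative for \<open>k \<ge> 1\<close>.
\<close>

fun Sigma_fm :: "nat \<Rightarrow> nat \<Rightarrow> 'v fm \<Rightarrow> bool"
and Pi_fm :: "nat \<Rightarrow> nat \<Rightarrow> 'v fm \<Rightarrow> bool" where
  "Sigma_fm 0 k F \<longleftrightarrow> fcard (disjuncts F) \<le> k \<and> (\<forall>G\<in>fset (disjuncts F). \<exists>l. G = Lit l)"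
| "Pi_fm 0 k F \<longleftrightarrow> fcard (conjuncts F) \<le> k \<and> (\<forall>G\<in>fset (conjuncts F). \<exists>l. G = Lit l)"
| "Sigma_fm (Suc t) k F \<longleftrightarrow> (\<forall>G\<in>fset (disjuncts F). Pi_fm t k G)"
| "Pi_fm (Suc t) k F \<longleftrightarrow> (\<forall>G\<in>fset (conjuncts F). Sigma_fm t k G)"

text \<open>A refutation of depth \<open>t\<close>, bottom fan-in \<open>k\<close> and size \<open>s\<close>.\<close>

definition bounded_refutation ::
    "'v clause set \<Rightarrow> nat \<Rightarrow> nat \<Rightarrow> nat \<Rightarrow> 'v fm list \<Rightarrow> bool" where
  "bounded_refutation F t k s \<pi> \<longleftrightarrow>
     frege_refutation F \<pi> \<and> (\<forall>G\<in>set \<pi>. Sigma_fm t k G) \<and> proof_size \<pi> = s"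


section \<open>Polynomial-time computable maps on structures\<close>

text \<open>
  The machine model: programs with structured control over finitely many stacks of symbols
  from a fixed finite alphabet; every assignment and every test costs one unit of time. Two
  stacks form the tape of a Turing machine, so these programs and deterministic multi-tape
  Turing machines simulate each other with polynomial (indeed linear) overhead.
\<close>

datatype symb = Zero | One | Elt | Tup | Arg

datatype com =
    Skip
  | Push nat symb
  | Pop nat
  | Seq com com
  | If_top nat symb com com
  | While_nonempty nat com

type_synonym stacks = "nat \<Rightarrow> symb list"

inductive exec :: "com \<Rightarrow> stacks \<Rightarrow> nat \<Rightarrow> stacks \<Rightarrow> bool" where
  skip: "exec Skip s 1 s"
| push: "exec (Push i x) s 1 (s(i := x # s i))"
| pop: "exec (Pop i) s 1 (s(i := tl (s i)))"
| seq: "exec c s m s' \<Longrightarrow> exec d s' n s'' \<Longrightarrow> exec (Seq c d) s (m + n) s''"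
| if_true: "s i \<noteq> [] \<and> hd (s i) = x \<Longrightarrow> exec c s n s' \<Longrightarrow> exec (If_top i x c d) s (Suc n) s'"
| if_false: "\<not> (s i \<noteq> [] \<and> hd (s i) = x) \<Longrightarrow> exec d s n s' \<Longrightarrow>
    exec (If_top i x c d) s (Suc n) s'"
| while_end: "s i = [] \<Longrightarrow> exec (While_nonempty i c) s 1 s"
| while_loop: "s i \<noteq> [] \<Longrightarrow> exec c s m s' \<Longrightarrow> exec (While_nonempty i c) s' n s'' \<Longrightarrow>
    exec (While_nonempty i c) s (Suc (m + n)) s''"

text \<open>Binary notation, least significant bit first.\<close>

fun bits :: "nat \<Rightarrow> symb list" where
  "bits n = (if n = 0 then [] else (if odd n then One else Zero) # bits (n div 2))"

definition code_elt :: "nat \<Rightarrow> symb list" where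
  "code_elt a = Elt # bits a"

definition code_tuple :: "nat \<times> nat list \<Rightarrow> symb list" where
  "code_tuple = (\<lambda>(R, t). Tup # bits R @ concat (map (\<lambda>a. Arg # bits a) t))"

text \<open>
  A word that encodes a structure lists the elements and then the tuples, each in any order and
  without repetitions.
\<close>

definition encodes :: "vocabulary \<Rightarrow> nat struct \<Rightarrow> symb list \<Rightarrow> bool" where
  "encodes L A w \<longleftrightarrow> (\<exists>es ts.
     distinct es \<and> set es = univ A \<and>
     distinct ts \<and> set ts = {(R, t). R \<in> dom L \<and> t \<in> rel A R} \<and>
     w = concat (map code_elt es) @ concat (map code_tuple ts))"

text \<open>Input and output are on stack 0, with the first symbol on top.\<close>

definition poly_time_map ::
    "vocabulary \<Rightarrow> vocabulary \<Rightarrow> (nat struct \<Rightarrow> nat struct) \<Rightarrow> bool" where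
  "poly_time_map L L' F \<longleftrightarrow> (\<exists>c. \<exists>p :: nat poly. \<forall>A w. fin_struct L A \<and> encodes L A w \<longrightarrow>
     (\<exists>n s. exec c ((\<lambda>_. [])(0 := w)) n s \<and> n \<le> poly p (length w) \<and> encodes L' (F A) (s 0)))"


section \<open>Polynomials in three variables\<close>

definition poly3 :: "nat \<Rightarrow> (nat \<Rightarrow> nat \<Rightarrow> nat \<Rightarrow> nat) \<Rightarrow> nat \<Rightarrow> nat \<Rightarrow> nat \<Rightarrow> nat" where
  "poly3 d q x y z = (\<Sum>i\<le>d. \<Sum>j\<le>d. \<Sum>l\<le>d. q i j l * x ^ i * y ^ j * z ^ l)"

end

theory Submission
  imports Defs
begin

text \<open>
  Each construction yields a gadget reduction to the expansion of \<open>B\<close> by equality. The elements of \<open>A\<close>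
  are replaced by blocks of copies and the tuples by the conjuncts of a primitive positive formula over
  these copies and new witnesses; for the expansion by constants a copy of the core is added, which
  every homomorphism to the core maps onto it by an automorphism. Equality is then eliminated by a
  quotient.

  In both steps the reductions are local: the value at \<open>x\<close> of the homomorphism from \<open>A'\<close> to \<open>B\<close>
  that corresponds to a homomorphism from \<open>A\<close> to \<open>B'\<close> is a function of the values of the latter at
  boundedly many elements of \<open>A\<close>. Hence one can substitute for each variable \<open>X(x,b)\<close> of \<open>E(A')\<close> a Boolean
  function of boundedly many variables of \<open>E'(A)\<close>. Terms and clauses of \<open>k\<close> literals become disjunctive and
  conjunctive normal forms of bottom fan-in \<open>O(k)\<close> and size \<open>2^O(k)\<close>, which leaves the depth unchanged.
  Since the encodings are local, the translation of a clause of \<open>E(A')\<close> follows from the clauses of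
  \<open>E'(A)\<close> on boundedly many variables, and so has a short derivation from them. For the quotient, the
  clauses that identify two elements of a class are first derived along a path of equality atoms.

  Reductions compose because every finite structure has a local encoding scheme, which serves for
  the intermediate structures of the sequence.
\<close>

section \<open>Normal forms of formulas\<close>

text \<open>The depth must be preserved exactly, and replacing a literal by a DNF would add a level.
  So every formula has two translations, a set of disjuncts and a set of conjuncts, and its context
  decides which one is used. The price: for a literal or a short conjunction, the translations of
  the formula and of its negation are no longer negations of each other. One is a single DNF, the
  other a union of DNFs of literals. Axioms and cuts on such formulas are therefore simulated by
  truth tables over the at most \<open>c * k\<close> variables concerned, and this is where the
  factor 2^O(k) arises. For the quotient, clauses over boundedly many variables do not suffice,
  since identified elements may be connected by long paths only. Hence a local simulation may refer
  to auxiliary clauses, here those that tie each element to its representative. Only the passage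
  from homomorphisms to \<open>B'\<close> to homomorphisms to \<open>B\<close> has to be local,
  since refutations travel against it; the converse may be any argument. Running times are handled
  on binary trees in a prefix code: a value on a stack needs no end marker, so that programs can be
  nested.\<close>

definition fBig :: "('a \<Rightarrow> 'b fset) \<Rightarrow> 'a fset \<Rightarrow> 'b fset" where
  "fBig f S = ffUnion (f |`| S)"

lemma in_fBig [simp]: "x |\<in>| fBig f S \<longleftrightarrow> (\<exists>y. y |\<in>| S \<and> x |\<in>| f y)"
  unfolding fBig_def by (induction S) auto

lemma fset_fBig: "fset (fBig f S) = (\<Union>y\<in>fset S. fset (f y))"
  by auto

lemma fBig_simps [simp]: "fBig f {||} = {||}" "fBig f (finsert x S) = f x |\<union>| fBig f S"
  "fBig f (S |\<union>| T) = fBig f S |\<union>| fBig f T"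
  by auto

lemma fBig_fimage [simp]: "fBig f (h |`| S) = fBig (\<lambda>x. f (h x)) S"
  by auto

lemma fimage_fBig: "h |`| fBig f S = fBig (\<lambda>x. h |`| f x) S"
  by (simp add: fset_inject[symmetric] fset_fBig image_UN)

lemma fBig_cong: "(\<And>x. x |\<in>| S \<Longrightarrow> f x = g x) \<Longrightarrow> fBig f S = fBig g S"
  by (rule fset_eqI) auto

lemma lit_neg_neg [simp]: "lit_neg (lit_neg l) = l"
  by (cases l) auto

lemma lit_var_neg [simp]: "lit_var (lit_neg l) = lit_var l"
  by (cases l) auto

lemma fm_neg_neg [simp]: "fm_neg (fm_neg F) = F"
proof (induction F)
  case (Conj S)
  then have "(\<lambda>x. fm_neg (fm_neg x)) |`| S = (\<lambda>x. x) |`| S" by (intro fimage_cong) auto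
  then show ?case by (simp add: fset.map_comp comp_def)
next
  case (Disj S)
  then have "(\<lambda>x. fm_neg (fm_neg x)) |`| S = (\<lambda>x. x) |`| S" by (intro fimage_cong) auto
  then show ?case by (simp add: fset.map_comp comp_def)
qed simp

lemma inj_fm_neg: "inj fm_neg"
  by (metis fm_neg_neg injI)

lemma fm_neg_eq_iff [simp]: "fm_neg F = fm_neg G \<longleftrightarrow> F = G"
  by (metis fm_neg_neg)

lemma fm_neg_fimage [simp]: "fm_neg |`| fm_neg |`| S = S"
  by (auto simp: fset.map_comp comp_def)

lemma fm_neg_comp [simp]: "(fm_neg \<circ> fm_neg) |`| S = S"
  by (auto simp: comp_def)

lemma fm_neg_iff: "fm_neg F = Lit l \<longleftrightarrow> F = Lit (lit_neg l)" "fm_neg F = Conj S \<longleftrightarrow> F = Disj (fm_neg |`| S)"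
  "fm_neg F = Disj S \<longleftrightarrow> F = Conj (fm_neg |`| S)"
  by (metis fm_neg.simps fm_neg_neg lit_neg_neg fm_neg_fimage)+

lemma fm_neg_all: "(\<forall>T. F \<noteq> Conj (fm_neg |`| T)) \<longleftrightarrow> (\<forall>T. F \<noteq> Conj T)"
  "(\<forall>T. F \<noteq> Disj (fm_neg |`| T)) \<longleftrightarrow> (\<forall>T. F \<noteq> Disj T)" "(\<exists>l. F = Lit (lit_neg l)) \<longleftrightarrow> (\<exists>l. F = Lit l)"
  by (metis fm_neg_fimage lit_neg_neg)+

lemma fcard_fm_neg [simp]: "fcard (fm_neg |`| S) = fcard S"
  by (simp add: fcard.rep_eq card_image inj_on_subset[OF inj_fm_neg])

lemma fm_size_neg [simp]: "fm_size (fm_neg F) = fm_size F"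
proof (induction F)
  case (Conj S)
  then show ?case by (simp add: sum.reindex inj_on_subset[OF inj_fm_neg])
next
  case (Disj S)
  then show ?case by (simp add: sum.reindex inj_on_subset[OF inj_fm_neg])
qed simp

lemma fm_size_pos: "0 < fm_size F"
  by (cases F) auto

lemma fm_nf_neg [simp]: "fm_nf (fm_neg F) = fm_nf F"
  by (induction F) (auto simp: fm_neg_iff fm_neg_all)

lemma conjuncts_neg: "conjuncts (fm_neg F) = fm_neg |`| disjuncts F"
  and disjuncts_neg: "disjuncts (fm_neg F) = fm_neg |`| conjuncts F"
  by (cases F; simp)+

text \<open>With this duality a claim on conjuncts is the claim on disjuncts for the negated
  formula, so that later only one of the two has to be proved.\<close>

lemma Sigma_Pi_neg: "Pi_fm t k (fm_neg F) = Sigma_fm t k F" "Sigma_fm t k (fm_neg F) = Pi_fm t k F"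
  by (induction t k F and t k F rule: Sigma_fm_Pi_fm.induct)
    (auto simp: conjuncts_neg disjuncts_neg fm_neg_iff fm_neg_all)

lemma mk_disj_single [simp]: "mk_disj {|F|} = F" and mk_conj_single [simp]: "mk_conj {|F|} = F"
  by (auto simp: mk_disj_def mk_conj_def)

lemma mk_disj_other: "\<nexists>F. S = {|F|} \<Longrightarrow> mk_disj S = Disj S" and mk_conj_other: "\<nexists>F. S = {|F|} \<Longrightarrow> mk_conj S = Conj S"
  by (auto simp: mk_disj_def mk_conj_def)

lemma fm_neg_mk_conj: "fm_neg (mk_conj S) = mk_disj (fm_neg |`| S)"
proof (cases "\<exists>F. S = {|F|}")
  case False
  then have "\<nexists>F. fm_neg |`| S = {|F|}"
    by (metis fm_neg_fimage fimage_finsert fimage_fempty)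
  with False show ?thesis by (simp add: mk_disj_other mk_conj_other)
qed auto

lemma fm_neg_mk_disj: "fm_neg (mk_disj S) = mk_conj (fm_neg |`| S)"
  by (metis fm_neg_mk_conj fm_neg_neg fm_neg_fimage)

text \<open>The formulas that may be members of a normal disjunction. On sets of them
  \<open>disjuncts\<close> inverts \<open>mk_disj\<close>, so that a line can be handled as its set
  of disjuncts.\<close>

definition ndisj :: "'v fm \<Rightarrow> bool" where "ndisj F \<longleftrightarrow> fm_nf F \<and> (\<nexists>T. F = Disj T)"
definition nconj :: "'v fm \<Rightarrow> bool" where "nconj F \<longleftrightarrow> fm_nf F \<and> (\<nexists>T. F = Conj T)"

lemma ndisj_neg [simp]: "ndisj (fm_neg F) = nconj F" "nconj (fm_neg F) = ndisj F"
  by (auto simp: ndisj_def nconj_def fm_neg_iff fm_neg_all)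

lemma ndisj_Lit [simp]: "ndisj (Lit l)" "nconj (Lit l)"
  by (auto simp: ndisj_def nconj_def)

declare fcard_fempty [simp]

lemma fcard_single [simp]: "fcard {|x|} = Suc 0"
  by (simp add: fcard.rep_eq)

lemma fcard_one: "fcard S = Suc 0 \<longleftrightarrow> (\<exists>F. S = {|F|})"
proof
  assume "fcard S = Suc 0"
  then obtain x where "fset S = {x}" by (auto simp: fcard.rep_eq card_1_singleton_iff)
  then have "S = {|x|}" by (metis bot_fset.rep_eq finsert.rep_eq fset_inject)
  then show "\<exists>F. S = {|F|}" by blast
qed auto

lemma disjuncts_ndisj: "ndisj F \<Longrightarrow> disjuncts F = {|F|}"
  by (cases F) (auto simp: ndisj_def)

lemma conjuncts_nconj: "nconj F \<Longrightarrow> conjuncts F = {|F|}"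
  by (cases F) (auto simp: nconj_def)

lemma disjuncts_mk_disj: "(\<And>F. F |\<in>| S \<Longrightarrow> ndisj F) \<Longrightarrow> disjuncts (mk_disj S) = S"
  by (cases "\<exists>F. S = {|F|}") (auto simp: disjuncts_ndisj mk_disj_other)

lemma nf_mk_disj: "(\<And>F. F |\<in>| S \<Longrightarrow> ndisj F) \<Longrightarrow> fm_nf (mk_disj S)"
  by (cases "\<exists>F. S = {|F|}") (auto simp: mk_disj_other fcard_one ndisj_def)

lemma conjuncts_mk_conj: "(\<And>F. F |\<in>| S \<Longrightarrow> nconj F) \<Longrightarrow> conjuncts (mk_conj S) = S"
  by (cases "\<exists>F. S = {|F|}") (auto simp: conjuncts_nconj mk_conj_other)

lemma nf_mk_conj: "(\<And>F. F |\<in>| S \<Longrightarrow> nconj F) \<Longrightarrow> fm_nf (mk_conj S)"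
  by (cases "\<exists>F. S = {|F|}") (auto simp: mk_conj_other fcard_one nconj_def)

lemma ndisj_disjuncts: "fm_nf F \<Longrightarrow> G |\<in>| disjuncts F \<Longrightarrow> ndisj G"
  by (cases F) (auto simp: ndisj_def)

lemma disj_fm_mk_disj: "(\<And>F. F |\<in>| S \<Longrightarrow> ndisj F) \<Longrightarrow> disj_fm (mk_disj S) A = mk_disj (S |\<union>| disjuncts A)"
  by (simp add: disj_fm_def disjuncts_mk_disj)

lemma size_mk_disj: "fm_size (mk_disj S) \<le> 1 + (\<Sum>F\<in>fset S. fm_size F)"
  and size_mk_conj: "fm_size (mk_conj S) \<le> 1 + (\<Sum>F\<in>fset S. fm_size F)"
  by (cases "\<exists>F. S = {|F|}"; auto simp: mk_disj_other mk_conj_other)+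

lemma size_disjuncts: "(\<Sum>F\<in>fset (disjuncts G). fm_size F) \<le> fm_size G"
  and size_conjuncts: "(\<Sum>F\<in>fset (conjuncts G). fm_size F) \<le> fm_size G"
  by (cases G; auto)+

section \<open>The classes of the depth hierarchy\<close>

lemma Sigma_fm_mono: "k \<le> k' \<Longrightarrow> Sigma_fm t k F \<Longrightarrow> Sigma_fm t k' F"
  and Pi_fm_mono: "k \<le> k' \<Longrightarrow> Pi_fm t k F \<Longrightarrow> Pi_fm t k' F"
  by (induction t k F and t k F rule: Sigma_fm_Pi_fm.induct) auto

lemma Sigma_Pi_Lit [simp]: "1 \<le> k \<Longrightarrow> Sigma_fm t k (Lit l)" "1 \<le> k \<Longrightarrow> Pi_fm t k (Lit l)"
  by (induction t) auto

text \<open>A formula that is not a disjunction is its own only disjunct, and dually, so it changes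
  from one class to the other at the cost of a level. For a proper disjunction or conjunction the
  induction hypothesis is applied to the formula and to its members.\<close>

lemma Sigma_Pi_Suc:
  assumes "1 \<le> k"
  shows "(Sigma_fm t k F \<longrightarrow> Sigma_fm (Suc t) k F \<and> Pi_fm (Suc t) k F) \<and>
    (Pi_fm t k F \<longrightarrow> Sigma_fm (Suc t) k F \<and> Pi_fm (Suc t) k F)"
proof (induction t arbitrary: F)
  case 0
  have L: "Sigma_fm 0 k G \<and> Pi_fm 0 k G" if "\<exists>l. G = Lit l" for G :: "'a fm" using assms that by (elim exE) simp
  show ?case using assms
  proof (cases F)
    case (Conj S)
    have "Sigma_fm (Suc 0) k F \<and> Pi_fm (Suc 0) k F" if "Pi_fm 0 k F"
    proof -
      have "\<forall>G|\<in>|S. \<exists>l. G = Lit l" using that Conj by simp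
      then have "\<forall>G|\<in>|S. Sigma_fm 0 k G" using L by blast
      then show ?thesis using that Conj by (simp del: Sigma_fm.simps(1) Pi_fm.simps(1))
    qed
    then show ?thesis using Conj by simp
  next
    case (Disj S)
    have "Sigma_fm (Suc 0) k F \<and> Pi_fm (Suc 0) k F" if "Sigma_fm 0 k F"
    proof -
      have "\<forall>G|\<in>|S. \<exists>l. G = Lit l" using that Disj by simp
      then have "\<forall>G|\<in>|S. Pi_fm 0 k G" using L by blast
      then show ?thesis using that Disj by (simp del: Sigma_fm.simps(1) Pi_fm.simps(1))
    qed
    then show ?thesis using Disj by simp
  qed simp
next
  case (Suc t)
  show ?case
  proof (intro conjI impI)
    assume F: "Sigma_fm (Suc t) k F"
    show "Sigma_fm (Suc (Suc t)) k F"
      unfolding Sigma_fm.simps(2)[of "Suc t"] using F[unfolded Sigma_fm.simps(2)[of t]] Suc.IH by blast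
    show "Pi_fm (Suc (Suc t)) k F"
    proof (cases F)
      case (Conj S)
      with F have "Pi_fm t k F" by simp
      then have "Pi_fm (Suc t) k F" using Suc.IH by blast
      then have "\<forall>G|\<in>|conjuncts F. Sigma_fm t k G" by simp
      then show ?thesis unfolding Pi_fm.simps(2)[of "Suc t"] using Suc.IH by blast
    next
      case (Disj S)
      then show ?thesis using F by simp
    qed (use assms in simp)
  next
    assume F: "Pi_fm (Suc t) k F"
    show "Pi_fm (Suc (Suc t)) k F"
      unfolding Pi_fm.simps(2)[of "Suc t"] using F[unfolded Pi_fm.simps(2)[of t]] Suc.IH by blast
    show "Sigma_fm (Suc (Suc t)) k F"
    proof (cases F)
      case (Disj S)
      with F have "Sigma_fm t k F" by simp
      then have "Sigma_fm (Suc t) k F" using Suc.IH by blast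
      then have "\<forall>G|\<in>|disjuncts F. Pi_fm t k G" by simp
      then show ?thesis unfolding Sigma_fm.simps(2)[of "Suc t"] using Suc.IH by blast
    next
      case (Conj S)
      then show ?thesis using F by simp
    qed (use assms in simp)
  qed
qed

lemma Pi_0_le: "1 \<le> k \<Longrightarrow> Pi_fm 0 k F \<Longrightarrow> Pi_fm t k F"
  by (induction t) (use Sigma_Pi_Suc in blast)+

text \<open>A conjunction with a single member collapses to that member, which may be a disjunction;
  its disjuncts then become disjuncts of a translation. As a disjunction in a \<open>Pi\<close>
  class, it is a \<open>Sigma\<close> formula one level lower, so its disjuncts are literals or lie
  two levels lower.\<close>

lemma Pi_disjuncts: "1 \<le> k \<Longrightarrow> Pi_fm t k F \<Longrightarrow> G |\<in>| disjuncts F \<Longrightarrow> Pi_fm t k G"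
proof -
  assume k: "1 \<le> k" and F: "Pi_fm t k F" and G: "G |\<in>| disjuncts F"
  show ?thesis
  proof (cases F)
    case (Disj S)
    show ?thesis
    proof (cases t)
      case 0
      then show ?thesis using F Disj by auto
    next
      case (Suc t')
      then have S: "Sigma_fm t' k F" using F Disj by auto
      show ?thesis
      proof (cases t')
        case 0
        then show ?thesis using S G k by (metis Sigma_Pi_Lit(2) Sigma_fm.simps(1))
      next
        case (Suc t'')
        then have "Pi_fm t'' k G" using S G by auto
        then show ?thesis using Sigma_Pi_Suc[OF k] \<open>t = Suc t'\<close> Suc by blast
      qed
    qed
  qed (use F G in auto)
qed


section \<open>Substituting Boolean functions for variables\<close>

definition minterm :: "'u fset \<Rightarrow> 'u fset \<Rightarrow> 'u fm" where
  "minterm V \<alpha> = mk_conj ((\<lambda>v. Lit (if v |\<in>| \<alpha> then Pos v else Neg v)) |`| V)"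

text \<open>The literals of the negated minterm: on \<open>V\<close>, the clause that is false
  exactly at \<open>\<alpha>\<close>. A line extended by it only has to be proved under the
  assignment \<open>\<alpha>\<close>.\<close>

definition falsified :: "'u fset \<Rightarrow> 'u fset \<Rightarrow> 'u fm fset" where
  "falsified V \<alpha> = (\<lambda>v. Lit (if v |\<in>| \<alpha> then Neg v else Pos v)) |`| V"

definition all_lits :: "'u fset \<Rightarrow> 'u fm fset" where
  "all_lits V = (Lit \<circ> Pos) |`| V |\<union>| (Lit \<circ> Neg) |`| V"

text \<open>The conjunction may collapse to a single literal, but never to a disjunction.\<close>

lemma ndisj_minterm: "ndisj (minterm V \<alpha>)"
proof -
  have "fm_nf (minterm V \<alpha>)" unfolding minterm_def by (rule nf_mk_conj) auto
  moreover have "minterm V \<alpha> \<noteq> Disj T" for T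
  proof (cases "\<exists>F. (\<lambda>v. Lit (if v |\<in>| \<alpha> then Pos v else Neg v)) |`| V = {|F|}")
    case True
    then obtain F where F: "(\<lambda>v. Lit (if v |\<in>| \<alpha> then Pos v else Neg v)) |`| V = {|F|}" by blast
    have "F |\<in>| {|F|}" by simp
    then obtain v where "F = Lit (if v |\<in>| \<alpha> then Pos v else Neg v)" unfolding F[symmetric] by auto
    then show ?thesis unfolding minterm_def F by simp
  qed (simp add: minterm_def mk_conj_other)
  ultimately show ?thesis by (simp add: ndisj_def)
qed

lemma disjuncts_neg_minterm: "disjuncts (fm_neg (minterm V \<alpha>)) = falsified V \<alpha>"
proof -
  have "disjuncts (fm_neg (minterm V \<alpha>)) = fm_neg |`| (\<lambda>v. Lit (if v |\<in>| \<alpha> then Pos v else Neg v)) |`| V"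
    unfolding minterm_def fm_neg_mk_conj by (rule disjuncts_mk_disj) auto
  also have "\<dots> = falsified V \<alpha>"
    unfolding falsified_def fset.map_comp by (rule fimage_cong) auto
  finally show ?thesis .
qed

lemma falsified_mono: "V |\<subseteq>| V' \<Longrightarrow> falsified V \<alpha> |\<subseteq>| falsified V' \<alpha>"
  unfolding falsified_def by auto

lemma falsified_restrict: "falsified V (\<alpha> |\<inter>| V) = falsified V \<alpha>"
  unfolding falsified_def by (rule fimage_cong) auto

lemma size_minterm: "fm_size (minterm V \<alpha>) \<le> 1 + fcard V"
proof -
  let ?S = "(\<lambda>v. Lit (if v |\<in>| \<alpha> then Pos v else Neg v)) ` fset V"
  have "(\<Sum>F\<in>?S. fm_size F) = (\<Sum>F\<in>?S. 1)" by (rule sum.cong) auto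
  also have "\<dots> \<le> fcard V" by (simp add: fcard.rep_eq card_image_le)
  finally show ?thesis
    using size_mk_conj[of "(\<lambda>v. Lit (if v |\<in>| \<alpha> then Pos v else Neg v)) |`| V"] by (simp add: minterm_def)
qed

primrec subst_true :: "('v \<Rightarrow> 'u fset) \<Rightarrow> ('v \<Rightarrow> 'u fset \<Rightarrow> bool) \<Rightarrow> 'u fset \<Rightarrow> 'v lit \<Rightarrow> bool" where
  "subst_true W g \<alpha> (Pos v) \<longleftrightarrow> g v (\<alpha> |\<inter>| W v)"
| "subst_true W g \<alpha> (Neg v) \<longleftrightarrow> \<not> g v (\<alpha> |\<inter>| W v)"

locale substitution =
  fixes k :: nat and W :: "'v \<Rightarrow> 'u fset" and g :: "'v \<Rightarrow> 'u fset \<Rightarrow> bool" and c :: nat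
  assumes W_card: "fcard (W v) \<le> c" and k_pos: "1 \<le> k" and c_pos: "1 \<le> c"
begin

abbreviation lit_true :: "'u fset \<Rightarrow> 'v lit \<Rightarrow> bool" where
  "lit_true \<equiv> subst_true W g"

fun fm_vars :: "'v fm \<Rightarrow> 'u fset" where
  "fm_vars (Lit l) = W (lit_var l)"
| "fm_vars _ = {||}"

fun fm_true :: "'u fset \<Rightarrow> 'v fm \<Rightarrow> bool" where
  "fm_true \<alpha> (Lit l) = lit_true \<alpha> l"
| "fm_true \<alpha> _ = False"

definition term_vars :: "'v fm fset \<Rightarrow> 'u fset" where
  "term_vars S = fBig fm_vars S"

text \<open>\<open>S\<close> stands for the conjunction of its literals. This is the full DNF of
  that conjunction after the substitution, over all variables that occur; a literal is treated as a
  conjunction of one.\<close>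

definition dnf :: "'v fm fset \<Rightarrow> 'u fm fset" where
  "dnf S = minterm (term_vars S) |`| ffilter (\<lambda>\<alpha>. \<forall>F\<in>fset S. fm_true \<alpha> F) (fPow (term_vars S))"

definition short :: "'v fm fset \<Rightarrow> bool" where
  "short S \<longleftrightarrow> fcard S \<le> k \<and> (\<forall>F\<in>fset S. \<exists>l. F = Lit l)"

text \<open>
  \<open>trD F\<close> are the disjuncts and \<open>trC F\<close> the conjuncts of the translation of \<open>F\<close>. Conjunctions of at
  most \<open>k\<close> literals are expanded to DNF and disjunctions of at most \<open>k\<close> literals below a
  conjunction to CNF, so that the translation does not increase the depth.
\<close>

primrec tr :: "'v fm \<Rightarrow> 'u fm fset \<times> 'u fm fset" where
  "tr (Lit l) = (dnf {|Lit l|}, fm_neg |`| dnf {|Lit (lit_neg l)|})"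
| "tr (Conj S) =
    (if short S then dnf S else disjuncts (mk_conj (fBig snd (tr |`| S))), fBig snd (tr |`| S))"
| "tr (Disj S) =
    (fBig fst (tr |`| S), if short S then fm_neg |`| dnf (fm_neg |`| S) else conjuncts (mk_disj (fBig fst (tr |`| S))))"

definition trD :: "'v fm \<Rightarrow> 'u fm fset" where "trD F = fst (tr F)"
definition trC :: "'v fm \<Rightarrow> 'u fm fset" where "trC F = snd (tr F)"

lemma trD_simps: "trD (Lit l) = dnf {|Lit l|}"
  "trD (Conj S) = (if short S then dnf S else disjuncts (mk_conj (fBig trC S)))" "trD (Disj S) = fBig trD S"
  and trC_simps: "trC (Lit l) = fm_neg |`| dnf {|Lit (lit_neg l)|}" "trC (Conj S) = fBig trC S"
  "trC (Disj S) = (if short S then fm_neg |`| dnf (fm_neg |`| S) else conjuncts (mk_disj (fBig trD S)))"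
  by (simp_all add: trD_def[abs_def] trC_def[abs_def])

lemma lit_true_neg [simp]: "lit_true \<alpha> (lit_neg l) \<longleftrightarrow> \<not> lit_true \<alpha> l"
  by (cases l) auto

lemma fm_vars_neg [simp]: "fm_vars (fm_neg F) = fm_vars F"
  by (cases F) auto

lemma term_vars_neg [simp]: "term_vars (fm_neg |`| S) = term_vars S"
  by (simp add: term_vars_def)

lemma short_neg [simp]: "short (fm_neg |`| S) = short S"
  by (auto simp: short_def fm_neg_iff fm_neg_all)

lemma lit_true_restrict: "W (lit_var l) |\<subseteq>| V \<Longrightarrow> lit_true (\<alpha> |\<inter>| V) l = lit_true \<alpha> l"
proof -
  assume "W (lit_var l) |\<subseteq>| V"
  then have "(\<alpha> |\<inter>| V) |\<inter>| W (lit_var l) = \<alpha> |\<inter>| W (lit_var l)" by auto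
  then show ?thesis by (cases l) auto
qed

lemma fm_true_restrict: "fm_vars F |\<subseteq>| V \<Longrightarrow> fm_true (\<alpha> |\<inter>| V) F = fm_true \<alpha> F"
  by (cases F) (auto simp: lit_true_restrict)

lemma fm_vars_term_vars: "F |\<in>| S \<Longrightarrow> fm_vars F |\<subseteq>| term_vars S"
  by (auto simp: term_vars_def)

text \<open>The clauses of \<open>tr\<close> for \<open>Conj\<close> and \<open>Disj\<close> are
  dual, and shortness is invariant under negation. Claims on \<open>trC\<close> thus reduce to
  claims on \<open>trD\<close>.\<close>

lemma tr_neg: "trC (fm_neg F) = fm_neg |`| trD F \<and> trD (fm_neg F) = fm_neg |`| trC F"
proof (induction F)
  case (Conj S)
  have "fBig (\<lambda>x. trD (fm_neg x)) S = fBig (\<lambda>x. fm_neg |`| trC x) S"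
    by (rule fBig_cong) (use Conj in auto)
  then show ?case
    by (simp add: trD_simps trC_simps flip: fimage_fBig fm_neg_mk_conj conjuncts_neg)
next
  case (Disj S)
  have "fBig (\<lambda>x. trC (fm_neg x)) S = fBig (\<lambda>x. fm_neg |`| trD x) S"
    by (rule fBig_cong) (use Disj in auto)
  then show ?case
    by (simp add: trD_simps trC_simps flip: fimage_fBig fm_neg_mk_disj disjuncts_neg)
qed (simp add: trD_simps trC_simps)

lemma ndisj_dnf: "F |\<in>| dnf S \<Longrightarrow> ndisj F"
  unfolding dnf_def using ndisj_minterm by auto

lemma ndisj_tr: "(\<forall>G. G |\<in>| trD F \<longrightarrow> ndisj G) \<and> (\<forall>G. G |\<in>| trC F \<longrightarrow> nconj G)"
proof (induction F)
  case (Lit l)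
  then show ?case using ndisj_dnf by (auto simp: trD_simps trC_simps)
next
  case (Conj S)
  then have "fm_nf (mk_conj (fBig trC S))" by (intro nf_mk_conj) auto
  with Conj show ?case using ndisj_dnf ndisj_disjuncts by (auto simp: trD_simps trC_simps)
next
  case (Disj S)
  then have nf: "fm_nf (mk_disj (fBig trD S))" by (intro nf_mk_disj) auto
  have "nconj G" if "G |\<in>| conjuncts (mk_disj (fBig trD S))" for G
  proof -
    have "fm_neg G |\<in>| disjuncts (fm_neg (mk_disj (fBig trD S)))" using that by (auto simp: disjuncts_neg)
    then have "ndisj (fm_neg G)" using ndisj_disjuncts nf by (metis fm_nf_neg)
    then show ?thesis by simp
  qed
  with Disj show ?case using ndisj_dnf by (auto simp: trD_simps trC_simps)
qed

lemma ndisj_trD: "G |\<in>| trD F \<Longrightarrow> ndisj G"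
  using ndisj_tr by blast

lemma trD_mk_disj: "trD (mk_disj S) = fBig trD S"
  by (cases "\<exists>F. S = {|F|}") (auto simp: mk_disj_other trD_simps)

lemma trD_disjuncts: "fBig trD (disjuncts F) = trD F"
  by (cases F) (auto simp: trD_simps)

lemma trD_disj_fm: "trD (disj_fm F G) = trD F |\<union>| trD G"
  unfolding disj_fm_def trD_mk_disj by (simp add: trD_disjuncts)

lemma trC_conj_fm: "trC (conj_fm F G) = trC F |\<union>| trC G"
proof -
  have "fBig trC (conjuncts H) = trC H" for H by (cases H) (auto simp: trC_simps)
  moreover have "trC (mk_conj S) = fBig trC S" for S
    by (cases "\<exists>F. S = {|F|}") (auto simp: mk_conj_other trC_simps)
  ultimately show ?thesis unfolding conj_fm_def by simp
qed

subsection \<open>Sizes\<close>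

lemma term_vars_card: "short S \<Longrightarrow> fcard (term_vars S) \<le> c * k"
proof -
  assume S: "short S"
  have "card (fset (term_vars S)) \<le> (\<Sum>F\<in>fset S. card (fset (fm_vars F)))"
    unfolding term_vars_def fset_fBig by (rule card_UN_le) simp
  also have "\<dots> \<le> (\<Sum>F\<in>fset S. c)"
    using S W_card by (intro sum_mono) (auto simp: short_def fcard.rep_eq)
  also have "\<dots> \<le> c * k" using S by (simp add: short_def fcard.rep_eq)
  finally show ?thesis by (simp add: fcard.rep_eq)
qed

text \<open>\<open>E\<close> bounds the number of assignments to the at most \<open>c * k\<close>
  variables of a short term. \<open>K\<close> multiplies it by the size of a minterm and so bounds
  the total size of an expansion.\<close>

definition E :: nat where "E = 2 ^ (c * k)"
definition K :: nat where "K = E * (c * k + 1)"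

lemma card_dnf: "short S \<Longrightarrow> fcard (dnf S) \<le> E"
proof -
  assume S: "short S"
  have "fcard (dnf S) \<le> fcard (fPow (term_vars S))"
    unfolding dnf_def
    by (rule order.trans[OF _ fcard_mono[of "ffilter (\<lambda>\<alpha>. \<forall>F\<in>fset S. fm_true \<alpha> F) (fPow (term_vars S))"]])
      (auto simp: fcard.rep_eq card_image_le)
  also have "fcard (fPow V) \<le> 2 ^ fcard V" for V :: "'u fset"
  proof -
    have "fset ` fset (fPow V) \<subseteq> Pow (fset V)" by auto
    then have "card (fset ` fset (fPow V)) \<le> card (Pow (fset V))" by (intro card_mono) auto
    moreover have "card (fset ` fset (fPow V)) = card (fset (fPow V))"
      by (rule card_image) (auto simp: inj_on_def fset_inject)
    ultimately show ?thesis by (simp add: fcard.rep_eq card_Pow)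
  qed
  also have "(2::nat) ^ fcard (term_vars S) \<le> E"
    unfolding E_def using term_vars_card[OF S] by (intro power_increasing) auto
  finally show ?thesis .
qed

lemma size_dnf: "short S \<Longrightarrow> (\<Sum>F\<in>fset (dnf S). fm_size F) \<le> K"
proof -
  assume S: "short S"
  have "(\<Sum>F\<in>fset (dnf S). fm_size F) \<le> (\<Sum>F\<in>fset (dnf S). c * k + 1)"
  proof (rule sum_mono)
    fix F assume "F \<in> fset (dnf S)"
    then obtain \<alpha> where "F = minterm (term_vars S) \<alpha>" by (auto simp: dnf_def)
    then show "fm_size F \<le> c * k + 1" using size_minterm[of "term_vars S" \<alpha>] term_vars_card[OF S] by simp
  qed
  also have "\<dots> \<le> K" using card_dnf[OF S] by (simp add: K_def fcard.rep_eq mult_right_mono del: mult_Suc_right)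
  finally show ?thesis .
qed

lemma short_Lit [simp]: "short {|Lit l|}"
  using k_pos by (simp add: short_def)

lemma sum_size_neg: "(\<Sum>F\<in>fm_neg ` fset S. fm_size F) = (\<Sum>F\<in>fset S. fm_size F)"
  by (simp add: sum.reindex inj_on_subset[OF inj_fm_neg])

lemma sum_UN_le: "finite S \<Longrightarrow> (\<And>x. finite (A x)) \<Longrightarrow> (\<Sum>y\<in>(\<Union>x\<in>S. A x). f y) \<le> (\<Sum>x\<in>S. \<Sum>y\<in>A x. f y)"
  for f :: "'z \<Rightarrow> nat"
proof (induction S rule: finite_induct)
  case (insert x S)
  have "(\<Sum>y\<in>A x \<union> (\<Union>x\<in>S. A x). f y) \<le> (\<Sum>y\<in>A x. f y) + (\<Sum>y\<in>(\<Union>x\<in>S. A x). f y)"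
    using insert by (subst sum_Un_nat) auto
  with insert show ?case by simp
qed simp

lemma K_pos: "1 \<le> K"
  by (simp add: K_def E_def Suc_le_eq)

lemma size_fBig:
  assumes "\<And>F. F |\<in>| S \<Longrightarrow> (\<Sum>G\<in>fset (h F). fm_size G) \<le> K * fm_size F"
  shows "(\<Sum>G\<in>fset (fBig h S). fm_size G) \<le> K * (\<Sum>F\<in>fset S. fm_size F)"
proof -
  have "(\<Sum>G\<in>fset (fBig h S). fm_size G) \<le> (\<Sum>F\<in>fset S. \<Sum>G\<in>fset (h F). fm_size G)"
    unfolding fset_fBig by (rule sum_UN_le) auto
  also have "\<dots> \<le> (\<Sum>F\<in>fset S. K * fm_size F)" by (rule sum_mono) (use assms in auto)
  finally show ?thesis by (simp add: sum_distrib_left)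
qed

text \<open>An expanded conjunction or disjunction is charged \<open>K\<close> at its own node;
  otherwise the sizes add up over the members. The node that \<open>mk_conj\<close> or
  \<open>mk_disj\<close> may add is paid for by \<open>1 \<le> K\<close>.\<close>

lemma size_tr: "(\<Sum>G\<in>fset (trD F). fm_size G) \<le> K * fm_size F \<and> (\<Sum>G\<in>fset (trC F). fm_size G) \<le> K * fm_size F"
proof (induction F)
  case (Lit l)
  then show ?case using size_dnf[of "{|Lit l|}"] size_dnf[of "{|Lit (lit_neg l)|}"]
    by (simp add: trD_simps trC_simps sum_size_neg)
next
  case (Conj S)
  have 1: "(\<Sum>G\<in>fset (fBig trC S). fm_size G) \<le> K * (\<Sum>F\<in>fset S. fm_size F)"
    by (rule size_fBig) (use Conj in auto)
  have "(\<Sum>G\<in>fset (disjuncts (mk_conj (fBig trC S))). fm_size G) \<le> K * fm_size (Conj S)"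
    using order.trans[OF size_disjuncts size_mk_conj[of "fBig trC S"]] 1 K_pos by simp
  moreover have "short S \<Longrightarrow> (\<Sum>G\<in>fset (dnf S). fm_size G) \<le> K * fm_size (Conj S)"
    using size_dnf[of S] by simp
  ultimately show ?case using 1 by (simp add: trD_simps trC_simps)
next
  case (Disj S)
  have 1: "(\<Sum>G\<in>fset (fBig trD S). fm_size G) \<le> K * (\<Sum>F\<in>fset S. fm_size F)"
    by (rule size_fBig) (use Disj in auto)
  have "(\<Sum>G\<in>fset (conjuncts (mk_disj (fBig trD S))). fm_size G) \<le> K * fm_size (Disj S)"
    using order.trans[OF size_conjuncts size_mk_disj[of "fBig trD S"]] 1 K_pos by simp
  moreover have "short S \<Longrightarrow> (\<Sum>G\<in>fset (fm_neg |`| dnf (fm_neg |`| S)). fm_size G) \<le> K * fm_size (Disj S)"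
    using size_dnf[of "fm_neg |`| S"] by (simp add: sum_size_neg)
  ultimately show ?case using 1 by (simp add: trD_simps trC_simps)
qed

subsection \<open>Depth\<close>

lemma ck_pos: "1 \<le> c * k"
  using c_pos k_pos by (simp add: Suc_le_eq)

lemma Pi_dnf: "short S \<Longrightarrow> G |\<in>| dnf S \<Longrightarrow> Pi_fm t (c * k) G"
proof -
  assume S: "short S" and "G |\<in>| dnf S"
  then obtain \<alpha> where G: "G = minterm (term_vars S) \<alpha>" by (auto simp: dnf_def)
  have c: "conjuncts G = (\<lambda>v. Lit (if v |\<in>| \<alpha> then Pos v else Neg v)) |`| term_vars S"
    unfolding G minterm_def by (rule conjuncts_mk_conj) auto
  have "fcard (conjuncts G) \<le> fcard (term_vars S)"
    unfolding c by (simp add: fcard.rep_eq card_image_le)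
  then have "Pi_fm 0 (c * k) G" using term_vars_card[OF S] by (auto simp: c)
  then show ?thesis by (rule Pi_0_le[OF ck_pos])
qed

text \<open>The DNF of a bottom term merges with the disjunction above it, and the CNF of a bottom
  clause with the conjunction above it. Only the fan-in of the terms grows, from \<open>k\<close> to
  \<open>c * k\<close>.\<close>

lemma depth_tr:
  "(Sigma_fm (Suc t) k F \<longrightarrow> (\<forall>G. G |\<in>| trD F \<longrightarrow> Pi_fm t (c * k) G)) \<and>
   (Pi_fm (Suc t) k F \<longrightarrow> (\<forall>G. G |\<in>| trC F \<longrightarrow> Sigma_fm t (c * k) G))"
proof (induction t arbitrary: F)
  case 0
  have D: "Pi_fm 0 (c * k) G" if F: "Sigma_fm (Suc 0) k F" and G: "G |\<in>| trD F" for F G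
  proof -
    obtain H where H: "H |\<in>| disjuncts F" "G |\<in>| trD H" using G trD_disjuncts[of F] by (metis in_fBig)
    have *: "Pi_fm 0 k H" using F H by simp
    show ?thesis
    proof (cases H)
      case (Conj S)
      then have "short S" using * by (auto simp: short_def)
      then show ?thesis using H Conj Pi_dnf[of S G 0] by (simp add: trD_simps)
    next
      case (Lit l)
      then show ?thesis using H Pi_dnf[OF short_Lit] by (simp add: trD_simps del: Pi_fm.simps)
    next
      case (Disj S)
      then show ?thesis using * by simp
    qed
  qed
  have "Sigma_fm 0 (c * k) G" if F: "Pi_fm (Suc 0) k F" and G: "G |\<in>| trC F" for G
  proof -
    have "fm_neg G |\<in>| trD (fm_neg F)" using G tr_neg[of F] by auto
    with D[of "fm_neg F" "fm_neg G"] F show ?thesis by (simp only: Sigma_Pi_neg)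
  qed
  with D show ?case by blast
next
  case (Suc t)
  have D: "Pi_fm (Suc t) (c * k) G" if F: "Sigma_fm (Suc (Suc t)) k F" and G: "G |\<in>| trD F" for F G
  proof -
    obtain H where H: "H |\<in>| disjuncts F" "G |\<in>| trD H" using G trD_disjuncts[of F] by (metis in_fBig)
    have *: "Pi_fm (Suc t) k H" using F H by simp
    show ?thesis
    proof (cases H)
      case (Lit l)
      then show ?thesis using H Pi_dnf[OF short_Lit] by (simp add: trD_simps del: Pi_fm.simps)
    next
      case (Conj S)
      show ?thesis
      proof (cases "short S")
        case True
        then show ?thesis using H Conj Pi_dnf[of S G] by (simp add: trD_simps del: Pi_fm.simps)
      next
        case False
        have "trC H = fBig trC S" by (simp add: Conj trC_simps)
        moreover have "\<forall>G. G |\<in>| trC H \<longrightarrow> Sigma_fm t (c * k) G" using Suc * by blast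
        moreover have "conjuncts (mk_conj (fBig trC S)) = fBig trC S"
          by (rule conjuncts_mk_conj) (use ndisj_tr in auto)
        ultimately have "Pi_fm (Suc t) (c * k) (mk_conj (fBig trC S))" by auto
        moreover have "G |\<in>| disjuncts (mk_conj (fBig trC S))" using H Conj False by (simp add: trD_simps)
        ultimately show ?thesis by (rule Pi_disjuncts[OF ck_pos])
      qed
    next
      case (Disj S)
      \<comment> \<open>A disjunction is its own only conjunct, so it already belongs to a lower
        level.\<close>
      then have S: "Sigma_fm t k H" using * by simp
      show ?thesis
      proof (cases t)
        case 0
        then obtain l where "G |\<in>| trD (Lit l)" using S H Disj by (auto simp: trD_simps)
        then show ?thesis using Pi_dnf[OF short_Lit] by (simp add: trD_simps del: Pi_fm.simps)
      next
        case (Suc t')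
        have "Sigma_fm (Suc t) k H" using S Sigma_Pi_Suc[OF k_pos] by blast
        then have "Pi_fm t (c * k) G" using Suc.IH H by blast
        then show ?thesis using Sigma_Pi_Suc[OF ck_pos] by blast
      qed
    qed
  qed
  have "Sigma_fm (Suc t) (c * k) G" if F: "Pi_fm (Suc (Suc t)) k F" and G: "G |\<in>| trC F" for G
  proof -
    have "fm_neg G |\<in>| trD (fm_neg F)" using G tr_neg[of F] by auto
    with D[of "fm_neg F" "fm_neg G"] F show ?thesis by (simp only: Sigma_Pi_neg)
  qed
  with D show ?case by blast
qed

end

section \<open>Derivations of lines\<close>

text \<open>
  A line is the set of the disjuncts of a formula. Trees of rule applications whose lines are
  subsets of \<open>U\<close>; the number bounds the number of applications. The rule for conjunctions is
  not needed, as it follows from the axiom for the conjunction by two cuts.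
\<close>

inductive drv :: "'v fm fset set \<Rightarrow> 'v fm set \<Rightarrow> nat \<Rightarrow> 'v fm fset \<Rightarrow> bool" for \<Gamma> U where
  hyp: "X \<in> \<Gamma> \<Longrightarrow> fset X \<subseteq> U \<Longrightarrow> 1 \<le> n \<Longrightarrow> drv \<Gamma> U n X"
| ax: "fset (disjuncts A) \<subseteq> U \<Longrightarrow> fset (disjuncts (fm_neg A)) \<subseteq> U \<Longrightarrow> 1 \<le> n \<Longrightarrow>
    drv \<Gamma> U n (disjuncts A |\<union>| disjuncts (fm_neg A))"
| cut: "drv \<Gamma> U m (X |\<union>| disjuncts A) \<Longrightarrow> drv \<Gamma> U n (Y |\<union>| disjuncts (fm_neg A)) \<Longrightarrow> m + n < r \<Longrightarrow>
    drv \<Gamma> U r (X |\<union>| Y)"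
| weak: "drv \<Gamma> U m X \<Longrightarrow> X |\<subseteq>| Y \<Longrightarrow> fset Y \<subseteq> U \<Longrightarrow> m < n \<Longrightarrow> drv \<Gamma> U n Y"

lemma drv_mono: "drv \<Gamma> U m X \<Longrightarrow> m \<le> n \<Longrightarrow> drv \<Gamma> U n X"
  by (cases rule: drv.cases[of \<Gamma> U m X]) (auto intro: drv.intros order.strict_trans2)

lemma drv_subset: "drv \<Gamma> U n X \<Longrightarrow> fset X \<subseteq> U"
  by (induction rule: drv.induct) auto

text \<open>Both premises are weakened to a common context before the cut; the two weakenings and
  the cut account for the 3.\<close>

lemma drv_cut:
  assumes "drv \<Gamma> U m P" "drv \<Gamma> U n Q" "P |\<subseteq>| X |\<union>| disjuncts A" "Q |\<subseteq>| X |\<union>| disjuncts (fm_neg A)"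
    "fset X \<subseteq> U" "fset (disjuncts A) \<subseteq> U" "fset (disjuncts (fm_neg A)) \<subseteq> U"
  shows "drv \<Gamma> U (m + n + 3) X"
proof -
  have "drv \<Gamma> U (Suc m) (X |\<union>| disjuncts A)" by (rule weak[OF assms(1,3)]) (use assms in auto)
  moreover have "drv \<Gamma> U (Suc n) (X |\<union>| disjuncts (fm_neg A))" by (rule weak[OF assms(2,4)]) (use assms in auto)
  ultimately have "drv \<Gamma> U (m + n + 3) (X |\<union>| X)" by (rule cut) simp
  then show ?thesis by simp
qed

lemma frege_proof_snoc:
  "frege_proof \<Gamma> (\<rho> @ [F]) \<longleftrightarrow> frege_proof \<Gamma> \<rho> \<and> fm_nf F \<and> (F \<in> \<Gamma> \<or> (\<exists>Fs. set Fs \<subseteq> set \<rho> \<and> frege_rule Fs F))"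
  unfolding frege_proof_def by (auto simp: nth_append less_Suc_eq all_conj_distrib)

text \<open>The tree is written down in post-order, at most one line per rule application. The
  initial proof \<open>\<rho>\<close> is arbitrary in the induction, because the derivation of the
  second premise of a cut is appended after that of the first.\<close>

lemma drv_frege_proof:
  assumes "drv \<Gamma> U n X" and U: "\<And>F. F \<in> U \<Longrightarrow> ndisj F"
    and "frege_proof \<Delta> \<rho>" "\<And>Y. Y \<in> \<Gamma> \<Longrightarrow> mk_disj Y \<in> set \<rho> \<union> \<Delta>"
  shows "\<exists>\<rho>'. frege_proof \<Delta> (\<rho> @ \<rho>') \<and> length \<rho>' \<le> n \<and> mk_disj X \<in> set (\<rho> @ \<rho>') \<and>
    (\<forall>G\<in>set \<rho>'. \<exists>Y. fset Y \<subseteq> U \<and> G = mk_disj Y)"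
proof -
  have nf: "fm_nf (mk_disj Y)" if "fset Y \<subseteq> U" for Y by (rule nf_mk_disj) (use that U in auto)
  show ?thesis using assms(1,3,4)
  proof (induction arbitrary: \<rho> rule: drv.induct)
    case (hyp X n)
    show ?case
    proof (cases "mk_disj X \<in> set \<rho>")
      case True
      with hyp show ?thesis by (intro exI[of _ "[]"]) auto
    next
      case False
      with hyp show ?thesis by (intro exI[of _ "[mk_disj X]"]) (auto simp: frege_proof_snoc nf)
    qed
  next
    case (ax A n)
    have "disj_fm A (fm_neg A) = mk_disj (disjuncts A |\<union>| disjuncts (fm_neg A))" by (simp add: disj_fm_def)
    then have "frege_rule [] (mk_disj (disjuncts A |\<union>| disjuncts (fm_neg A)))" by (metis frege_rule.axiom)
    with ax show ?case
      by (intro exI[of _ "[mk_disj (disjuncts A |\<union>| disjuncts (fm_neg A))]"])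
        (auto simp: frege_proof_snoc nf intro!: exI[of _ "[]"] exI[of _ "disjuncts A |\<union>| disjuncts (fm_neg A)"])
  next
    case (cut m X A n Y r)
    have XY: "fset X \<subseteq> U" "fset Y \<subseteq> U" using cut.hyps drv_subset by fastforce+
    obtain \<rho>1 where 1: "frege_proof \<Delta> (\<rho> @ \<rho>1)" "length \<rho>1 \<le> m" "mk_disj (X |\<union>| disjuncts A) \<in> set (\<rho> @ \<rho>1)"
      "\<forall>G\<in>set \<rho>1. \<exists>Y. fset Y \<subseteq> U \<and> G = mk_disj Y"
      using cut.IH(1)[OF cut.prems] by blast
    have "\<And>Y. Y \<in> \<Gamma> \<Longrightarrow> mk_disj Y \<in> set (\<rho> @ \<rho>1) \<union> \<Delta>" using cut.prems by auto
    then obtain \<rho>2 where 2: "frege_proof \<Delta> ((\<rho> @ \<rho>1) @ \<rho>2)" "length \<rho>2 \<le> n"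
      "mk_disj (Y |\<union>| disjuncts (fm_neg A)) \<in> set ((\<rho> @ \<rho>1) @ \<rho>2)" "\<forall>G\<in>set \<rho>2. \<exists>Y. fset Y \<subseteq> U \<and> G = mk_disj Y"
      using cut.IH(2)[OF 1(1)] by blast
    have "frege_rule [disj_fm (mk_disj X) A, disj_fm (mk_disj Y) (fm_neg A)] (disj_fm (mk_disj X) (mk_disj Y))"
      by (rule frege_rule.cut)
    moreover have "disj_fm (mk_disj X) B = mk_disj (X |\<union>| disjuncts B)" "disj_fm (mk_disj Y) B = mk_disj (Y |\<union>| disjuncts B)" for B
      by (rule disj_fm_mk_disj; use XY U in auto)+
    moreover have "disjuncts (mk_disj Y) = Y" by (rule disjuncts_mk_disj) (use XY U in auto)
    ultimately have "frege_rule [mk_disj (X |\<union>| disjuncts A), mk_disj (Y |\<union>| disjuncts (fm_neg A))] (mk_disj (X |\<union>| Y))"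
      by simp
    moreover have "fm_nf (mk_disj (X |\<union>| Y))" by (rule nf) (use XY in auto)
    moreover have "set [mk_disj (X |\<union>| disjuncts A), mk_disj (Y |\<union>| disjuncts (fm_neg A))] \<subseteq> set ((\<rho> @ \<rho>1) @ \<rho>2)"
      using 1(3) 2(3) by auto
    ultimately have "frege_proof \<Delta> (((\<rho> @ \<rho>1) @ \<rho>2) @ [mk_disj (X |\<union>| Y)])"
      using 2(1) unfolding frege_proof_snoc by blast
    moreover have "\<exists>Z. fset Z \<subseteq> U \<and> mk_disj (X |\<union>| Y) = mk_disj Z" using XY by (intro exI[of _ "X |\<union>| Y"]) auto
    ultimately show ?case using 1 2 cut.hyps
      by (intro exI[of _ "\<rho>1 @ \<rho>2 @ [mk_disj (X |\<union>| Y)]"]) auto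
  next
    case (weak m X Y n)
    obtain \<rho>1 where 1: "frege_proof \<Delta> (\<rho> @ \<rho>1)" "length \<rho>1 \<le> m" "mk_disj X \<in> set (\<rho> @ \<rho>1)"
      "\<forall>G\<in>set \<rho>1. \<exists>Y. fset Y \<subseteq> U \<and> G = mk_disj Y"
      using weak.IH[OF weak.prems] by blast
    have X: "fset X \<subseteq> U" using weak.hyps drv_subset by blast
    have "frege_rule [mk_disj X] (disj_fm (mk_disj X) (mk_disj Y))" by (rule frege_rule.weakening)
    moreover have "disj_fm (mk_disj X) (mk_disj Y) = mk_disj (X |\<union>| disjuncts (mk_disj Y))"
      by (rule disj_fm_mk_disj) (use X U in auto)
    moreover have "disjuncts (mk_disj Y) = Y" by (rule disjuncts_mk_disj) (use weak.hyps U in auto)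
    moreover have "X |\<union>| Y = Y" using weak.hyps(2) by auto
    ultimately have "frege_rule [mk_disj X] (mk_disj Y)" by simp
    moreover have "fm_nf (mk_disj Y)" using nf weak.hyps by blast
    moreover have "set [mk_disj X] \<subseteq> set (\<rho> @ \<rho>1)" using 1(3) by auto
    ultimately have "frege_proof \<Delta> ((\<rho> @ \<rho>1) @ [mk_disj Y])"
      using 1(1) unfolding frege_proof_snoc by blast
    then show ?case using 1 weak.hyps by (intro exI[of _ "\<rho>1 @ [mk_disj Y]"]) auto
  qed
qed

lemma falsified_subset:
  assumes "V' |\<subseteq>| V" "fset (all_lits V) \<subseteq> U" shows "fset (falsified V' \<alpha>) \<subseteq> U"
proof
  fix F assume "F \<in> fset (falsified V' \<alpha>)"
  then obtain v where "v |\<in>| V'" "F = Lit (Pos v) \<or> F = Lit (Neg v)" by (auto simp: falsified_def)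
  then have "F \<in> fset (all_lits V)" using assms(1) by (auto simp: all_lits_def)
  then show "F \<in> U" using assms(2) by blast
qed

text \<open>The variables are cut away one by one. Each of them turns the cost \<open>n\<close> into
  \<open>2 * n + 3\<close>, and this doubles \<open>n + 3\<close>.\<close>

lemma drv_truth_table:
  assumes "\<And>\<alpha>. \<alpha> |\<subseteq>| V \<Longrightarrow> drv \<Gamma> U n (X |\<union>| falsified V \<alpha>)" "fset X \<subseteq> U" "fset (all_lits V) \<subseteq> U"
  shows "drv \<Gamma> U (2 ^ fcard V * (n + 3)) X"
  using assms
proof (induction V arbitrary: n)
  case empty
  have "drv \<Gamma> U n X" using empty.prems(1)[of "{||}"] by (simp add: falsified_def)
  then show ?case by (rule drv_mono) simp
next
  case (insert v V)
  have "drv \<Gamma> U (n + n + 3) (X |\<union>| falsified V \<alpha>)" if \<alpha>: "\<alpha> |\<subseteq>| V" for \<alpha>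
  proof (rule drv_cut[where A = "Lit (Neg v)"])
    have v: "v |\<notin>| \<alpha>" using \<alpha> insert by auto
    show "drv \<Gamma> U n (X |\<union>| falsified (finsert v V) (finsert v \<alpha>))" "drv \<Gamma> U n (X |\<union>| falsified (finsert v V) \<alpha>)"
      using \<alpha> by (auto intro!: insert.prems(1))
    have "falsified V (finsert v \<alpha>) = falsified V \<alpha>"
      unfolding falsified_def by (rule fimage_cong) (use insert.hyps in auto)
    then show "X |\<union>| falsified (finsert v V) (finsert v \<alpha>) |\<subseteq>| (X |\<union>| falsified V \<alpha>) |\<union>| disjuncts (Lit (Neg v))"
      by (auto simp: falsified_def)
    show "X |\<union>| falsified (finsert v V) \<alpha> |\<subseteq>| (X |\<union>| falsified V \<alpha>) |\<union>| disjuncts (fm_neg (Lit (Neg v)))"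
      using v by (auto simp: falsified_def)
    show "fset (X |\<union>| falsified V \<alpha>) \<subseteq> U"
      using insert.prems falsified_subset[OF _ insert.prems(3), of V \<alpha>] by auto
  qed (use insert.prems in \<open>auto simp: all_lits_def\<close>)
  then have "drv \<Gamma> U (2 ^ fcard V * (n + n + 3 + 3)) X"
    by (rule insert.IH) (use insert.prems in \<open>auto simp: all_lits_def\<close>)
  then show ?case
    using insert.hyps by (auto simp: fcard_finsert_disjoint algebra_simps elim!: drv_mono)
qed

text \<open>The negation of a minterm that disagrees with \<open>\<alpha>\<close> at
  \<open>v\<close> contains the literal opposite to the one that \<open>falsified V \<alpha>\<close>
  has for \<open>v\<close>. So the axiom for \<open>v\<close> proves this negation in the context
  \<open>Z\<close>, and a cut removes the minterm.\<close>

lemma drv_remove_false_minterms: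
  assumes "drv \<Gamma> U n (Z |\<union>| T)" "falsified V \<alpha> |\<subseteq>| Z" "fset Z \<subseteq> U" "fset T \<subseteq> U" "fset (all_lits V) \<subseteq> U"
    and "\<And>F. F |\<in>| T \<Longrightarrow> \<exists>V' \<beta>. F = minterm V' \<beta> \<and> V' |\<subseteq>| V \<and> (\<exists>v. v |\<in>| V' \<and> (v |\<in>| \<beta>) \<noteq> (v |\<in>| \<alpha>))"
  shows "drv \<Gamma> U (n + 6 * fcard T) Z"
  using assms
proof (induction T arbitrary: n)
  case empty
  then show ?case by simp
next
  case (insert F T)
  obtain V' \<beta> v where F: "F = minterm V' \<beta>" "V' |\<subseteq>| V" "v |\<in>| V'" "(v |\<in>| \<beta>) \<noteq> (v |\<in>| \<alpha>)"
    using insert.prems(6)[of F] by auto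
  have dF: "disjuncts F = {|F|}" "disjuncts (fm_neg F) = falsified V' \<beta>"
    by (simp_all add: F(1) disjuncts_ndisj ndisj_minterm disjuncts_neg_minterm)
  have U: "fset (falsified V' \<beta>) \<subseteq> U"
    by (rule falsified_subset[OF F(2) insert.prems(5)])
  have vU: "Lit (Pos v) \<in> U" "Lit (Neg v) \<in> U" using F insert.prems(5) by (auto simp: all_lits_def)
  have "drv \<Gamma> U 1 (disjuncts (Lit (Pos v)) |\<union>| disjuncts (fm_neg (Lit (Pos v))))"
    by (rule ax) (use vU in auto)
  then have "drv \<Gamma> U 2 (Z |\<union>| T |\<union>| falsified V' \<beta>)"
  proof (rule weak)
    have "v |\<in>| V" using F by auto
    then have "{|Lit (Pos v), Lit (Neg v)|} |\<subseteq>| falsified V \<alpha> |\<union>| falsified V' \<beta>"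
      using F(3,4) by (auto simp: falsified_def image_iff)
    then show "disjuncts (Lit (Pos v)) |\<union>| disjuncts (fm_neg (Lit (Pos v))) |\<subseteq>| Z |\<union>| T |\<union>| falsified V' \<beta>"
      using insert.prems(2) by auto
  qed (use U insert.prems in auto)
  then have "drv \<Gamma> U (n + 2 + 3) (Z |\<union>| T)"
    by (rule drv_cut[OF insert.prems(1), where A = F]) (use U insert.prems in \<open>auto simp: dF\<close>)
  then have "drv \<Gamma> U (n + 2 + 3 + 6 * fcard T) Z"
    by (rule insert.IH) (use insert.prems in auto)
  then show ?case using insert.hyps by (auto simp: fcard_finsert_disjoint elim!: drv_mono)
qed

section \<open>Truth-table derivations of translated axioms and cuts\<close>

context substitution
begin

text \<open>The minterm of \<open>\<alpha>\<close> is in the DNF, and the literals of its negation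
  are in \<open>falsified V \<alpha>\<close>; the axiom for this minterm is weakened to the
  line.\<close>

lemma drv_true_dnf:
  assumes "\<And>F. F |\<in>| S \<Longrightarrow> fm_true \<alpha> F" "term_vars S |\<subseteq>| V" "dnf S |\<subseteq>| X" "fset X \<subseteq> U" "fset (all_lits V) \<subseteq> U"
  shows "drv \<Gamma> U 2 (X |\<union>| falsified V \<alpha>)"
proof -
  let ?V = "term_vars S"
  let ?A = "minterm ?V (\<alpha> |\<inter>| ?V)"
  have "?A |\<in>| dnf S" unfolding dnf_def
    using assms(1) fm_true_restrict[OF fm_vars_term_vars] by auto
  then have A: "?A |\<in>| X" using assms(3) by auto
  have d: "disjuncts ?A = {|?A|}" "disjuncts (fm_neg ?A) = falsified ?V \<alpha>"
    using ndisj_minterm disjuncts_ndisj disjuncts_neg_minterm falsified_restrict by metis+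
  have f: "falsified ?V \<alpha> |\<subseteq>| falsified V \<alpha>" "fset (falsified V \<alpha>) \<subseteq> U"
    using falsified_mono[OF assms(2)] falsified_subset[OF _ assms(5)] by auto
  have "drv \<Gamma> U 1 (disjuncts ?A |\<union>| disjuncts (fm_neg ?A))"
    by (rule ax) (use A assms(4) f in \<open>auto simp: d\<close>)
  then show ?thesis by (rule weak) (use A assms(4) f in \<open>auto simp: d\<close>)
qed

text \<open>A minterm of a DNF stems from an assignment that makes all literals of the term true. If
  \<open>\<alpha>\<close> makes one of them false, the two assignments differ at a variable of the
  term, so the minterm can be removed.\<close>

lemma drv_false_dnf:
  assumes "drv \<Gamma> U n (Z |\<union>| T)" "falsified V \<alpha> |\<subseteq>| Z" "fset Z \<subseteq> U" "fset T \<subseteq> U" "fset (all_lits V) \<subseteq> U"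
    and "\<And>G. G |\<in>| T \<Longrightarrow> \<exists>S F. G |\<in>| dnf S \<and> term_vars S |\<subseteq>| V \<and> F |\<in>| S \<and> \<not> fm_true \<alpha> F"
  shows "drv \<Gamma> U (n + 6 * fcard T) Z"
proof (rule drv_remove_false_minterms[OF assms(1-5)])
  fix G assume "G |\<in>| T"
  then obtain S F where S: "G |\<in>| dnf S" "term_vars S |\<subseteq>| V" "F |\<in>| S" "\<not> fm_true \<alpha> F" using assms(6) by blast
  then obtain \<beta> where \<beta>: "G = minterm (term_vars S) \<beta>" "\<beta> |\<subseteq>| term_vars S" "fm_true \<beta> F"
    by (auto simp: dnf_def)
  have "\<exists>v. v |\<in>| term_vars S \<and> (v |\<in>| \<beta>) \<noteq> (v |\<in>| \<alpha>)"
  proof (rule ccontr)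
    assume "\<not> ?thesis"
    then have "\<beta> = \<alpha> |\<inter>| term_vars S" using \<beta>(2) by blast
    then show False using \<beta>(3) S fm_true_restrict[OF fm_vars_term_vars[OF S(3)]] by simp
  qed
  with \<beta> S(2) show "\<exists>V' \<beta>. G = minterm V' \<beta> \<and> V' |\<subseteq>| V \<and> (\<exists>v. v |\<in>| V' \<and> (v |\<in>| \<beta>) \<noteq> (v |\<in>| \<alpha>))" by blast
qed

text \<open>The variables of the truth table for an axiom or a cut on the formula. A conjunction or
  disjunction that is not short needs none: its translation and that of its negation are negations
  of each other.\<close>

fun short_vars :: "'v fm \<Rightarrow> 'u fset" where
  "short_vars (Lit l) = W (lit_var l)"
| "short_vars (Conj S) = (if short S then term_vars S else {||})"
| "short_vars (Disj S) = (if short S then term_vars S else {||})"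

lemma short_vars_neg [simp]: "short_vars (fm_neg F) = short_vars F"
  by (cases F) auto

lemma card_short_vars: "fcard (short_vars F) \<le> c * k"
  using term_vars_card term_vars_card[OF short_Lit]
  by (cases F) (auto simp: term_vars_def)

lemma trD_neg_short: "short S \<Longrightarrow> trD (Disj (fm_neg |`| S)) = fBig (\<lambda>F. dnf {|fm_neg F|}) S"
  unfolding trD_simps fBig_fimage
proof (rule fBig_cong)
  fix F assume "short S" "F |\<in>| S"
  then obtain l where "F = Lit l" by (auto simp: short_def)
  then show "trD (fm_neg F) = dnf {|fm_neg F|}" by (simp add: trD_simps)
qed

text \<open>The negated conjunction is translated to the DNFs of its negated literals. Every
  assignment makes either all literals of \<open>S\<close> or some negated literal true, and so
  satisfies one of the DNFs.\<close>

lemma drv_axiom_short: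
  assumes S: "short S" and "fset (all_lits (term_vars S)) \<subseteq> U" "fset (dnf S) \<subseteq> U" "fset (fBig (\<lambda>F. dnf {|fm_neg F|}) S) \<subseteq> U"
  shows "drv \<Gamma> U (5 * E) (dnf S |\<union>| fBig (\<lambda>F. dnf {|fm_neg F|}) S)"
proof -
  let ?X = "dnf S |\<union>| fBig (\<lambda>F. dnf {|fm_neg F|}) S"
  have "drv \<Gamma> U (2 ^ fcard (term_vars S) * (2 + 3)) ?X"
  proof (rule drv_truth_table)
    fix \<alpha>
    show "drv \<Gamma> U 2 (?X |\<union>| falsified (term_vars S) \<alpha>)"
    proof (cases "\<forall>F. F |\<in>| S \<longrightarrow> fm_true \<alpha> F")
      case True
      then show ?thesis by (intro drv_true_dnf[of S]) (use assms in auto)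
    next
      case False
      then obtain F where F: "F |\<in>| S" "\<not> fm_true \<alpha> F" by blast
      then obtain l where l: "F = Lit l" using S by (auto simp: short_def)
      have 1: "term_vars {|fm_neg F|} |\<subseteq>| term_vars S" using fm_vars_term_vars[OF F(1)] by (simp add: term_vars_def)
      have 2: "dnf {|fm_neg F|} |\<subseteq>| ?X" using F(1) by auto
      show ?thesis
        by (rule drv_true_dnf[OF _ 1 2]) (use assms F l in auto)
    qed
  qed (use assms in auto)
  moreover have "2 ^ fcard (term_vars S) \<le> E"
    unfolding E_def by (rule power_increasing[OF term_vars_card[OF S]]) simp
  then have "2 ^ fcard (term_vars S) * (2 + 3) \<le> 5 * E" by simp
  ultimately show ?thesis using drv_mono by blast
qed

lemma E_pos [simp]: "Suc 0 \<le> E" "0 < E"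
  by (simp_all add: E_def Suc_le_eq)

text \<open>A bound on the number of disjuncts of a negated short conjunction: at most
  \<open>k\<close> literals, each with at most \<open>E\<close> minterms.\<close>

definition R :: nat where "R = E * k"

lemma card_neg_dnfs:
  assumes "short S" shows "fcard (fBig (\<lambda>F. dnf {|fm_neg F|}) S) \<le> R"
proof -
  have "card (fset (fBig (\<lambda>F. dnf {|fm_neg F|}) S)) \<le> (\<Sum>F\<in>fset S. card (fset (dnf {|fm_neg F|})))"
    unfolding fset_fBig by (rule card_UN_le) simp
  also have "\<dots> \<le> (\<Sum>F\<in>fset S. E)"
  proof (rule sum_mono)
    fix F assume "F \<in> fset S"
    then obtain l where "F = Lit l" using assms by (auto simp: short_def)
    then show "card (fset (dnf {|fm_neg F|})) \<le> E" using card_dnf[OF short_Lit] by (simp add: fcard.rep_eq)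
  qed
  also have "\<dots> \<le> R" using assms by (simp add: short_def fcard.rep_eq R_def)
  finally show ?thesis by (simp add: fcard.rep_eq)
qed

text \<open>No formula is available for a single cut, so one argues by truth table. Where the
  conjunction holds, all minterms in the second premise that belong to negated literals are false
  and can be removed; where it fails, those of \<open>dnf S\<close> in the first premise
  are.\<close>

lemma drv_cut_short:
  assumes S: "short S" and P: "drv \<Gamma> U m P" "P |\<subseteq>| X |\<union>| dnf S"
    and Q: "drv \<Gamma> U n Q" "Q |\<subseteq>| X |\<union>| fBig (\<lambda>F. dnf {|fm_neg F|}) S"
    and U: "fset (all_lits (term_vars S)) \<subseteq> U" "fset (dnf S) \<subseteq> U" "fset (fBig (\<lambda>F. dnf {|fm_neg F|}) S) \<subseteq> U" "fset X \<subseteq> U"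
  shows "drv \<Gamma> U (E * (m + n + 6 * R + 4)) X"
proof -
  let ?V = "term_vars S"
  have R: "fcard (dnf S) \<le> R" using card_dnf[OF S] k_pos by (simp add: R_def le_trans)
  have "drv \<Gamma> U (2 ^ fcard ?V * (m + n + 6 * R + 1 + 3)) X"
  proof (rule drv_truth_table)
    fix \<alpha>
    let ?Z = "X |\<union>| falsified ?V \<alpha>"
    have Z: "fset ?Z \<subseteq> U" using U falsified_subset[OF _ U(1), of ?V \<alpha>] by auto
    show "drv \<Gamma> U (m + n + 6 * R + 1) ?Z"
    proof (cases "\<forall>F. F |\<in>| S \<longrightarrow> fm_true \<alpha> F")
      case True
      have "drv \<Gamma> U (Suc n) (?Z |\<union>| fBig (\<lambda>F. dnf {|fm_neg F|}) S)"
        by (rule weak[OF Q(1)]) (use Q Z U in auto)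
      then have "drv \<Gamma> U (Suc n + 6 * fcard (fBig (\<lambda>F. dnf {|fm_neg F|}) S)) ?Z"
      proof (rule drv_false_dnf[where V = "?V" and \<alpha> = \<alpha>])
        fix G assume "G |\<in>| fBig (\<lambda>F. dnf {|fm_neg F|}) S"
        then obtain F where F: "F |\<in>| S" "G |\<in>| dnf {|fm_neg F|}" by auto
        then obtain l where "F = Lit l" using S by (auto simp: short_def)
        with F True fm_vars_term_vars[OF F(1)]
        show "\<exists>S F. G |\<in>| dnf S \<and> term_vars S |\<subseteq>| ?V \<and> F |\<in>| S \<and> \<not> fm_true \<alpha> F"
          by (intro exI[of _ "{|fm_neg F|}"] exI[of _ "fm_neg F"]) (auto simp: term_vars_def)
      qed (use Z U in auto)
      then show ?thesis by (rule drv_mono) (use card_neg_dnfs[OF S] in auto)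
    next
      case False
      have "drv \<Gamma> U (Suc m) (?Z |\<union>| dnf S)"
        by (rule weak[OF P(1)]) (use P Z U in auto)
      then have "drv \<Gamma> U (Suc m + 6 * fcard (dnf S)) ?Z"
        by (rule drv_false_dnf[where V = "?V" and \<alpha> = \<alpha>]) (use Z U False in auto)
      then show ?thesis by (rule drv_mono) (use R in auto)
    qed
  qed (use U in auto)
  moreover have "2 ^ fcard ?V \<le> E"
    unfolding E_def by (rule power_increasing[OF term_vars_card[OF S]]) simp
  then have "2 ^ fcard ?V * (m + n + 6 * R + 1 + 3) \<le> E * (m + n + 6 * R + 4)"
    by (intro mult_mono) auto
  ultimately show ?thesis using drv_mono by blast
qed

text \<open>By symmetry it suffices to treat literals and conjunctions.\<close>

lemma fm_cases_neg:
  assumes "\<And>l. P (Lit l)" "\<And>S. P (Conj S)" "\<And>F. P F \<Longrightarrow> P (fm_neg F)"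
  shows "P F"
proof (cases F)
  case (Disj S)
  then have "F = fm_neg (Conj (fm_neg |`| S))" by simp
  then show ?thesis using assms(2,3) by metis
qed (use assms in auto)

text \<open>A long conjunction is translated member by member, so the disjuncts of its translation
  and of the translation of its negation come from a formula and its negation. Genuine axioms and
  cuts therefore apply.\<close>

lemma long_conj:
  assumes "\<not> short S"
  obtains A where "disjuncts A = trD (Conj S)" "disjuncts (fm_neg A) = trD (fm_neg (Conj S))"
proof
  show "disjuncts (mk_conj (fBig trC S)) = trD (Conj S)" using assms by (simp add: trD_simps)
  have "fm_neg |`| fBig trC S = fBig (\<lambda>F. trD (fm_neg F)) S"
    unfolding fimage_fBig by (rule fBig_cong) (use tr_neg in auto)
  moreover have "disjuncts (fm_neg (mk_conj (fBig trC S))) = fm_neg |`| fBig trC S"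
    unfolding fm_neg_mk_conj by (rule disjuncts_mk_disj) (use ndisj_tr in auto)
  ultimately show "disjuncts (fm_neg (mk_conj (fBig trC S))) = trD (fm_neg (Conj S))"
    by (simp add: trD_simps)
qed

lemma drv_axiom:
  assumes "fset (all_lits (short_vars F)) \<subseteq> U" "fset (trD F) \<subseteq> U" "fset (trD (fm_neg F)) \<subseteq> U"
  shows "drv \<Gamma> U (5 * E) (trD F |\<union>| trD (fm_neg F))"
  using assms
proof (induction F rule: fm_cases_neg)
  case (1 l)
  then show ?case using drv_axiom_short[of "{|Lit l|}" U \<Gamma>] by (simp add: trD_simps term_vars_def)
next
  case (2 S)
  show ?case
  proof (cases "short S")
    case True
    then show ?thesis using 2 drv_axiom_short[OF True, of U \<Gamma>] trD_neg_short[OF True] by (simp add: trD_simps)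
  next
    case False
    then obtain A where A: "disjuncts A = trD (Conj S)" "disjuncts (fm_neg A) = trD (fm_neg (Conj S))" by (rule long_conj)
    have "1 \<le> 5 * E" by simp
    with ax[of A U "5 * E" \<Gamma>] 2 show ?thesis by (simp add: A)
  qed
next
  case (3 F)
  then show ?case by (simp add: sup_commute)
qed

lemma drv_cut_tr:
  assumes "drv \<Gamma> U m P" "P |\<subseteq>| X |\<union>| trD F" "drv \<Gamma> U n Q" "Q |\<subseteq>| X |\<union>| trD (fm_neg F)"
    and "fset (all_lits (short_vars F)) \<subseteq> U" "fset (trD F) \<subseteq> U" "fset (trD (fm_neg F)) \<subseteq> U" "fset X \<subseteq> U"
  shows "drv \<Gamma> U (E * (m + n + 6 * R + 4)) X"
  using assms
proof (induction F arbitrary: m n P Q rule: fm_cases_neg)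
  case (1 l)
  then show ?case using drv_cut_short[of "{|Lit l|}" \<Gamma> U m P X n Q] by (simp add: trD_simps term_vars_def)
next
  case (2 S)
  show ?case
  proof (cases "short S")
    case True
    show ?thesis
      by (rule drv_cut_short[OF True, where P = P and Q = Q]) (use 2 True trD_neg_short[OF True] in \<open>simp_all add: trD_simps\<close>)
  next
    case False
    then obtain A where A: "disjuncts A = trD (Conj S)" "disjuncts (fm_neg A) = trD (fm_neg (Conj S))" by (rule long_conj)
    have "drv \<Gamma> U (m + n + 3) X" by (rule drv_cut[OF 2(1,3), where A = A]) (use 2 in \<open>simp_all add: A\<close>)
    moreover have "1 * (m + n + 3) \<le> E * (m + n + 6 * R + 4)" by (rule mult_mono) auto
    ultimately show ?thesis by (metis drv_mono mult_1)
  qed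
next
  case (3 F)
  have "drv \<Gamma> U (E * (n + m + 6 * R + 4)) X"
    by (rule 3(1)[OF 3(4) _ 3(2)]) (use 3 in auto)
  then show ?case by (simp add: add.commute)
qed


subsection \<open>Simulation of refutations\<close>

text \<open>The cost of conjunction introduction, the most expensive rule: the axiom for the
  conjunction, of cost \<open>5 * E\<close>, followed by two cuts in the sense of
  \<open>drv_cut_tr\<close>.\<close>

definition step_cost :: nat where
  "step_cost = E * (E * (5 * E + 6 * R + 5) + 6 * R + 5)"

text \<open>All lines of the simulation of one step are subsets of a single set \<open>U\<close>.
  Its total size \<open>M\<close> then bounds the size of each line up to 1, however many lines
  there are.\<close>

definition admissible :: "nat \<Rightarrow> nat \<Rightarrow> 'u fm set \<Rightarrow> bool" where
  "admissible t M U \<longleftrightarrow> finite U \<and> (\<forall>G\<in>U. ndisj G \<and> Pi_fm t (c * k) G) \<and> (\<Sum>G\<in>U. fm_size G) \<le> M"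

lemma admissible_Un: "admissible t M U \<Longrightarrow> admissible t N V \<Longrightarrow> admissible t (M + N) (U \<union> V)"
  unfolding admissible_def by (auto simp: sum_Un_nat)

lemma admissible_mono: "admissible t M U \<Longrightarrow> M \<le> N \<Longrightarrow> admissible t N U"
  unfolding admissible_def by auto

lemma admissible_trD:
  assumes "Sigma_fm (Suc t) k F" "fm_size F \<le> s" shows "admissible t (K * s) (fset (trD F))"
  using assms ndisj_trD depth_tr size_tr[of F] mult_left_mono[OF assms(2), of K]
  unfolding admissible_def by (meson finite_fset le_trans zero_le)

lemma admissible_all_lits: "fcard V \<le> m \<Longrightarrow> admissible t (2 * m) (fset (all_lits V))"
proof -
  assume m: "fcard V \<le> m"
  have "(\<Sum>G\<in>fset (all_lits V). fm_size G) = (\<Sum>G\<in>fset (all_lits V). 1)"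
    by (rule sum.cong) (auto simp: all_lits_def)
  also have "\<dots> \<le> card ((Lit \<circ> Pos) ` fset V) + card ((Lit \<circ> Neg) ` fset V)"
    unfolding all_lits_def by (simp add: card_Un_le)
  also have "\<dots> \<le> 2 * m"
    using card_image_le[of "fset V" "Lit \<circ> Pos"] card_image_le[of "fset V" "Lit \<circ> Neg"] m
    by (simp add: fcard.rep_eq)
  finally have "(\<Sum>G\<in>fset (all_lits V). fm_size G) \<le> 2 * m" .
  then show ?thesis using ck_pos unfolding admissible_def by (auto simp: all_lits_def)
qed

lemma Conj_disjuncts_mk_disj: "Conj S |\<in>| T \<Longrightarrow> Conj S |\<in>| disjuncts (mk_disj T)"
proof (cases "\<exists>F. T = {|F|}")
  case True
  moreover assume "Conj S |\<in>| T"
  ultimately have "T = {|Conj S|}" by auto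
  then show ?thesis by simp
qed (simp add: mk_disj_other)

lemma Conj_disjuncts_disj_fm: "G = Conj S \<Longrightarrow> G |\<in>| disjuncts (disj_fm H G)"
  unfolding disj_fm_def by (simp add: Conj_disjuncts_mk_disj)

text \<open>Units and idempotence can make a conjunction collapse to one of its two sides; the rule
  is then an instance of weakening. Otherwise the conjunction is a genuine one and appears as a
  disjunct of the conclusion.\<close>

lemma conj_fm_cases:
  assumes "fm_nf (disj_fm C A)" "fm_nf (disj_fm D B)"
  obtains "conj_fm A B = A" | "conj_fm A B = B" | S where "conj_fm A B = Conj S"
proof (cases "\<exists>H. conjuncts A |\<union>| conjuncts B = {|H|}")
  case True
  then obtain H where H: "conjuncts A |\<union>| conjuncts B = {|H|}" by blast
  then have G: "conj_fm A B = H" by (simp add: conj_fm_def)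
  have *: "F = H \<or> conjuncts F = {||}" if "conjuncts F |\<subseteq>| {|H|}" "fm_nf (disj_fm X F)" for X F
  proof (cases F)
    case (Conj S)
    then have "fm_nf (Conj S)" using ndisj_disjuncts[OF that(2)] Conj_disjuncts_disj_fm by (metis ndisj_def)
    then show ?thesis using that(1) Conj by (auto simp: fcard_one)
  qed (use that in auto)
  have "A = H \<or> B = H" using *[of A C] *[of B D] H assms by auto
  then show ?thesis
  proof
    assume "A = H"
    with G show ?thesis by (intro that(1)) simp
  next
    assume "B = H"
    with G show ?thesis by (intro that(2)) simp
  qed
next
  case False
  with that(3) show ?thesis by (simp add: conj_fm_def mk_conj_other)
qed

lemma fm_size_disjunct: "G |\<in>| disjuncts F \<Longrightarrow> fm_size G \<le> fm_size F"
  using order.trans[OF member_le_sum[of G "fset (disjuncts F)" fm_size] size_disjuncts] by simp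

text \<open>Conjunction introduction is replaced by two cuts with the axiom for the conjunction. The
  size bound is that of this case: both premises, the conclusion and the negated conjunction
  contribute \<open>K * s\<close> each, and the literals of three truth tables
  \<open>2 * (c * k)\<close> each.\<close>

lemma simulate_step:
  assumes "frege_rule Fs F" "\<And>G. G \<in> set (F # Fs) \<Longrightarrow> fm_nf G \<and> Sigma_fm (Suc t) k G \<and> fm_size G \<le> s"
  shows "\<exists>U. admissible t (4 * (K * s) + 6 * (c * k)) U \<and> drv (trD ` set Fs) U step_cost (trD F)"
  using assms
proof cases
  case (axiom A)
  let ?U = "fset (trD F) \<union> fset (all_lits (short_vars A))"
  have F: "trD F = trD A |\<union>| trD (fm_neg A)" using axiom by (simp add: trD_disj_fm)
  have "admissible t (K * s + 2 * (c * k)) ?U"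
    by (intro admissible_Un admissible_trD admissible_all_lits card_short_vars) (use assms(2) in auto)
  moreover have "drv (trD ` set Fs) ?U (5 * E) (trD F)"
    unfolding F by (rule drv_axiom) auto
  moreover have "1 * (1 * (5 * E)) \<le> step_cost"
    unfolding step_cost_def by (intro mult_mono trans_le_add1) auto
  ultimately show ?thesis by (intro exI[of _ ?U] conjI) (auto elim!: admissible_mono drv_mono)
next
  case (cut C A D)
  let ?P = "disj_fm C A" and ?Q = "disj_fm D (fm_neg A)"
  let ?U = "fset (trD ?P) \<union> fset (trD ?Q) \<union> fset (all_lits (short_vars A))"
  have "admissible t (K * s + K * s + 2 * (c * k)) ?U"
    by (intro admissible_Un admissible_trD admissible_all_lits card_short_vars) (use assms(2) cut in auto)
  moreover have "drv (trD ` set Fs) ?U (E * (1 + 1 + 6 * R + 4)) (trD F)"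
  proof (rule drv_cut_tr)
    show "drv (trD ` set Fs) ?U 1 (trD ?P)" "drv (trD ` set Fs) ?U 1 (trD ?Q)"
      by (rule hyp; use cut in auto)+
    show "trD ?P |\<subseteq>| trD F |\<union>| trD A" "trD ?Q |\<subseteq>| trD F |\<union>| trD (fm_neg A)"
      unfolding cut(2) trD_disj_fm by auto
  qed (auto simp: trD_disj_fm cut(2))
  moreover have "E * (1 + 1 + 6 * R + 4) \<le> step_cost"
  proof -
    have "1 * 5 \<le> E * (5 * E + 6 * R + 5)" by (rule mult_mono) auto
    then show ?thesis unfolding step_cost_def by (intro mult_left_mono) auto
  qed
  ultimately show ?thesis by (intro exI[of _ ?U] conjI) (auto elim!: admissible_mono drv_mono)
next
  case (conj_intro C A D B)
  let ?P = "disj_fm C A" and ?Q = "disj_fm D B" and ?G = "conj_fm A B"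
  let ?U0 = "fset (trD ?P) \<union> fset (trD ?Q) \<union> fset (trD F)"
  have F: "trD F = trD C |\<union>| trD D |\<union>| trD ?G" by (simp add: conj_intro trD_disj_fm)
  have U0: "admissible t (K * s + K * s + K * s) ?U0"
    by (intro admissible_Un admissible_trD) (use assms(2) conj_intro in auto)
  have P: "drv (trD ` set Fs) U 1 (trD ?P)" "drv (trD ` set Fs) U 1 (trD ?Q)" if "?U0 \<subseteq> U" for U
    using that conj_intro by (auto intro!: hyp)
  have small: "2 \<le> step_cost"
  proof -
    have "1 * 2 \<le> step_cost" unfolding step_cost_def by (rule mult_mono) auto
    then show ?thesis by simp
  qed
  have "fm_nf ?P" "fm_nf ?Q" using assms(2) conj_intro by auto
  then show ?thesis
  proof (cases rule: conj_fm_cases)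
    case 1
    have "drv (trD ` set Fs) ?U0 2 (trD F)"
      by (rule weak[OF P(1)]) (auto simp: F 1 trD_disj_fm)
    with small show ?thesis using U0 by (intro exI[of _ ?U0] conjI) (auto elim!: admissible_mono drv_mono)
  next
    case 2
    have "drv (trD ` set Fs) ?U0 2 (trD F)"
      by (rule weak[OF P(2)]) (auto simp: F 2 trD_disj_fm)
    with small show ?thesis using U0 by (intro exI[of _ ?U0] conjI) (auto elim!: admissible_mono drv_mono)
  next
    case (3 S)
    let ?L = "fset (all_lits (short_vars A)) \<union> fset (all_lits (short_vars B)) \<union> fset (all_lits (short_vars ?G))"
    let ?U = "?U0 \<union> fset (trD (fm_neg ?G)) \<union> ?L"
    \<comment> \<open>The conjunction is a disjunct of the conclusion, which bounds its class and
      its size; its components alone would not.\<close>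
    have G: "?G |\<in>| disjuncts F" unfolding conj_intro by (rule Conj_disjuncts_disj_fm[OF 3])
    have "Pi_fm t k ?G" using G assms(2)[of F] by auto
    then have "Sigma_fm (Suc t) k (fm_neg ?G)" using Sigma_Pi_Suc[OF k_pos, of t "fm_neg ?G"] by (simp only: Sigma_Pi_neg)
    moreover have "fm_size (fm_neg ?G) \<le> s" using fm_size_disjunct[OF G] assms(2)[of F] by simp
    ultimately have "admissible t (K * s) (fset (trD (fm_neg ?G)))" by (rule admissible_trD)
    then have U: "admissible t ((K * s + K * s + K * s) + K * s + (2 * (c * k) + 2 * (c * k) + 2 * (c * k))) ?U"
      by (intro admissible_Un[OF admissible_Un[OF U0]] admissible_Un admissible_all_lits card_short_vars)
    have nG: "trD (fm_neg ?G) = trD (fm_neg A) |\<union>| trD (fm_neg B)"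
      using tr_neg[of ?G] tr_neg[of A] tr_neg[of B] by (simp add: trC_conj_fm fimage_funion)
    have a: "drv (trD ` set Fs) ?U (5 * E) (trD ?G |\<union>| trD (fm_neg ?G))"
      by (rule drv_axiom) (auto simp: F)
    have b: "drv (trD ` set Fs) ?U (E * (1 + 5 * E + 6 * R + 4)) (trD C |\<union>| trD ?G |\<union>| trD (fm_neg B))"
      by (rule drv_cut_tr[OF P(1) _ a, where F = A]) (auto simp: F nG trD_disj_fm)
    have "drv (trD ` set Fs) ?U (E * (1 + E * (1 + 5 * E + 6 * R + 4) + 6 * R + 4)) (trD F)"
      by (rule drv_cut_tr[OF P(2) _ b, where F = B]) (auto simp: F nG trD_disj_fm)
    then have "drv (trD ` set Fs) ?U step_cost (trD F)"
      by (rule drv_mono) (simp add: step_cost_def algebra_simps)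
    with U show ?thesis by (intro exI[of _ ?U] conjI) (auto elim!: admissible_mono)
  qed
next
  case (weakening C D)
  let ?U = "fset (trD F)"
  have "admissible t (K * s) ?U" by (rule admissible_trD) (use assms(2) in auto)
  moreover have "drv (trD ` set Fs) ?U 1 (trD C)"
    by (rule hyp) (auto simp: weakening trD_disj_fm)
  then have "drv (trD ` set Fs) ?U 2 (trD F)"
    by (rule weak) (auto simp: weakening trD_disj_fm)
  moreover have "1 * 2 \<le> step_cost" unfolding step_cost_def by (rule mult_mono) auto
  ultimately show ?thesis by (intro exI[of _ ?U] conjI) (auto elim!: admissible_mono drv_mono)
qed

lemma admissible_lines:
  assumes "admissible t M U" "fset Y \<subseteq> U"
  shows "Sigma_fm (Suc t) (c * k) (mk_disj Y)" "fm_size (mk_disj Y) \<le> M + 1"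
proof -
  have "disjuncts (mk_disj Y) = Y" by (rule disjuncts_mk_disj) (use assms in \<open>auto simp: admissible_def\<close>)
  then show "Sigma_fm (Suc t) (c * k) (mk_disj Y)" using assms by (auto simp: admissible_def)
  have "(\<Sum>G\<in>fset Y. fm_size G) \<le> (\<Sum>G\<in>U. fm_size G)"
    by (rule sum_mono2) (use assms in \<open>auto simp: admissible_def\<close>)
  then show "fm_size (mk_disj Y) \<le> M + 1"
    using size_mk_disj[of Y] assms by (simp add: admissible_def)
qed

lemma trD_clause_fm: "trD (clause_fm C) = fBig (\<lambda>l. dnf {|Lit l|}) C"
  unfolding clause_fm_def trD_mk_disj by (simp add: trD_simps)

lemma mk_disj_empty [simp]: "mk_disj {||} = Disj {||}"
  by (rule mk_disj_other) auto

text \<open>\<open>N\<close> bounds the number of new lines per line of \<open>\<pi>\<close> and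
  \<open>M + 1\<close> their size; \<open>\<pi>\<close> has at most \<open>s\<close> lines since
  each has positive size. \<open>\<rho>0\<close> is a preliminary derivation whose lines may be used
  for the initial clauses.\<close>

theorem simulate_refutation:
  assumes \<pi>: "bounded_refutation \<Phi> (Suc t) k s \<pi>"
    and \<rho>0: "frege_proof (clause_fm ` \<Delta>) \<rho>0" "\<And>G. G \<in> set \<rho>0 \<Longrightarrow> Sigma_fm (Suc t) (c * k) G"
    and inp: "\<And>C. C \<in> \<Phi> \<Longrightarrow> \<exists>U. admissible t M U \<and>
      drv {X. mk_disj X \<in> set \<rho>0 \<union> clause_fm ` \<Delta>} U N (fBig (\<lambda>l. dnf {|Lit l|}) C)"
    and N: "step_cost \<le> N" and M: "4 * (K * s) + 6 * (c * k) \<le> M"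
  shows "\<exists>\<pi>' s'. bounded_refutation \<Delta> (Suc t) (c * k) s' \<pi>' \<and> s' \<le> proof_size \<rho>0 + s * N * (M + 1) + 1"
proof -
  have pf: "frege_proof (clause_fm ` \<Phi>) \<pi>" and last: "\<pi> \<noteq> []" "last \<pi> = empty_fm"
    and cls: "\<And>G. G \<in> set \<pi> \<Longrightarrow> Sigma_fm (Suc t) k G" and size: "proof_size \<pi> = s"
    using \<pi> by (auto simp: bounded_refutation_def frege_refutation_def)
  have nf: "fm_nf G" if "G \<in> set \<pi>" for G
    using that pf by (auto simp: frege_proof_def in_set_conv_nth)
  have le_s: "fm_size G \<le> s" if "G \<in> set \<pi>" for G
    unfolding size[symmetric] proof_size_def using that by (simp add: member_le_sum_list)
  have "(\<Sum>G\<leftarrow>\<pi>. 1) \<le> (\<Sum>G\<leftarrow>\<pi>. fm_size G)"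
    by (rule sum_list_mono) (simp add: fm_size_pos Suc_le_eq)
  then have len: "length \<pi> \<le> s"
    unfolding size[symmetric] proof_size_def by (simp add: sum_list_triv)
  have "\<exists>\<rho>. frege_proof (clause_fm ` \<Delta>) (\<rho>0 @ \<rho>) \<and> length \<rho> \<le> i * N \<and>
      (\<forall>j<i. mk_disj (trD (\<pi> ! j)) \<in> set (\<rho>0 @ \<rho>)) \<and>
      (\<forall>G\<in>set \<rho>. Sigma_fm (Suc t) (c * k) G \<and> fm_size G \<le> M + 1)" if "i \<le> length \<pi>" for i
    using that
  proof (induction i)
    case 0
    then show ?case using \<rho>0 by (intro exI[of _ "[]"]) auto
  next
    case (Suc i)
    then obtain \<rho> where \<rho>: "frege_proof (clause_fm ` \<Delta>) (\<rho>0 @ \<rho>)" "length \<rho> \<le> i * N"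
      "\<And>j. j < i \<Longrightarrow> mk_disj (trD (\<pi> ! j)) \<in> set (\<rho>0 @ \<rho>)"
      "\<And>G. G \<in> set \<rho> \<Longrightarrow> Sigma_fm (Suc t) (c * k) G \<and> fm_size G \<le> M + 1" by auto
    let ?F = "\<pi> ! i"
    have "\<exists>\<Gamma> U. admissible t M U \<and> drv \<Gamma> U N (trD ?F) \<and> (\<forall>Y\<in>\<Gamma>. mk_disj Y \<in> set (\<rho>0 @ \<rho>) \<union> clause_fm ` \<Delta>)"
    proof (cases "?F \<in> clause_fm ` \<Phi>")
      case True
      then obtain C where "C \<in> \<Phi>" "?F = clause_fm C" by blast
      with inp[of C] obtain U where "admissible t M U"
        "drv {X. mk_disj X \<in> set \<rho>0 \<union> clause_fm ` \<Delta>} U N (trD ?F)" by (auto simp: trD_clause_fm)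
      then show ?thesis by (intro exI[of _ "{X. mk_disj X \<in> set \<rho>0 \<union> clause_fm ` \<Delta>}"] exI[of _ U]) auto
    next
      case False
      then obtain Fs where Fs: "set Fs \<subseteq> set (take i \<pi>)" "frege_rule Fs ?F"
        using pf Suc.prems unfolding frege_proof_def by (meson Suc_le_lessD)
      have "\<exists>U. admissible t (4 * (K * s) + 6 * (c * k)) U \<and> drv (trD ` set Fs) U step_cost (trD ?F)"
      proof (rule simulate_step[OF Fs(2)])
        fix G assume "G \<in> set (?F # Fs)"
        then have "G \<in> set \<pi>" using Fs(1) Suc.prems by (auto dest: in_set_takeD)
        then show "fm_nf G \<and> Sigma_fm (Suc t) k G \<and> fm_size G \<le> s" using nf cls le_s by blast
      qed
      then obtain U where "admissible t M U" "drv (trD ` set Fs) U N (trD ?F)"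
        using admissible_mono[OF _ M] drv_mono[OF _ N] by blast
      moreover have "mk_disj Y \<in> set (\<rho>0 @ \<rho>)" if Y: "Y \<in> trD ` set Fs" for Y
      proof -
        obtain G where G: "G \<in> set (take i \<pi>)" "Y = trD G" using Y Fs(1) by blast
        then obtain j where "j < i" "G = \<pi> ! j" by (metis in_set_conv_nth length_take min_less_iff_conj nth_take)
        then show ?thesis using \<rho>(3) G(2) by blast
      qed
      ultimately show ?thesis by (intro exI[of _ "trD ` set Fs"] exI[of _ U]) auto
    qed
    then obtain \<Gamma> U where U: "admissible t M U" "drv \<Gamma> U N (trD ?F)"
      "\<And>Y. Y \<in> \<Gamma> \<Longrightarrow> mk_disj Y \<in> set (\<rho>0 @ \<rho>) \<union> clause_fm ` \<Delta>" by blast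
    have nd: "ndisj G" if "G \<in> U" for G using U(1) that by (simp add: admissible_def)
    obtain \<rho>' where \<rho>': "frege_proof (clause_fm ` \<Delta>) ((\<rho>0 @ \<rho>) @ \<rho>')" "length \<rho>' \<le> N"
      "mk_disj (trD ?F) \<in> set ((\<rho>0 @ \<rho>) @ \<rho>')" "\<forall>G\<in>set \<rho>'. \<exists>Y. fset Y \<subseteq> U \<and> G = mk_disj Y"
      using drv_frege_proof[OF U(2) nd \<rho>(1) U(3)] by blast
    have cl: "Sigma_fm (Suc t) (c * k) G \<and> fm_size G \<le> M + 1" if G: "G \<in> set (\<rho> @ \<rho>')" for G
    proof (cases "G \<in> set \<rho>")
      case False
      with G \<rho>'(4) obtain Y where "fset Y \<subseteq> U" "G = mk_disj Y" by auto
      then show ?thesis using admissible_lines[OF U(1)] by blast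
    qed (rule \<rho>(4))
    show ?case
    proof (intro exI[of _ "\<rho> @ \<rho>'"] conjI allI impI ballI)
      show "frege_proof (clause_fm ` \<Delta>) (\<rho>0 @ \<rho> @ \<rho>')" using \<rho>'(1) by simp
      show "length (\<rho> @ \<rho>') \<le> Suc i * N" using \<rho>(2) \<rho>'(2) by simp
      show "mk_disj (trD (\<pi> ! j)) \<in> set (\<rho>0 @ \<rho> @ \<rho>')" if "j < Suc i" for j
        using that \<rho>(3)[of j] \<rho>'(3) by (cases "j = i") auto
    qed (use cl in blast)+
  qed
  from this[of "length \<pi>"] obtain \<rho> where \<rho>: "frege_proof (clause_fm ` \<Delta>) (\<rho>0 @ \<rho>)" "length \<rho> \<le> length \<pi> * N"
      "\<And>j. j < length \<pi> \<Longrightarrow> mk_disj (trD (\<pi> ! j)) \<in> set (\<rho>0 @ \<rho>)"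
      "\<And>G. G \<in> set \<rho> \<Longrightarrow> Sigma_fm (Suc t) (c * k) G \<and> fm_size G \<le> M + 1" by auto
  have "mk_disj (trD (last \<pi>)) \<in> set (\<rho>0 @ \<rho>)" using \<rho>(3)[of "length \<pi> - 1"] last(1) by (simp add: last_conv_nth)
  then have e: "empty_fm \<in> set (\<rho>0 @ \<rho>)" using last(2) by (simp add: trD_simps)
  \<comment> \<open>The empty formula occurs somewhere in the simulation. Weakening it by itself
    repeats it as the last line.\<close>
  have "disj_fm empty_fm empty_fm = (empty_fm :: 'u fm)" by (simp add: disj_fm_def)
  then have "frege_rule [empty_fm] (empty_fm :: 'u fm)" by (metis frege_rule.weakening)
  moreover have "set [empty_fm] \<subseteq> set (\<rho>0 @ \<rho>)" using e by auto
  ultimately have p: "frege_proof (clause_fm ` \<Delta>) ((\<rho>0 @ \<rho>) @ [empty_fm])"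
    unfolding frege_proof_snoc using \<rho>(1) by (auto simp: fcard_fempty)
  have "(\<Sum>G\<leftarrow>\<rho>. fm_size G) \<le> (\<Sum>G\<leftarrow>\<rho>. M + 1)" by (rule sum_list_mono) (use \<rho>(4) in auto)
  also have "\<dots> = length \<rho> * (M + 1)" by (simp add: sum_list_triv)
  also have "\<dots> \<le> s * N * (M + 1)"
    using \<rho>(2) len by (meson le_trans mult_le_mono order.refl)
  finally have "proof_size ((\<rho>0 @ \<rho>) @ [empty_fm]) \<le> proof_size \<rho>0 + s * N * (M + 1) + 1"
    by (simp add: proof_size_def)
  moreover have "bounded_refutation \<Delta> (Suc t) (c * k) (proof_size ((\<rho>0 @ \<rho>) @ [empty_fm])) ((\<rho>0 @ \<rho>) @ [empty_fm])"
    unfolding bounded_refutation_def frege_refutation_def using p \<rho>(4) \<rho>0(2) by auto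
  ultimately show ?thesis by blast
qed

end

section \<open>Local simulations between encodings\<close>

text \<open>Implicational completeness by truth table: under each assignment either a literal of
  \<open>C\<close> is true and its axiom is weakened, or some clause of \<open>\<Delta>\<close> over
  \<open>V\<close> is false and hence contained in \<open>falsified V \<alpha>\<close>.\<close>

lemma drv_clause:
  assumes "\<And>\<alpha>. \<alpha> |\<subseteq>| V \<Longrightarrow> (\<And>D. D \<in> \<Delta> \<Longrightarrow> (\<And>l. l |\<in>| D \<Longrightarrow> lit_var l |\<in>| V) \<Longrightarrow> \<exists>l. l |\<in>| D \<and> lit_sat (fset \<alpha>) l) \<Longrightarrow>
      (\<exists>l. l |\<in>| C \<and> lit_sat (fset \<alpha>) l)"
    and C: "\<And>l. l |\<in>| C \<Longrightarrow> lit_var l |\<in>| V" and \<Gamma>: "\<And>D. D \<in> \<Delta> \<Longrightarrow> Lit |`| D \<in> \<Gamma>"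
  shows "drv \<Gamma> (fset (all_lits V)) (2 ^ fcard V * 5) (Lit |`| C)"
proof -
  let ?U = "fset (all_lits V)"
  have U: "Lit l \<in> ?U \<and> Lit (lit_neg l) \<in> ?U" if "lit_var l |\<in>| V" for l
    using that by (cases l) (auto simp: all_lits_def)
  have fal: "Lit l |\<in>| falsified V \<alpha>" if "lit_var l |\<in>| V" "\<not> lit_sat (fset \<alpha>) l" for l \<alpha>
    using that by (cases l) (auto simp: falsified_def)
  have CU: "fset (Lit |`| C) \<subseteq> ?U" using C U by auto
  have "drv \<Gamma> ?U (2 ^ fcard V * (2 + 3)) (Lit |`| C)"
  proof (rule drv_truth_table[OF _ CU])
    fix \<alpha> assume \<alpha>: "\<alpha> |\<subseteq>| V"
    have fU: "fset (falsified V \<alpha>) \<subseteq> ?U" by (rule falsified_subset) auto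
    show "drv \<Gamma> ?U 2 (Lit |`| C |\<union>| falsified V \<alpha>)"
    proof (cases "\<exists>l. l |\<in>| C \<and> lit_sat (fset \<alpha>) l")
      case True
      then obtain l where l: "l |\<in>| C" "lit_sat (fset \<alpha>) l" by blast
      have lV: "lit_var l |\<in>| V" using C l by auto
      have "\<not> lit_sat (fset \<alpha>) (lit_neg l)" using l(2) by (cases l) auto
      then have "Lit (lit_neg l) |\<in>| falsified V \<alpha>" using fal[of "lit_neg l" \<alpha>] lV by simp
      moreover have "drv \<Gamma> ?U 1 (disjuncts (Lit l) |\<union>| disjuncts (fm_neg (Lit l)))"
        by (rule ax) (use U[OF lV] in auto)
      ultimately show ?thesis using l(1) CU fU by (elim weak) auto
    next
      case False
      then obtain D where D: "D \<in> \<Delta>" "\<And>l. l |\<in>| D \<Longrightarrow> lit_var l |\<in>| V" "\<And>l. l |\<in>| D \<Longrightarrow> \<not> lit_sat (fset \<alpha>) l"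
        using assms(1)[OF \<alpha>] by blast
      have "drv \<Gamma> ?U 1 (Lit |`| D)" by (rule hyp[OF \<Gamma>[OF D(1)]]) (use D(2) U in auto)
      moreover have "Lit |`| D |\<subseteq>| falsified V \<alpha>" using D fal by auto
      ultimately show ?thesis using CU fU by (elim weak) auto
    qed
  qed auto
  then show ?thesis by simp
qed

context substitution
begin

text \<open>The analogue of \<open>drv_clause\<close> after substitution: where a literal of
  \<open>C\<close> becomes true, its DNF contains a minterm that holds under the assignment.\<close>

lemma drv_substituted_clause:
  assumes sem: "\<And>\<alpha>. \<alpha> |\<subseteq>| V \<Longrightarrow>
      (\<And>D. D \<in> \<Delta> \<Longrightarrow> (\<And>l. l |\<in>| D \<Longrightarrow> lit_var l |\<in>| V) \<Longrightarrow> \<exists>l. l |\<in>| D \<and> lit_sat (fset \<alpha>) l) \<Longrightarrow>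
      (\<exists>l. l |\<in>| C \<and> lit_true \<alpha> l)"
    and C: "\<And>l. l |\<in>| C \<Longrightarrow> W (lit_var l) |\<subseteq>| V" and \<Gamma>: "\<And>D. D \<in> \<Delta> \<Longrightarrow> Lit |`| D \<in> \<Gamma>"
  shows "\<exists>U. admissible t (K * fcard C + 2 * fcard V) U \<and>
    drv \<Gamma> U (2 ^ fcard V * 5) (fBig (\<lambda>l. dnf {|Lit l|}) C)"
proof -
  let ?X = "fBig (\<lambda>l. dnf {|Lit l|}) C"
  let ?U = "fset ?X \<union> fset (all_lits V)"
  have U: "Lit l \<in> fset (all_lits V)" if "lit_var l |\<in>| V" for l
    using that by (cases l) (auto simp: all_lits_def)
  have fal: "Lit l |\<in>| falsified V \<alpha>" if "lit_var l |\<in>| V" "\<not> lit_sat (fset \<alpha>) l" for l \<alpha>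
    using that by (cases l) (auto simp: falsified_def)
  have "drv \<Gamma> ?U (2 ^ fcard V * (2 + 3)) ?X"
  proof (rule drv_truth_table)
    fix \<alpha> assume \<alpha>: "\<alpha> |\<subseteq>| V"
    show "drv \<Gamma> ?U 2 (?X |\<union>| falsified V \<alpha>)"
    proof (cases "\<exists>l. l |\<in>| C \<and> lit_true \<alpha> l")
      case True
      then obtain l where l: "l |\<in>| C" "lit_true \<alpha> l" by blast
      then have "dnf {|Lit l|} |\<subseteq>| ?X" by auto
      then show ?thesis using l C[OF l(1)]
        by (intro drv_true_dnf[of "{|Lit l|}"]) (auto simp: term_vars_def)
    next
      case False
      then obtain D where D: "D \<in> \<Delta>" "\<And>l. l |\<in>| D \<Longrightarrow> lit_var l |\<in>| V" "\<And>l. l |\<in>| D \<Longrightarrow> \<not> lit_sat (fset \<alpha>) l"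
        using sem[OF \<alpha>] by blast
      have "drv \<Gamma> ?U 1 (Lit |`| D)" by (rule hyp[OF \<Gamma>[OF D(1)]]) (use D(2) U in auto)
      moreover have "Lit |`| D |\<subseteq>| falsified V \<alpha>" using D fal by auto
      moreover have "fset (falsified V \<alpha>) \<subseteq> ?U" using falsified_subset[of V V] by blast
      ultimately show ?thesis by (elim weak) auto
    qed
  qed auto
  moreover have "admissible t (K * fcard C) (fset ?X)"
  proof -
    have "(\<Sum>G\<in>fset ?X. fm_size G) \<le> (\<Sum>l\<in>fset C. \<Sum>G\<in>fset (dnf {|Lit l|}). fm_size G)"
      unfolding fset_fBig by (rule sum_UN_le) auto
    also have "\<dots> \<le> (\<Sum>l\<in>fset C. K)" by (intro sum_mono size_dnf) simp
    finally show ?thesis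
      unfolding admissible_def using ndisj_dnf Pi_dnf[OF short_Lit] by (auto simp: fcard.rep_eq mult.commute)
  qed
  then have "admissible t (K * fcard C + 2 * fcard V) ?U"
    by (intro admissible_Un admissible_all_lits) auto
  ultimately show ?thesis by (intro exI[of _ ?U]) simp
qed

text \<open>As \<open>k\<close> is less than \<open>E\<close>, all costs are polynomial in
  \<open>E\<close>, which is a power of \<open>2 ^ k\<close> with the fixed exponent
  \<open>c\<close>. The 27 is 16 + 6 + 5, where 16 = 5 + 6 + 5 bounds the inner bracket of
  \<open>step_cost\<close>.\<close>

lemma cost_bounds: "K \<le> E ^ 2" "R \<le> E ^ 2" "step_cost \<le> 27 * E ^ 4" "c * k + 1 \<le> E"
proof -
  show ck: "c * k + 1 \<le> E" unfolding E_def by (simp add: Suc_le_eq)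
  then show "K \<le> E ^ 2" unfolding K_def power2_eq_square by (intro mult_left_mono) auto
  have "1 * k \<le> c * k" using c_pos by (rule mult_right_mono) simp
  then have "k \<le> E" using ck unfolding mult_1 by linarith
  then show R: "R \<le> E ^ 2" unfolding R_def power2_eq_square by (intro mult_left_mono) auto
  have E1: "1 \<le> E" by simp
  have p: "E \<le> E ^ 2" "1 \<le> E ^ 2" "E ^ 2 \<le> E ^ 3" "1 \<le> E ^ 3"
    using power_increasing[of 1 2 E] power_increasing[of 2 3 E] by simp_all
  have "5 * E + 6 * R + 5 \<le> 16 * E ^ 2" using R p by linarith
  then have "E * (5 * E + 6 * R + 5) \<le> E * (16 * E ^ 2)" by (rule mult_left_mono) simp
  also have "\<dots> = 16 * E ^ 3" by (simp add: power2_eq_square power3_eq_cube)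
  finally have "E * (5 * E + 6 * R + 5) + 6 * R + 5 \<le> 27 * E ^ 3" using R p by linarith
  then have "step_cost \<le> E * (27 * E ^ 3)" unfolding step_cost_def by (rule mult_left_mono) simp
  also have "\<dots> = 27 * E ^ 4" using power_Suc[of E 3] by simp
  finally show "step_cost \<le> 27 * E ^ 4" .
qed

end

text \<open>One parameter serves as coefficient and exponent. Bounds of this shape are closed under
  composition of reductions and absorb constants; \<open>n + 1\<close> keeps the factor positive for
  the empty structure.\<close>

definition size_bound :: "nat \<Rightarrow> nat \<Rightarrow> nat \<Rightarrow> nat \<Rightarrow> nat" where
  "size_bound b k s n = (b * 2 ^ k * s * (n + 1)) ^ b"

text \<open>All hypotheses on the instance are packed into one implication so that \<open>b\<close>
  is chosen before \<open>k\<close>, \<open>t\<close>, \<open>s\<close> and the instance.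
  \<open>m\<close> bounds the initial clauses and the variables of their derivations,
  \<open>a\<close> the preliminary proof.\<close>

lemma simulate_bounded:
  fixes c m a :: nat
  assumes "1 \<le> c"
  shows "\<exists>b. \<forall>k W g (\<Phi> :: 'v clause set) (\<Delta> :: 'u clause set) \<Delta>' \<rho>0 t s \<pi> n.
    1 \<le> k \<and> (\<forall>v. fcard (W v) \<le> c) \<and>
    bounded_refutation \<Phi> (Suc t) k s \<pi> \<and> frege_proof (clause_fm ` \<Delta>) \<rho>0 \<and> (\<forall>G\<in>set \<rho>0. Sigma_fm (Suc t) (c * k) G) \<and>
    proof_size \<rho>0 \<le> (a * (n + 1)) ^ a \<and> clause_fm ` \<Delta>' \<subseteq> set \<rho>0 \<union> clause_fm ` \<Delta> \<and>
    (\<forall>C\<in>\<Phi>. \<exists>V. fcard V \<le> m \<and> fcard C \<le> m \<and> (\<forall>l. l |\<in>| C \<longrightarrow> W (lit_var l) |\<subseteq>| V) \<and>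
      (\<forall>\<alpha>. \<alpha> |\<subseteq>| V \<and> (\<forall>D\<in>\<Delta>'. (\<forall>l. l |\<in>| D \<longrightarrow> lit_var l |\<in>| V) \<longrightarrow> (\<exists>l. l |\<in>| D \<and> lit_sat (fset \<alpha>) l)) \<longrightarrow>
        (\<exists>l. l |\<in>| C \<and> subst_true W g \<alpha> l))) \<longrightarrow>
    (\<exists>\<pi>' s'. bounded_refutation \<Delta> (Suc t) (c * k) s' \<pi>' \<and> s' \<le> size_bound b k s n)"
proof -
  \<comment> \<open>The factor \<open>27 * 5 * 2 ^ m\<close> comes from \<open>N\<close>, at most
    \<open>27 * E ^ 4 * (5 * 2 ^ m)\<close>, and \<open>11 + 3 * m\<close> from
    \<open>M + 1\<close>, at most \<open>E ^ 2 * s * (11 + 3 * m)\<close>, where \<open>E\<close> is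
    \<open>2 ^ k\<close> to the power \<open>c\<close>.\<close>
  define A where "A = 27 * 5 * 2 ^ m * (11 + 3 * m)"
  \<comment> \<open>Neither the coefficient \<open>a ^ a + A + 1\<close> nor the exponents
    \<open>6 * c + 2\<close> and \<open>a\<close> below may exceed \<open>b\<close>.\<close>
  define b where "b = a ^ a + A + a + 6 * c + 3"
  have *: "\<exists>\<pi>' s'. bounded_refutation \<Delta> (Suc t) (c * k) s' \<pi>' \<and> s' \<le> size_bound b k s n"
    if k: "1 \<le> k" and W: "\<forall>v. fcard (W v) \<le> c"
      and \<pi>: "bounded_refutation \<Phi> (Suc t) k s \<pi>" and \<rho>0: "frege_proof (clause_fm ` \<Delta>) \<rho>0" "\<forall>G\<in>set \<rho>0. Sigma_fm (Suc t) (c * k) G"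
      and size: "proof_size \<rho>0 \<le> (a * (n + 1)) ^ a" and \<Delta>': "clause_fm ` \<Delta>' \<subseteq> set \<rho>0 \<union> clause_fm ` \<Delta>"
      and inp: "\<forall>C\<in>\<Phi>. \<exists>V. fcard V \<le> m \<and> fcard C \<le> m \<and> (\<forall>l. l |\<in>| C \<longrightarrow> W (lit_var l) |\<subseteq>| V) \<and>
      (\<forall>\<alpha>. \<alpha> |\<subseteq>| V \<and> (\<forall>D\<in>\<Delta>'. (\<forall>l. l |\<in>| D \<longrightarrow> lit_var l |\<in>| V) \<longrightarrow> (\<exists>l. l |\<in>| D \<and> lit_sat (fset \<alpha>) l)) \<longrightarrow>
        (\<exists>l. l |\<in>| C \<and> subst_true W g \<alpha> l))"
    for k W g t s \<pi> n and \<Phi> :: "'v clause set" and \<Delta> \<Delta>' :: "'u clause set" and \<rho>0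
  proof -
    interpret substitution k W g c using W k assms by unfold_locales auto
    let ?\<Gamma> = "{X. mk_disj X \<in> set \<rho>0 \<union> clause_fm ` \<Delta>}"
    define N where "N = step_cost + 2 ^ m * 5"
    define M where "M = 4 * (K * s) + 6 * (c * k) + (K * m + 2 * m)"
    have \<Gamma>: "Lit |`| D \<in> ?\<Gamma>" if "D \<in> \<Delta>'" for D
      using that \<Delta>' by (auto simp: clause_fm_def)
    have "\<exists>U. admissible t M U \<and> drv ?\<Gamma> U N (fBig (\<lambda>l. dnf {|Lit l|}) C)" if "C \<in> \<Phi>" for C
    proof -
      from bspec[OF inp \<open>C \<in> \<Phi>\<close>] obtain V where V: "fcard V \<le> m" "fcard C \<le> m"
        "\<forall>l. l |\<in>| C \<longrightarrow> W (lit_var l) |\<subseteq>| V"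
        "\<forall>\<alpha>. \<alpha> |\<subseteq>| V \<and> (\<forall>D\<in>\<Delta>'. (\<forall>l. l |\<in>| D \<longrightarrow> lit_var l |\<in>| V) \<longrightarrow> (\<exists>l. l |\<in>| D \<and> lit_sat (fset \<alpha>) l)) \<longrightarrow>
          (\<exists>l. l |\<in>| C \<and> lit_true \<alpha> l)"
        by (elim exE conjE) (rule that; assumption)
      have "\<exists>U. admissible t (K * fcard C + 2 * fcard V) U \<and> drv ?\<Gamma> U (2 ^ fcard V * 5) (fBig (\<lambda>l. dnf {|Lit l|}) C)"
      proof (rule drv_substituted_clause[where \<Delta> = \<Delta>'])
        fix \<alpha>
        assume "\<alpha> |\<subseteq>| V" "\<And>D. D \<in> \<Delta>' \<Longrightarrow> (\<And>l. l |\<in>| D \<Longrightarrow> lit_var l |\<in>| V) \<Longrightarrow> \<exists>l. l |\<in>| D \<and> lit_sat (fset \<alpha>) l"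
        then show "\<exists>l. l |\<in>| C \<and> lit_true \<alpha> l"
          by (intro V(4)[rule_format] conjI ballI impI) auto
      qed (use V(3) \<Gamma> in auto)
      then obtain U where U: "admissible t (K * fcard C + 2 * fcard V) U"
        "drv ?\<Gamma> U (2 ^ fcard V * 5) (fBig (\<lambda>l. dnf {|Lit l|}) C)" by blast
      have "K * fcard C + 2 * fcard V \<le> M" unfolding M_def using V by (intro trans_le_add2 add_mono mult_left_mono) auto
      moreover have "2 ^ fcard V * 5 \<le> N" unfolding N_def using V(1) by (intro trans_le_add2 mult_right_mono power_increasing) auto
      ultimately show ?thesis using U admissible_mono drv_mono by blast
    qed
    then obtain \<pi>' s' where s': "bounded_refutation \<Delta> (Suc t) (c * k) s' \<pi>'" "s' \<le> proof_size \<rho>0 + s * N * (M + 1) + 1"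
      using simulate_refutation[OF \<pi> \<rho>0(1) \<rho>0(2)[rule_format], of M N] by (auto simp: M_def N_def)
    have "\<pi> \<noteq> []" "proof_size \<pi> = s" using \<pi> by (auto simp: bounded_refutation_def frege_refutation_def)
    then have s: "1 \<le> s" using fm_size_pos[of "hd \<pi>"] by (cases \<pi>) (auto simp: proof_size_def)
    define x :: nat where "x = 2 ^ k"
    have x: "1 \<le> x" by (simp add: x_def)
    have E: "E = x ^ c" by (simp add: E_def x_def power_mult[symmetric] mult.commute)
    have E1: "1 \<le> E" by simp
    have add_le_mult: "p + q \<le> p * q" if "2 \<le> p" "2 \<le> q" for p q :: nat
    proof -
      obtain i j where "p = 2 + i" "q = 2 + j" using \<open>2 \<le> p\<close> \<open>2 \<le> q\<close> by (auto simp: le_iff_add)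
      then show ?thesis by (simp add: algebra_simps)
    qed
    have "N \<le> 27 * E ^ 4 * (5 * 2 ^ m)"
    proof -
      have "1 \<le> E ^ 4" "(1::nat) \<le> 2 ^ m" by simp_all
      then have "2 \<le> 27 * E ^ 4" "2 \<le> 5 * (2::nat) ^ m" by linarith+
      then show ?thesis using add_le_mult[of "27 * E ^ 4" "5 * 2 ^ m"] cost_bounds(3) by (simp add: N_def)
    qed
    moreover have "M + 1 \<le> E ^ 2 * s * (11 + 3 * m)"
    proof -
      have Es: "1 \<le> E ^ 2 * s" "E \<le> E ^ 2 * s" "E ^ 2 \<le> E ^ 2 * s" using s E1 by (auto simp: power2_eq_square)
      define z where "z = E ^ 2 * s"
      have Ks: "K * s \<le> z" unfolding z_def using cost_bounds(1) by (rule mult_right_mono) simp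
      have ck: "c * k \<le> z" using cost_bounds(4) Es unfolding z_def by linarith
      have "K \<le> z" unfolding z_def using cost_bounds(1) Es by linarith
      then have Km: "K * m \<le> z * m" by (rule mult_right_mono) simp
      have "1 * m \<le> z * m" unfolding z_def using Es(1) by (rule mult_right_mono) simp
      moreover have "z * (11 + 3 * m) = 11 * z + 3 * (z * m)" by (simp add: algebra_simps)
      ultimately show ?thesis unfolding M_def z_def[symmetric] using Es(1) Ks ck Km unfolding z_def[symmetric] by linarith
    qed
    ultimately have "N * (M + 1) \<le> (27 * E ^ 4 * (5 * 2 ^ m)) * (E ^ 2 * s * (11 + 3 * m))" by (rule mult_le_mono)
    also have "\<dots> = A * (E ^ 6 * s)" using power_add[of E 4 2] by (simp add: A_def algebra_simps)
    finally have "s * (N * (M + 1)) \<le> s * (A * (E ^ 6 * s))" by (rule mult_left_mono) simp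
    then have NM: "s * N * (M + 1) \<le> A * (x ^ (6 * c) * s ^ 2)"
      by (simp add: E power_mult[symmetric] algebra_simps power2_eq_square)
    define u where "u = x * s * (n + 1)"
    have xu: "x \<le> u" "s \<le> u" "n + 1 \<le> u"
    proof -
      have "x * 1 * 1 \<le> u" "1 * s * 1 \<le> u" "1 * 1 * (n + 1) \<le> u"
        unfolding u_def using x s by (intro mult_le_mono; simp)+
      then show "x \<le> u" "s \<le> u" "n + 1 \<le> u" by simp_all
    qed
    then have u: "1 \<le> u" by simp
    have "x ^ (6 * c) * s ^ 2 \<le> u ^ (6 * c) * u ^ 2" using xu by (intro mult_le_mono power_mono) auto
    also have "\<dots> \<le> u ^ b" unfolding power_add[symmetric] b_def using u by (intro power_increasing) auto
    finally have "A * (x ^ (6 * c) * s ^ 2) \<le> A * u ^ b" by (rule mult_left_mono) simp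
    moreover have "(a * (n + 1)) ^ a \<le> a ^ a * u ^ b"
    proof -
      have "(n + 1) ^ a \<le> u ^ a" using xu by (intro power_mono) auto
      also have "\<dots> \<le> u ^ b" unfolding b_def using u by (intro power_increasing) auto
      finally have "a ^ a * (n + 1) ^ a \<le> a ^ a * u ^ b" by (rule mult_left_mono) simp
      then show ?thesis unfolding power_mult_distrib .
    qed
    moreover have "1 \<le> u ^ b" using u by simp
    ultimately have "s' \<le> a ^ a * u ^ b + A * u ^ b + u ^ b" using s'(2) NM size by linarith
    also have "\<dots> = (a ^ a + A + 1) * u ^ b" by (simp add: algebra_simps)
    also have "\<dots> \<le> b * u ^ b" unfolding b_def by (rule mult_right_mono) auto
    also have "\<dots> \<le> b ^ b * u ^ b" using self_le_power[of b b] by (intro mult_right_mono) (auto simp: b_def)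
    also have "\<dots> = size_bound b k s n" unfolding size_bound_def u_def x_def by (simp only: power_mult_distrib mult.assoc)
    finally show ?thesis using s'(1) by blast
  qed
  show ?thesis by (intro exI[of _ b] allI impI, elim conjE) (rule *; assumption)
qed


section \<open>Locality of encodings and partial homomorphisms\<close>

definition fprod :: "'a fset \<Rightarrow> 'b fset \<Rightarrow> ('a \<times> 'b) fset" where
  "fprod A B = fBig (\<lambda>a. Pair a |`| B) A"

lemma in_fprod [simp]: "(a, b) |\<in>| fprod A B \<longleftrightarrow> a |\<in>| A \<and> b |\<in>| B"
  by (auto simp: fprod_def)

lemma fset_fprod: "fset (fprod A B) = fset A \<times> fset B"
  by auto

lemma fprod_mono: "A |\<subseteq>| A' \<Longrightarrow> fprod A B |\<subseteq>| fprod A' B"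
  by (simp add: less_eq_fset.rep_eq fset_fprod Sigma_mono)

lemma fcard_fprod: "fcard (fprod A B) = fcard A * fcard B"
  by (simp add: fcard.rep_eq fset_fprod card_cartesian_product)

definition fgraph :: "('a \<Rightarrow> 'b) \<Rightarrow> 'a fset \<Rightarrow> ('a \<times> 'b) fset" where
  "fgraph h D = (\<lambda>a. (a, h a)) |`| D"

lemma in_fgraph [simp]: "(a, b) |\<in>| fgraph h D \<longleftrightarrow> a |\<in>| D \<and> b = h a"
  by (auto simp: fgraph_def)

lemma clauses_sat_restrict:
  assumes "\<And>C l. C \<in> F \<Longrightarrow> l |\<in>| C \<Longrightarrow> lit_var l \<in> V"
  shows "clauses_sat (H \<inter> V) F \<longleftrightarrow> clauses_sat H F"
proof -
  have "lit_sat (H \<inter> V) l \<longleftrightarrow> lit_sat H l" if "lit_var l \<in> V" for l using that by (cases l) auto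
  then show ?thesis unfolding clauses_sat_def using assms by blast
qed

lemma fin_struct_point: "fin_struct L A \<Longrightarrow> fin_struct L (point_struct a)"
  by (auto simp: fin_struct_def point_struct_def split: option.split)

lemma fin_struct_tuple: "fin_struct L A \<Longrightarrow> t \<in> rel A R \<Longrightarrow> fin_struct L (tuple_struct R t)"
  unfolding fin_struct_def tuple_struct_def
  by (auto simp: tuples_def split: option.splits)

lemma fin_struct_rel:
  assumes "fin_struct L A" "t \<in> rel A R" obtains "R \<in> dom L" "L R = Some (length t)" "set t \<subseteq> univ A"
proof (cases "L R")
  case None
  then show ?thesis using assms unfolding fin_struct_def by (metis empty_iff option.simps(4))
next
  case (Some r)
  then have "rel A R \<subseteq> tuples r (univ A)" using assms unfolding fin_struct_def by (metis option.simps(5))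
  then show ?thesis using assms Some that by (auto simp: tuples_def)
qed

lemma scheme_vars: "encoding_scheme L B E \<Longrightarrow> fin_struct L A \<Longrightarrow> C \<in> E A \<Longrightarrow> l |\<in>| C \<Longrightarrow> lit_var l \<in> univ A \<times> univ B"
  unfolding encoding_scheme_def by blast

lemma scheme_sat:
  assumes "encoding_scheme L B E" "fin_struct L A"
  shows "clauses_sat H (E A) \<longleftrightarrow> (\<exists>h. is_hom h A B \<and> H \<inter> (univ A \<times> univ B) = {(a, h a) |a. a \<in> univ A})"
proof -
  have "clauses_sat H (E A) \<longleftrightarrow> clauses_sat (H \<inter> (univ A \<times> univ B)) (E A)"
    by (rule clauses_sat_restrict[symmetric]) (rule scheme_vars[OF assms])
  also have "\<dots> \<longleftrightarrow> (\<exists>h. is_hom h A B \<and> H \<inter> (univ A \<times> univ B) = {(a, h a) |a. a \<in> univ A})"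
    using assms unfolding encoding_scheme_def by (meson inf_le2)
  finally show ?thesis .
qed

lemma local_schemeD:
  assumes "local_scheme L E" "fin_struct L A"
  shows "E A = (\<Union>a\<in>univ A. E (point_struct a)) \<union> (\<Union>R\<in>dom L. \<Union>t\<in>rel A R. E (tuple_struct R t))"
  by (rule conjunct2[OF assms(1)[unfolded local_scheme_def], rule_format, OF assms(2)])

lemma scheme_point_sub: "local_scheme L E \<Longrightarrow> fin_struct L A \<Longrightarrow> a \<in> univ A \<Longrightarrow> E (point_struct a) \<subseteq> E A"
  by (drule (1) local_schemeD) blast

lemma scheme_tuple_sub:
  assumes "local_scheme L E" "fin_struct L A" "t \<in> rel A R" shows "E (tuple_struct R t) \<subseteq> E A"
proof -
  have "R \<in> dom L" using fin_struct_rel[OF assms(2,3)] by blast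
  then show ?thesis using assms(3) local_schemeD[OF assms(1,2)] by blast
qed

text \<open>Only clauses over \<open>fprod D Bf\<close> are assumed to hold. By locality these
  include the encodings of the points of \<open>D\<close>, which force exactly one value at each of
  them, and of the tuples within \<open>D\<close>, which force the values to preserve the
  relations.\<close>

lemma assignment_graph:
  assumes E: "encoding_scheme L B E" "local_scheme L E" "fin_struct L A" and D: "fset D \<subseteq> univ A" and B: "fset Bf = univ B"
    and \<alpha>: "\<alpha> |\<subseteq>| fprod D Bf"
    and sat: "\<And>C. C \<in> E A \<Longrightarrow> (\<And>l. l |\<in>| C \<Longrightarrow> lit_var l |\<in>| fprod D Bf) \<Longrightarrow> \<exists>l. l |\<in>| C \<and> lit_sat (fset \<alpha>) l"
  obtains h where "\<And>a. a |\<in>| D \<Longrightarrow> h a \<in> univ B" "\<alpha> = fgraph h D"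
    "\<And>R t. t \<in> rel A R \<Longrightarrow> set t \<subseteq> fset D \<Longrightarrow> map h t \<in> rel B R"
proof -
  have sat': "clauses_sat (fset \<alpha>) (E Z)" if Z: "E Z \<subseteq> E A" "fin_struct L Z" "univ Z \<subseteq> fset D" for Z
    unfolding clauses_sat_def
  proof
    fix C assume C: "C \<in> E Z"
    have "lit_var l |\<in>| fprod D Bf" if "l |\<in>| C" for l
      using scheme_vars[OF E(1) Z(2) C that] Z(3) B by (cases "lit_var l") auto
    then show "\<exists>l. l |\<in>| C \<and> lit_sat (fset \<alpha>) l" using sat C Z by blast
  qed
  have "\<exists>b. b \<in> univ B \<and> fset \<alpha> \<inter> ({a} \<times> univ B) = {(a, b)}" if "a |\<in>| D" for a
  proof -
    have a: "a \<in> univ A" using that D by auto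
    have f: "fin_struct L (point_struct a)" by (rule fin_struct_point[OF E(3)])
    have "clauses_sat (fset \<alpha>) (E (point_struct a))"
      by (rule sat'[OF scheme_point_sub[OF E(2,3) a] f]) (use that in \<open>auto simp: point_struct_def\<close>)
    then obtain h where "is_hom h (point_struct a) B" "fset \<alpha> \<inter> ({a} \<times> univ B) = {(a', h a') |a'. a' \<in> {a}}"
      unfolding scheme_sat[OF E(1) f] by (auto simp: point_struct_def)
    then show ?thesis by (intro exI[of _ "h a"]) (auto simp: is_hom_def point_struct_def)
  qed
  then obtain h where h: "\<And>a. a |\<in>| D \<Longrightarrow> h a \<in> univ B \<and> fset \<alpha> \<inter> ({a} \<times> univ B) = {(a, h a)}" by metis
  have gr: "(a, b) |\<in>| \<alpha> \<longleftrightarrow> a |\<in>| D \<and> b = h a" for a b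
  proof
    assume ab: "(a, b) |\<in>| \<alpha>"
    then have "(a, b) |\<in>| fprod D Bf" using \<alpha> by auto
    then have a: "a |\<in>| D" "b \<in> univ B" using B by auto
    then have "(a, b) \<in> fset \<alpha> \<inter> ({a} \<times> univ B)" using ab by auto
    then show "a |\<in>| D \<and> b = h a" using h[OF a(1)] a by auto
  next
    assume "a |\<in>| D \<and> b = h a"
    then show "(a, b) |\<in>| \<alpha>" using h[of a] by auto
  qed
  have "\<alpha> = fgraph h D" by (rule fset_eqI) (auto simp: gr)
  moreover have "map h t \<in> rel B R" if t: "t \<in> rel A R" "set t \<subseteq> fset D" for R t
  proof -
    have f: "fin_struct L (tuple_struct R t)" by (rule fin_struct_tuple[OF E(3) t(1)])
    have "clauses_sat (fset \<alpha>) (E (tuple_struct R t))"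
      by (rule sat'[OF scheme_tuple_sub[OF E(2,3) t(1)] f]) (use t in \<open>auto simp: tuple_struct_def\<close>)
    then obtain h' where h': "is_hom h' (tuple_struct R t) B" "fset \<alpha> \<inter> (set t \<times> univ B) = {(a, h' a) |a. a \<in> set t}"
      unfolding scheme_sat[OF E(1) f] by (auto simp: tuple_struct_def)
    have "h' a = h a" if "a \<in> set t" for a
    proof -
      have "(a, h' a) \<in> fset \<alpha>" using h'(2) that by blast
      then show ?thesis by (simp add: gr)
    qed
    then have "map h' t = map h t" by simp
    moreover have "map h' t \<in> rel B R" using h'(1) by (auto simp: is_hom_def tuple_struct_def)
    ultimately show ?thesis by metis
  qed
  ultimately show ?thesis using h that by blast
qed

text \<open>A homomorphism on the part \<open>D\<close> of \<open>A\<close> only, which moreover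
  satisfies those clauses of \<open>\<Delta>\<close> that speak about \<open>D\<close>. The set
  \<open>\<Delta>\<close> carries facts that hold for homomorphisms on all of \<open>A\<close> but
  need not follow from what is visible on \<open>D\<close>.\<close>

definition compatible :: "'c struct \<Rightarrow> 'd struct \<Rightarrow> ('c \<times> 'd) clause set \<Rightarrow> 'c fset \<Rightarrow> ('c \<Rightarrow> 'd) \<Rightarrow> bool" where
  "compatible A B \<Delta> D h \<longleftrightarrow> (\<forall>a. a |\<in>| D \<longrightarrow> h a \<in> univ B) \<and>
     (\<forall>R t. t \<in> rel A R \<longrightarrow> set t \<subseteq> fset D \<longrightarrow> map h t \<in> rel B R) \<and>
     (\<forall>C\<in>\<Delta>. (\<forall>l. l |\<in>| C \<longrightarrow> lit_var l \<in> fset D \<times> univ B) \<longrightarrow> (\<exists>l. l |\<in>| C \<and> lit_sat (fset (fgraph h D)) l))"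

text \<open>
  The value of a homomorphism at the element \<open>x\<close> of \<open>As\<close> is \<open>val x h\<close>, which depends only on the
  values of \<open>h\<close> on the set \<open>N x\<close> of at most \<open>m\<close> elements of \<open>A\<close>.
\<close>

definition local_simulation ::
    "'b struct \<Rightarrow> 'd struct \<Rightarrow> nat \<Rightarrow> 'a struct \<Rightarrow> 'c struct \<Rightarrow> ('c \<times> 'd) clause set \<Rightarrow>
     ('a \<Rightarrow> 'c fset) \<Rightarrow> ('a \<Rightarrow> ('c \<Rightarrow> 'd) \<Rightarrow> 'b) \<Rightarrow> bool" where
  "local_simulation B B' m As A \<Delta> N val \<longleftrightarrow>
     (\<forall>x\<in>univ As. fset (N x) \<subseteq> univ A \<and> fcard (N x) \<le> m) \<and>
     (\<forall>x h h'. (\<forall>a. a |\<in>| N x \<longrightarrow> h a = h' a) \<longrightarrow> val x h = val x h') \<and>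
     (\<forall>x\<in>univ As. \<exists>D. fset D \<subseteq> univ A \<and> fcard D \<le> m \<and> N x |\<subseteq>| D \<and>
        (\<forall>h. compatible A B' \<Delta> D h \<longrightarrow> val x h \<in> univ B)) \<and>
     (\<forall>R t. t \<in> rel As R \<longrightarrow> (\<exists>D. fset D \<subseteq> univ A \<and> fcard D \<le> m \<and> (\<forall>x\<in>set t. N x |\<subseteq>| D) \<and>
        (\<forall>h. compatible A B' \<Delta> D h \<longrightarrow> map (\<lambda>x. val x h) t \<in> rel B R)))"

text \<open>By locality \<open>C\<close> belongs to the encoding of a point or a tuple. An
  assignment to the variables over the corresponding set \<open>D\<close> that satisfies the given
  clauses is the graph of a compatible map, whose values under \<open>val\<close> form a
  homomorphism on that point or tuple and hence satisfy \<open>C\<close>.\<close>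

lemma local_simulation_clause:
  fixes E :: "'a struct \<Rightarrow> ('a \<times> 'b) clause set" and E' :: "'c struct \<Rightarrow> ('c \<times> 'd) clause set"
  assumes E: "encoding_scheme L B E" "local_scheme L E" "fin_struct L As"
    and E': "encoding_scheme L' B' E'" "local_scheme L' E'" "fin_struct L' A"
    and B: "fin_struct L B" and B': "fset Bf = univ B'"
    and ls: "local_simulation B B' m As A \<Delta> N val" and ar: "\<forall>R r. L R = Some r \<longrightarrow> r \<le> m" and m: "1 \<le> m"
    and C: "C \<in> E As"
  shows "\<exists>V. fcard V \<le> m * fcard Bf \<and> fcard C \<le> 2 * (m * card (univ B)) \<and>
    (\<forall>l. l |\<in>| C \<longrightarrow> (case lit_var l of (x, b) \<Rightarrow> if x \<in> univ As then fprod (N x) Bf else {||}) |\<subseteq>| V) \<and>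
    (\<forall>\<alpha>. \<alpha> |\<subseteq>| V \<and> (\<forall>D\<in>E' A \<union> \<Delta>. (\<forall>l. l |\<in>| D \<longrightarrow> lit_var l |\<in>| V) \<longrightarrow> (\<exists>l. l |\<in>| D \<and> lit_sat (fset \<alpha>) l)) \<longrightarrow>
      (\<exists>l. l |\<in>| C \<and> subst_true (\<lambda>(x, b). if x \<in> univ As then fprod (N x) Bf else {||})
         (\<lambda>(x, b) \<alpha>. \<exists>h. \<alpha> = fgraph h (N x) \<and> val x h = b) \<alpha> l))"
proof -
  have finB: "finite (univ B)" using B unfolding fin_struct_def by blast
  note ls = ls[unfolded local_simulation_def]
  note N = ls[THEN conjunct1, rule_format]
    and val_cong = ls[THEN conjunct2, THEN conjunct1, rule_format]
    and val_univ = ls[THEN conjunct2, THEN conjunct2, THEN conjunct1, rule_format]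
    and val_rel = ls[THEN conjunct2, THEN conjunct2, THEN conjunct2, rule_format]
  \<comment> \<open>Variables that do not belong to the instance get no variables, since the
    cardinality bound of the substitution is demanded for all of them.\<close>
  let ?W = "\<lambda>(x, b :: 'b). if x \<in> univ As then fprod (N x) Bf else {||}"
  \<comment> \<open>The function must be defined on assignments, so the map is recovered from its
    graph on \<open>N x\<close>; by \<open>val_cong\<close> the choice of \<open>h\<close> does not
    matter.\<close>
  let ?g = "\<lambda>(x, b) \<alpha>. \<exists>h. \<alpha> = fgraph h (N x) \<and> val x h = b"
  obtain Z D where Z: "C \<in> E Z" "fin_struct L Z" "univ Z \<subseteq> univ As" "finite (univ Z)" "card (univ Z) \<le> m"
    and D: "fset D \<subseteq> univ A" "fcard D \<le> m" "\<And>x. x \<in> univ Z \<Longrightarrow> N x |\<subseteq>| D"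
    and hom: "\<And>h. compatible A B' \<Delta> D h \<Longrightarrow> is_hom (\<lambda>x. val x h) Z B"
  proof -
    have "C \<in> (\<Union>a\<in>univ As. E (point_struct a)) \<union> (\<Union>R\<in>dom L. \<Union>t\<in>rel As R. E (tuple_struct R t))"
      using C unfolding local_schemeD[OF E(2,3)] .
    then consider a where "a \<in> univ As" "C \<in> E (point_struct a)" | R t where "t \<in> rel As R" "C \<in> E (tuple_struct R t)"
      by blast
    then show ?thesis
    proof cases
      case 1
      obtain D where D: "fset D \<subseteq> univ A" "fcard D \<le> m" "N a |\<subseteq>| D"
        "\<forall>h. compatible A B' \<Delta> D h \<longrightarrow> val a h \<in> univ B"
        using val_univ[OF 1(1)] by blast
      show ?thesis
      proof (rule that[OF 1(2) fin_struct_point[OF E(3)]])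
        show "is_hom (\<lambda>x. val x h) (point_struct a) B" if "compatible A B' \<Delta> D h" for h
          using D(4) that by (auto simp: point_struct_def is_hom_def)
      qed (use 1 D m in \<open>auto simp: point_struct_def\<close>)
    next
      case 2
      obtain D where D: "fset D \<subseteq> univ A" "fcard D \<le> m" "\<forall>x\<in>set t. N x |\<subseteq>| D"
        "\<forall>h. compatible A B' \<Delta> D h \<longrightarrow> map (\<lambda>x. val x h) t \<in> rel B R"
        using val_rel[OF 2(1)] by blast
      have t: "L R = Some (length t)" "set t \<subseteq> univ As" using fin_struct_rel[OF E(3) 2(1)] by auto
      have u: "card (set t) \<le> m" using card_length[of t] ar[rule_format, OF t(1)] by linarith
      show ?thesis
      proof (rule that[OF 2(2) fin_struct_tuple[OF E(3) 2(1)]])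
        show "is_hom (\<lambda>x. val x h) (tuple_struct R t) B" if h: "compatible A B' \<Delta> D h" for h
        proof -
          have v: "map (\<lambda>x. val x h) t \<in> rel B R" using D(4) h by blast
          then have "set (map (\<lambda>x. val x h) t) \<subseteq> univ B" by (rule fin_struct_rel[OF B])
          with v show ?thesis by (auto simp: tuple_struct_def is_hom_def)
        qed
      qed (use 2 t u D in \<open>auto simp: tuple_struct_def\<close>)
    qed
  qed
  have lv: "lit_var l \<in> univ Z \<times> univ B" if "l |\<in>| C" for l by (rule scheme_vars[OF E(1) Z(2,1) that])
  have 1: "fcard (fprod D Bf) \<le> m * fcard Bf" using D(2) by (simp add: fcard_fprod)
  have 2: "fcard C \<le> 2 * (m * card (univ B))"
  proof -
    have "fset C \<subseteq> Pos ` (univ Z \<times> univ B) \<union> Neg ` (univ Z \<times> univ B)"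
    proof
      fix l assume "l \<in> fset C"
      then have "lit_var l \<in> univ Z \<times> univ B" using lv by blast
      then show "l \<in> Pos ` (univ Z \<times> univ B) \<union> Neg ` (univ Z \<times> univ B)" by (cases l) auto
    qed
    then have "card (fset C) \<le> card (Pos ` (univ Z \<times> univ B) \<union> Neg ` (univ Z \<times> univ B))"
      using Z(4) finB by (intro card_mono) auto
    also have "\<dots> \<le> card (univ Z \<times> univ B) + card (univ Z \<times> univ B)"
      using Z(4) finB by (intro order.trans[OF card_Un_le] add_mono card_image_le) auto
    also have "\<dots> \<le> 2 * (m * card (univ B))"
      using mult_right_mono[OF Z(5), of "card (univ B)"] unfolding card_cartesian_product by linarith
    finally show ?thesis by (simp add: fcard.rep_eq)
  qed
  have 3: "(case lit_var l of (x, b) \<Rightarrow> if x \<in> univ As then fprod (N x) Bf else {||}) |\<subseteq>| fprod D Bf" if "l |\<in>| C" for l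
  proof -
    obtain x b where xb: "lit_var l = (x, b)" by fastforce
    then have "x \<in> univ Z" using lv[OF that] by simp
    then have "N x |\<subseteq>| D" by (rule D(3))
    then have "fprod (N x) Bf |\<subseteq>| fprod D Bf" by (rule fprod_mono)
    then show ?thesis using xb by auto
  qed
  have 4: "\<exists>l. l |\<in>| C \<and> subst_true ?W ?g \<alpha> l"
    if \<alpha>: "\<alpha> |\<subseteq>| fprod D Bf" and sat: "\<forall>C\<in>E' A \<union> \<Delta>. (\<forall>l. l |\<in>| C \<longrightarrow> lit_var l |\<in>| fprod D Bf) \<longrightarrow> (\<exists>l. l |\<in>| C \<and> lit_sat (fset \<alpha>) l)"
    for \<alpha>
  proof -
    obtain h where h: "\<And>a. a |\<in>| D \<Longrightarrow> h a \<in> univ B'" "\<alpha> = fgraph h D"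
      "\<And>R t. t \<in> rel A R \<Longrightarrow> set t \<subseteq> fset D \<Longrightarrow> map h t \<in> rel B' R"
      using assignment_graph[OF E' D(1) B' \<alpha>] sat by blast
    have "is_hom (\<lambda>x. val x h) Z B"
      by (rule hom) (use h sat in \<open>auto simp: compatible_def fset_fprod B'\<close>)
    then have "clauses_sat {(x, val x h) |x. x \<in> univ Z} (E Z)"
      unfolding scheme_sat[OF E(1) Z(2)] by (intro exI[of _ "\<lambda>x. val x h"]) (auto simp: is_hom_def)
    then obtain l where l: "l |\<in>| C" "lit_sat {(x, val x h) |x. x \<in> univ Z} l"
      using Z(1) by (auto simp: clauses_sat_def)
    obtain x b where xb: "lit_var l = (x, b)" by fastforce
    then have x: "x \<in> univ Z" "x \<in> univ As" using lv[OF l(1)] Z(3) by auto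
    have r: "\<alpha> |\<inter>| ?W (x, b) = fgraph h (N x)"
    proof (rule fset_eqI)
      fix p
      have "N x |\<subseteq>| D" using D(3) x by blast
      then show "p |\<in>| \<alpha> |\<inter>| ?W (x, b) \<longleftrightarrow> p |\<in>| fgraph h (N x)"
        using h(1,2) x B' by (cases p) auto
    qed
    have "?g (x, b) (\<alpha> |\<inter>| ?W (x, b)) \<longleftrightarrow> val x h = b"
    proof
      assume "?g (x, b) (\<alpha> |\<inter>| ?W (x, b))"
      then obtain h' where h': "fgraph h (N x) = fgraph h' (N x)" "val x h' = b" unfolding r by auto
      have "h a = h' a" if "a |\<in>| N x" for a
      proof -
        have "(a, h a) |\<in>| fgraph h' (N x)" using that by (simp flip: h'(1))
        then show ?thesis by simp
      qed
      then show "val x h = b" using val_cong[of x h h'] h'(2) by simp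
    qed (unfold r, auto)
    then have "subst_true ?W ?g \<alpha> l \<longleftrightarrow> lit_sat {(x, val x h) |x. x \<in> univ Z} l"
      using xb x by (cases l) (auto simp del: split_conv)
    with l show ?thesis by blast
  qed
  from 1 2 3 4 show ?thesis by (intro exI[of _ "fprod D Bf"]) blast
qed

lemma local_simulation_transfer:
  fixes E :: "'a struct \<Rightarrow> ('a \<times> 'b) clause set" and E' :: "'c struct \<Rightarrow> ('c \<times> 'd) clause set" and m a :: nat
  assumes E: "encoding_scheme L B E" "local_scheme L E" and E': "encoding_scheme L' B' E'" "local_scheme L' E'"
    and B: "fin_struct L B" and B': "finite (univ B')" and ar: "\<forall>R r. L R = Some r \<longrightarrow> r \<le> m"
  shows "\<exists>c\<ge>1. \<exists>b. \<forall>As A \<Delta> N val \<rho>0 t k s \<pi>.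
    fin_struct L As \<and> fin_struct L' A \<and> local_simulation B B' m As A \<Delta> N val \<and> 1 \<le> k \<and>
    bounded_refutation (E As) (Suc t) k s \<pi> \<and> frege_proof (clause_fm ` E' A) \<rho>0 \<and>
    (\<forall>G\<in>set \<rho>0. Sigma_fm (Suc t) 1 G) \<and> proof_size \<rho>0 \<le> (a * (struct_size L' A + 1)) ^ a \<and>
    clause_fm ` \<Delta> \<subseteq> set \<rho>0 \<longrightarrow>
    (\<exists>\<pi>' s'. bounded_refutation (E' A) (Suc t) (c * k) s' \<pi>' \<and> s' \<le> size_bound b k s (struct_size L' A))"
proof -
  define Bf where "Bf = Abs_fset (univ B')"
  have Bf: "fset Bf = univ B'" unfolding Bf_def using B' by (simp add: Abs_fset_inverse)
  \<comment> \<open>A positive bound even if all arities are 0, as one-point structures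
    require.\<close>
  define m1 where "m1 = m + 1"
  \<comment> \<open>The function for one variable reads the variables of at most \<open>m1\<close>
    elements. The added 1 keeps \<open>c\<close> positive if \<open>B'\<close> is empty.\<close>
  define c where "c = m1 * fcard Bf + 1"
  define m' where "m' = m1 * fcard Bf + 2 * (m1 * card (univ B))"
  have c: "1 \<le> c" by (simp add: c_def)
  obtain b where b: "\<forall>k W g (\<Phi> :: ('a \<times> 'b) clause set) (\<Delta> :: ('c \<times> 'd) clause set) \<Delta>' \<rho>0 t s \<pi> n.
    1 \<le> k \<and> (\<forall>v. fcard (W v) \<le> c) \<and>
    bounded_refutation \<Phi> (Suc t) k s \<pi> \<and> frege_proof (clause_fm ` \<Delta>) \<rho>0 \<and> (\<forall>G\<in>set \<rho>0. Sigma_fm (Suc t) (c * k) G) \<and>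
    proof_size \<rho>0 \<le> (a * (n + 1)) ^ a \<and> clause_fm ` \<Delta>' \<subseteq> set \<rho>0 \<union> clause_fm ` \<Delta> \<and>
    (\<forall>C\<in>\<Phi>. \<exists>V. fcard V \<le> m' \<and> fcard C \<le> m' \<and> (\<forall>l. l |\<in>| C \<longrightarrow> W (lit_var l) |\<subseteq>| V) \<and>
      (\<forall>\<alpha>. \<alpha> |\<subseteq>| V \<and> (\<forall>D\<in>\<Delta>'. (\<forall>l. l |\<in>| D \<longrightarrow> lit_var l |\<in>| V) \<longrightarrow> (\<exists>l. l |\<in>| D \<and> lit_sat (fset \<alpha>) l)) \<longrightarrow>
        (\<exists>l. l |\<in>| C \<and> subst_true W g \<alpha> l))) \<longrightarrow>
    (\<exists>\<pi>' s'. bounded_refutation \<Delta> (Suc t) (c * k) s' \<pi>' \<and> s' \<le> size_bound b k s n)"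
    using simulate_bounded[OF c, of a m'] by blast
  have *: "\<exists>\<pi>' s'. bounded_refutation (E' A) (Suc t) (c * k) s' \<pi>' \<and> s' \<le> size_bound b k s (struct_size L' A)"
    if As: "fin_struct L As" and A: "fin_struct L' A" and ls: "local_simulation B B' m As A \<Delta> N val" and k: "1 \<le> k"
      and \<pi>: "bounded_refutation (E As) (Suc t) k s \<pi>" and \<rho>0: "frege_proof (clause_fm ` E' A) \<rho>0"
        "\<forall>G\<in>set \<rho>0. Sigma_fm (Suc t) 1 G" "proof_size \<rho>0 \<le> (a * (struct_size L' A + 1)) ^ a" "clause_fm ` \<Delta> \<subseteq> set \<rho>0"
    for As A \<Delta> N val \<rho>0 t k s \<pi>
  proof -
    let ?W = "\<lambda>(x, b :: 'b). if x \<in> univ As then fprod (N x) Bf else {||}"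
    let ?g = "\<lambda>(x, b) \<alpha>. \<exists>h. \<alpha> = fgraph h (N x) \<and> val x h = b"
    have W: "\<forall>v. fcard (?W v) \<le> c"
    proof (clarsimp simp: c_def fcard_fprod)
      fix x assume "x \<in> univ As"
      then have "fcard (N x) \<le> m" using ls unfolding local_simulation_def by blast
      then show "fcard (N x) * fcard Bf \<le> Suc (m1 * fcard Bf)" unfolding m1_def by (intro le_SucI mult_right_mono) auto
    qed
    have ck: "1 \<le> c * k" using c k by (simp add: Suc_le_eq)
    have \<rho>0': "\<forall>G\<in>set \<rho>0. Sigma_fm (Suc t) (c * k) G" using \<rho>0(2) Sigma_fm_mono[OF ck] by blast
    have ls1: "local_simulation B B' m1 As A \<Delta> N val"
      using ls unfolding local_simulation_def m1_def by (meson le_SucI trans_le_add1)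
    have in1: "\<forall>C\<in>E As. \<exists>V. fcard V \<le> m' \<and> fcard C \<le> m' \<and> (\<forall>l. l |\<in>| C \<longrightarrow> ?W (lit_var l) |\<subseteq>| V) \<and>
      (\<forall>\<alpha>. \<alpha> |\<subseteq>| V \<and> (\<forall>D\<in>E' A \<union> \<Delta>. (\<forall>l. l |\<in>| D \<longrightarrow> lit_var l |\<in>| V) \<longrightarrow> (\<exists>l. l |\<in>| D \<and> lit_sat (fset \<alpha>) l)) \<longrightarrow>
        (\<exists>l. l |\<in>| C \<and> subst_true ?W ?g \<alpha> l))"
    proof
      fix C assume C: "C \<in> E As"
      have ar1: "\<forall>R r. L R = Some r \<longrightarrow> r \<le> m1" using ar unfolding m1_def by (auto intro: le_SucI)
      have m1: "1 \<le> m1" by (simp add: m1_def)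
      obtain V where V: "fcard V \<le> m1 * fcard Bf" "fcard C \<le> 2 * (m1 * card (univ B))"
        "\<forall>l. l |\<in>| C \<longrightarrow> ?W (lit_var l) |\<subseteq>| V"
        "\<forall>\<alpha>. \<alpha> |\<subseteq>| V \<and> (\<forall>D\<in>E' A \<union> \<Delta>. (\<forall>l. l |\<in>| D \<longrightarrow> lit_var l |\<in>| V) \<longrightarrow> (\<exists>l. l |\<in>| D \<and> lit_sat (fset \<alpha>) l)) \<longrightarrow>
          (\<exists>l. l |\<in>| C \<and> subst_true ?W ?g \<alpha> l)"
        using local_simulation_clause[OF E As E' A B Bf ls1 ar1 m1 C] by (elim exE conjE) (rule that; assumption)
      have "fcard V \<le> m'" "fcard C \<le> m'" using V(1,2) by (auto simp: m'_def)
      with V(3,4) show "\<exists>V. fcard V \<le> m' \<and> fcard C \<le> m' \<and> (\<forall>l. l |\<in>| C \<longrightarrow> ?W (lit_var l) |\<subseteq>| V) \<and>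
        (\<forall>\<alpha>. \<alpha> |\<subseteq>| V \<and> (\<forall>D\<in>E' A \<union> \<Delta>. (\<forall>l. l |\<in>| D \<longrightarrow> lit_var l |\<in>| V) \<longrightarrow> (\<exists>l. l |\<in>| D \<and> lit_sat (fset \<alpha>) l)) \<longrightarrow>
          (\<exists>l. l |\<in>| C \<and> subst_true ?W ?g \<alpha> l))"
        by (intro exI[of _ V] conjI)
    qed
    have \<Delta>: "clause_fm ` (E' A \<union> \<Delta>) \<subseteq> set \<rho>0 \<union> clause_fm ` E' A" using \<rho>0(4) by auto
    show ?thesis
      by (rule b[THEN spec[of _ k], THEN spec[of _ ?W], THEN spec[of _ ?g], THEN spec[of _ "E As"], THEN spec[of _ "E' A"],
            THEN spec[of _ "E' A \<union> \<Delta>"], THEN spec[of _ \<rho>0], THEN spec[of _ t], THEN spec[of _ s], THEN spec[of _ \<pi>],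
            THEN spec[of _ "struct_size L' A"], THEN mp]; intro conjI; fact)
  qed
  show ?thesis
    by (rule exI[of _ c], rule conjI[OF c], rule exI[of _ b], intro allI impI, elim conjE) (rule *; assumption)
qed

section \<open>Binary trees as data and their prefix code\<close>

datatype tree = Leaf | Node tree tree

text \<open>Prefix notation is self-delimiting, so a value can lie on top of arbitrary other
  contents of a stack.\<close>

primrec code :: "tree \<Rightarrow> symb list" where
  "code Leaf = [Zero]"
| "code (Node l r) = One # code l @ code r"

lemma code_ne [simp]: "code x \<noteq> []"
  by (cases x) auto

abbreviation tsz :: "tree \<Rightarrow> nat" where
  "tsz x \<equiv> length (code x)"

lemma code_prefix: "code x @ r = code y @ r' \<Longrightarrow> x = y \<and> r = r'"
proof (induction x arbitrary: y r r')
  case Leaf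
  show ?case
  proof (cases y)
    case Leaf
    with Leaf.prems show ?thesis by simp
  next
    case (Node a b)
    with Leaf.prems show ?thesis by simp
  qed
next
  case (Node x1 x2)
  show ?case
  proof (cases y)
    case Leaf
    with Node.prems show ?thesis by simp
  next
    case (Node y1 y2)
    with Node.prems have "code x1 @ (code x2 @ r) = code y1 @ (code y2 @ r')"
      by (simp only: code.simps append.simps append_assoc list.inject)
    from Node.IH(1)[OF this] have *: "x1 = y1" "code x2 @ r = code y2 @ r'" by auto
    from Node.IH(2)[OF *(2)] * Node show ?thesis by simp
  qed
qed

lemma code_inj: "code x = code y \<longleftrightarrow> x = y"
  using code_prefix[of x "[]" y "[]"] by auto

lemma exec_length: "exec c s n s' \<Longrightarrow> length (s' i) \<le> length (s i) + n"
proof (induction arbitrary: i rule: exec.induct)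
  case (seq c s m s' d n s'')
  from seq.IH(1)[of i] seq.IH(2)[of i] show ?case by simp
next
  case (while_loop s j c m s' n s'')
  from while_loop.IH(1)[of i] while_loop.IH(2)[of i] show ?case by simp
qed (simp_all add: le_Suc_eq)

section \<open>Programs on stacks\<close>

primrec seqs :: "com list \<Rightarrow> com" where
  "seqs [] = Skip"
| "seqs (c # cs) = Seq c (seqs cs)"

text \<open>Running time is only bounded from above, which makes the bounds compose without side conditions.\<close>

definition runs :: "com \<Rightarrow> stacks \<Rightarrow> nat \<Rightarrow> stacks \<Rightarrow> bool" where
  "runs c s n s' \<longleftrightarrow> (\<exists>m\<le>n. exec c s m s')"

lemma runs_mono: "runs c s n s' \<Longrightarrow> n \<le> n' \<Longrightarrow> runs c s n' s'"
  unfolding runs_def by (meson le_trans)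

lemma exec_runs: "exec c s n s' \<Longrightarrow> runs c s n s'"
  unfolding runs_def by blast

lemma runs_skip: "runs Skip s 1 s" and runs_push: "runs (Push i x) s 1 (s(i := x # s i))"
  and runs_pop: "runs (Pop i) s 1 (s(i := tl (s i)))"
  by (intro exec_runs exec.intros)+

lemma runs_seq:
  assumes "runs c s m s'" "runs d s' n s''" shows "runs (Seq c d) s (m + n) s''"
proof -
  obtain m' n' where "m' \<le> m" "exec c s m' s'" "n' \<le> n" "exec d s' n' s''"
    using assms unfolding runs_def by blast
  then show ?thesis unfolding runs_def by (intro exI[of _ "m' + n'"] conjI exec.seq) auto
qed

lemma runs_if:
  assumes "runs (if s i \<noteq> [] \<and> hd (s i) = x then c else d) s n s'"
  shows "runs (If_top i x c d) s (Suc n) s'"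
proof -
  obtain m where "m \<le> n" "exec (if s i \<noteq> [] \<and> hd (s i) = x then c else d) s m s'"
    using assms unfolding runs_def by blast
  then have "exec (If_top i x c d) s (Suc m) s'"
  proof (cases "s i \<noteq> [] \<and> hd (s i) = x")
    case True
    with \<open>exec _ s m s'\<close> have "exec c s m s'" by simp
    with True show ?thesis by (rule exec.if_true)
  next
    case False
    with \<open>exec _ s m s'\<close> have "exec d s m s'" by (simp only: if_False)
    with False show ?thesis by (rule exec.if_false)
  qed
  with \<open>m \<le> n\<close> show ?thesis unfolding runs_def by (intro exI[of _ "Suc m"]) simp
qed

lemma runs_if_true: "s i = x # xs \<Longrightarrow> runs c s n s' \<Longrightarrow> runs (If_top i x c d) s (Suc n) s'"
  by (rule runs_if) simp

lemma runs_if_false: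
  "\<not> (s i \<noteq> [] \<and> hd (s i) = x) \<Longrightarrow> runs d s n s' \<Longrightarrow> runs (If_top i x c d) s (Suc n) s'"
  by (rule runs_if) (simp only: if_False)

lemma runs_while_end: "s i = [] \<Longrightarrow> runs (While_nonempty i c) s 1 s"
  by (intro exec_runs exec.intros)

lemma runs_while_loop:
  assumes "s i \<noteq> []" "runs c s m s'" "runs (While_nonempty i c) s' n s''"
  shows "runs (While_nonempty i c) s (Suc (m + n)) s''"
proof -
  obtain m' n' where "m' \<le> m" "exec c s m' s'" "n' \<le> n" "exec (While_nonempty i c) s' n' s''"
    using assms unfolding runs_def by blast
  then show ?thesis unfolding runs_def
    by (intro exI[of _ "Suc (m' + n')"] conjI exec.while_loop[where s = s and i = i, OF assms(1)]) auto
qed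

lemma runs_eqI: "runs c s n s' \<Longrightarrow> n \<le> n' \<Longrightarrow> s' = s'' \<Longrightarrow> runs c s n' s''"
  using runs_mono by blast

definition case_symb :: "nat \<Rightarrow> (symb \<Rightarrow> com) \<Rightarrow> com" where
  "case_symb i g = If_top i Zero (g Zero) (If_top i One (g One) (If_top i Elt (g Elt)
     (If_top i Tup (g Tup) (g Arg))))"

lemma runs_case_symb:
  assumes "s i = x # xs" "runs (g x) s n s'" shows "runs (case_symb i g) s (n + 4) s'"
proof -
  have "hd (s i) = x" "s i \<noteq> []" using assms by auto
  then have "runs (case_symb i g) s (Suc (Suc (Suc (Suc n)))) s'"
    using assms(2) runs_mono[of _ s n s' "Suc n"] runs_mono[of _ s n s' "Suc (Suc n)"] runs_mono[of _ s n s' "Suc (Suc (Suc n))"]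
    unfolding case_symb_def by (cases x) (auto intro!: runs_if)
  then show ?thesis by (simp add: numeral_eq_Suc)
qed

definition move :: "nat \<Rightarrow> nat \<Rightarrow> com" where
  "move e f = While_nonempty e (case_symb e (\<lambda>x. Seq (Pop e) (Push f x)))"

lemma runs_move:
  assumes "e \<noteq> f"
  shows "runs (move e f) s (7 * length (s e) + 1) (s(e := [], f := rev (s e) @ s f))"
proof (induction "s e" arbitrary: s)
  case Nil
  then show ?case unfolding move_def by (auto intro!: runs_eqI[OF runs_while_end] simp: fun_eq_iff)
next
  case (Cons x xs)
  let ?s = "s(e := xs, f := x # s f)"
  have 1: "runs (case_symb e (\<lambda>x. Seq (Pop e) (Push f x))) s (2 + 4) ?s"
    by (rule runs_case_symb[where s = s and i = e, OF Cons.hyps(2)[symmetric]],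
        rule runs_eqI[OF runs_seq[OF runs_pop runs_push]])
      (use assms Cons.hyps(2)[symmetric] in \<open>auto simp: fun_eq_iff\<close>)
  have 2: "runs (move e f) ?s (7 * length xs + 1) (?s(e := [], f := rev xs @ x # s f))"
    using Cons.hyps(1)[of ?s] assms by simp
  show ?case unfolding move_def
    by (rule runs_eqI[OF runs_while_loop[OF _ 1 2[unfolded move_def]]])
      (use assms Cons.hyps(2)[symmetric] in \<open>auto simp: fun_eq_iff\<close>)
qed

definition clear :: "nat \<Rightarrow> com" where
  "clear e = While_nonempty e (Pop e)"

lemma runs_clear: "runs (clear e) s (2 * length (s e) + 1) (s(e := []))"
proof (induction "s e" arbitrary: s)
  case Nil
  then show ?case unfolding clear_def by (auto intro!: runs_eqI[OF runs_while_end] simp: fun_eq_iff)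
next
  case (Cons x xs)
  have 2: "runs (clear e) (s(e := tl (s e))) (2 * length xs + 1) (s(e := tl (s e), e := []))"
    using Cons.hyps(1)[of "s(e := tl (s e))"] Cons.hyps(2)[symmetric] by simp
  show ?case unfolding clear_def
    by (rule runs_eqI[OF runs_while_loop[OF _ runs_pop 2[unfolded clear_def]]])
      (use Cons.hyps(2)[symmetric] in \<open>auto simp: fun_eq_iff\<close>)
qed

definition move2 :: "nat \<Rightarrow> nat \<Rightarrow> nat \<Rightarrow> com" where
  "move2 e f g = While_nonempty e (case_symb e (\<lambda>x. Seq (Pop e) (Seq (Push f x) (Push g x))))"

lemma runs_move2:
  assumes "e \<noteq> f" "e \<noteq> g" "f \<noteq> g"
  shows "runs (move2 e f g) s (8 * length (s e) + 1) (s(e := [], f := rev (s e) @ s f, g := rev (s e) @ s g))"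
proof (induction "s e" arbitrary: s)
  case Nil
  then show ?case unfolding move2_def by (auto intro!: runs_eqI[OF runs_while_end] simp: fun_eq_iff)
next
  case (Cons x xs)
  let ?s = "s(e := xs, f := x # s f, g := x # s g)"
  have 1: "runs (case_symb e (\<lambda>x. Seq (Pop e) (Seq (Push f x) (Push g x)))) s (3 + 4) ?s"
    by (rule runs_case_symb[where s = s and i = e, OF Cons.hyps(2)[symmetric]],
        rule runs_eqI[OF runs_seq[OF runs_pop runs_seq[OF runs_push runs_push]]])
      (use assms Cons.hyps(2)[symmetric] in \<open>auto simp: fun_eq_iff\<close>)
  have 2: "runs (move2 e f g) ?s (8 * length xs + 1) (?s(e := [], f := rev xs @ x # s f, g := rev xs @ x # s g))"
    using Cons.hyps(1)[of ?s] assms by simp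
  show ?case unfolding move2_def
    by (rule runs_eqI[OF runs_while_loop[OF _ 1 2[unfolded move2_def]]])
      (use assms Cons.hyps(2)[symmetric] in \<open>auto simp: fun_eq_iff\<close>)
qed

primrec pushes :: "nat \<Rightarrow> symb list \<Rightarrow> com" where
  "pushes e [] = Skip"
| "pushes e (x # xs) = Seq (pushes e xs) (Push e x)"

lemma runs_pushes: "runs (pushes e xs) s (length xs + 1) (s(e := xs @ s e))"
proof (induction xs arbitrary: s)
  case Nil show ?case by (auto intro!: runs_eqI[OF runs_skip])
next
  case (Cons x xs)
  show ?case unfolding pushes.simps by (rule runs_eqI[OF runs_seq[OF Cons.IH runs_push]]) auto
qed

text \<open>Stack \<open>d\<close> counts in unary the trees that still have to be read.\<close>

definition scan_body :: "nat \<Rightarrow> nat \<Rightarrow> com" where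
  "scan_body d e = If_top 0 One (Seq (Pop 0) (Seq (Push d One) (Push e One)))
                                (Seq (Pop 0) (Seq (Pop d) (Push e Zero)))"

definition scan :: "nat \<Rightarrow> nat \<Rightarrow> com" where
  "scan d e = Seq (Push d One) (While_nonempty d (scan_body d e))"

text \<open>Reading \<open>One\<close> replaces a pending tree by its two subtrees, reading
  \<open>Zero\<close> finishes one. The list \<open>xs\<close> can become longer, so the induction
  is on the length of the code that is left.\<close>

lemma runs_scan_loop:
  assumes "d \<noteq> e" "d \<noteq> 0" "e \<noteq> 0" "s 0 = concat (map code xs) @ r" "s d = replicate (length xs) One"
  shows "runs (While_nonempty d (scan_body d e)) s (5 * length (concat (map code xs)) + 1)
     (s(0 := r, d := [], e := rev (concat (map code xs)) @ s e))"
  using assms(4,5)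
proof (induction "length (concat (map code xs))" arbitrary: xs s rule: less_induct)
  case less
  show ?case
  proof (cases xs)
    case Nil
    with less.prems show ?thesis by (auto intro!: runs_eqI[OF runs_while_end] simp: fun_eq_iff)
  next
    case (Cons y ys)
    show ?thesis
    proof (cases y)
      case Leaf
      let ?s = "s(0 := concat (map code ys) @ r, d := replicate (length ys) One, e := Zero # s e)"
      have 1: "runs (scan_body d e) s 4 ?s" unfolding scan_body_def
        by (rule runs_eqI[OF runs_if_false[OF _ runs_seq[OF runs_pop runs_seq[OF runs_pop runs_push]]]])
          (use assms less.prems Cons Leaf in \<open>auto simp: fun_eq_iff\<close>)
      have 2: "runs (While_nonempty d (scan_body d e)) ?s (5 * length (concat (map code ys)) + 1)
        (?s(0 := r, d := [], e := rev (concat (map code ys)) @ ?s e))"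
        by (rule less.hyps) (use assms Cons Leaf in auto)
      show ?thesis
        by (rule runs_eqI[OF runs_while_loop[OF _ 1 2]])
          (use assms less.prems Cons Leaf in \<open>auto simp: fun_eq_iff\<close>)
    next
      case (Node a b)
      let ?zs = "a # b # ys"
      let ?s = "s(0 := concat (map code ?zs) @ r, d := replicate (length ?zs) One, e := One # s e)"
      have 1: "runs (scan_body d e) s 4 ?s" unfolding scan_body_def
        by (rule runs_eqI[OF runs_if_true[OF _ runs_seq[OF runs_pop runs_seq[OF runs_push runs_push]]]])
          (use assms less.prems Cons Node in \<open>auto simp: fun_eq_iff\<close>)
      have 2: "runs (While_nonempty d (scan_body d e)) ?s (5 * length (concat (map code ?zs)) + 1)
        (?s(0 := r, d := [], e := rev (concat (map code ?zs)) @ ?s e))"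
        by (rule less.hyps) (use assms Cons Node in auto)
      show ?thesis
        by (rule runs_eqI[OF runs_while_loop[OF _ 1 2]])
          (use assms less.prems Cons Node in \<open>auto simp: fun_eq_iff\<close>)
    qed
  qed
qed

lemma runs_scan:
  assumes "d \<noteq> e" "d \<noteq> 0" "e \<noteq> 0" "s 0 = code x @ r" "s d = []"
  shows "runs (scan d e) s (5 * tsz x + 2) (s(0 := r, e := rev (code x) @ s e))"
proof -
  have 1: "runs (While_nonempty d (scan_body d e)) (s(d := One # s d)) (5 * length (concat (map code [x])) + 1)
     ((s(d := One # s d))(0 := r, d := [], e := rev (concat (map code [x])) @ (s(d := One # s d)) e))"
    by (rule runs_scan_loop) (use assms in auto)
  show ?thesis unfolding scan_def
    by (rule runs_eqI[OF runs_seq[OF runs_push 1]]) (use assms in \<open>auto simp: fun_eq_iff\<close>)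
qed

definition drop_top :: "nat \<Rightarrow> com" where
  "drop_top d = Seq (scan d (d + 1)) (clear (d + 1))"

lemma runs_drop_top:
  assumes "d \<ge> 1" "s 0 = code x @ r" "\<forall>i\<ge>d. s i = []"
  shows "runs (drop_top d) s (7 * tsz x + 3) (s(0 := r))"
proof -
  have 1: "runs (scan d (d + 1)) s (5 * tsz x + 2) (s(0 := r, d + 1 := rev (code x) @ s (d + 1)))"
    by (rule runs_scan) (use assms in auto)
  show ?thesis unfolding drop_top_def
    by (rule runs_eqI[OF runs_seq[OF 1 runs_clear]]) (use assms in \<open>auto simp: fun_eq_iff\<close>)
qed

definition dup :: "nat \<Rightarrow> com" where
  "dup d = Seq (scan d (d + 1)) (Seq (move2 (d + 1) 0 (d + 2)) (Seq (move (d + 2) (d + 1)) (move (d + 1) 0)))"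

lemma runs_dup:
  assumes "d \<ge> 1" "s 0 = code x @ r" "\<forall>i\<ge>d. s i = []"
  shows "runs (dup d) s (27 * tsz x + 5) (s(0 := code x @ code x @ r))"
proof -
  have 1: "runs (scan d (d + 1)) s (5 * tsz x + 2) (s(0 := r, d + 1 := rev (code x) @ s (d + 1)))"
    by (rule runs_scan) (use assms in auto)
  show ?thesis unfolding dup_def
    by (rule runs_eqI[OF runs_seq[OF 1 runs_seq[OF runs_move2 runs_seq[OF runs_move runs_move]]]])
      (use assms in \<open>auto simp: fun_eq_iff\<close>)
qed

definition swap :: "nat \<Rightarrow> com" where
  "swap d = Seq (scan d (d + 1)) (Seq (scan d (d + 2)) (Seq (move (d + 1) 0) (move (d + 2) 0)))"

lemma runs_swap:
  assumes "d \<ge> 1" "s 0 = code x @ code y @ r" "\<forall>i\<ge>d. s i = []"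
  shows "runs (swap d) s (12 * (tsz x + tsz y) + 6) (s(0 := code y @ code x @ r))"
proof -
  let ?s = "s(0 := code y @ r, d + 1 := rev (code x) @ s (d + 1))"
  have 1: "runs (scan d (d + 1)) s (5 * tsz x + 2) ?s"
    by (rule runs_scan) (use assms in auto)
  have 2: "runs (scan d (d + 2)) ?s (5 * tsz y + 2) (?s(0 := r, d + 2 := rev (code y) @ ?s (d + 2)))"
    by (rule runs_scan) (use assms in auto)
  show ?thesis unfolding swap_def
    by (rule runs_eqI[OF runs_seq[OF 1 runs_seq[OF 2 runs_seq[OF runs_move runs_move]]]])
      (use assms in \<open>auto simp: fun_eq_iff\<close>)
qed

section \<open>Polynomial-time functions on trees\<close>

lemma poly_nat_mono: "x \<le> y \<Longrightarrow> poly p x \<le> poly p y" for p :: "nat poly"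
  by (induction p) (auto intro: add_mono mult_mono)


class enc =
  fixes enc :: "'a \<Rightarrow> tree"
  assumes enc_inj [simp]: "enc x = enc y \<longleftrightarrow> x = y"

abbreviation ec :: "'a::enc \<Rightarrow> symb list" where
  "ec x \<equiv> code (enc x)"

abbreviation esz :: "'a::enc \<Rightarrow> nat" where
  "esz x \<equiv> tsz (enc x)"

instantiation tree :: enc
begin
definition enc_tree :: "tree \<Rightarrow> tree" where [simp]: "enc_tree t = t"
instance by standard simp
end

instantiation bool :: enc
begin
definition enc_bool :: "bool \<Rightarrow> tree" where "enc_bool b = (if b then Node Leaf Leaf else Leaf)"
instance by standard (auto simp: enc_bool_def)
end

instantiation prod :: (enc, enc) enc
begin
primrec enc_prod :: "'a \<times> 'b \<Rightarrow> tree" where "enc_prod (a, b) = Node (enc a) (enc b)"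
instance by standard auto
end

instantiation list :: (enc) enc
begin
primrec enc_list :: "'a list \<Rightarrow> tree" where
  "enc_list [] = Leaf"
| "enc_list (x # xs) = Node (enc x) (enc_list xs)"
instance
proof
  fix xs ys :: "'a list"
  show "enc xs = enc ys \<longleftrightarrow> xs = ys"
    by (induction xs arbitrary: ys; case_tac ys) auto
qed
end

instantiation symb :: enc
begin
primrec enc_symb :: "symb \<Rightarrow> tree" where
  "enc_symb Zero = Leaf"
| "enc_symb One = Node Leaf Leaf"
| "enc_symb Elt = Node Leaf (Node Leaf Leaf)"
| "enc_symb Tup = Node (Node Leaf Leaf) Leaf"
| "enc_symb Arg = Node (Node Leaf Leaf) (Node Leaf Leaf)"
instance
proof
  fix x y :: symb
  show "enc x = enc y \<longleftrightarrow> x = y" by (cases x; cases y) auto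
qed
end

text \<open>A mismatch leaves a mark on stack \<open>d\<close>; the loop goes on, since the copy on
  \<open>e\<close> has to be used up anyway.\<close>

definition cmp_body :: "nat \<Rightarrow> nat \<Rightarrow> nat \<Rightarrow> com" where
  "cmp_body d e f = case_symb e (\<lambda>a. Seq (If_top f a Skip (Push d One)) (Seq (Pop e) (Pop f)))"

lemma runs_cmp_loop:
  assumes "d \<noteq> e" "d \<noteq> f" "e \<noteq> f"
  shows "\<exists>k. runs (While_nonempty e (cmp_body d e f)) s (9 * length (s e) + 1)
     (s(e := [], f := drop (length (s e)) (s f), d := replicate k One @ s d)) \<and>
     (k = 0 \<longleftrightarrow> take (length (s e)) (s f) = s e) \<and> k \<le> length (s e)"
proof (induction "s e" arbitrary: s)
  case Nil
  then show ?case
    by (intro exI[of _ 0] conjI runs_eqI[OF runs_while_end]) (auto simp: fun_eq_iff)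
next
  case (Cons x xs)
  note se = Cons.hyps(2)[symmetric]
  define j :: nat where "j = (if s f \<noteq> [] \<and> hd (s f) = x then 0 else 1)"
  have 0: "runs (If_top f x Skip (Push d One)) s 2 (s(d := replicate j One @ s d))"
  proof (cases "s f \<noteq> [] \<and> hd (s f) = x")
    case True
    then obtain ys where "s f = x # ys" by (cases "s f") auto
    then show ?thesis using True unfolding j_def
      by (intro runs_eqI[OF runs_if_true[OF _ runs_skip]]) (auto simp: fun_eq_iff)
  next
    case False
    then show ?thesis unfolding j_def
      by (intro runs_eqI[OF runs_if_false[OF _ runs_push]]) (auto simp: fun_eq_iff)
  qed
  let ?s = "s(d := replicate j One @ s d, e := xs, f := tl (s f))"
  have 1: "runs (cmp_body d e f) s (4 + 4) ?s" unfolding cmp_body_def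
    by (rule runs_case_symb[where s = s and i = e, OF se], rule runs_eqI[OF runs_seq[OF 0 runs_seq[OF runs_pop runs_pop]]])
      (use assms se in \<open>auto simp: fun_eq_iff\<close>)
  obtain k where k: "runs (While_nonempty e (cmp_body d e f)) ?s (9 * length xs + 1)
     (?s(e := [], f := drop (length xs) (tl (s f)), d := replicate k One @ replicate j One @ s d))"
     "k = 0 \<longleftrightarrow> take (length xs) (tl (s f)) = xs" "k \<le> length xs"
    using Cons.hyps(1)[of ?s] assms by auto
  have "runs (While_nonempty e (cmp_body d e f)) s (9 * length (s e) + 1)
     (s(e := [], f := drop (length (s e)) (s f), d := replicate (k + j) One @ s d))"
    by (rule runs_eqI[OF runs_while_loop[OF _ 1 k(1)]])
      (use assms se in \<open>auto simp: fun_eq_iff drop_Suc replicate_add\<close>)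
  moreover have "k + j = 0 \<longleftrightarrow> take (length (s e)) (s f) = s e"
    using k(2) se by (cases "s f") (auto simp: j_def)
  moreover have "k + j \<le> length (s e)" using k(3) se by (auto simp: j_def)
  ultimately show ?case by blast
qed

text \<open>After the comparison the rest of the second copy is moved onto the marks, so that stack
  \<open>d\<close> is empty iff the trees are equal. Emptiness is decided by tests for
  \<open>One\<close> and \<open>Zero\<close>, the only symbols that can be there.\<close>

definition tree_eq :: "nat \<Rightarrow> com" where
  "tree_eq d = Seq (scan d (d + 1)) (Seq (scan d (d + 2)) (Seq (While_nonempty (d + 1) (cmp_body d (d + 1) (d + 2)))
     (Seq (move (d + 2) d)
       (If_top d One (Seq (clear d) (Push 0 Zero)) (If_top d Zero (Seq (clear d) (Push 0 Zero)) (pushes 0 [One, Zero, Zero]))))))"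

lemma runs_tree_eq:
  assumes d: "d \<ge> 1" "s 0 = code x @ code y @ r" "\<forall>i\<ge>d. s i = []"
  shows "runs (tree_eq d) s (30 * (tsz x + tsz y) + 30) (s(0 := code (enc (x = y)) @ r))"
proof -
  let ?s1 = "s(0 := code y @ r, d + 1 := rev (code x) @ s (d + 1))"
  have 1: "runs (scan d (d + 1)) s (5 * tsz x + 2) ?s1"
    by (rule runs_scan) (use assms in auto)
  let ?s2 = "?s1(0 := r, d + 2 := rev (code y) @ ?s1 (d + 2))"
  have 2: "runs (scan d (d + 2)) ?s1 (5 * tsz y + 2) ?s2"
    by (rule runs_scan) (use assms in auto)
  obtain k where k: "runs (While_nonempty (d + 1) (cmp_body d (d + 1) (d + 2))) ?s2 (9 * tsz x + 1)
     (?s2(d + 1 := [], d + 2 := drop (tsz x) (rev (code y)), d := replicate k One))"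
     "k = 0 \<longleftrightarrow> take (tsz x) (rev (code y)) = rev (code x)" "k \<le> tsz x"
    using runs_cmp_loop[of d "d + 1" "d + 2" ?s2] assms by auto
  let ?zs = "rev (drop (tsz x) (rev (code y))) @ replicate k One"
  have lz: "length ?zs \<le> tsz x + tsz y" using k(3) by simp
  have eq: "x = y \<longleftrightarrow> ?zs = []"
  proof
    assume "?zs = []"
    with k(2) have "rev (code x) = rev (code y)" by (auto simp: drop_eq_Nil)
    then show "x = y" by (simp add: code_inj)
  qed (use k(2) in auto)
  let ?s4 = "s(0 := r, d := ?zs)"
  have 4: "runs (move (d + 2) d) (?s2(d + 1 := [], d + 2 := drop (tsz x) (rev (code y)), d := replicate k One))
     (7 * tsz y + 1) ?s4"
    by (rule runs_eqI[OF runs_move]) (use assms in \<open>auto simp: fun_eq_iff\<close>)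
  have cl: "runs (Seq (clear d) (Push 0 Zero)) ?s4 (2 * (tsz x + tsz y) + 2) (s(0 := Zero # r))"
    by (rule runs_eqI[OF runs_seq[OF runs_clear runs_push]]) (use lz assms in \<open>auto simp: fun_eq_iff\<close>)
  have zo: "z \<in> {Zero, One}" if "z \<in> set ?zs" for z
  proof -
    have "set (code t) \<subseteq> {Zero, One}" for t by (induction t) auto
    moreover have "z \<in> set (code y) \<or> z = One" using that by (auto dest!: in_set_dropD split: if_splits)
    ultimately show ?thesis by blast
  qed
  have 5: "runs (If_top d One (Seq (clear d) (Push 0 Zero)) (If_top d Zero (Seq (clear d) (Push 0 Zero)) (pushes 0 [One, Zero, Zero])))
    ?s4 (2 * (tsz x + tsz y) + 20) (s(0 := code (enc (x = y)) @ r))"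
  proof (cases "?zs")
    case Nil
    then have [simp]: "x = y" using eq by simp
    show ?thesis
      by (rule runs_eqI[OF runs_if_false[OF _ runs_if_false[OF _ runs_pushes]]])
        (use Nil assms in \<open>auto simp: fun_eq_iff enc_bool_def\<close>)
  next
    case (Cons z zs)
    then have n: "x \<noteq> y" using eq by simp
    show ?thesis
    proof (cases "z = One")
      case True
      show ?thesis
        by (rule runs_eqI[OF runs_if_true[OF _ cl]])
          (use Cons True assms n in \<open>auto simp: fun_eq_iff enc_bool_def\<close>)
    next
      case False
      then have z: "z = Zero" using zo[of z] unfolding Cons by auto
      show ?thesis
        by (rule runs_eqI[OF runs_if_false[OF _ runs_if_true[OF _ cl]]])
          (use Cons z assms n in \<open>auto simp: fun_eq_iff enc_bool_def\<close>)
    qed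
  qed
  show ?thesis unfolding tree_eq_def
    by (rule runs_eqI[OF runs_seq[OF 1 runs_seq[OF 2 runs_seq[OF k(1) runs_seq[OF 4 5]]]]]) auto
qed

text \<open>
  A program computes \<open>f\<close> by replacing the argument on top of stack 0 by the value; what lies below
  and the stacks below \<open>d\<close> may hold anything, so that computations can be nested.
\<close>

definition computes :: "nat \<Rightarrow> com \<Rightarrow> nat poly \<Rightarrow> ('a::enc \<Rightarrow> 'b::enc) \<Rightarrow> bool" where
  "computes d c p f \<longleftrightarrow> (\<forall>s x r. s 0 = ec x @ r \<and> (\<forall>i\<ge>d. s i = []) \<longrightarrow>
     runs c s (poly p (esz x)) (s(0 := ec (f x) @ r)))"

definition ptime :: "('a::enc \<Rightarrow> 'b::enc) \<Rightarrow> bool" where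
  "ptime f \<longleftrightarrow> (\<forall>d\<ge>1. \<exists>c p. computes d c p f)"

lemma computesI:
  assumes "\<And>s x r. s 0 = ec x @ r \<Longrightarrow> \<forall>i\<ge>d. s i = [] \<Longrightarrow> runs c s (poly p (esz x)) (s(0 := ec (f x) @ r))"
  shows "computes d c p f"
  using assms unfolding computes_def by blast

lemma computesD:
  assumes "computes d c p f" "s 0 = ec x @ r" "\<forall>i\<ge>d. s i = []"
  shows "runs c s (poly p (esz x)) (s(0 := ec (f x) @ r))"
  using assms unfolding computes_def by blast

text \<open>A program lengthens a stack by at most one symbol per step, so its running time bounds
  the size of its output. This supplies the size bounds needed for compositions.\<close>

lemma ptime_size:
  assumes "ptime f" obtains p :: "nat poly" where "\<And>x. esz (f x) \<le> poly p (esz x)"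
proof -
  obtain c p where c: "computes 1 c p f" using assms unfolding ptime_def by blast
  have "esz (f x) \<le> poly ([:0, 1:] + p) (esz x)" for x
  proof -
    have "runs c ((\<lambda>_. [])(0 := ec x)) (poly p (esz x)) ((\<lambda>_. [])(0 := ec x, 0 := ec (f x) @ []))"
      by (rule computesD[OF c]) auto
    then obtain m where "m \<le> poly p (esz x)"
      "exec c ((\<lambda>_. [])(0 := ec x)) m ((\<lambda>_. [])(0 := ec x, 0 := ec (f x) @ []))"
      unfolding runs_def by blast
    from exec_length[OF this(2), of 0] this(1) show ?thesis by simp
  qed
  with that show ?thesis by blast
qed

lemma ptime_id: "ptime (\<lambda>x. x)"
proof -
  have "computes d Skip [:1:] (\<lambda>x. x)" for d
    by (rule computesI) (auto intro!: runs_eqI[OF runs_skip] simp: fun_eq_iff)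
  then show ?thesis unfolding ptime_def by blast
qed

lemma ptime_comp:
  assumes "ptime f" "ptime g" shows "ptime (\<lambda>x. f (g x))"
  unfolding ptime_def
proof (intro allI impI)
  fix d :: nat assume "d \<ge> 1"
  then obtain c p c' p' where c: "computes d c p f" "computes d c' p' g"
    using assms unfolding ptime_def by blast
  obtain q where q: "\<And>x. esz (g x) \<le> poly q (esz x)" using ptime_size[OF assms(2)] by blast
  have "computes d (Seq c' c) (p' + pcompose p q) (\<lambda>x. f (g x))"
  proof (rule computesI, goal_cases)
    case (1 s x r)
    note s = 1
    have 2: "runs c (s(0 := ec (g x) @ r)) (poly p (esz (g x))) (s(0 := ec (g x) @ r, 0 := ec (f (g x)) @ r))"
      by (rule computesD[OF c(1)]) (use s \<open>d \<ge> 1\<close> in auto)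
    show "runs (Seq c' c) s (poly (p' + pcompose p q) (esz x)) (s(0 := ec (f (g x)) @ r))"
      by (rule runs_eqI[OF runs_seq[OF computesD[OF c(2) s] 2]])
        (use poly_nat_mono[OF q] in \<open>auto simp: poly_pcompose\<close>)
  qed
  then show "\<exists>c p. computes d c p (\<lambda>x. f (g x))" by blast
qed

lemma ptime_const: "ptime (\<lambda>x. t)"
proof -
  have "computes d (Seq (drop_top d) (pushes 0 (ec t))) [:4 + esz t, 7:] (\<lambda>x. t)" if "d \<ge> 1" for d
    by (rule computesI, rule runs_eqI[OF runs_seq[OF runs_drop_top[OF that] runs_pushes]])
      (use that in \<open>auto simp: fun_eq_iff\<close>)
  then show ?thesis unfolding ptime_def by blast
qed

lemma ptime_pair:
  assumes "ptime f" "ptime g" shows "ptime (\<lambda>x. (f x, g x))"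
  unfolding ptime_def
proof (intro allI impI)
  fix d :: nat assume d: "d \<ge> 1"
  then obtain c p c' p' where c: "computes d c p f" "computes d c' p' g"
    using assms unfolding ptime_def by blast
  obtain q where q: "\<And>x. esz (g x) \<le> poly q (esz x)" using ptime_size[OF assms(2)] by blast
  have "computes d (Seq (dup d) (Seq c' (Seq (swap d) (Seq c (Push 0 One)))))
    ([:12, 39:] + p' + smult 12 q + p) (\<lambda>x. (f x, g x))"
  proof (rule computesI, goal_cases)
    case (1 s x r)
    note s = 1
    let ?s1 = "s(0 := ec x @ ec x @ r)"
    have 1: "runs (dup d) s (27 * esz x + 5) ?s1" by (rule runs_dup) (use d s in auto)
    let ?s2 = "?s1(0 := ec (g x) @ ec x @ r)"
    have 2: "runs c' ?s1 (poly p' (esz x)) ?s2"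
      by (rule computesD[OF c(2)]) (use s d in auto)
    let ?s3 = "?s2(0 := ec x @ ec (g x) @ r)"
    have 3: "runs (swap d) ?s2 (12 * (esz (g x) + esz x) + 6) ?s3"
      by (rule runs_swap) (use s d in auto)
    have 4: "runs c ?s3 (poly p (esz x)) (?s3(0 := ec (f x) @ ec (g x) @ r))"
      by (rule computesD[OF c(1)]) (use s d in auto)
    show "runs (Seq (dup d) (Seq c' (Seq (swap d) (Seq c (Push 0 One))))) s
      (poly ([:12, 39:] + p' + smult 12 q + p) (esz x)) (s(0 := ec (f x, g x) @ r))"
      by (rule runs_eqI[OF runs_seq[OF 1 runs_seq[OF 2 runs_seq[OF 3 runs_seq[OF 4 runs_push]]]]])
        (use q[of x] in \<open>auto simp: algebra_simps\<close>)
  qed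
  then show "\<exists>c p. computes d c p (\<lambda>x. (f x, g x))" by blast
qed

text \<open>Encoded types are views on trees: a function of trees that is right on the codes of
  arguments suffices.\<close>

lemma ptime_conv:
  fixes f :: "'a::enc \<Rightarrow> 'b::enc" and g :: "tree \<Rightarrow> 'c::enc"
  assumes "ptime g" "\<And>x. enc (g (enc x)) = enc (f x)" shows "ptime f"
proof -
  have "computes d c p f" if "computes d c p g" for d c p
  proof (rule computesI, goal_cases)
    case (1 s x r)
    then show ?case using computesD[OF that, of s "enc x" r] by (simp add: assms(2))
  qed
  then show ?thesis using assms(1) unfolding ptime_def by meson
qed

primrec left :: "tree \<Rightarrow> tree" where
  "left Leaf = Leaf" | "left (Node l r) = l"

primrec right :: "tree \<Rightarrow> tree" where
  "right Leaf = Leaf" | "right (Node l r) = r"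

lemma ptime_right: "ptime right"
proof -
  have "computes d (If_top 0 One (Seq (Pop 0) (drop_top d)) Skip) [:5, 7:] right" if d: "d \<ge> 1" for d
  proof (rule computesI, goal_cases)
    case (1 s x r)
    note s = 1
    show "runs (If_top 0 One (Seq (Pop 0) (drop_top d)) Skip) s (poly [:5, 7:] (esz x)) (s(0 := ec (right x) @ r))"
    proof (cases x)
      case Leaf
      then show ?thesis using s
        by (intro runs_eqI[OF runs_if_false[OF _ runs_skip]]) (auto simp: fun_eq_iff)
    next
      case (Node a b)
      have 1: "runs (drop_top d) (s(0 := tl (s 0))) (7 * esz a + 3) (s(0 := tl (s 0), 0 := ec b @ r))"
        by (rule runs_drop_top) (use d s Node in auto)
      show ?thesis
        by (rule runs_eqI[OF runs_if_true[OF _ runs_seq[OF runs_pop 1]]]) (use s Node in auto)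
    qed
  qed
  then show ?thesis unfolding ptime_def by blast
qed

lemma ptime_left: "ptime left"
proof -
  have "computes d (If_top 0 One (Seq (Pop 0) (Seq (swap d) (drop_top d))) Skip) [:11, 19:] left" if d: "d \<ge> 1" for d
  proof (rule computesI, goal_cases)
    case (1 s x r)
    note s = 1
    show "runs (If_top 0 One (Seq (Pop 0) (Seq (swap d) (drop_top d))) Skip) s (poly [:11, 19:] (esz x)) (s(0 := ec (left x) @ r))"
    proof (cases x)
      case Leaf
      then show ?thesis using s
        by (intro runs_eqI[OF runs_if_false[OF _ runs_skip]]) (auto simp: fun_eq_iff)
    next
      case (Node a b)
      let ?s1 = "s(0 := tl (s 0))"
      let ?s2 = "?s1(0 := ec b @ ec a @ r)"
      have 0: "runs (swap d) ?s1 (12 * (esz a + esz b) + 6) ?s2"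
        by (rule runs_swap) (use d s Node in auto)
      have 1: "runs (drop_top d) ?s2 (7 * esz b + 3) (?s2(0 := ec a @ r))"
        by (rule runs_drop_top) (use d s Node in auto)
      show ?thesis
        by (rule runs_eqI[OF runs_if_true[OF _ runs_seq[OF runs_pop runs_seq[OF 0 1]]]]) (use s Node in auto)
    qed
  qed
  then show ?thesis unfolding ptime_def by blast
qed

lemma ptime_if:
  assumes "ptime b" "ptime f" "ptime g"
  shows "ptime (\<lambda>x. if b x then f x else g x)"
  unfolding ptime_def
proof (intro allI impI)
  fix d :: nat assume d: "d \<ge> 1"
  then obtain c p c' p' c0 p0 where c: "computes d c p f" "computes d c' p' g"
    "computes d c0 p0 b"
    using assms unfolding ptime_def by meson
  \<comment> \<open>\<open>False\<close> is coded by \<open>Zero\<close> and \<open>True\<close> by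
    \<open>One\<close>, \<open>Zero\<close>, \<open>Zero\<close>; hence one pop in one branch and
    three in the other.\<close>
  let ?c = "Seq (dup d) (Seq c0 (If_top 0 Zero (Seq (Pop 0) c') (Seq (Pop 0) (Seq (Pop 0) (Seq (Pop 0) c)))))"
  have "computes d ?c ([:9, 27:] + p0 + p + p') (\<lambda>x. if b x then f x else g x)"
  proof (rule computesI, goal_cases)
    case (1 s x r)
    note s = 1
    let ?s1 = "s(0 := ec x @ ec x @ r)"
    have 1: "runs (dup d) s (27 * esz x + 5) ?s1" by (rule runs_dup) (use d s in auto)
    let ?s2 = "?s1(0 := ec (b x) @ ec x @ r)"
    have 2: "runs c0 ?s1 (poly p0 (esz x)) ?s2"
      by (rule computesD[OF c(3)]) (use s d in auto)
    have 3: "runs c (s(0 := ec x @ r)) (poly p (esz x)) (s(0 := ec x @ r, 0 := ec (f x) @ r))"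
      by (rule computesD[OF c(1)]) (use s d in auto)
    have 4: "runs c' (s(0 := ec x @ r)) (poly p' (esz x)) (s(0 := ec x @ r, 0 := ec (g x) @ r))"
      by (rule computesD[OF c(2)]) (use s d in auto)
    have 5: "runs (If_top 0 Zero (Seq (Pop 0) c') (Seq (Pop 0) (Seq (Pop 0) (Seq (Pop 0) c)))) ?s2
      (4 + poly p (esz x) + poly p' (esz x)) (s(0 := ec (if b x then f x else g x) @ r))"
    proof (cases "b x")
      case True
      let ?t = "s(0 := ec x @ r)"
      have p1: "runs (Pop 0) ?s2 1 (s(0 := Zero # Zero # ec x @ r))"
        by (rule runs_eqI[OF runs_pop]) (use True in \<open>auto simp: enc_bool_def\<close>)
      have p2: "runs (Pop 0) (s(0 := Zero # Zero # ec x @ r)) 1 (s(0 := Zero # ec x @ r))"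
        by (rule runs_eqI[OF runs_pop]) auto
      have p3: "runs (Pop 0) (s(0 := Zero # ec x @ r)) 1 ?t"
        by (rule runs_eqI[OF runs_pop]) auto
      show ?thesis
        by (rule runs_eqI[OF runs_if_false[OF _ runs_seq[OF p1 runs_seq[OF p2 runs_seq[OF p3 3]]]]])
          (use True in \<open>auto simp: enc_bool_def\<close>)
    next
      case False
      have p1: "runs (Pop 0) ?s2 1 (s(0 := ec x @ r))"
        by (rule runs_eqI[OF runs_pop]) (use False in \<open>auto simp: enc_bool_def\<close>)
      show ?thesis
        by (rule runs_eqI[OF runs_if_true[OF _ runs_seq[OF p1 4]]])
          (use False in \<open>auto simp: enc_bool_def\<close>)
    qed
    show "runs ?c s (poly ([:9, 27:] + p0 + p + p') (esz x)) (s(0 := ec (if b x then f x else g x) @ r))"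
      by (rule runs_eqI[OF runs_seq[OF 1 runs_seq[OF 2 5]]]) (auto simp: algebra_simps)
  qed
  then show "\<exists>c p. computes d c p (\<lambda>x. if b x then f x else g x)" by blast
qed

lemma ptime_eq:
  assumes "ptime f" "ptime g" shows "ptime (\<lambda>x. f x = g x)"
proof -
  have "ptime (\<lambda>x. left x = right x)" unfolding ptime_def
  proof (intro allI impI)
    fix d :: nat assume d: "d \<ge> 1"
    have "computes d (If_top 0 One (Seq (Pop 0) (tree_eq d)) (pushes 0 [One, Zero])) [:40, 30:] (\<lambda>x. left x = right x)"
    proof (rule computesI, goal_cases)
      case (1 s x r)
      note s = 1
      show "runs (If_top 0 One (Seq (Pop 0) (tree_eq d)) (pushes 0 [One, Zero])) s (poly [:40, 30:] (esz x))
        (s(0 := ec (left x = right x) @ r))"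
      proof (cases x)
        case Leaf
        then show ?thesis using s
          by (intro runs_eqI[OF runs_if_false[OF _ runs_pushes]]) (auto simp: fun_eq_iff enc_bool_def)
      next
        case (Node a b)
        have 1: "runs (tree_eq d) (s(0 := tl (s 0))) (30 * (esz a + esz b) + 30) (s(0 := tl (s 0), 0 := ec (a = b) @ r))"
          by (rule runs_eqI[OF runs_tree_eq[where x = a and y = b and r = r]]) (use d s Node in auto)
        show ?thesis
          by (rule runs_eqI[OF runs_if_true[OF _ runs_seq[OF runs_pop 1]]]) (use s Node in auto)
      qed
    qed
    then show "\<exists>c p. computes d c p (\<lambda>x. left x = right x)" by blast
  qed
  from ptime_comp[OF ptime_conv[OF this, of "\<lambda>(x, y). x = y"] ptime_pair[OF assms]] show ?thesis by auto
qed

lemma runs_iterate: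
  fixes f :: "'a::enc \<Rightarrow> 'a"
  assumes c: "computes (d + 1) c p f" and d: "d \<ge> 1" and "\<forall>i\<ge>d + 1. s i = []" "s 0 = ec x @ r"
    and "\<forall>i\<le>length (s d). esz ((f ^^ i) x) \<le> M"
  shows "runs (While_nonempty d (Seq (Pop d) c)) s (length (s d) * (poly p M + 2) + 1)
    (s(d := [], 0 := ec ((f ^^ length (s d)) x) @ r))"
  using assms(3-)
proof (induction "s d" arbitrary: s x)
  case Nil
  then show ?case by (auto intro!: runs_eqI[OF runs_while_end] simp: fun_eq_iff)
next
  case (Cons y ys)
  note sd = Cons.hyps(2)[symmetric]
  have "runs c (s(d := tl (s d))) (poly p (esz x)) (s(d := tl (s d), 0 := ec (f x) @ r))"
    by (rule computesD[OF c]) (use d Cons.prems in auto)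
  moreover have "esz x \<le> M" using Cons.prems(3)[rule_format, of 0] by simp
  ultimately have 1: "runs c (s(d := tl (s d))) (poly p M) (s(d := tl (s d), 0 := ec (f x) @ r))"
    using poly_nat_mono runs_mono by blast
  let ?s = "s(d := ys, 0 := ec (f x) @ r)"
  have a: "runs (Seq (Pop d) c) s (1 + poly p M) ?s"
    by (rule runs_eqI[OF runs_seq[OF runs_pop 1]]) (use sd in auto)
  have b: "runs (While_nonempty d (Seq (Pop d) c)) ?s (length (?s d) * (poly p M + 2) + 1)
    (?s(d := [], 0 := ec ((f ^^ length (?s d)) (f x)) @ r))"
  proof (rule Cons.hyps(1))
    show "\<forall>i\<le>length (?s d). esz ((f ^^ i) (f x)) \<le> M"
    proof (intro allI impI)
      fix i assume "i \<le> length (?s d)"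
      then show "esz ((f ^^ i) (f x)) \<le> M"
        using Cons.prems(3)[rule_format, of "Suc i"] sd d by (auto simp: funpow_swap1)
    qed
  qed (use d Cons.prems in auto)
  show ?case
    by (rule runs_eqI[OF runs_while_loop[OF _ a b]])
      (use d sd in \<open>auto simp: funpow_swap1 fun_eq_iff\<close>)
qed

text \<open>A copy of the code of the initial value serves as a unary loop counter. The bound
  \<open>q\<close> on intermediate values is essential, since a polynomial-time step might double
  the size each time.\<close>

lemma ptime_iterate:
  fixes f :: "'a::enc \<Rightarrow> 'a"
  assumes "ptime f" "ptime g"
    and q: "\<And>x i. i \<le> esz (g x) \<Longrightarrow> esz ((f ^^ i) (g x)) \<le> poly q (esz x)"
  shows "ptime (\<lambda>x. (f ^^ esz (g x)) (g x))"
proof -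
  have "\<exists>c p. computes d c p (\<lambda>x. (f ^^ esz (g x)) (g x))" if d: "d \<ge> 1" for d
  proof -
    obtain c p where c: "computes (d + 1) c p f"
      using assms(1) d unfolding ptime_def by (meson le_add2)
    obtain c0 p0 where c0: "computes d c0 p0 g"
      using assms(2) d unfolding ptime_def by blast
    let ?c = "Seq c0 (Seq (dup d) (Seq (scan d (d + 1)) (Seq (move (d + 1) d) (While_nonempty d (Seq (Pop d) c)))))"
    have "computes d ?c (p0 + [:9:] + smult 41 q + q * pcompose p q) (\<lambda>x. (f ^^ esz (g x)) (g x))"
    proof (rule computesI, goal_cases)
      case (1 s x r)
      note s = 1
      let ?s0 = "s(0 := ec (g x) @ r)"
      have 0: "runs c0 s (poly p0 (esz x)) ?s0" by (rule computesD[OF c0 s])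
      let ?s1 = "s(0 := ec (g x) @ ec (g x) @ r)"
      have 1: "runs (dup d) ?s0 (27 * esz (g x) + 5) ?s1"
        by (rule runs_eqI[OF runs_dup[where x = "enc (g x)" and r = r]]) (use d s in \<open>auto simp: fun_eq_iff\<close>)
      let ?s2 = "s(0 := ec (g x) @ r, d + 1 := rev (ec (g x)))"
      have 2: "runs (scan d (d + 1)) ?s1 (5 * esz (g x) + 2) ?s2"
        by (rule runs_eqI[OF runs_scan]) (use d s in \<open>auto simp: fun_eq_iff\<close>)
      let ?s3 = "s(0 := ec (g x) @ r, d := ec (g x))"
      have 3: "runs (move (d + 1) d) ?s2 (7 * esz (g x) + 1) ?s3"
        by (rule runs_eqI[OF runs_move]) (use d s in \<open>auto simp: fun_eq_iff\<close>)
      have 4: "runs (While_nonempty d (Seq (Pop d) c)) ?s3 (length (?s3 d) * (poly p (poly q (esz x)) + 2) + 1)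
        (?s3(d := [], 0 := ec ((f ^^ length (?s3 d)) (g x)) @ r))"
        by (rule runs_iterate[OF c d]) (use d s q in auto)
      have le: "esz (g x) \<le> poly q (esz x)" using q[of 0 x] by simp
      then have "esz (g x) * (41 + poly p (poly q (esz x))) \<le> poly q (esz x) * (41 + poly p (poly q (esz x)))"
        by (rule mult_right_mono) simp
      then have le': "41 * esz (g x) + esz (g x) * poly p (poly q (esz x)) \<le>
        41 * poly q (esz x) + poly q (esz x) * poly p (poly q (esz x))"
        by (simp add: algebra_simps)
      show "runs ?c s (poly (p0 + [:9:] + smult 41 q + q * pcompose p q) (esz x)) (s(0 := ec ((f ^^ esz (g x)) (g x)) @ r))"
        by (intro runs_eqI[OF runs_seq[OF 0 runs_seq[OF 1 runs_seq[OF 2 runs_seq[OF 3 4]]]]])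
          (use d s le' in \<open>auto simp: algebra_simps poly_pcompose fun_eq_iff\<close>)
    qed
    then show ?thesis by blast
  qed
  then show ?thesis unfolding ptime_def by blast
qed

named_theorems ptime_intros

lemmas [ptime_intros] = ptime_id ptime_const ptime_pair ptime_if ptime_eq

lemma ptime_recode: "ptime f \<Longrightarrow> (\<And>x. enc (f x) = enc (g x)) \<Longrightarrow> ptime g"
  unfolding ptime_def computes_def by simp

lemma ptime_fst [ptime_intros]: "ptime f \<Longrightarrow> ptime (\<lambda>x. fst (f x))"
  by (rule ptime_comp[where f = fst], rule ptime_conv[OF ptime_left]) auto

lemma ptime_snd [ptime_intros]: "ptime f \<Longrightarrow> ptime (\<lambda>x. snd (f x))"
  by (rule ptime_comp[where f = snd], rule ptime_conv[OF ptime_right]) auto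

lemma ptime_Cons [ptime_intros]: "ptime f \<Longrightarrow> ptime l \<Longrightarrow> ptime (\<lambda>x. f x # l x)"
  by (rule ptime_recode[where f = "\<lambda>x. (f x, l x)"]) (auto intro: ptime_pair)

lemma ptime_tl [ptime_intros]: "ptime f \<Longrightarrow> ptime (\<lambda>x. tl (f x))"
proof (rule ptime_comp[where f = tl], rule ptime_conv[OF ptime_right])
  show "enc (right (enc xs)) = enc (tl xs)" for xs :: "'b list" by (cases xs) auto
qed

definition hdd :: "'a \<Rightarrow> 'a list \<Rightarrow> 'a" where
  "hdd d xs = (case xs of [] \<Rightarrow> d | x # _ \<Rightarrow> x)"

lemma hdd_simps [simp]: "hdd d [] = d" "hdd d (x # xs) = x"
  by (auto simp: hdd_def)

lemma ptime_hdd [ptime_intros]: "ptime f \<Longrightarrow> ptime (\<lambda>x. hdd d (f x))"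
proof (rule ptime_comp[where f = "hdd d"], rule ptime_conv)
  show "ptime (\<lambda>t. if t = Leaf then enc d else left t)"
    by (intro ptime_intros ptime_left)
  show "enc (if enc xs = Leaf then enc d else left (enc xs)) = enc (hdd d xs)" for xs
    by (cases xs) auto
qed

lemma ptime_case_list [ptime_intros]:
  assumes "ptime l" "ptime f" "ptime (\<lambda>p. g (fst p) (fst (snd p)) (snd (snd p)))"
  shows "ptime (\<lambda>x. case l x of [] \<Rightarrow> f x | y # ys \<Rightarrow> g x y ys)"
proof -
  have "ptime (\<lambda>x. g x (hdd undefined (l x)) (tl (l x)))"
    using ptime_comp[OF assms(3) ptime_pair[OF ptime_id ptime_pair[OF ptime_hdd[OF assms(1), of undefined] ptime_tl[OF assms(1)]]]]
    by simp
  then have "ptime (\<lambda>x. if l x = [] then f x else g x (hdd undefined (l x)) (tl (l x)))"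
    using assms by (intro ptime_intros)
  moreover have "(\<lambda>x. if l x = [] then f x else g x (hdd undefined (l x)) (tl (l x))) =
    (\<lambda>x. case l x of [] \<Rightarrow> f x | y # ys \<Rightarrow> g x y ys)"
    by (auto simp: fun_eq_iff split: list.split)
  ultimately show ?thesis by simp
qed

lemma ptime_not [ptime_intros]: "ptime f \<Longrightarrow> ptime (\<lambda>x. \<not> f x)"
  by (rule ptime_recode[where f = "\<lambda>x. if f x then False else True"], intro ptime_intros) auto

lemma ptime_disj [ptime_intros]: "ptime f \<Longrightarrow> ptime g \<Longrightarrow> ptime (\<lambda>x. f x \<or> g x)"
  by (rule ptime_recode[where f = "\<lambda>x. if f x then True else g x"], intro ptime_intros) auto

lemma esz_list: "length xs < esz xs" "y \<in> set xs \<Longrightarrow> esz y < esz xs" "esz (drop i xs) \<le> esz xs"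
  by (induction xs arbitrary: i) (auto simp: drop_Cons' less_Suc_eq_le intro: le_SucI trans_le_add2)

lemma esz_append: "esz (xs @ ys) + 1 = esz xs + esz ys"
  by (induction xs) auto

text \<open>The state holds a parameter, the rest of the list and the accumulator. It no longer
  changes once the list is used up, so any number of iterations that is at least the length of the
  list gives the fold; the size of the code is such a number.\<close>

definition fold_step :: "('a \<Rightarrow> 'c \<Rightarrow> 'b \<Rightarrow> 'c) \<Rightarrow> 'a \<times> 'b list \<times> 'c \<Rightarrow> 'a \<times> 'b list \<times> 'c" where
  "fold_step g = (\<lambda>z. case fst (snd z) of [] \<Rightarrow> z | y # ys \<Rightarrow> (fst z, ys, g (fst z) (snd (snd z)) y))"

lemma fold_step_pow: "(fold_step g ^^ i) (x, l, a) = (x, drop i l, foldl (g x) a (take i l))"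
proof (induction i arbitrary: l a)
  case (Suc i)
  have "fold_step g (x, l, a) = (x, drop 1 l, foldl (g x) a (take 1 l))"
    by (cases l) (auto simp: fold_step_def)
  then show ?case by (cases l) (auto simp: funpow_Suc_right Suc simp del: funpow.simps)
qed auto

lemma ptime_foldl:
  assumes g: "ptime (\<lambda>p. g (fst p) (fst (snd p)) (snd (snd p)))" and l: "ptime l" and a: "ptime a"
    and q: "\<And>x i. esz (foldl (g x) (a x) (take i (l x))) \<le> poly q (esz x)"
  shows "ptime (\<lambda>x. foldl (g x) (a x) (l x))"
proof -
  have g': "ptime (\<lambda>p. g (fst (fst p)) (snd (snd (fst p))) (fst (snd p)))"
    by (rule ptime_comp[OF g, of "\<lambda>p. (fst (fst p), snd (snd (fst p)), fst (snd p))", simplified]) (intro ptime_intros)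
  have s: "ptime (fold_step g)"
    unfolding fold_step_def by (intro ptime_intros g')
  have i: "ptime (\<lambda>x. (x, l x, a x))" by (intro ptime_intros l a)
  obtain ql where ql: "\<And>x. esz (l x) \<le> poly ql (esz x)" using ptime_size[OF l] by blast
  have b: "esz ((fold_step g ^^ i) (x, l x, a x)) \<le> poly ([:2, 1:] + ql + q) (esz x)" for x i
    using q[of x i] ql[of x] esz_list(3)[of i "l x"] unfolding fold_step_pow by simp
  have "ptime (\<lambda>x. (fold_step g ^^ esz (x, l x, a x)) (x, l x, a x))"
    by (rule ptime_iterate[OF s i b])
  then have "ptime (\<lambda>x. snd (snd ((fold_step g ^^ esz (x, l x, a x)) (x, l x, a x))))"
    by (intro ptime_fst ptime_snd)
  moreover have "snd (snd ((fold_step g ^^ esz (x, l x, a x)) (x, l x, a x))) = foldl (g x) (a x) (l x)" for x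
  proof -
    have "length (l x) \<le> esz (x, l x, a x)" using esz_list(1)[of "l x"] by simp
    then show ?thesis unfolding fold_step_pow by simp
  qed
  ultimately show ?thesis by simp
qed

text \<open>If each step enlarges the accumulator by at most an amount that is polynomial in the
  size of the whole input, not of the accumulator, then all intermediate values stay
  polynomial.\<close>

lemma ptime_foldl_add:
  assumes g: "ptime (\<lambda>p. g (fst p) (fst (snd p)) (snd (snd p)))" and l: "ptime l" and a: "ptime a"
    and r: "\<And>x c y. y \<in> set (l x) \<Longrightarrow> esz (g x c y) \<le> esz c + poly r (esz x)"
  shows "ptime (\<lambda>x. foldl (g x) (a x) (l x))"
proof -
  obtain ql where ql: "\<And>x. esz (l x) \<le> poly ql (esz x)" using ptime_size[OF l] by blast
  obtain qa where qa: "\<And>x. esz (a x) \<le> poly qa (esz x)" using ptime_size[OF a] by blast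
  have *: "esz (foldl (g x) c ys) \<le> esz c + length ys * poly r (esz x)" if "set ys \<subseteq> set (l x)" for x c ys
    using that
  proof (induction ys arbitrary: c)
    case (Cons y ys)
    from Cons.IH[of "g x c y"] r[of y x c] Cons.prems show ?case by simp
  qed simp
  have "esz (foldl (g x) (a x) (take i (l x))) \<le> poly (qa + ql * r) (esz x)" for x i
  proof -
    have "length (take i (l x)) * poly r (esz x) \<le> poly ql (esz x) * poly r (esz x)"
      using ql[of x] esz_list(1)[of "l x"] by (intro mult_right_mono) auto
    moreover have "esz (foldl (g x) (a x) (take i (l x))) \<le> esz (a x) + length (take i (l x)) * poly r (esz x)"
      by (rule *) (auto dest: in_set_takeD)
    ultimately show ?thesis using qa[of x] unfolding poly_add poly_mult by linarith
  qed
  then show ?thesis by (rule ptime_foldl[OF g l a])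
qed

lemma ptime_rev [ptime_intros]:
  assumes "ptime l" shows "ptime (\<lambda>x. rev (l x))"
proof -
  obtain q where q: "\<And>x. esz (l x) \<le> poly q (esz x)" using ptime_size[OF assms] by blast
  have "ptime (\<lambda>x. foldl (\<lambda>c y. y # c) [] (l x))"
  proof (rule ptime_foldl_add[where r = "[:1:] + q"])
    show "esz (y # c) \<le> esz c + poly ([:1:] + q) (esz x)" if "y \<in> set (l x)" for x c and y :: 'b
      using esz_list(2)[OF that] q[of x] by simp
  qed (intro ptime_intros assms)+
  moreover have "foldl (\<lambda>c y. y # c) zs ys = rev ys @ zs" for ys zs :: "'b list"
    by (induction ys arbitrary: zs) auto
  ultimately show ?thesis by simp
qed

lemma ptime_append [ptime_intros]:
  assumes l: "ptime l" and a: "ptime a" shows "ptime (\<lambda>x. l x @ a x)"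
proof -
  obtain q where q: "\<And>x. esz (l x) \<le> poly q (esz x)" using ptime_size[OF l] by blast
  have "ptime (\<lambda>x. foldl (\<lambda>c y. y # c) (a x) (rev (l x)))"
  proof (rule ptime_foldl_add[where r = "[:1:] + q"])
    show "esz (y # c) \<le> esz c + poly ([:1:] + q) (esz x)" if "y \<in> set (rev (l x))" for x c and y :: 'b
      using esz_list(2)[of y "l x"] that q[of x] by simp
  qed (intro ptime_intros assms)+
  moreover have "foldl (\<lambda>c y. y # c) zs ys = rev ys @ zs" for ys zs :: "'b list"
    by (induction ys arbitrary: zs) auto
  ultimately show ?thesis by simp
qed

lemma ptime_map [ptime_intros]:
  assumes f: "ptime (\<lambda>p. f (fst p) (snd p))" and l: "ptime l"
  shows "ptime (\<lambda>x. map (f x) (l x))"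
proof -
  obtain q where q: "\<And>x. esz (l x) \<le> poly q (esz x)" using ptime_size[OF l] by blast
  obtain r where r: "\<And>p. esz (f (fst p) (snd p)) \<le> poly r (esz p)" using ptime_size[OF f] by blast
  have f': "ptime (\<lambda>p. f (fst p) (snd (snd p)))"
    by (rule ptime_comp[OF f, of "\<lambda>p. (fst p, snd (snd p))", simplified]) (intro ptime_intros)
  have "ptime (\<lambda>x. rev (foldl (\<lambda>c y. f x y # c) [] (l x)))"
  proof (intro ptime_rev ptime_foldl_add[where r = "[:1:] + pcompose r ([:1, 1:] + q)"])
    show "esz (f x y # c) \<le> esz c + poly ([:1:] + pcompose r ([:1, 1:] + q)) (esz x)" if "y \<in> set (l x)" for x c y
    proof -
      have "esz (f x y) \<le> poly r (esz (x, y))" using r[of "(x, y)"] by simp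
      also have "\<dots> \<le> poly r (1 + esz x + poly q (esz x))"
        using esz_list(2)[OF that] q[of x] by (intro poly_nat_mono) simp
      finally show ?thesis by (simp add: poly_pcompose add.assoc)
    qed
  qed (intro ptime_intros l f')+
  moreover have "foldl (\<lambda>c y. f x y # c) zs ys = rev (map (f x) ys) @ zs" for x ys zs
    by (induction ys arbitrary: zs) auto
  ultimately show ?thesis by simp
qed

lemma ptime_concat [ptime_intros]:
  assumes l: "ptime l" shows "ptime (\<lambda>x. concat (l x))"
proof -
  obtain q where q: "\<And>x. esz (l x) \<le> poly q (esz x)" using ptime_size[OF l] by blast
  have "ptime (\<lambda>x. foldl (\<lambda>c y. c @ y) [] (l x))"
  proof (rule ptime_foldl_add[where r = q])
    show "esz (c @ y) \<le> esz c + poly q (esz x)" if "y \<in> set (l x)" for x c and y :: "'b list"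
      using esz_list(2)[OF that] q[of x] esz_append[of c y] by linarith
  qed (intro ptime_intros l)+
  moreover have "foldl (\<lambda>c y. c @ y) zs ys = zs @ concat ys" for ys and zs :: "'b list"
    by (induction ys arbitrary: zs) auto
  ultimately show ?thesis by simp
qed

lemma ptime_filter [ptime_intros]:
  assumes f: "ptime (\<lambda>p. f (fst p) (snd p))" and l: "ptime l"
  shows "ptime (\<lambda>x. filter (f x) (l x))"
proof -
  have "ptime (\<lambda>x. concat (map (\<lambda>y. if f x y then [y] else []) (l x)))"
    by (intro ptime_intros f l)
  moreover have "concat (map (\<lambda>y. if f x y then [y] else []) ys) = filter (f x) ys" for x ys
    by (induction ys) auto
  ultimately show ?thesis by simp
qed

lemma ptime_member [ptime_intros]:
  assumes f: "ptime f" and l: "ptime l" shows "ptime (\<lambda>x. f x \<in> set (l x))"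
proof -
  have "ptime (\<lambda>x. filter (\<lambda>y. y = f x) (l x) \<noteq> [])"
    by (intro ptime_intros l ptime_comp[OF f])
  moreover have "filter (\<lambda>y. y = f x) (l x) \<noteq> [] \<longleftrightarrow> f x \<in> set (l x)" for x
    by (auto simp: filter_empty_conv)
  ultimately show ?thesis by simp
qed

definition dedup :: "'a list \<Rightarrow> 'a list" where
  "dedup = foldl (\<lambda>c y. if y \<in> set c then c else y # c) []"

lemma dedup [simp]: "set (dedup xs) = set xs" "distinct (dedup xs)"
proof -
  have "set (foldl (\<lambda>c y. if y \<in> set c then c else y # c) c xs) = set c \<union> set xs \<and>
    (distinct c \<longrightarrow> distinct (foldl (\<lambda>c y. if y \<in> set c then c else y # c) c xs))" for c
    by (induction xs arbitrary: c) auto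
  from this[of "[]"] show "set (dedup xs) = set xs" "distinct (dedup xs)" by (auto simp: dedup_def)
qed

lemma ptime_dedup [ptime_intros]:
  assumes l: "ptime l" shows "ptime (\<lambda>x. dedup (l x))"
proof -
  obtain q where q: "\<And>x. esz (l x) \<le> poly q (esz x)" using ptime_size[OF l] by blast
  show ?thesis unfolding dedup_def
  proof (rule ptime_foldl_add[where r = "[:1:] + q"])
    show "esz (if y \<in> set c then c else y # c) \<le> esz c + poly ([:1:] + q) (esz x)"
      if "y \<in> set (l x)" for x c and y :: 'b
      using esz_list(2)[OF that] q[of x] by simp
  qed (intro ptime_intros l)+
qed

section \<open>Words on the input and output stack\<close>

text \<open>Loop-free programs can be run by simplification with \<open>effect\<close> and
  \<open>cost\<close>, which settles the decoding of a symbol by cases.\<close>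

primrec straight :: "com \<Rightarrow> bool" where
  "straight Skip = True" | "straight (Push i x) = True" | "straight (Pop i) = True"
| "straight (Seq c d) \<longleftrightarrow> straight c \<and> straight d"
| "straight (If_top i x c d) \<longleftrightarrow> straight c \<and> straight d"
| "straight (While_nonempty i c) = False"

primrec effect :: "com \<Rightarrow> stacks \<Rightarrow> stacks" where
  "effect Skip s = s" | "effect (Push i x) s = s(i := x # s i)" | "effect (Pop i) s = s(i := tl (s i))"
| "effect (Seq c d) s = effect d (effect c s)"
| "effect (If_top i x c d) s = (if s i \<noteq> [] \<and> hd (s i) = x then effect c s else effect d s)"
| "effect (While_nonempty i c) s = s"

primrec cost :: "com \<Rightarrow> nat" where
  "cost Skip = 1" | "cost (Push i x) = 1" | "cost (Pop i) = 1"
| "cost (Seq c d) = cost c + cost d"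
| "cost (If_top i x c d) = Suc (cost c + cost d)"
| "cost (While_nonempty i c) = 1"

lemma runs_straight: "straight c \<Longrightarrow> runs c s (cost c) (effect c s)"
proof (induction c arbitrary: s)
  case (Seq c d) then show ?case by (auto intro: runs_seq)
next
  case (If_top i x c d)
  then have "runs (if s i \<noteq> [] \<and> hd (s i) = x then c else d) s (cost c + cost d) (effect (If_top i x c d) s)"
    using runs_mono[of c s "cost c" _ "cost c + cost d"] runs_mono[of d s "cost d" _ "cost c + cost d"] by auto
  then show ?case by (auto intro: runs_if)
qed (use runs_skip runs_push runs_pop in auto)

text \<open>The word is reversed onto stack 1, because the code of a list is built from its last
  member on.\<close>

definition load :: com where
  "load = Seq (move 0 1) (Seq (Push 0 Zero)
     (While_nonempty 1 (case_symb 1 (\<lambda>x. Seq (Pop 1) (Seq (pushes 0 (ec x)) (Push 0 One))))))"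

lemma esz_symb: "esz x \<le> 7" for x :: symb
  by (cases x) auto

lemma runs_load: "runs load ((\<lambda>_. [])(0 := w)) (30 * length w + 3) ((\<lambda>_. [])(0 := ec w))"
proof -
  let ?b = "case_symb 1 (\<lambda>x. Seq (Pop 1) (Seq (pushes 0 (ec x)) (Push 0 One)))"
  have body: "runs ?b s 14 (s(1 := xs, 0 := One # ec x @ s 0))" if "s 1 = x # xs" for s and x :: symb and xs
  proof -
    have "runs (Seq (Pop 1) (Seq (pushes 0 (ec x)) (Push 0 One))) s 10 (s(1 := xs, 0 := One # ec x @ s 0))"
      by (rule runs_eqI[OF runs_seq[OF runs_pop runs_seq[OF runs_pushes runs_push]]])
        (use that esz_symb[of x] in \<open>auto simp: fun_eq_iff\<close>)
    from runs_case_symb[where s = s and i = 1 and g = "\<lambda>x. Seq (Pop 1) (Seq (pushes 0 (ec x)) (Push 0 One))", OF that this]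
    show ?thesis by simp
  qed
  have loop: "runs (While_nonempty 1 ?b) ((\<lambda>_. [])(1 := rev v, 0 := ec u)) (15 * length v + 1) ((\<lambda>_. [])(0 := ec (v @ u)))"
    for u v :: "symb list"
  proof (induction v arbitrary: u rule: rev_induct)
    case Nil
    then show ?case by (auto intro!: runs_eqI[OF runs_while_end] simp: fun_eq_iff)
  next
    case (snoc x v)
    have 1: "runs ?b ((\<lambda>_. [])(1 := rev (v @ [x]), 0 := ec u)) 14 ((\<lambda>_. [])(1 := rev v, 0 := ec (x # u)))"
      by (rule runs_eqI[OF body]) (auto simp: fun_eq_iff)
    show ?case
      by (rule runs_eqI[OF runs_while_loop[OF _ 1 snoc.IH]]) auto
  qed
  have 1: "runs (move 0 1) ((\<lambda>_. [])(0 := w)) (7 * length w + 1) ((\<lambda>_. [])(1 := rev w))"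
    by (rule runs_eqI[OF runs_move]) (auto simp: fun_eq_iff)
  have 2: "runs (Push 0 Zero) ((\<lambda>_. [])(1 := rev w)) 1 ((\<lambda>_. [])(1 := rev w, 0 := ec []))"
    by (rule runs_eqI[OF runs_push]) (auto simp: fun_eq_iff)
  show ?thesis unfolding load_def
    by (rule runs_eqI[OF runs_seq[OF 1 runs_seq[OF 2 loop]]]) auto
qed

primrec pops :: "nat \<Rightarrow> com" where
  "pops 0 = Skip"
| "pops (Suc n) = Seq (Pop 0) (pops n)"

text \<open>\<open>pops 3\<close> skips the code of \<open>Node Leaf Leaf\<close>, the only proper
  subtree other than \<open>Leaf\<close> that occurs in the codes of symbols.\<close>

definition decode_symb :: com where
  "decode_symb = If_top 0 Zero (Seq (Pop 0) (Push 2 Zero))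
     (Seq (Pop 0) (If_top 0 Zero
        (Seq (Pop 0) (If_top 0 Zero (Seq (Pop 0) (Push 2 One)) (Seq (pops 3) (Push 2 Elt))))
        (Seq (pops 3) (If_top 0 Zero (Seq (Pop 0) (Push 2 Tup)) (Seq (pops 3) (Push 2 Arg))))))"

definition store_body :: com where
  "store_body = If_top 0 One (Seq (Pop 0) decode_symb) (Seq (Pop 0) (Pop 1))"

text \<open>Stack 1 is the loop flag; it is emptied when the code of the empty list is reached. The
  symbols arrive on stack 2 in reverse order and are moved back.\<close>

definition store :: com where
  "store = Seq (Push 1 One) (Seq (While_nonempty 1 store_body) (move 2 0))"

lemma runs_store_body:
  "runs store_body ((\<lambda>_. [])(0 := ec (x # w), 1 := [One], 2 := v)) 40 ((\<lambda>_. [])(0 := ec w, 1 := [One], 2 := x # v))"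
  "runs store_body ((\<lambda>_. [])(0 := ec ([] :: symb list), 1 := [One], 2 := v)) 40 ((\<lambda>_. [])(2 := v))"
proof -
  have s: "straight store_body" "cost store_body \<le> 40"
    by (simp_all add: store_body_def decode_symb_def numeral_eq_Suc)
  show "runs store_body ((\<lambda>_. [])(0 := ec (x # w), 1 := [One], 2 := v)) 40 ((\<lambda>_. [])(0 := ec w, 1 := [One], 2 := x # v))"
    by (rule runs_eqI[OF runs_straight[OF s(1)] s(2)])
      (cases x; simp add: store_body_def decode_symb_def numeral_eq_Suc fun_eq_iff)
  show "runs store_body ((\<lambda>_. [])(0 := ec ([] :: symb list), 1 := [One], 2 := v)) 40 ((\<lambda>_. [])(2 := v))"
    by (rule runs_eqI[OF runs_straight[OF s(1)] s(2)])
      (simp add: store_body_def decode_symb_def numeral_eq_Suc fun_eq_iff)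
qed

lemma runs_store: "runs store ((\<lambda>_. [])(0 := ec w)) (48 * length w + 45) ((\<lambda>_. [])(0 := w))"
proof -
  have loop: "runs (While_nonempty 1 store_body) ((\<lambda>_. [])(0 := ec w, 1 := [One], 2 := v)) (41 * length w + 42)
    ((\<lambda>_. [])(2 := rev w @ v))" for v
  proof (induction w arbitrary: v)
    case Nil
    show ?case
      by (rule runs_eqI[OF runs_while_loop[OF _ runs_store_body(2) runs_while_end]]) auto
  next
    case (Cons x w)
    show ?case
      by (rule runs_eqI[OF runs_while_loop[OF _ runs_store_body(1) Cons.IH]]) auto
  qed
  have 1: "runs (Push 1 One) ((\<lambda>_. [])(0 := ec w)) 1 ((\<lambda>_. [])(0 := ec w, 1 := [One], 2 := []))"
    by (rule runs_eqI[OF runs_push]) (auto simp: fun_eq_iff)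
  show ?thesis unfolding store_def
    by (rule runs_eqI[OF runs_seq[OF 1 runs_seq[OF loop runs_move]]]) (auto simp: fun_eq_iff)
qed

lemma ptime_program:
  fixes g :: "symb list \<Rightarrow> symb list"
  assumes "ptime g"
  obtains c and p :: "nat poly"
  where "\<And>w. \<exists>n s. exec c ((\<lambda>_. [])(0 := w)) n s \<and> n \<le> poly p (length w) \<and> s 0 = g w"
proof -
  obtain c p where c: "computes 1 c p g" using assms unfolding ptime_def by blast
  obtain q where q: "\<And>w. esz (g w) \<le> poly q (esz w)" using ptime_size[OF assms] by blast
  have ew: "esz w \<le> 8 * length w + 1" for w :: "symb list"
  proof (induction w)
    case (Cons x w) then show ?case using esz_symb[of x] by simp
  qed simp
  let ?p = "[:3, 30:] + pcompose p [:1, 8:] + smult 48 (pcompose q [:1, 8:]) + [:45:]"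
  have "\<exists>n s. exec (Seq load (Seq c store)) ((\<lambda>_. [])(0 := w)) n s \<and> n \<le> poly ?p (length w) \<and> s 0 = g w" for w
  proof -
    have 1: "runs c ((\<lambda>_. [])(0 := ec w)) (poly p (esz w)) ((\<lambda>_. [])(0 := ec (g w)))"
      by (rule runs_eqI[OF computesD[OF c, where x = w and r = "[]"]]) auto
    have "poly p (esz w) \<le> poly p (8 * length w + 1)" "poly q (esz w) \<le> poly q (8 * length w + 1)"
      by (intro poly_nat_mono ew)+
    moreover have "length (g w) \<le> poly q (esz w)" using q[of w] esz_list(1)[of "g w"] by linarith
    ultimately have "runs (Seq load (Seq c store)) ((\<lambda>_. [])(0 := w)) (poly ?p (length w)) ((\<lambda>_. [])(0 := g w))"
      by (intro runs_eqI[OF runs_seq[OF runs_load runs_seq[OF 1 runs_store]]])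
        (auto simp: poly_pcompose algebra_simps)
    then show ?thesis unfolding runs_def by force
  qed
  then show ?thesis using that by blast
qed

section \<open>Reductions\<close>

text \<open>A form of \<open>poly_time_map\<close> that composes: it refers to a function of words
  rather than to a program and its final stacks.\<close>

definition pt_map :: "vocabulary \<Rightarrow> vocabulary \<Rightarrow> (nat struct \<Rightarrow> nat struct) \<Rightarrow> bool" where
  "pt_map L L' F \<longleftrightarrow> (\<exists>g. ptime g \<and> (\<forall>A w. fin_struct L A \<and> encodes L A w \<longrightarrow> encodes L' (F A) (g w)))"

lemma pt_map_poly_time: "pt_map L L' F \<Longrightarrow> poly_time_map L L' F"
proof -
  assume "pt_map L L' F"
  then obtain g where g: "ptime g" "\<And>A w. fin_struct L A \<and> encodes L A w \<Longrightarrow> encodes L' (F A) (g w)"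
    unfolding pt_map_def by blast
  obtain c p where "\<And>w. \<exists>n s. exec c ((\<lambda>_. [])(0 := w)) n s \<and> n \<le> poly p (length w) \<and> s 0 = g w"
    using ptime_program[OF g(1)] by blast
  with g(2) show ?thesis unfolding poly_time_map_def by (intro exI[of _ c] exI[of _ p]) metis
qed

definition refutation_transfer ::
    "vocabulary \<Rightarrow> ('a struct \<Rightarrow> ('a \<times> 'b) clause set) \<Rightarrow> ('c struct \<Rightarrow> ('c \<times> 'd) clause set) \<Rightarrow> ('c struct \<Rightarrow> 'a struct) \<Rightarrow> bool" where
  "refutation_transfer L' E E' F \<longleftrightarrow> (\<exists>c\<ge>1. \<exists>b. \<forall>A t k s \<pi>. fin_struct L' A \<and> 1 \<le> t \<and> 1 \<le> k \<and> bounded_refutation (E (F A)) t k s \<pi> \<longrightarrow>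
     (\<exists>\<pi>' s'. bounded_refutation (E' A) t (c * k) s' \<pi>' \<and> s' \<le> size_bound b k s (struct_size L' A)))"

text \<open>Instances go from the first problem to the second, refutations from the second back to
  the first. As the transfer is demanded for all local encodings, any of them can be chosen for an
  intermediate problem.\<close>

definition reduces :: "vocabulary \<times> nat struct \<Rightarrow> vocabulary \<times> nat struct \<Rightarrow> bool" where
  "reduces = (\<lambda>(L', B') (L, B). \<exists>F. pt_map L' L F \<and>
     (\<forall>A. fin_struct L' A \<longrightarrow> fin_struct L (F A)) \<and>
     (\<exists>c d. \<forall>A. fin_struct L' A \<longrightarrow> struct_size L (F A) \<le> c * struct_size L' A + d) \<and>
     (\<forall>A. fin_struct L' A \<longrightarrow> (maps_to (F A) B \<longleftrightarrow> maps_to A B')) \<and>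
     (\<forall>E E'. encoding_scheme L B E \<and> local_scheme L E \<and> encoding_scheme L' B' E' \<and> local_scheme L' E' \<longrightarrow>
        refutation_transfer L' E E' F))"

subsection \<open>The direct encoding\<close>

text \<open>\<open>Abs_fset\<close> yields the intended clause if the domain of \<open>B\<close> is
  finite, which the facts below on encoding and locality assume.\<close>

definition direct :: "'b struct \<Rightarrow> 'a struct \<Rightarrow> ('a \<times> 'b) clause set" where
  "direct B A =
     {Abs_fset {Pos (a, b) |b. b \<in> univ B} |a. a \<in> univ A} \<union>
     {{|Neg (a, b), Neg (a, b')|} |a b b'. a \<in> univ A \<and> b \<in> univ B \<and> b' \<in> univ B \<and> b \<noteq> b'} \<union>
     {fset_of_list (map Neg (zip t u)) |R t u. t \<in> rel A R \<and> length u = length t \<and> set u \<subseteq> univ B \<and> u \<notin> rel B R}"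

lemma direct_cases:
  assumes "C \<in> direct B A"
  obtains a where "a \<in> univ A" "C = Abs_fset {Pos (a, b) |b. b \<in> univ B}"
  | a b b' where "a \<in> univ A" "b \<in> univ B" "b' \<in> univ B" "b \<noteq> b'" "C = {|Neg (a, b), Neg (a, b')|}"
  | R t u where "t \<in> rel A R" "length u = length t" "set u \<subseteq> univ B" "u \<notin> rel B R" "C = fset_of_list (map Neg (zip t u))"
  using assms unfolding direct_def
  by (elim UnE CollectE exE conjE)
    (rule that(1), assumption+ | rule that(2), assumption+ | rule that(3), assumption+)+

lemma directI:
  "a \<in> univ A \<Longrightarrow> Abs_fset {Pos (a, b) |b. b \<in> univ B} \<in> direct B A"
  "a \<in> univ A \<Longrightarrow> b \<in> univ B \<Longrightarrow> b' \<in> univ B \<Longrightarrow> b \<noteq> b' \<Longrightarrow> {|Neg (a, b), Neg (a, b')|} \<in> direct B A"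
  "t \<in> rel A R \<Longrightarrow> length u = length t \<Longrightarrow> set u \<subseteq> univ B \<Longrightarrow> u \<notin> rel B R \<Longrightarrow> fset_of_list (map Neg (zip t u)) \<in> direct B A"
  unfolding direct_def by blast+

lemma direct_encoding:
  fixes B :: "'b struct"
  assumes B: "finite (univ B)" shows "encoding_scheme L B (direct B :: 'a struct \<Rightarrow> ('a \<times> 'b) clause set)"
proof -
  define P where "P a = Abs_fset {Pos (a, b) |b. b \<in> univ B}" for a :: 'a
  have P: "fset (P a) = {Pos (a, b) |b. b \<in> univ B}" for a
    unfolding P_def using B by (intro Abs_fset_inverse) simp
  have 1: "lit_var l \<in> univ A \<times> univ B" if A: "fin_struct L A" and "C \<in> direct B A" "l |\<in>| C" for A :: "'a struct" and C l
  proof -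
    from \<open>C \<in> direct B A\<close> show ?thesis
    proof (cases rule: direct_cases)
      case (3 R t u)
      then obtain a b where "(a, b) \<in> set (zip t u)" "l = Neg (a, b)"
        using \<open>l |\<in>| C\<close> by (auto simp: fset_of_list.rep_eq)
      moreover have "set t \<subseteq> univ A" using fin_struct_rel[OF A 3(1)] by blast
      ultimately show ?thesis using 3 set_zip_leftD[of a b t u] set_zip_rightD[of a b t u] by auto
    next
      case (1 a)
      then show ?thesis using that P[of a] by (auto simp: P_def)
    qed (use that in auto)
  qed
  have 2: "clauses_sat H (direct B A) \<longleftrightarrow> (\<exists>h. is_hom h A B \<and> H = {(a, h a) |a. a \<in> univ A})"
    if A: "fin_struct L A" and H: "H \<subseteq> univ A \<times> univ B" for A :: "'a struct" and H
  proof
    assume sat: "clauses_sat H (direct B A)"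
    have "\<exists>b. b \<in> univ B \<and> (a, b) \<in> H" if "a \<in> univ A" for a
    proof -
      have "\<exists>l. l |\<in>| P a \<and> lit_sat H l" using sat directI(1)[OF that] unfolding clauses_sat_def P_def by blast
      then show ?thesis by (auto simp: P)
    qed
    then obtain h where h: "\<And>a. a \<in> univ A \<Longrightarrow> h a \<in> univ B \<and> (a, h a) \<in> H" by metis
    have un: "b = h a" if "(a, b) \<in> H" for a b
    proof (rule ccontr)
      assume "b \<noteq> h a"
      moreover have "a \<in> univ A" "b \<in> univ B" using that H by auto
      ultimately have "{|Neg (a, b), Neg (a, h a)|} \<in> direct B A" using h by (intro directI) auto
      then have "\<exists>l. l |\<in>| {|Neg (a, b), Neg (a, h a)|} \<and> lit_sat H l" using sat unfolding clauses_sat_def by blast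
      then show False using that h[OF \<open>a \<in> univ A\<close>] by auto
    qed
    have "map h t \<in> rel B R" if t: "t \<in> rel A R" for R t
    proof (rule ccontr)
      assume n: "map h t \<notin> rel B R"
      have tA: "set t \<subseteq> univ A" using fin_struct_rel[OF A t] by blast
      then have "set (map h t) \<subseteq> univ B" using h by auto
      then have "fset_of_list (map Neg (zip t (map h t))) \<in> direct B A" using t n by (intro directI) auto
      then obtain l where l: "l |\<in>| fset_of_list (map Neg (zip t (map h t)))" "lit_sat H l"
        using sat unfolding clauses_sat_def by blast
      then obtain a where "a \<in> set t" "l = Neg (a, h a)"
        by (auto simp: fset_of_list.rep_eq zip_map2 zip_same_conv_map)
      then show False using l(2) h tA by auto
    qed
    then have "is_hom h A B" using h by (auto simp: is_hom_def)
    moreover have "H = {(a, h a) |a. a \<in> univ A}" using h un H by auto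
    ultimately show "\<exists>h. is_hom h A B \<and> H = {(a, h a) |a. a \<in> univ A}" by blast
  next
    assume "\<exists>h. is_hom h A B \<and> H = {(a, h a) |a. a \<in> univ A}"
    then obtain h where h: "is_hom h A B" "H = {(a, h a) |a. a \<in> univ A}" by blast
    show "clauses_sat H (direct B A)" unfolding clauses_sat_def
    proof
      fix C assume "C \<in> direct B A"
      then show "\<exists>l. l |\<in>| C \<and> lit_sat H l"
      proof (cases rule: direct_cases)
        case (1 a)
        then have "C = P a" by (simp add: P_def)
        then show ?thesis using 1(1) h by (intro exI[of _ "Pos (a, h a)"]) (auto simp: P is_hom_def)
      next
        case (2 a b b')
        then show ?thesis using h(2) by (cases "b = h a") auto
      next
        case (3 R t u)
        have "map h t \<in> rel B R" using h 3 by (auto simp: is_hom_def)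
        then have "map h t \<noteq> u" using 3 by blast
        then obtain i where i: "i < length t" "h (t ! i) \<noteq> u ! i"
          using 3(2) by (metis length_map nth_equalityI nth_map)
        then have "(t ! i, u ! i) \<in> set (zip t u)" using 3(2) by (auto simp: set_zip)
        then show ?thesis using 3(5) h(2) i
          by (intro exI[of _ "Neg (t ! i, u ! i)"]) (auto simp: fset_of_list.rep_eq)
      qed
    qed
  qed
  show ?thesis unfolding encoding_scheme_def
    by (intro allI impI conjI ballI) ((rule 1; assumption) | (rule 2; assumption))+
qed

lemma direct_local:
  fixes B :: "'b struct"
  assumes B: "finite (univ B)" shows "local_scheme L (direct B :: 'a struct \<Rightarrow> ('a \<times> 'b) clause set)"
  unfolding local_scheme_def
proof (intro conjI allI impI)
  fix A A' :: "'a struct" and f :: "'a \<Rightarrow> 'a"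
  assume "fin_struct L A \<and> fin_struct L A' \<and> is_iso f A A'"
  then have A: "univ A' = f ` univ A" "\<And>R. rel A' R = map f ` rel A R"
    by (auto simp: is_iso_def bij_betw_def)
  let ?m = "map_lit (\<lambda>(a, b :: 'b). (f a, b))"
  define P where "P a = Abs_fset {Pos (a, b) |b. b \<in> univ B}" for a :: 'a
  have P: "fset (P a) = {Pos (a, b) |b. b \<in> univ B}" for a
    unfolding P_def using B by (intro Abs_fset_inverse) simp
  have e1: "P (f a) = ?m |`| P a" for a
    by (rule fset_eqI) (auto simp: P image_iff)
  have e2: "{|Neg (f a, b), Neg (f a, b')|} = ?m |`| {|Neg (a, b), Neg (a, b')|}" for a b b' by auto
  have e3: "fset_of_list (map Neg (zip (map f t) u)) = ?m |`| fset_of_list (map Neg (zip t u))" for t u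
    by (rule fset_eqI) (auto simp: fset_of_list.rep_eq zip_map1 image_iff)
  have "{P a |a. a \<in> univ A'} = fimage ?m ` {P a |a. a \<in> univ A}"
    unfolding A Setcompr_eq_image image_image e1 ..
  moreover have "{{|Neg (a, b), Neg (a, b')|} |a b b'. a \<in> univ A' \<and> b \<in> univ B \<and> b' \<in> univ B \<and> b \<noteq> b'} =
    fimage ?m ` {{|Neg (a, b), Neg (a, b')|} |a b b'. a \<in> univ A \<and> b \<in> univ B \<and> b' \<in> univ B \<and> b \<noteq> b'}"
    (is "?L = fimage ?m ` ?R")
  proof (intro equalityI subsetI)
    fix C assume "C \<in> ?L"
    then obtain a b b' where C: "C = {|Neg (f a, b), Neg (f a, b')|}" "a \<in> univ A" "b \<in> univ B" "b' \<in> univ B" "b \<noteq> b'"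
      unfolding A by blast
    then have "{|Neg (a, b), Neg (a, b')|} \<in> ?R" by blast
    then show "C \<in> fimage ?m ` ?R" unfolding C(1) e2 by (rule imageI)
  next
    fix C assume "C \<in> fimage ?m ` ?R"
    then obtain a b b' where C: "C = ?m |`| {|Neg (a, b), Neg (a, b')|}" "a \<in> univ A" "b \<in> univ B" "b' \<in> univ B" "b \<noteq> b'"
      by blast
    then show "C \<in> ?L" unfolding C(1) e2[symmetric] A by blast
  qed
  moreover have "{fset_of_list (map Neg (zip t u)) |R t u. t \<in> rel A' R \<and> length u = length t \<and> set u \<subseteq> univ B \<and> u \<notin> rel B R} =
    fimage ?m ` {fset_of_list (map Neg (zip t u)) |R t u. t \<in> rel A R \<and> length u = length t \<and> set u \<subseteq> univ B \<and> u \<notin> rel B R}"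
    (is "?L = fimage ?m ` ?R")
  proof (intro equalityI subsetI)
    fix C assume "C \<in> ?L"
    then obtain R t u where C: "C = fset_of_list (map Neg (zip (map f t) u))" "t \<in> rel A R" "length u = length t"
      "set u \<subseteq> univ B" "u \<notin> rel B R"
      unfolding A by auto
    then have "fset_of_list (map Neg (zip t u)) \<in> ?R" by blast
    then show "C \<in> fimage ?m ` ?R" unfolding C(1) e3 by (rule imageI)
  next
    fix C assume "C \<in> fimage ?m ` ?R"
    then obtain R t u where C: "C = ?m |`| fset_of_list (map Neg (zip t u))" "t \<in> rel A R" "length u = length t"
      "set u \<subseteq> univ B" "u \<notin> rel B R"
      by blast
    then have "map f t \<in> rel A' R" "length u = length (map f t)" unfolding A by auto
    then show "C \<in> ?L" unfolding C(1) e3[symmetric] using C(4,5) by blast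
  qed
  ultimately show "direct B A' = fimage ?m ` direct B A"
    unfolding direct_def P_def[symmetric] image_Un by simp
next
  fix A :: "'a struct"
  assume A: "fin_struct L A"
  have r: "rel A R \<noteq> {} \<Longrightarrow> R \<in> dom L" "t \<in> rel A R \<Longrightarrow> set t \<subseteq> univ A" for R t
    using fin_struct_rel[OF A] by blast+
  show "direct B A = (\<Union>a\<in>univ A. direct B (point_struct a)) \<union> (\<Union>R\<in>dom L. \<Union>t\<in>rel A R. direct B (tuple_struct R t))"
  proof (intro equalityI subsetI)
    fix C assume "C \<in> direct B A"
    then consider a where "a \<in> univ A" "C \<in> direct B (point_struct a)" | R t where "t \<in> rel A R" "C \<in> direct B (tuple_struct R t)"
    proof (cases rule: direct_cases)
      case (1 a)
      have "C \<in> direct B (point_struct a)" unfolding 1(2) by (rule directI(1)) (simp add: point_struct_def)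
      with 1(1) show ?thesis by (rule that(1))
    next
      case (2 a b b')
      have "C \<in> direct B (point_struct a)" unfolding 2(5) by (rule directI(2)) (use 2 in \<open>auto simp: point_struct_def\<close>)
      with 2(1) show ?thesis by (rule that(1))
    next
      case (3 R t u)
      have "C \<in> direct B (tuple_struct R t)"
        unfolding 3(5) by (rule directI(3)[where R = R]) (use 3 in \<open>auto simp: tuple_struct_def\<close>)
      with 3(1) show ?thesis by (rule that(2))
    qed
    then show "C \<in> (\<Union>a\<in>univ A. direct B (point_struct a)) \<union> (\<Union>R\<in>dom L. \<Union>t\<in>rel A R. direct B (tuple_struct R t))"
    proof cases
      case 1
      then show ?thesis by blast
    next
      case (2 R t)
      then have "R \<in> dom L" using r(1)[of R] by blast
      with 2 show ?thesis by blast
    qed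
  next
    fix C assume "C \<in> (\<Union>a\<in>univ A. direct B (point_struct a)) \<union> (\<Union>R\<in>dom L. \<Union>t\<in>rel A R. direct B (tuple_struct R t))"
    then consider a where "a \<in> univ A" "C \<in> direct B (point_struct a)" | R t where "t \<in> rel A R" "C \<in> direct B (tuple_struct R t)"
      by (elim UnE UN_E)
    then show "C \<in> direct B A"
    proof cases
      case 1
      from 1(2) show ?thesis
        by (cases rule: direct_cases) (use 1(1) in \<open>auto simp: point_struct_def intro!: directI\<close>)
    next
      case (2 R t)
      from 2(2) show ?thesis
      proof (cases rule: direct_cases)
        case (3 R' t' u)
        then have Rt: "R' = R" "t' = t" by (auto simp: tuple_struct_def split: if_splits)
        show ?thesis unfolding 3(5) by (rule directI(3)[where R = R]) (use 2(1) 3 Rt in auto)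
      qed (use r(2)[OF 2(1)] in \<open>auto simp: tuple_struct_def intro!: directI\<close>)
    qed
  qed
qed

subsection \<open>Composition\<close>

text \<open>Passing from \<open>k\<close> to \<open>c * k\<close> raises \<open>2 ^ k\<close> to the
  power \<open>c\<close>, a linear change of \<open>n\<close> is absorbed by a coefficient, and
  \<open>s'\<close> is itself bounded by a power. Exponents are multiplied and added, but remain
  constants.\<close>

lemma size_bound_trans:
  "\<exists>b. \<forall>k s n n' s'. 1 \<le> s \<and> s' \<le> size_bound b1 k s n' \<and> n' \<le> e * n + f \<longrightarrow> size_bound b2 (c * k) s' n \<le> size_bound b k s n"
proof -
  define g where "g = b1 * (e + f + 1)"
  \<comment> \<open>With \<open>u\<close> as defined below, the composed bound is the coefficient
    \<open>(b2 * g ^ b1) ^ b2\<close> times \<open>u\<close> to the power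
    \<open>(c + b1 + 1) * b2\<close>; \<open>b\<close> dominates both.\<close>
  define b where "b = (b2 * g ^ b1) ^ b2 + (c + b1 + 1) * b2 + 1"
  have "size_bound b2 (c * k) s' n \<le> size_bound b k s n"
    if s: "1 \<le> s" and s': "s' \<le> size_bound b1 k s n'" and n': "n' \<le> e * n + f" for k s n n' s'
  proof -
    define x :: nat where "x = 2 ^ k"
    define u where "u = x * s * (n + 1)"
    have x: "1 \<le> x" by (simp add: x_def)
    have "x * 1 * 1 \<le> u" "1 * 1 * (n + 1) \<le> u"
      unfolding u_def using x s by (intro mult_le_mono; simp)+
    then have u: "x \<le> u" "n + 1 \<le> u" "1 \<le> u" by simp_all
    have "n' + 1 \<le> (e + f + 1) * (n + 1)" using n' by (simp add: algebra_simps)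
    then have "b1 * x * s * (n' + 1) \<le> b1 * x * s * ((e + f + 1) * (n + 1))" by (rule mult_left_mono) simp
    also have "\<dots> = g * u" by (simp add: g_def u_def algebra_simps)
    finally have "(b1 * x * s * (n' + 1)) ^ b1 \<le> (g * u) ^ b1" by (rule power_mono) simp
    with s' have s1: "s' \<le> (g * u) ^ b1" unfolding size_bound_def x_def by (rule order.trans)
    have "size_bound b2 (c * k) s' n = (b2 * x ^ c * s' * (n + 1)) ^ b2"
      by (simp add: size_bound_def x_def power_mult[symmetric] mult.commute)
    also have "\<dots> \<le> (b2 * u ^ c * (g * u) ^ b1 * u) ^ b2"
      using s1 u by (intro power_mono mult_mono) auto
    also have "b2 * u ^ c * (g * u) ^ b1 * u = (b2 * g ^ b1) * u ^ (c + b1 + 1)"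
      by (simp add: power_mult_distrib power_add)
    also have "((b2 * g ^ b1) * u ^ (c + b1 + 1)) ^ b2 = (b2 * g ^ b1) ^ b2 * u ^ ((c + b1 + 1) * b2)"
      unfolding power_mult power_mult_distrib ..
    also have "\<dots> \<le> b * u ^ b"
      using u(3) by (intro mult_mono power_increasing) (auto simp: b_def)
    also have "\<dots> \<le> b ^ b * u ^ b" using self_le_power[of b b] by (intro mult_right_mono) (auto simp: b_def)
    also have "\<dots> = size_bound b k s n" unfolding size_bound_def u_def x_def by (simp only: power_mult_distrib mult.assoc)
    finally show ?thesis .
  qed
  then show ?thesis by blast
qed

lemma bounded_refutation_pos: "bounded_refutation F t k s \<pi> \<Longrightarrow> 1 \<le> s"
  using fm_size_pos[of "hd \<pi>"] by (cases \<pi>) (auto simp: proof_size_def bounded_refutation_def frege_refutation_def)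

lemma refutation_transfer_trans:
  assumes 1: "refutation_transfer M E D F" and 2: "refutation_transfer L' D E' G"
    and G: "\<And>A. fin_struct L' A \<Longrightarrow> fin_struct M (G A)" "\<And>A. fin_struct L' A \<Longrightarrow> struct_size M (G A) \<le> e * struct_size L' A + f"
  shows "refutation_transfer L' E E' (\<lambda>A. F (G A))"
proof -
  obtain c1 b1 where c1: "1 \<le> c1" and 1: "\<And>A t k s \<pi>. fin_struct M A \<and> 1 \<le> t \<and> 1 \<le> k \<and> bounded_refutation (E (F A)) t k s \<pi> \<Longrightarrow>
     \<exists>\<pi>' s'. bounded_refutation (D A) t (c1 * k) s' \<pi>' \<and> s' \<le> size_bound b1 k s (struct_size M A)"
    using 1 unfolding refutation_transfer_def by blast
  obtain c2 b2 where c2: "1 \<le> c2" and 2: "\<And>A t k s \<pi>. fin_struct L' A \<and> 1 \<le> t \<and> 1 \<le> k \<and> bounded_refutation (D (G A)) t k s \<pi> \<Longrightarrow>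
     \<exists>\<pi>' s'. bounded_refutation (E' A) t (c2 * k) s' \<pi>' \<and> s' \<le> size_bound b2 k s (struct_size L' A)"
    using 2 unfolding refutation_transfer_def by blast
  obtain b where b: "\<And>k s n n' s'. 1 \<le> s \<Longrightarrow> s' \<le> size_bound b1 k s n' \<Longrightarrow> n' \<le> e * n + f \<Longrightarrow>
      size_bound b2 (c1 * k) s' n \<le> size_bound b k s n"
    using size_bound_trans[of b1 e f b2 c1] by blast
  have "\<exists>\<pi>' s'. bounded_refutation (E' A) t (c2 * c1 * k) s' \<pi>' \<and> s' \<le> size_bound b k s (struct_size L' A)"
    if A: "fin_struct L' A" and t: "1 \<le> t" and k: "1 \<le> k" and \<pi>: "bounded_refutation (E (F (G A))) t k s \<pi>" for A t k s \<pi>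
  proof -
    obtain \<pi>1 s1 where p1: "bounded_refutation (D (G A)) t (c1 * k) s1 \<pi>1" "s1 \<le> size_bound b1 k s (struct_size M (G A))"
      using 1[of "G A" t k s \<pi>] G(1)[OF A] t k \<pi> by blast
    have "1 \<le> c1 * k" using c1 k by (simp add: Suc_le_eq)
    then obtain \<pi>2 s2 where p2: "bounded_refutation (E' A) t (c2 * (c1 * k)) s2 \<pi>2" "s2 \<le> size_bound b2 (c1 * k) s1 (struct_size L' A)"
      using 2[of A t "c1 * k" s1 \<pi>1] A t p1 by blast
    have "s2 \<le> size_bound b k s (struct_size L' A)"
      using p2(2) b[OF bounded_refutation_pos[OF \<pi>] p1(2) G(2)[OF A]] by simp
    with p2(1) show ?thesis by (auto simp: mult.assoc)
  qed
  moreover have "1 \<le> c2 * c1" using c1 c2 by (simp add: Suc_le_eq)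
  ultimately show ?thesis unfolding refutation_transfer_def by (intro exI[of _ "c2 * c1"] conjI exI[of _ b]) blast+
qed

lemma pt_map_comp:
  assumes "pt_map L M G" "pt_map M N F" "\<And>A. fin_struct L A \<Longrightarrow> fin_struct M (G A)" shows "pt_map L N (\<lambda>A. F (G A))"
proof -
  obtain g where g: "ptime g" "\<And>A w. fin_struct L A \<and> encodes L A w \<Longrightarrow> encodes M (G A) (g w)"
    using assms(1) unfolding pt_map_def by blast
  obtain f where f: "ptime f" "\<And>A w. fin_struct M A \<and> encodes M A w \<Longrightarrow> encodes N (F A) (f w)"
    using assms(2) unfolding pt_map_def by blast
  have "ptime (\<lambda>w. f (g w))" by (rule ptime_comp[OF f(1) g(1)])
  then show ?thesis unfolding pt_map_def using f(2) g(2) assms(3) by (intro exI[of _ "\<lambda>w. f (g w)"]) blast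
qed

lemma reduces_trans:
  assumes "reduces (L', B') (M, D)" "reduces (M, D) (L, B)" "finite (univ D)"
  shows "reduces (L', B') (L, B)"
proof -
  obtain G e1 f1 where G: "pt_map L' M G" "\<And>A. fin_struct L' A \<Longrightarrow> fin_struct M (G A)"
    "\<And>A. fin_struct L' A \<Longrightarrow> struct_size M (G A) \<le> e1 * struct_size L' A + f1"
    "\<And>A. fin_struct L' A \<Longrightarrow> maps_to (G A) D \<longleftrightarrow> maps_to A B'"
    "\<And>E E'. encoding_scheme M D E \<and> local_scheme M E \<and> encoding_scheme L' B' E' \<and> local_scheme L' E' \<Longrightarrow> refutation_transfer L' E E' G"
    using assms(1) unfolding reduces_def prod.case by blast
  obtain F e2 f2 where F: "pt_map M L F" "\<And>A. fin_struct M A \<Longrightarrow> fin_struct L (F A)"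
    "\<And>A. fin_struct M A \<Longrightarrow> struct_size L (F A) \<le> e2 * struct_size M A + f2"
    "\<And>A. fin_struct M A \<Longrightarrow> maps_to (F A) B \<longleftrightarrow> maps_to A D"
    "\<And>E E'. encoding_scheme L B E \<and> local_scheme L E \<and> encoding_scheme M D E' \<and> local_scheme M E' \<Longrightarrow> refutation_transfer M E E' F"
    using assms(2) unfolding reduces_def prod.case by blast
  show ?thesis unfolding reduces_def prod.case
  proof (intro exI[of _ "\<lambda>A. F (G A)"] conjI allI impI)
    show "pt_map L' L (\<lambda>A. F (G A))" by (rule pt_map_comp[OF G(1) F(1) G(2)])
    show "\<exists>c d. \<forall>A. fin_struct L' A \<longrightarrow> struct_size L (F (G A)) \<le> c * struct_size L' A + d"
    proof (intro exI allI impI)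
      fix A :: "nat struct" assume A: "fin_struct L' A"
      have "struct_size L (F (G A)) \<le> e2 * struct_size M (G A) + f2" using F(3) G(2) A by blast
      also have "\<dots> \<le> e2 * (e1 * struct_size L' A + f1) + f2" using G(3)[OF A] by simp
      finally show "struct_size L (F (G A)) \<le> (e2 * e1) * struct_size L' A + (e2 * f1 + f2)" by (simp add: algebra_simps)
    qed
    show "refutation_transfer L' E E' (\<lambda>A. F (G A))"
      if "encoding_scheme L B E \<and> local_scheme L E \<and> encoding_scheme L' B' E' \<and> local_scheme L' E'" for E E'
    proof (rule refutation_transfer_trans[OF _ _ G(2,3)])
      show "refutation_transfer M E (direct D) F"
        using F(5) that direct_encoding[OF assms(3)] direct_local[OF assms(3)] by blast
      show "refutation_transfer L' (direct D) E' G"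
        using G(5) that direct_encoding[OF assms(3)] direct_local[OF assms(3)] by blast
    qed
  qed (use F G in auto)
qed

lemma fin_struct_finite:
  assumes "fin_struct L A" shows "finite (dom L)" "finite (univ A)"
  using assms unfolding fin_struct_def by blast+

lemma fin_structI:
  assumes "finite (dom L)" "finite (univ A)" "\<And>R t. t \<in> rel A R \<Longrightarrow> L R = Some (length t) \<and> set t \<subseteq> univ A"
  shows "fin_struct L A"
proof -
  have "case L R of None \<Rightarrow> rel A R = {} | Some r \<Rightarrow> rel A R \<subseteq> tuples r (univ A)" for R
  proof (cases "L R")
    case None
    with assms(3) have "rel A R = {}" by force
    with None show ?thesis by simp
  next
    case (Some r)
    have "rel A R \<subseteq> tuples r (univ A)"
    proof
      fix t assume "t \<in> rel A R"
      from assms(3)[OF this] Some show "t \<in> tuples r (univ A)" by (simp add: tuples_def)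
    qed
    with Some show ?thesis by simp
  qed
  with assms(1,2) show ?thesis unfolding fin_struct_def by blast
qed

lemma finite_rel:
  assumes "fin_struct L A" shows "finite (rel A R)"
proof -
  have "rel A R \<subseteq> {t. set t \<subseteq> univ A \<and> length t = the (L R)}"
  proof
    fix t assume "t \<in> rel A R"
    then show "t \<in> {t. set t \<subseteq> univ A \<and> length t = the (L R)}"
      by (rule fin_struct_rel[OF assms]) simp
  qed
  then show ?thesis using finite_lists_length_eq[OF fin_struct_finite(2)[OF assms]] finite_subset by blast
qed

subsection \<open>Identifying elements\<close>

definition with_eq :: "nat \<Rightarrow> nat struct \<Rightarrow> nat struct" where
  "with_eq q B = B\<lparr>rel := (rel B)(q := {[b, b] |b. b \<in> univ B})\<rparr>"

definition eq_edges :: "nat \<Rightarrow> nat struct \<Rightarrow> (nat \<times> nat) set" where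
  "eq_edges q A = {(x, y). [x, y] \<in> rel A q}"

definition class_rel :: "(nat \<times> nat) set \<Rightarrow> (nat \<times> nat) set" where
  "class_rel E = (E \<union> E\<inverse>)\<^sup>*"

text \<open>The least element of the class is a canonical choice: the quotient has to be a function
  of the structure and not of the order in which a word lists it.\<close>

definition rep :: "(nat \<times> nat) set \<Rightarrow> nat \<Rightarrow> nat" where
  "rep E x = (LEAST y. (x, y) \<in> class_rel E)"

definition identify :: "nat \<Rightarrow> nat struct \<Rightarrow> nat struct" where
  "identify q A = \<lparr>univ = rep (eq_edges q A) ` univ A,
     rel = (\<lambda>R. if R = q then {} else map (rep (eq_edges q A)) ` rel A R)\<rparr>"

lemma class_rel_refl [simp]: "(x, x) \<in> class_rel E"
  by (simp add: class_rel_def)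

lemma class_rel_sym: "(x, y) \<in> class_rel E \<Longrightarrow> (y, x) \<in> class_rel E"
  unfolding class_rel_def by (meson sym_Un_converse sym_rtrancl symD)

lemma class_rel_trans: "(x, y) \<in> class_rel E \<Longrightarrow> (y, z) \<in> class_rel E \<Longrightarrow> (x, z) \<in> class_rel E"
  unfolding class_rel_def by (rule rtrancl_trans)

lemma rep_rel: "(x, rep E x) \<in> class_rel E"
  unfolding rep_def by (rule LeastI[of _ x]) simp

lemma rep_cong: "(x, y) \<in> class_rel E \<Longrightarrow> rep E x = rep E y"
  unfolding rep_def by (rule arg_cong[where f = Least]) (auto intro: class_rel_trans class_rel_sym)

lemma rep_rep [simp]: "rep E (rep E x) = rep E x"
  using rep_cong[OF rep_rel] by metis

lemma class_rel_univ:
  assumes "E \<subseteq> U \<times> U" "(x, y) \<in> class_rel E" "x \<in> U" shows "y \<in> U"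
  using assms(2,3) unfolding class_rel_def by (induction rule: rtrancl_induct) (use assms(1) in auto)

lemma class_rel_const:
  assumes "\<And>x y. (x, y) \<in> E \<Longrightarrow> h x = h y" "(x, y) \<in> class_rel E" shows "h x = h y"
  using assms(2) unfolding class_rel_def by (induction rule: rtrancl_induct) (use assms(1) in fastforce)+

text \<open>A path from \<open>Z\<close> to its complement has an edge that crosses. This finds the
  next element for which equality clauses can be derived.\<close>

lemma class_rel_leaves:
  assumes "(x, y) \<in> class_rel E" "x \<in> Z" "y \<notin> Z" obtains u v where "u \<in> Z" "v \<notin> Z" "(u, v) \<in> E \<or> (v, u) \<in> E"
proof -
  have "\<exists>u v. u \<in> Z \<and> v \<notin> Z \<and> ((u, v) \<in> E \<or> (v, u) \<in> E)"
    using assms unfolding class_rel_def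
  proof (induction rule: rtrancl_induct)
    case (step y z)
    then show ?case by (cases "y \<in> Z") auto
  qed simp
  with that show thesis by blast
qed

locale identification =
  fixes L :: vocabulary and q :: nat and B :: "nat struct"
  assumes B: "fin_struct L B" and q: "q \<notin> dom L"
begin

abbreviation "L' \<equiv> L(q \<mapsto> 2)"
abbreviation "B' \<equiv> with_eq q B"

lemma B'_simps [simp]: "univ B' = univ B" "R \<noteq> q \<Longrightarrow> rel B' R = rel B R" "rel B' q = {[b, b] |b. b \<in> univ B}"
  by (auto simp: with_eq_def)

context
  fixes A :: "nat struct"
  assumes A: "fin_struct L' A"
begin

abbreviation "r \<equiv> rep (eq_edges q A)"

lemma edges_univ: "eq_edges q A \<subseteq> univ A \<times> univ A"
proof clarify
  fix x y assume "(x, y) \<in> eq_edges q A"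
  then have "[x, y] \<in> rel A q" by (simp add: eq_edges_def)
  then have "set [x, y] \<subseteq> univ A" using fin_struct_rel[OF A] by metis
  then show "x \<in> univ A \<and> y \<in> univ A" by simp
qed

lemma r_univ: "x \<in> univ A \<Longrightarrow> r x \<in> univ A"
  by (rule class_rel_univ[OF edges_univ rep_rel])

lemma rel_identify: "t \<in> rel (identify q A) R \<longleftrightarrow> R \<noteq> q \<and> (\<exists>t0\<in>rel A R. t = map r t0)"
  by (auto simp: identify_def)

lemma fin_identify: "fin_struct L (identify q A)"
proof (rule fin_structI)
  show "finite (dom L)" by (rule fin_struct_finite[OF B])
  show "finite (univ (identify q A))" using fin_struct_finite[OF A] by (simp add: identify_def)
  fix R t assume "t \<in> rel (identify q A) R"
  then obtain t0 where t0: "t0 \<in> rel A R" "t = map r t0" "R \<noteq> q" by (auto simp: rel_identify)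
  then have "L' R = Some (length t0)" "set t0 \<subseteq> univ A" using fin_struct_rel[OF A t0(1)] by metis+
  then show "L R = Some (length t) \<and> set t \<subseteq> univ (identify q A)" using t0 by (auto simp: identify_def)
qed

lemma size_identify: "struct_size L (identify q A) \<le> struct_size L' A"
proof -
  have "card (univ (identify q A)) \<le> card (univ A)"
    using fin_struct_finite[OF A] by (simp add: identify_def card_image_le)
  moreover have "(\<Sum>R\<in>dom L. card (rel (identify q A) R)) \<le> (\<Sum>R\<in>dom L. card (rel A R))"
    by (rule sum_mono) (simp add: identify_def finite_rel[OF A] card_image_le)
  moreover have "(\<Sum>R\<in>dom L. card (rel A R)) \<le> (\<Sum>R\<in>dom L'. card (rel A R))"
    using fin_struct_finite[OF B] by (intro sum_mono2) auto
  ultimately show ?thesis unfolding struct_size_def by linarith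
qed

lemma maps_to_identify: "maps_to (identify q A) B \<longleftrightarrow> maps_to A B'"
proof
  assume "maps_to (identify q A) B"
  then obtain h where h: "is_hom h (identify q A) B" unfolding maps_to_def by blast
  have "is_hom (h \<circ> r) A B'" unfolding is_hom_def
  proof (intro conjI allI ballI)
    show u: "(h \<circ> r) ` univ A \<subseteq> univ B'" using h by (auto simp: is_hom_def identify_def)
    fix R t assume t: "t \<in> rel A R"
    show "map (h \<circ> r) t \<in> rel B' R"
    proof (cases "R = q")
      case True
      then have "L' R = Some 2" by simp
      then have "length t = 2" "set t \<subseteq> univ A" using fin_struct_rel[OF A t] by auto
      then obtain x y where xy: "t = [x, y]" "x \<in> univ A" by (auto simp: numeral_2_eq_2 length_Suc_conv)
      then have "(x, y) \<in> eq_edges q A" using t True by (simp add: eq_edges_def)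
      then have "r x = r y" by (intro rep_cong) (auto simp: class_rel_def)
      then show ?thesis using xy True u by auto
    next
      case False
      then have "map h (map r t) \<in> rel B R" using h t unfolding is_hom_def by (metis rel_identify)
      then show ?thesis using False by simp
    qed
  qed
  then show "maps_to A B'" unfolding maps_to_def by blast
next
  assume "maps_to A B'"
  then obtain h where h: "is_hom h A B'" unfolding maps_to_def by blast
  have "h x = h y" if "(x, y) \<in> eq_edges q A" for x y
  proof -
    have "map h [x, y] \<in> rel B' q" using h that unfolding is_hom_def eq_edges_def by blast
    then show ?thesis by simp
  qed
  then have hr: "h (r x) = h x" for x using class_rel_const[OF _ rep_rel, of "eq_edges q A" h x] by simp
  have "is_hom h (identify q A) B" unfolding is_hom_def
  proof (intro conjI allI ballI)
    show "h ` univ (identify q A) \<subseteq> univ B" using h by (auto simp: is_hom_def identify_def hr)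
    fix R t assume "t \<in> rel (identify q A) R"
    then obtain t0 where t0: "R \<noteq> q" "t0 \<in> rel A R" "t = map r t0" by (auto simp: rel_identify)
    have "map h t0 \<in> rel B' R" using h t0 unfolding is_hom_def by blast
    moreover have "map h t = map h t0" using t0 hr by simp
    ultimately show "map h t \<in> rel B R" using t0(1) by simp
  qed
  then show "maps_to (identify q A) B" unfolding maps_to_def by blast
qed

text \<open>Together with the encodings of points these clauses say that \<open>a\<close> and its
  representative have the same value. They relate the two directly, however long the path of edges
  between them.\<close>

definition eq_clauses :: "nat set \<Rightarrow> (nat \<times> nat) clause set" where
  "eq_clauses Z = {{|Neg (r a, b), Neg (a, b')|} |a b b'. a \<in> Z \<and> b \<in> univ B \<and> b' \<in> univ B \<and> b \<noteq> b'}"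

text \<open>An element of the quotient is a representative and thus an element of \<open>A\<close>,
  so a homomorphism on \<open>A\<close> is simply evaluated there.\<close>

lemma local_simulation_identify:
  assumes m: "\<And>R n. L R = Some n \<Longrightarrow> 2 * n \<le> m" "1 \<le> m"
  shows "local_simulation B B' m (identify q A) A (eq_clauses (univ A)) (\<lambda>x. {|x|}) (\<lambda>x h. h x)"
  unfolding local_simulation_def
proof (intro conjI allI ballI impI)
  fix x assume "x \<in> univ (identify q A)"
  then show "fset {|x|} \<subseteq> univ A" using r_univ by (auto simp: identify_def)
  then show "\<exists>D. fset D \<subseteq> univ A \<and> fcard D \<le> m \<and> {|x|} |\<subseteq>| D \<and>
    (\<forall>h. compatible A B' (eq_clauses (univ A)) D h \<longrightarrow> h x \<in> univ B)"
    using m(2) r_univ by (intro exI[of _ "{|x|}"]) (auto simp: compatible_def identify_def)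
  show "fcard {|x|} \<le> m" using m(2) by simp
next
  fix R t assume "t \<in> rel (identify q A) R"
  then obtain t0 where t0: "R \<noteq> q" "t0 \<in> rel A R" "t = map r t0" by (auto simp: rel_identify)
  have L: "L R = Some (length t0)" "set t0 \<subseteq> univ A" using fin_struct_rel[OF A t0(2)] t0(1) by (metis fun_upd_other)+
  \<comment> \<open>The relation is known for the original tuple \<open>t0\<close> only; the
    equality clauses carry it over to the representatives. Both are needed, hence the factor 2 in
    the bound on arities.\<close>
  let ?D = "fset_of_list (t0 @ t)"
  show "\<exists>D. fset D \<subseteq> univ A \<and> fcard D \<le> m \<and> (\<forall>x\<in>set t. {|x|} |\<subseteq>| D) \<and>
    (\<forall>h. compatible A B' (eq_clauses (univ A)) D h \<longrightarrow> map (\<lambda>x. h x) t \<in> rel B R)"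
  proof (intro exI[of _ ?D] conjI allI impI)
    show "fset ?D \<subseteq> univ A" using L t0 r_univ by (auto simp: fset_of_list.rep_eq)
    have "card (set (t0 @ t)) \<le> length (t0 @ t)" by (rule card_length)
    then have "fcard ?D \<le> length (t0 @ t)" by (simp add: fcard.rep_eq fset_of_list.rep_eq)
    then show "fcard ?D \<le> m" using m(1)[OF L(1)] t0(3) by simp
    show "\<forall>x\<in>set t. {|x|} |\<subseteq>| ?D" by (auto simp: fset_of_list.rep_eq)
    fix h assume h: "compatible A B' (eq_clauses (univ A)) ?D h"
    have "h (r a) = h a" if a: "a \<in> set t0" for a
    proof (rule ccontr)
      assume ne: "h (r a) \<noteq> h a"
      let ?C = "{|Neg (r a, h (r a)), Neg (a, h a)|}"
      have aD: "a |\<in>| ?D" "r a |\<in>| ?D" using a t0(3) by (auto simp: fset_of_list.rep_eq)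
      then have hB: "h a \<in> univ B" "h (r a) \<in> univ B" using h by (auto simp: compatible_def)
      have "?C \<in> eq_clauses (univ A)" using a L(2) hB ne unfolding eq_clauses_def by blast
      then have "\<exists>l. l |\<in>| ?C \<and> lit_sat (fset (fgraph h ?D)) l"
        using h aD hB unfolding compatible_def by auto
      then show False using aD by auto
    qed
    then have "map h t = map h t0" using t0(3) by simp
    moreover have "map h t0 \<in> rel B' R" using h t0(2) unfolding compatible_def by (auto simp: fset_of_list.rep_eq)
    ultimately show "map (\<lambda>x. h x) t \<in> rel B R" using t0(1) by simp
  qed
qed auto


definition Bf :: "nat fset" where "Bf = Abs_fset (univ B)"

lemma fset_Bf: "fset Bf = univ B"
  using fin_struct_finite[OF B] by (simp add: Bf_def Abs_fset_inverse)

text \<open>One clause for each pair of values, each derived by a truth table over the variables of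
  three elements.\<close>

definition eq_cost :: nat where
  "eq_cost = (fcard Bf * fcard Bf) * (2 ^ (3 * fcard Bf) * 5)"

text \<open>On the elements \<open>r y\<close>, \<open>x\<close>, \<open>y\<close> everything is
  local: the edge equates the values at \<open>x\<close> and \<open>y\<close>, and the clauses for
  \<open>x\<close> those at \<open>x\<close> and its representative, which is also that of
  \<open>y\<close>. If \<open>y\<close> is its own representative, the clause only says that values
  are unique.\<close>

lemma derive_eq_clause:
  assumes E': "encoding_scheme L' B' E'" "local_scheme L' E'"
    and \<rho>: "frege_proof (clause_fm ` E' A) \<rho>" "clause_fm ` eq_clauses Z \<subseteq> set \<rho>"
    and y: "y \<in> univ A" "y = r y \<or> (\<exists>x\<in>Z. (x, y) \<in> eq_edges q A \<or> (y, x) \<in> eq_edges q A)"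
    and Z: "Z \<subseteq> univ A" and b: "b \<in> univ B" "b' \<in> univ B" "b \<noteq> b'"
  shows "\<exists>\<rho>'. frege_proof (clause_fm ` E' A) (\<rho> @ \<rho>') \<and> length \<rho>' \<le> 2 ^ (3 * fcard Bf) * 5 \<and>
    clause_fm {|Neg (r y, b), Neg (y, b')|} \<in> set (\<rho> @ \<rho>') \<and>
    (\<forall>G\<in>set \<rho>'. Sigma_fm (Suc t) 1 G \<and> fm_size G \<le> 6 * fcard Bf + 1)"
proof -
  obtain x where x: "x \<in> univ A" "y = r y \<or> x \<in> Z \<and> ((x, y) \<in> eq_edges q A \<or> (y, x) \<in> eq_edges q A)"
    using y Z by blast
  let ?D = "{|r y, x, y|}"
  let ?V = "fprod ?D Bf"
  let ?C = "{|Neg (r y, b), Neg (y, b')|}"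
  let ?\<Gamma> = "(\<lambda>D. Lit |`| D) ` (E' A \<union> eq_clauses Z)"
  have V: "fcard ?V \<le> 3 * fcard Bf"
    unfolding fcard_fprod by (intro mult_right_mono) (auto simp: fcard_finsert_if)
  have drv: "drv ?\<Gamma> (fset (all_lits ?V)) (2 ^ fcard ?V * 5) (Lit |`| ?C)"
  proof (rule drv_clause[where \<Delta> = "E' A \<union> eq_clauses Z"])
    fix \<alpha> assume \<alpha>: "\<alpha> |\<subseteq>| ?V"
      and sat: "\<And>D. D \<in> E' A \<union> eq_clauses Z \<Longrightarrow> (\<And>l. l |\<in>| D \<Longrightarrow> lit_var l |\<in>| ?V) \<Longrightarrow> \<exists>l. l |\<in>| D \<and> lit_sat (fset \<alpha>) l"
    have D: "fset ?D \<subseteq> univ A" using x y r_univ by auto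
    have Bf': "fset Bf = univ B'" using fset_Bf by simp
    obtain h where h: "\<And>a. a |\<in>| ?D \<Longrightarrow> h a \<in> univ B'" "\<alpha> = fgraph h ?D"
      "\<And>R t. t \<in> rel A R \<Longrightarrow> set t \<subseteq> fset ?D \<Longrightarrow> map h t \<in> rel B' R"
      using assignment_graph[OF E' A D Bf' \<alpha>] sat by blast
    have "h (r y) = h y"
    proof (cases "y = r y")
      case False
      with x have xZ: "x \<in> Z" and e: "(x, y) \<in> eq_edges q A \<or> (y, x) \<in> eq_edges q A" by auto
      then have "(x, y) \<in> class_rel (eq_edges q A)" by (auto simp: class_rel_def)
      then have rxy: "r x = r y" by (rule rep_cong)
      have "h x = h y"
        using e
      proof
        assume "(x, y) \<in> eq_edges q A"
        then have "map h [x, y] \<in> rel B' q" by (intro h(3)) (auto simp: eq_edges_def)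
        then show ?thesis by simp
      next
        assume "(y, x) \<in> eq_edges q A"
        then have "map h [y, x] \<in> rel B' q" by (intro h(3)) (auto simp: eq_edges_def)
        then show ?thesis by simp
      qed
      moreover have "h (r y) = h x"
      proof (rule ccontr)
        assume ne: "h (r y) \<noteq> h x"
        have hB: "h (r y) \<in> univ B" "h x \<in> univ B" using h(1) by simp_all
        then have "{|Neg (r x, h (r y)), Neg (x, h x)|} \<in> eq_clauses Z" unfolding eq_clauses_def using ne xZ by blast
        then have "\<exists>l. l |\<in>| {|Neg (r x, h (r y)), Neg (x, h x)|} \<and> lit_sat (fset \<alpha>) l"
          using hB by (intro sat) (auto simp: rxy fset_Bf)
        then show False by (auto simp: rxy h(2))
      qed
      ultimately show ?thesis by simp
    qed simp
    then show "\<exists>l. l |\<in>| ?C \<and> lit_sat (fset \<alpha>) l" using b(3) by (cases "b = h y") (auto simp: h(2))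
  qed (use b fset_Bf in auto)
  have lits: "ndisj G \<and> Pi_fm t 1 G \<and> fm_size G = 1" if "G \<in> fset (all_lits ?V)" for G
    using that by (auto simp: all_lits_def)
  have "\<exists>\<rho>'. frege_proof (clause_fm ` E' A) (\<rho> @ \<rho>') \<and> length \<rho>' \<le> 2 ^ fcard ?V * 5 \<and> mk_disj (Lit |`| ?C) \<in> set (\<rho> @ \<rho>') \<and>
    (\<forall>G\<in>set \<rho>'. \<exists>Y. fset Y \<subseteq> fset (all_lits ?V) \<and> G = mk_disj Y)"
    by (rule drv_frege_proof[OF drv _ \<rho>(1)]) (use lits \<rho>(2) in \<open>auto simp: clause_fm_def\<close>)
  then obtain \<rho>' where \<rho>': "frege_proof (clause_fm ` E' A) (\<rho> @ \<rho>')" "length \<rho>' \<le> 2 ^ fcard ?V * 5"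
    "mk_disj (Lit |`| ?C) \<in> set (\<rho> @ \<rho>')" "\<forall>G\<in>set \<rho>'. \<exists>Y. fset Y \<subseteq> fset (all_lits ?V) \<and> G = mk_disj Y" by blast
  have "Sigma_fm (Suc t) 1 G \<and> fm_size G \<le> 6 * fcard Bf + 1" if G: "G \<in> set \<rho>'" for G
  proof -
    obtain Y where Y: "fset Y \<subseteq> fset (all_lits ?V)" "G = mk_disj Y" using \<rho>'(4) G by blast
    have "disjuncts G = Y" unfolding Y(2) by (rule disjuncts_mk_disj) (use Y(1) lits in blast)
    then have 1: "Sigma_fm (Suc t) 1 G" using Y(1) lits by auto
    have "(\<Sum>F\<in>fset Y. fm_size F) = card (fset Y)" using Y(1) lits by (simp add: subset_iff)
    also have "\<dots> \<le> card (fset (all_lits ?V))" using Y(1) by (intro card_mono) auto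
    also have "\<dots> \<le> card ((Lit \<circ> Pos) ` fset ?V) + card ((Lit \<circ> Neg) ` fset ?V)"
      unfolding all_lits_def by (simp add: card_Un_le)
    also have "\<dots> \<le> fcard ?V + fcard ?V" unfolding fcard.rep_eq by (intro add_mono card_image_le) auto
    finally show ?thesis using 1 V size_mk_disj[of Y] Y(2) by simp
  qed
  moreover have "(2::nat) ^ fcard ?V * 5 \<le> 2 ^ (3 * fcard Bf) * 5" using V by (intro mult_right_mono power_increasing) auto
  ultimately show ?thesis using \<rho>' unfolding clause_fm_def
    by (intro exI[of _ \<rho>'] conjI) (auto intro: order.trans)
qed

lemma derive_eq_clauses_element:
  assumes E': "encoding_scheme L' B' E'" "local_scheme L' E'"
    and \<rho>: "frege_proof (clause_fm ` E' A) \<rho>" "clause_fm ` eq_clauses Z \<subseteq> set \<rho>"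
    and y: "y \<in> univ A" "y = r y \<or> (\<exists>x\<in>Z. (x, y) \<in> eq_edges q A \<or> (y, x) \<in> eq_edges q A)"
    and Z: "Z \<subseteq> univ A"
  shows "\<exists>\<rho>'. frege_proof (clause_fm ` E' A) (\<rho> @ \<rho>') \<and> length \<rho>' \<le> eq_cost \<and>
    clause_fm ` eq_clauses {y} \<subseteq> set (\<rho> @ \<rho>') \<and>
    (\<forall>G\<in>set \<rho>'. Sigma_fm (Suc t) 1 G \<and> fm_size G \<le> 6 * fcard Bf + 1)"
proof -
  have "\<exists>\<rho>'. frege_proof (clause_fm ` E' A) (\<rho> @ \<rho>') \<and> length \<rho>' \<le> card S * (2 ^ (3 * fcard Bf) * 5) \<and>
    (\<forall>(b, b')\<in>S. b \<noteq> b' \<longrightarrow> clause_fm {|Neg (r y, b), Neg (y, b')|} \<in> set (\<rho> @ \<rho>')) \<and>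
    (\<forall>G\<in>set \<rho>'. Sigma_fm (Suc t) 1 G \<and> fm_size G \<le> 6 * fcard Bf + 1)"
    if "finite S" "S \<subseteq> univ B \<times> univ B" for S
    using that
  proof (induction S rule: finite_induct)
    case empty
    then show ?case using \<rho>(1) by (intro exI[of _ "[]"]) simp
  next
    case (insert p S)
    obtain b b' where p: "p = (b, b')" by fastforce
    obtain \<rho>1 where 1: "frege_proof (clause_fm ` E' A) (\<rho> @ \<rho>1)" "length \<rho>1 \<le> card S * (2 ^ (3 * fcard Bf) * 5)"
      "\<forall>(b, b')\<in>S. b \<noteq> b' \<longrightarrow> clause_fm {|Neg (r y, b), Neg (y, b')|} \<in> set (\<rho> @ \<rho>1)"
      "\<forall>G\<in>set \<rho>1. Sigma_fm (Suc t) 1 G \<and> fm_size G \<le> 6 * fcard Bf + 1" using insert by auto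
    show ?case
    proof (cases "b = b'")
      case True
      then show ?thesis using 1 p insert.hyps by (intro exI[of _ \<rho>1]) auto
    next
      case False
      have "clause_fm ` eq_clauses Z \<subseteq> set (\<rho> @ \<rho>1)" using \<rho>(2) by auto
      from derive_eq_clause[OF E' 1(1) this y Z _ _ False, of t]
      obtain \<rho>2 where 2: "frege_proof (clause_fm ` E' A) ((\<rho> @ \<rho>1) @ \<rho>2)" "length \<rho>2 \<le> 2 ^ (3 * fcard Bf) * 5"
        "clause_fm {|Neg (r y, b), Neg (y, b')|} \<in> set ((\<rho> @ \<rho>1) @ \<rho>2)"
        "\<forall>G\<in>set \<rho>2. Sigma_fm (Suc t) 1 G \<and> fm_size G \<le> 6 * fcard Bf + 1"
        using insert.prems p by auto
      show ?thesis using 1 2 p insert.hyps by (intro exI[of _ "\<rho>1 @ \<rho>2"]) auto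
    qed
  qed
  from this[of "univ B \<times> univ B"] fin_struct_finite[OF B] obtain \<rho>' where \<rho>': "frege_proof (clause_fm ` E' A) (\<rho> @ \<rho>')"
    "length \<rho>' \<le> card (univ B \<times> univ B) * (2 ^ (3 * fcard Bf) * 5)"
    "\<forall>(b, b')\<in>univ B \<times> univ B. b \<noteq> b' \<longrightarrow> clause_fm {|Neg (r y, b), Neg (y, b')|} \<in> set (\<rho> @ \<rho>')"
    "\<forall>G\<in>set \<rho>'. Sigma_fm (Suc t) 1 G \<and> fm_size G \<le> 6 * fcard Bf + 1" by auto
  have "clause_fm ` eq_clauses {y} \<subseteq> set (\<rho> @ \<rho>')" using \<rho>'(3) by (fastforce simp: eq_clauses_def)
  then show ?thesis using \<rho>' by (intro exI[of _ \<rho>']) (simp add: eq_cost_def card_cartesian_product fcard.rep_eq fset_Bf)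
qed

text \<open>The set \<open>Z\<close> of finished elements grows by one element at a time. If the
  representative of a missing element is missing too, it comes next; otherwise some edge leads from
  \<open>Z\<close> to a missing element. So each element is handled once, at a cost that depends on
  \<open>B\<close> only.\<close>

lemma derive_eq_clauses:
  assumes E': "encoding_scheme L' B' E'" "local_scheme L' E'"
  shows "\<exists>\<rho>. frege_proof (clause_fm ` E' A) \<rho> \<and> length \<rho> \<le> card (univ A) * eq_cost \<and>
    clause_fm ` eq_clauses (univ A) \<subseteq> set \<rho> \<and> (\<forall>G\<in>set \<rho>. Sigma_fm (Suc t) 1 G \<and> fm_size G \<le> 6 * fcard Bf + 1)"
proof -
  have fin: "finite (univ A)" by (rule fin_struct_finite[OF A])
  have "\<exists>Z \<rho>. Z \<subseteq> univ A \<and> card Z = n \<and> frege_proof (clause_fm ` E' A) \<rho> \<and> length \<rho> \<le> n * eq_cost \<and>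
    clause_fm ` eq_clauses Z \<subseteq> set \<rho> \<and> (\<forall>G\<in>set \<rho>. Sigma_fm (Suc t) 1 G \<and> fm_size G \<le> 6 * fcard Bf + 1)"
    if "n \<le> card (univ A)" for n
    using that
  proof (induction n)
    case 0
    show ?case by (intro exI[of _ "{}"] exI[of _ "[]"]) (auto simp: frege_proof_def eq_clauses_def)
  next
    case (Suc n)
    then obtain Z \<rho> where Z: "Z \<subseteq> univ A" "card Z = n" and \<rho>: "frege_proof (clause_fm ` E' A) \<rho>" "length \<rho> \<le> n * eq_cost"
      "clause_fm ` eq_clauses Z \<subseteq> set \<rho>" "\<forall>G\<in>set \<rho>. Sigma_fm (Suc t) 1 G \<and> fm_size G \<le> 6 * fcard Bf + 1"
      by auto
    have "Z \<noteq> univ A" using Z Suc.prems by auto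
    then obtain y0 where y0: "y0 \<in> univ A" "y0 \<notin> Z" using Z by blast
    obtain y where y: "y \<in> univ A" "y \<notin> Z" "y = r y \<or> (\<exists>x\<in>Z. (x, y) \<in> eq_edges q A \<or> (y, x) \<in> eq_edges q A)"
    proof (cases "r y0 \<in> Z")
      case True
      obtain u v where uv: "u \<in> Z" "v \<notin> Z" "(u, v) \<in> eq_edges q A \<or> (v, u) \<in> eq_edges q A"
        using class_rel_leaves[OF class_rel_sym[OF rep_rel] True y0(2)] by blast
      then have "v \<in> univ A" using edges_univ by blast
      with uv show ?thesis by (intro that[of v]) auto
    next
      case False
      then show ?thesis using r_univ[OF y0(1)] by (intro that[of "r y0"]) auto
    qed
    obtain \<rho>' where \<rho>': "frege_proof (clause_fm ` E' A) (\<rho> @ \<rho>')" "length \<rho>' \<le> eq_cost"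
      "clause_fm ` eq_clauses {y} \<subseteq> set (\<rho> @ \<rho>')" "\<forall>G\<in>set \<rho>'. Sigma_fm (Suc t) 1 G \<and> fm_size G \<le> 6 * fcard Bf + 1"
      using derive_eq_clauses_element[OF E' \<rho>(1,3) y(1,3) Z(1), of t] by blast
    have "eq_clauses (insert y Z) = eq_clauses {y} \<union> eq_clauses Z" unfolding eq_clauses_def by blast
    then have "clause_fm ` eq_clauses (insert y Z) \<subseteq> set (\<rho> @ \<rho>')" using \<rho>'(3) \<rho>(3) by auto
    moreover have "card (insert y Z) = Suc n" using y(2) Z fin by (simp add: finite_subset)
    ultimately show ?case using y(1) Z(1) \<rho>'(1,2,4) \<rho>(2,4)
      by (intro exI[of _ "insert y Z"] exI[of _ "\<rho> @ \<rho>'"]) auto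
  qed
  from this[of "card (univ A)"] obtain Z \<rho> where Z: "Z \<subseteq> univ A" "card Z = card (univ A)" and
    \<rho>: "frege_proof (clause_fm ` E' A) \<rho>" "length \<rho> \<le> card (univ A) * eq_cost"
      "clause_fm ` eq_clauses Z \<subseteq> set \<rho>" "\<forall>G\<in>set \<rho>. Sigma_fm (Suc t) 1 G \<and> fm_size G \<le> 6 * fcard Bf + 1" by auto
  have "Z = univ A" using Z fin by (metis card_subset_eq)
  with \<rho> show ?thesis by blast
qed

end

lemma transfer_identify:
  assumes E: "encoding_scheme L B E" "local_scheme L E" and E': "encoding_scheme L' B' E'" "local_scheme L' E'"
  shows "refutation_transfer L' E E' (identify q)"
proof -
  have finB: "finite (univ B)" "finite (dom L)" by (rule fin_struct_finite[OF B])+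
  define m where "m = 2 * Max (insert 1 (ran L))"
  have "finite (ran L)" using finB(2) by (rule finite_ran)
  then have m: "2 * n \<le> m" if "L R = Some n" for R n
    unfolding m_def using that by (auto intro!: Max_ge ranI)
  have m1: "1 \<le> m" unfolding m_def using Max_ge[of "insert 1 (ran L)" 1] \<open>finite (ran L)\<close> by simp
  have ar: "\<forall>R n. L R = Some n \<longrightarrow> n \<le> m" using m by fastforce
  \<comment> \<open>At most \<open>eq_cost\<close> lines for each element, each of size at most
    \<open>6 * fcard Bf + 1\<close>. The added 1 makes \<open>a\<close> positive, so that a power
    with exponent \<open>a\<close> is at least its base.\<close>
  define a where "a = eq_cost * (6 * fcard Bf + 1) + 1"
  have finB': "finite (univ B')" using finB by simp
  obtain c b where c: "1 \<le> c" and tr: "\<forall>As A \<Delta> N val \<rho>0 t k s \<pi>.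
    fin_struct L As \<and> fin_struct L' A \<and> local_simulation B B' m As A \<Delta> N val \<and> 1 \<le> k \<and>
    bounded_refutation (E As) (Suc t) k s \<pi> \<and> frege_proof (clause_fm ` E' A) \<rho>0 \<and>
    (\<forall>G\<in>set \<rho>0. Sigma_fm (Suc t) 1 G) \<and> proof_size \<rho>0 \<le> (a * (struct_size L' A + 1)) ^ a \<and>
    clause_fm ` \<Delta> \<subseteq> set \<rho>0 \<longrightarrow>
    (\<exists>\<pi>' s'. bounded_refutation (E' A) (Suc t) (c * k) s' \<pi>' \<and> s' \<le> size_bound b k s (struct_size L' A))"
    using local_simulation_transfer[OF E E' B finB' ar, where a = a] by (elim exE conjE) (rule that; assumption)
  have "\<exists>\<pi>' s'. bounded_refutation (E' A) t (c * k) s' \<pi>' \<and> s' \<le> size_bound b k s (struct_size L' A)"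
    if A: "fin_struct L' A" and t: "1 \<le> t" and k: "1 \<le> k" and \<pi>: "bounded_refutation (E (identify q A)) t k s \<pi>" for A t k s \<pi>
  proof -
    obtain t' where t': "t = Suc t'" using t by (cases t) auto
    obtain \<rho> where \<rho>: "frege_proof (clause_fm ` E' A) \<rho>" "length \<rho> \<le> card (univ A) * eq_cost"
      "clause_fm ` eq_clauses A (univ A) \<subseteq> set \<rho>" "\<forall>G\<in>set \<rho>. Sigma_fm (Suc t') 1 G \<and> fm_size G \<le> 6 * fcard Bf + 1"
      using derive_eq_clauses[OF A E', of t'] by blast
    have "proof_size \<rho> \<le> (\<Sum>G\<leftarrow>\<rho>. 6 * fcard Bf + 1)" unfolding proof_size_def by (rule sum_list_mono) (use \<rho>(4) in auto)
    also have "\<dots> = length \<rho> * (6 * fcard Bf + 1)" by (simp add: sum_list_triv)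
    also have "\<dots> \<le> card (univ A) * eq_cost * (6 * fcard Bf + 1)" using \<rho>(2) by (rule mult_right_mono) simp
    also have "\<dots> \<le> (struct_size L' A + 1) * a" unfolding a_def mult.assoc
      by (intro mult_mono) (auto simp: struct_size_def)
    also have "\<dots> \<le> (a * (struct_size L' A + 1)) ^ a"
      using self_le_power[of "a * (struct_size L' A + 1)" a] by (simp add: a_def mult.commute)
    finally have sz: "proof_size \<rho> \<le> (a * (struct_size L' A + 1)) ^ a" .
    have ls: "local_simulation B B' m (identify q A) A (eq_clauses A (univ A)) (\<lambda>x. {|x|}) (\<lambda>x h. h x)"
      by (rule local_simulation_identify[OF A]) (use m m1 in auto)
    have S1: "\<forall>G\<in>set \<rho>. Sigma_fm (Suc t') 1 G" using \<rho>(4) by blast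
    show ?thesis unfolding t'
      by (rule tr[THEN spec[of _ "identify q A"], THEN spec[of _ A], THEN spec[of _ "eq_clauses A (univ A)"], THEN spec[of _ "\<lambda>x. {|x|}"],
          THEN spec[of _ "\<lambda>x h. h x"], THEN spec[of _ \<rho>], THEN spec[of _ t'], THEN spec[of _ k], THEN spec[of _ s], THEN spec[of _ \<pi>], THEN mp])
        (intro conjI fin_identify[OF A] A ls k \<pi>[unfolded t'] \<rho>(1,3) S1 sz)
  qed
  with c show ?thesis unfolding refutation_transfer_def by (intro exI[of _ c] conjI exI[of _ b]) blast+
qed

lemma reduces_identify:
  assumes "pt_map L' L (identify q)"
  shows "reduces (L', B') (L, B)"
  unfolding reduces_def prod.case
proof (intro exI[of _ "identify q"] conjI allI impI assms)
  show "\<exists>c d. \<forall>A. fin_struct L' A \<longrightarrow> struct_size L (identify q A) \<le> c * struct_size L' A + d"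
    using size_identify by (intro exI[of _ 1] exI[of _ 0]) auto
qed (use fin_identify maps_to_identify transfer_identify in auto)

end

lemma fin_struct_relD: "fin_struct L A \<Longrightarrow> t \<in> rel A R \<Longrightarrow> L R = Some (length t) \<and> set t \<subseteq> univ A"
  by (erule (1) fin_struct_rel) simp

section \<open>Names of elements\<close>

fun unbits :: "symb list \<Rightarrow> nat" where
  "unbits [] = 0"
| "unbits (x # w) = (if x = One then 1 else 0) + 2 * unbits w"

lemma unbits_bits [simp]: "unbits (bits n) = n"
  by (induction n rule: bits.induct) (subst bits.simps, auto)

lemma bits_inj [simp]: "bits m = bits n \<longleftrightarrow> m = n"
  by (metis unbits_bits)

lemma set_bits: "set (bits n) \<subseteq> {Zero, One}"
proof (induction n rule: bits.induct)
  case (1 n)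
  then show ?case by (subst bits.simps) auto
qed

declare bits.simps [simp del]

lemma bits_unbits: "set w \<subseteq> {Zero, One} \<Longrightarrow> w \<noteq> [] \<longrightarrow> last w = One \<Longrightarrow> bits (unbits w) = w"
proof (induction w)
  case Nil
  show ?case by (simp add: bits.simps)
next
  case (Cons x w)
  have "w \<noteq> [] \<longrightarrow> last w = One" using Cons.prems(2) by auto
  with Cons have IH: "bits (unbits w) = w" by simp
  have "unbits (x # w) \<noteq> 0"
  proof
    assume 0: "unbits (x # w) = 0"
    then have x: "x = Zero" "unbits w = 0" using Cons.prems by (auto split: if_splits)
    then have "w = []" using IH by (simp add: bits.simps)
    then show False using x Cons.prems by simp
  qed
  then show ?case using IH Cons.prems by (subst bits.simps) (auto split: if_splits)
qed

text \<open>Each symbol is announced by \<open>One\<close> and the end is marked by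
  \<open>Zero\<close>. This makes the code prefix-free with the symbols of binary notation
  alone.\<close>

definition escape :: "symb list \<Rightarrow> symb list" where
  "escape w = concat (map (\<lambda>x. [One, x]) w) @ [Zero]"

text \<open>The final \<open>One\<close> makes the word the binary notation of a number.\<close>

definition name_bits :: "symb list list \<Rightarrow> symb list" where
  "name_bits ws = concat (map escape ws) @ [One]"

definition name :: "nat list \<Rightarrow> nat" where
  "name xs = unbits (name_bits (map bits xs))"

lemma escape_append: "escape v @ r = escape w @ r' \<Longrightarrow> v = w \<and> r = r'"
proof (induction v arbitrary: w)
  case Nil
  then show ?case by (cases w) (auto simp: escape_def)
next
  case (Cons x v)
  then obtain y w' where w: "w = y # w'" by (cases w) (auto simp: escape_def)
  have "x = y" "escape v @ r = escape w' @ r'" using Cons.prems by (simp_all add: w escape_def)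
  with Cons.IH[OF this(2)] w show ?case by simp
qed

lemma escape_One: "escape w @ r \<noteq> [One]"
  by (cases w) (auto simp: escape_def)

lemma name_bits_inj: "name_bits vs = name_bits ws \<Longrightarrow> vs = ws"
proof (induction vs arbitrary: ws)
  case Nil
  show ?case
  proof (cases ws)
    case (Cons w ws')
    have "escape w @ name_bits ws' = [One]" using Nil Cons by (simp add: name_bits_def)
    then show ?thesis using escape_One by blast
  qed simp
next
  case (Cons v vs)
  have "ws \<noteq> []"
  proof
    assume "ws = []"
    then have "escape v @ name_bits vs = [One]" using Cons.prems by (simp add: name_bits_def)
    then show False using escape_One by blast
  qed
  then obtain w ws' where ws: "ws = w # ws'" by (cases ws) auto
  have "escape v @ name_bits vs = escape w @ name_bits ws'" using Cons.prems by (simp add: ws name_bits_def)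
  from escape_append[OF this] Cons.IH show ?case by (auto simp: ws)
qed

lemma bits_name: "bits (name xs) = name_bits (map bits xs)"
  unfolding name_def
proof (rule bits_unbits)
  show "set (name_bits (map bits xs)) \<subseteq> {Zero, One}"
  proof -
    have "set (escape (bits n)) \<subseteq> {Zero, One}" for n using set_bits[of n] by (auto simp: escape_def)
    then show ?thesis by (auto simp: name_bits_def)
  qed
qed (simp add: name_bits_def)

lemma name_inj [simp]: "name xs = name ys \<longleftrightarrow> xs = ys"
proof
  assume "name xs = name ys"
  then have "map bits xs = map bits ys" using bits_name name_bits_inj by metis
  then show "xs = ys" using inj_map_eq_map[of bits] by (simp add: inj_def)
qed simp

section \<open>Gadget reductions\<close>

text \<open>
  Elements of the new structure: constants, copies of the elements of \<open>A\<close>, and witnesses that belong to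
  the tuples of \<open>A\<close>. The argument \<open>GE k j\<close> is the \<open>k\<close>-th copy of the \<open>j\<close>-th entry of the tuple.
\<close>

datatype garg = GC nat | GE nat nat | GW nat

text \<open>The tags 0, 1, 2 keep the three kinds of elements apart. A copy is named by the entry
  alone, so tuples with a common element share its copies, whereas a witness is private to its
  symbol and tuple.\<close>

primrec gname :: "nat \<Rightarrow> nat list \<Rightarrow> garg \<Rightarrow> nat list" where
  "gname R t (GC c) = [0, c]"
| "gname R t (GE k j) = [1, k, t ! j]"
| "gname R t (GW k) = 2 # k # R # t"

text \<open>Constants \<open>cs\<close> with atoms \<open>ca\<close>; \<open>ne\<close> copies of
  each element with atoms \<open>ea\<close>, written for a tuple with one entry, whence the index 0
  in \<open>GE k 0\<close>; \<open>nw R\<close> witnesses and atoms \<open>ta R\<close> for each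
  tuple of \<open>R\<close>. None of these data depends on the instance, which makes the new
  structure linear in size.\<close>

locale gadget =
  fixes L L' :: vocabulary
    and cs :: "nat list" and ca :: "(nat \<times> garg list) list"
    and ne :: nat and ea :: "(nat \<times> garg list) list"
    and nw :: "nat \<Rightarrow> nat" and ta :: "nat \<Rightarrow> (nat \<times> garg list) list"
  assumes finL: "finite (dom L)"
    and ca: "\<And>S args. (S, args) \<in> set ca \<Longrightarrow> L S = Some (length args) \<and> set args \<subseteq> GC ` set cs"
    and ea: "\<And>S args. (S, args) \<in> set ea \<Longrightarrow> L S = Some (length args) \<and> set args \<subseteq> GC ` set cs \<union> {GE k 0 |k. k < ne}"
    and ta: "\<And>R r S args. L' R = Some r \<Longrightarrow> (S, args) \<in> set (ta R) \<Longrightarrow>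
      L S = Some (length args) \<and> set args \<subseteq> GC ` set cs \<union> {GE k j |k j. k < ne \<and> j < r} \<union> GW ` {..<nw R}"
begin

definition names :: "nat struct \<Rightarrow> nat list set" where
  "names A = {[0, c] |c. c \<in> set cs} \<union> {[1, k, a] |k a. k < ne \<and> a \<in> univ A} \<union>
     {2 # k # R # t |k R t. R \<in> dom L' \<and> t \<in> rel A R \<and> k < nw R}"

definition atoms :: "nat struct \<Rightarrow> (nat \<times> nat list list) set" where
  "atoms A = {(S, map (gname 0 []) args) |S args. (S, args) \<in> set ca} \<union>
     {(S, map (gname 0 [a]) args) |S args a. a \<in> univ A \<and> (S, args) \<in> set ea} \<union>
     {(S, map (gname R t) args) |S args R t. R \<in> dom L' \<and> t \<in> rel A R \<and> (S, args) \<in> set (ta R)}"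

definition build :: "nat struct \<Rightarrow> nat struct" where
  "build A = \<lparr>univ = name ` names A, rel = (\<lambda>S. {map name ns |ns. (S, ns) \<in> atoms A})\<rparr>"

context
  fixes A :: "nat struct"
  assumes A: "fin_struct L' A"
begin

lemma atoms_wf: "(S, ns) \<in> atoms A \<Longrightarrow> L S = Some (length ns) \<and> set ns \<subseteq> names A"
proof -
  assume "(S, ns) \<in> atoms A"
  then consider args where "(S, args) \<in> set ca" "ns = map (gname 0 []) args"
    | args a where "a \<in> univ A" "(S, args) \<in> set ea" "ns = map (gname 0 [a]) args"
    | args R t where "R \<in> dom L'" "t \<in> rel A R" "(S, args) \<in> set (ta R)" "ns = map (gname R t) args"
    unfolding atoms_def by blast
  then show ?thesis
  proof cases
    case 1
    then show ?thesis using ca[OF 1(1)] by (auto simp: names_def)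
  next
    case 2
    then show ?thesis using ea[OF 2(2)] by (auto simp: names_def)
  next
    case 3
    have t: "L' R = Some (length t)" "set t \<subseteq> univ A" using fin_struct_relD[OF A 3(2)] by simp_all
    note wf = ta[OF t(1) 3(3)]
    have "gname R t g \<in> names A" if g: "g \<in> set args" for g
    proof -
      have "g \<in> GC ` set cs \<union> {GE k j |k j. k < ne \<and> j < length t} \<union> GW ` {..<nw R}" using wf g by blast
      then consider c where "c \<in> set cs" "g = GC c" | k j where "k < ne" "j < length t" "g = GE k j" | k where "k < nw R" "g = GW k"
        by blast
      then show ?thesis
      proof cases
        case 2
        then have "t ! j \<in> univ A" using t(2) by auto
        with 2 show ?thesis by (auto simp: names_def)
      qed (use 3(1,2) in \<open>auto simp: names_def\<close>)
    qed
    then show ?thesis using 3(4) wf by auto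
  qed
qed

lemma names_finite:
  "finite (names A)" "card (names A) \<le> length cs + ne * card (univ A) + (\<Sum>R\<in>dom L'. nw R * card (rel A R))"
proof -
  let ?X = "(\<lambda>c. [0, c]) ` set cs" and ?Y = "(\<lambda>(k, a). [1, k, a]) ` ({..<ne} \<times> univ A)"
    and ?Z = "\<Union>R\<in>dom L'. (\<lambda>(k, t). 2 # k # R # t) ` ({..<nw R} \<times> rel A R)"
  note fin = fin_struct_finite[OF A] finite_rel[OF A]
  have e: "names A \<subseteq> ?X \<union> ?Y \<union> ?Z"
  proof
    fix x assume "x \<in> names A"
    then consider c where "c \<in> set cs" "x = [0, c]" | k a where "k < ne" "a \<in> univ A" "x = [1, k, a]"
      | k R t where "R \<in> dom L'" "t \<in> rel A R" "k < nw R" "x = 2 # k # R # t" unfolding names_def by blast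
    then show "x \<in> ?X \<union> ?Y \<union> ?Z"
    proof cases
      case 2
      then have "x \<in> ?Y" by (intro image_eqI[of _ _ "(k, a)"]) auto
      then show ?thesis by blast
    next
      case 3
      then have "x \<in> ?Z" by (intro UN_I[of R] image_eqI[of _ _ "(k, t)"]) auto
      then show ?thesis by blast
    qed blast
  qed
  have f: "finite (?X \<union> ?Y \<union> ?Z)" using fin by auto
  show "finite (names A)" by (rule finite_subset[OF e f])
  have "card ?X \<le> length cs" by (rule order.trans[OF card_image_le]) (auto simp: card_length)
  moreover have "card ?Y \<le> ne * card (univ A)"
    by (rule order.trans[OF card_image_le]) (use fin in \<open>auto simp: card_cartesian_product\<close>)
  moreover have "card ?Z \<le> (\<Sum>R\<in>dom L'. nw R * card (rel A R))"
  proof (rule order.trans[OF card_UN_le[OF fin(1)] sum_mono])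
    fix R
    show "card ((\<lambda>(k, t). 2 # k # R # t) ` ({..<nw R} \<times> rel A R)) \<le> nw R * card (rel A R)"
      by (rule order.trans[OF card_image_le]) (use fin in \<open>auto simp: card_cartesian_product\<close>)
  qed
  moreover have "card (names A) \<le> card ?X + card ?Y + card ?Z"
    using card_mono[OF f e] card_Un_le[of "?X \<union> ?Y" ?Z] card_Un_le[of ?X ?Y] by linarith
  ultimately show "card (names A) \<le> length cs + ne * card (univ A) + (\<Sum>R\<in>dom L'. nw R * card (rel A R))"
    by linarith
qed

lemma atoms_finite:
  "finite (atoms A)" "card (atoms A) \<le> length ca + length ea * card (univ A) + (\<Sum>R\<in>dom L'. length (ta R) * card (rel A R))"
proof -
  let ?X = "(\<lambda>(S, args). (S, map (gname 0 []) args)) ` set ca"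
    and ?Y = "(\<lambda>((S, args), a). (S, map (gname 0 [a]) args)) ` (set ea \<times> univ A)"
    and ?Z = "\<Union>R\<in>dom L'. (\<lambda>((S, args), t). (S, map (gname R t) args)) ` (set (ta R) \<times> rel A R)"
  note fin = fin_struct_finite[OF A] finite_rel[OF A]
  have e: "atoms A \<subseteq> ?X \<union> ?Y \<union> ?Z"
  proof
    fix x assume "x \<in> atoms A"
    then consider S args where "(S, args) \<in> set ca" "x = (S, map (gname 0 []) args)"
      | S args a where "a \<in> univ A" "(S, args) \<in> set ea" "x = (S, map (gname 0 [a]) args)"
      | S args R t where "R \<in> dom L'" "t \<in> rel A R" "(S, args) \<in> set (ta R)" "x = (S, map (gname R t) args)"
      unfolding atoms_def by blast
    then show "x \<in> ?X \<union> ?Y \<union> ?Z"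
    proof cases
      case 1
      then have "x \<in> ?X" by (intro image_eqI[of _ _ "(S, args)"]) auto
      then show ?thesis by blast
    next
      case 2
      then have "x \<in> ?Y" by (intro image_eqI[of _ _ "((S, args), a)"]) auto
      then show ?thesis by blast
    next
      case 3
      then have "x \<in> ?Z" by (intro UN_I[of R] image_eqI[of _ _ "((S, args), t)"]) auto
      then show ?thesis by blast
    qed
  qed
  have f: "finite (?X \<union> ?Y \<union> ?Z)" using fin by auto
  show "finite (atoms A)" by (rule finite_subset[OF e f])
  have "card ?X \<le> length ca" by (rule order.trans[OF card_image_le]) (auto simp: card_length)
  moreover have "card ?Y \<le> length ea * card (univ A)"
    by (rule order.trans[OF card_image_le]) (use fin card_length[of ea] in \<open>auto simp: card_cartesian_product intro: mult_right_mono\<close>)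
  moreover have "card ?Z \<le> (\<Sum>R\<in>dom L'. length (ta R) * card (rel A R))"
  proof (rule order.trans[OF card_UN_le[OF fin(1)] sum_mono])
    fix R
    show "card ((\<lambda>((S, args), t). (S, map (gname R t) args)) ` (set (ta R) \<times> rel A R)) \<le> length (ta R) * card (rel A R)"
      by (rule order.trans[OF card_image_le]) (use fin card_length[of "ta R"] in \<open>auto simp: card_cartesian_product intro: mult_right_mono\<close>)
  qed
  moreover have "card (atoms A) \<le> card ?X + card ?Y + card ?Z"
    using card_mono[OF f e] card_Un_le[of "?X \<union> ?Y" ?Z] card_Un_le[of ?X ?Y] by linarith
  ultimately show "card (atoms A) \<le> length ca + length ea * card (univ A) + (\<Sum>R\<in>dom L'. length (ta R) * card (rel A R))"
    by linarith
qed

lemma fin_build: "fin_struct L (build A)"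
proof (rule fin_structI)
  show "finite (univ (build A))" using names_finite by (simp add: build_def)
  fix S t assume "t \<in> rel (build A) S"
  then obtain ns where "(S, ns) \<in> atoms A" "t = map name ns" by (auto simp: build_def)
  with atoms_wf[OF this(1)] show "L S = Some (length t) \<and> set t \<subseteq> univ (build A)" by (auto simp: build_def)
qed (rule finL)

lemma size_build:
  "struct_size L (build A) \<le> (ne + length ea + (\<Sum>R\<in>dom L'. nw R + length (ta R))) * struct_size L' A + (length cs + length ca)"
proof -
  have fin: "finite (dom L')" by (rule fin_struct_finite[OF A])
  have 1: "card (univ (build A)) \<le> card (names A)"
    using names_finite(1) by (simp add: build_def card_image_le)
  have fa: "finite {ns. (S, ns) \<in> atoms A}" for S
    by (rule finite_subset[OF _ finite_imageI[OF atoms_finite(1), of snd]]) force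
  have "(\<Sum>S\<in>dom L. card (rel (build A) S)) \<le> (\<Sum>S\<in>dom L. card {ns. (S, ns) \<in> atoms A})"
  proof (rule sum_mono)
    fix S
    have "rel (build A) S = map name ` {ns. (S, ns) \<in> atoms A}" by (auto simp: build_def)
    then show "card (rel (build A) S) \<le> card {ns. (S, ns) \<in> atoms A}" using fa by (simp add: card_image_le)
  qed
  also have "\<dots> = card (Sigma (dom L) (\<lambda>S. {ns. (S, ns) \<in> atoms A}))"
    by (rule card_SigmaI[symmetric, OF finL]) (simp add: fa)
  also have "\<dots> \<le> card (atoms A)" by (rule card_mono[OF atoms_finite(1)]) auto
  finally have 2: "(\<Sum>S\<in>dom L. card (rel (build A) S)) \<le> card (atoms A)" .
  have 3: "(\<Sum>R\<in>dom L'. v R * card (rel A R)) \<le> (\<Sum>R\<in>dom L'. v R) * (\<Sum>R\<in>dom L'. card (rel A R))" for v :: "nat \<Rightarrow> nat"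
  proof -
    have "(\<Sum>R\<in>dom L'. v R * card (rel A R)) \<le> (\<Sum>R\<in>dom L'. (\<Sum>R\<in>dom L'. v R) * card (rel A R))"
      using fin by (intro sum_mono mult_right_mono member_le_sum) auto
    then show ?thesis by (simp add: sum_distrib_left)
  qed
  define U T where "U = card (univ A)" and "T = (\<Sum>R\<in>dom L'. card (rel A R))"
  define nW nT where "nW = (\<Sum>R\<in>dom L'. nw R)" and "nT = (\<Sum>R\<in>dom L'. length (ta R))"
  have "struct_size L (build A) \<le> (length cs + ne * U + nW * T) + (length ca + length ea * U + nT * T)"
    unfolding struct_size_def U_def T_def nW_def nT_def using 1 2 names_finite(2) atoms_finite(2) 3[of nw] 3[of "\<lambda>R. length (ta R)"] by linarith
  also have "\<dots> \<le> (ne + length ea + (nW + nT)) * (U + T) + (length cs + length ca)" by (simp add: algebra_simps)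
  finally show ?thesis unfolding struct_size_def U_def T_def nW_def nT_def by (simp add: sum.distrib)
qed

end

end

text \<open>
  The values \<open>vc\<close>, \<open>ve\<close>, \<open>vw\<close> of the new elements turn homomorphisms to \<open>B'\<close> into homomorphisms to \<open>B\<close>.
\<close>

primrec gsem :: "(nat \<Rightarrow> nat) \<Rightarrow> (nat \<Rightarrow> nat \<Rightarrow> nat) \<Rightarrow> (nat \<Rightarrow> nat \<Rightarrow> nat list \<Rightarrow> nat) \<Rightarrow> nat \<Rightarrow> nat list \<Rightarrow> garg \<Rightarrow> nat" where
  "gsem vc ve vw R bs (GC c) = vc c"
| "gsem vc ve vw R bs (GE k j) = ve k (bs ! j)"
| "gsem vc ve vw R bs (GW k) = vw R k bs"

text \<open>Values are prescribed for one element or one tuple at a time, as the local simulation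
  requires. The converse \<open>conv\<close> asserts mere existence, since no refutation is
  transferred along it.\<close>

locale gadget_reduction = gadget +
  fixes B B' :: "nat struct" and vc :: "nat \<Rightarrow> nat" and ve :: "nat \<Rightarrow> nat \<Rightarrow> nat" and vw :: "nat \<Rightarrow> nat \<Rightarrow> nat list \<Rightarrow> nat"
  assumes B: "fin_struct L B" and B': "fin_struct L' B'"
    and vc: "\<And>c. c \<in> set cs \<Longrightarrow> vc c \<in> univ B"
    and ve: "\<And>k b. k < ne \<Longrightarrow> b \<in> univ B' \<Longrightarrow> ve k b \<in> univ B"
    and vw: "\<And>R k bs. k < nw R \<Longrightarrow> bs \<in> rel B' R \<Longrightarrow> vw R k bs \<in> univ B"
    and rc: "\<And>S args. (S, args) \<in> set ca \<Longrightarrow> map (gsem vc ve vw 0 []) args \<in> rel B S"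
    and re: "\<And>S args b. (S, args) \<in> set ea \<Longrightarrow> b \<in> univ B' \<Longrightarrow> map (gsem vc ve vw 0 [b]) args \<in> rel B S"
    and rt: "\<And>S args R bs. (S, args) \<in> set (ta R) \<Longrightarrow> bs \<in> rel B' R \<Longrightarrow> map (gsem vc ve vw R bs) args \<in> rel B S"
    and conv: "\<And>A. fin_struct L' A \<Longrightarrow> maps_to (build A) B \<Longrightarrow> maps_to A B'"
begin

definition nvars :: "nat list \<Rightarrow> nat fset" where
  "nvars xs = (if hd xs = 0 then {||} else if hd xs = 1 then {|xs ! 2|} else fset_of_list (drop 3 xs))"

definition nval :: "nat list \<Rightarrow> (nat \<Rightarrow> nat) \<Rightarrow> nat" where
  "nval xs h = (if hd xs = 0 then vc (xs ! 1) else if hd xs = 1 then ve (xs ! 1) (h (xs ! 2))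
     else vw (xs ! 2) (xs ! 1) (map h (drop 3 xs)))"

definition unname :: "nat \<Rightarrow> nat list" where "unname x = (SOME xs. name xs = x)"

lemma unname_name [simp]: "unname (name xs) = xs"
  unfolding unname_def by simp

lemma nval_simps [simp]: "nval [0, c] h = vc c" "nval [Suc 0, k, a] h = ve k (h a)" "nval (2 # k # R # t) h = vw R k (map h t)"
  by (simp_all add: nval_def numeral_2_eq_2 numeral_3_eq_3)

lemma nvars_simps [simp]: "nvars [0, c] = {||}" "nvars [Suc 0, k, a] = {|a|}" "nvars (2 # k # R # t) = fset_of_list t"
  by (simp_all add: nvars_def numeral_2_eq_2 numeral_3_eq_3)

lemma nval_cong: "(\<And>a. a |\<in>| nvars xs \<Longrightarrow> h a = h' a) \<Longrightarrow> nval xs h = nval xs h'"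
  unfolding nval_def nvars_def by (auto simp: fset_of_list.rep_eq cong: map_cong split: if_splits)

lemma nval_gname: "g \<in> set args \<Longrightarrow> (\<And>k j. GE k j \<in> set args \<Longrightarrow> j < length t) \<Longrightarrow> nval (gname R t g) h = gsem vc ve vw R (map h t) g"
  by (cases g) auto

text \<open>Every element and every atom of the new structure stems from the constants, from one
  element or from one tuple of \<open>A\<close>, and the entries of the latter serve as
  \<open>D\<close>.\<close>

lemma local_conditions:
  assumes A: "fin_struct L' A"
  shows "xs \<in> names A \<Longrightarrow> \<exists>D. fset D \<subseteq> univ A \<and> (D = {||} \<or> (\<exists>a. D = {|a|}) \<or> (\<exists>R t. t \<in> rel A R \<and> D = fset_of_list t)) \<and>
      nvars xs |\<subseteq>| D \<and> (\<forall>h. (\<forall>a. a |\<in>| D \<longrightarrow> h a \<in> univ B') \<longrightarrow>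
        (\<forall>R t. t \<in> rel A R \<longrightarrow> set t \<subseteq> fset D \<longrightarrow> map h t \<in> rel B' R) \<longrightarrow> nval xs h \<in> univ B)" (is "_ \<Longrightarrow> ?T1")
    and "(S, ns) \<in> atoms A \<Longrightarrow> \<exists>D. fset D \<subseteq> univ A \<and> (D = {||} \<or> (\<exists>a. D = {|a|}) \<or> (\<exists>R t. t \<in> rel A R \<and> D = fset_of_list t)) \<and>
      (\<forall>n\<in>set ns. nvars n |\<subseteq>| D) \<and> (\<forall>h. (\<forall>a. a |\<in>| D \<longrightarrow> h a \<in> univ B') \<longrightarrow>
        (\<forall>R t. t \<in> rel A R \<longrightarrow> set t \<subseteq> fset D \<longrightarrow> map h t \<in> rel B' R) \<longrightarrow> map (\<lambda>n. nval n h) ns \<in> rel B S)" (is "_ \<Longrightarrow> ?T2")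
proof -
  assume "xs \<in> names A"
  then consider c where "c \<in> set cs" "xs = [0, c]" | k a where "k < ne" "a \<in> univ A" "xs = [1, k, a]"
    | k R t where "t \<in> rel A R" "k < nw R" "xs = 2 # k # R # t" unfolding names_def by blast
  then show ?T1
  proof cases
    case 1
    then show ?thesis by (intro exI[of _ "{||}"]) (simp add: vc)
  next
    case 2
    then show ?thesis by (intro exI[of _ "{|a|}"]) (simp add: ve)
  next
    case 3
    have "set t \<subseteq> univ A" using fin_struct_relD[OF A 3(1)] by simp
    then show ?thesis using 3
      by (intro exI[of _ "fset_of_list t"]) (auto simp: fset_of_list.rep_eq intro!: vw)
  qed
next
  assume at: "(S, ns) \<in> atoms A"
  then consider args where "(S, args) \<in> set ca" "ns = map (gname 0 []) args"
    | args a where "a \<in> univ A" "(S, args) \<in> set ea" "ns = map (gname 0 [a]) args"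
    | args R t where "R \<in> dom L'" "t \<in> rel A R" "(S, args) \<in> set (ta R)" "ns = map (gname R t) args"
    unfolding atoms_def by blast
  then show ?T2
  proof cases
    case 1
    have "map (\<lambda>n. nval n h) ns = map (gsem vc ve vw 0 []) args" for h
      unfolding 1(2) map_map comp_def by (rule map_cong[OF refl]) (use ca[OF 1(1)] nval_gname[of _ args "[]" 0 h] in auto)
    moreover have "\<forall>n\<in>set ns. nvars n |\<subseteq>| {||}" using ca[OF 1(1)] 1(2) by auto
    ultimately show ?thesis using rc[OF 1(1)] by (intro exI[of _ "{||}"]) auto
  next
    case 2
    have "map (\<lambda>n. nval n h) ns = map (gsem vc ve vw 0 [h a]) args" for h
      unfolding 2(3) map_map comp_def by (rule map_cong[OF refl]) (use ea[OF 2(2)] nval_gname[of _ args "[a]" 0 h] in auto)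
    moreover have "\<forall>n\<in>set ns. nvars n |\<subseteq>| {|a|}" using ea[OF 2(2)] 2(3) by auto
    ultimately show ?thesis using re[OF 2(2)] 2(1) by (intro exI[of _ "{|a|}"]) auto
  next
    case 3
    have t: "L' R = Some (length t)" "set t \<subseteq> univ A" using fin_struct_relD[OF A 3(2)] by simp_all
    note wf = ta[OF t(1) 3(3)]
    have "map (\<lambda>n. nval n h) ns = map (gsem vc ve vw R (map h t)) args" for h
      unfolding 3(4) map_map comp_def by (rule map_cong[OF refl]) (use wf nval_gname[of _ args t R h] in auto)
    moreover have "\<forall>n\<in>set ns. nvars n |\<subseteq>| fset_of_list t"
      using wf 3(4) by (fastforce simp: fset_of_list.rep_eq)
    ultimately show ?thesis using rt[OF 3(3)] 3(2) t(2)
      by (intro exI[of _ "fset_of_list t"]) (auto simp: fset_of_list.rep_eq)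
  qed
qed

lemma maps_to_build: assumes A: "fin_struct L' A" shows "maps_to (build A) B \<longleftrightarrow> maps_to A B'"
proof
  assume "maps_to A B'"
  then obtain h where h: "is_hom h A B'" unfolding maps_to_def by blast
  have hu: "h a \<in> univ B'" if "a \<in> univ A" for a using h that by (auto simp: is_hom_def)
  have hr: "map h t \<in> rel B' R" if "t \<in> rel A R" for R t using h that by (auto simp: is_hom_def)
  have "is_hom (\<lambda>x. nval (unname x) h) (build A) B" unfolding is_hom_def
  proof (intro conjI allI ballI)
    have "nval xs h \<in> univ B" if "xs \<in> names A" for xs
      using local_conditions(1)[OF A that] hu hr by blast
    then show "(\<lambda>x. nval (unname x) h) ` univ (build A) \<subseteq> univ B" by (auto simp: build_def)
    fix S t assume "t \<in> rel (build A) S"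
    then obtain ns where ns: "(S, ns) \<in> atoms A" "t = map name ns" by (auto simp: build_def)
    have "map (\<lambda>n. nval n h) ns \<in> rel B S" using local_conditions(2)[OF A ns(1)] hu hr by blast
    then show "map (\<lambda>x. nval (unname x) h) t \<in> rel B S" by (simp add: ns(2) comp_def)
  qed
  then show "maps_to (build A) B" unfolding maps_to_def by blast
qed (rule conv[OF A])

lemma local_simulation_build:
  assumes A: "fin_struct L' A" and m: "\<And>R r. L' R = Some r \<Longrightarrow> r \<le> m" "1 \<le> m"
  shows "local_simulation B B' m (build A) A {} (\<lambda>x. nvars (unname x)) (\<lambda>x. nval (unname x))"
proof -
  have card: "fcard D \<le> m" if "D = {||} \<or> (\<exists>a. D = {|a|}) \<or> (\<exists>R t. t \<in> rel A R \<and> D = fset_of_list t)" for D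
  proof -
    have "fcard (fset_of_list t) \<le> m" if t: "t \<in> rel A R" for R t
    proof -
      have "L' R = Some (length t)" using fin_struct_relD[OF A t] by simp
      then show ?thesis using m(1) card_length[of t] by (force simp: fcard.rep_eq fset_of_list.rep_eq)
    qed
    then show ?thesis using that m(2) by auto
  qed
  have D1: "\<exists>D. fset D \<subseteq> univ A \<and> fcard D \<le> m \<and> nvars xs |\<subseteq>| D \<and> (\<forall>h. compatible A B' {} D h \<longrightarrow> nval xs h \<in> univ B)"
    if "xs \<in> names A" for xs
  proof -
    from local_conditions(1)[OF A that] obtain D where "fset D \<subseteq> univ A" "nvars xs |\<subseteq>| D"
      "D = {||} \<or> (\<exists>a. D = {|a|}) \<or> (\<exists>R t. t \<in> rel A R \<and> D = fset_of_list t)"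
      and v: "\<forall>h. (\<forall>a. a |\<in>| D \<longrightarrow> h a \<in> univ B') \<longrightarrow>
        (\<forall>R t. t \<in> rel A R \<longrightarrow> set t \<subseteq> fset D \<longrightarrow> map h t \<in> rel B' R) \<longrightarrow> nval xs h \<in> univ B"
      by (elim exE conjE) (rule that; assumption)
    then show ?thesis using card[of D]
      by (intro exI[of _ D] conjI allI impI v[rule_format]) (auto simp: compatible_def)
  qed
  have D2: "\<exists>D. fset D \<subseteq> univ A \<and> fcard D \<le> m \<and> (\<forall>n\<in>set ns. nvars n |\<subseteq>| D) \<and>
    (\<forall>h. compatible A B' {} D h \<longrightarrow> map (\<lambda>n. nval n h) ns \<in> rel B S)" if "(S, ns) \<in> atoms A" for S ns
  proof -
    from local_conditions(2)[OF A that] obtain D where "fset D \<subseteq> univ A" "\<forall>n\<in>set ns. nvars n |\<subseteq>| D"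
      "D = {||} \<or> (\<exists>a. D = {|a|}) \<or> (\<exists>R t. t \<in> rel A R \<and> D = fset_of_list t)"
      and v: "\<forall>h. (\<forall>a. a |\<in>| D \<longrightarrow> h a \<in> univ B') \<longrightarrow>
        (\<forall>R t. t \<in> rel A R \<longrightarrow> set t \<subseteq> fset D \<longrightarrow> map h t \<in> rel B' R) \<longrightarrow> map (\<lambda>n. nval n h) ns \<in> rel B S"
      by (elim exE conjE) (rule that; assumption)
    then show ?thesis using card[of D]
      by (intro exI[of _ D] conjI allI impI v[rule_format]) (auto simp: compatible_def)
  qed
  show ?thesis unfolding local_simulation_def
  proof (intro conjI ballI allI impI)
    fix x assume "x \<in> univ (build A)"
    then obtain xs where xs: "xs \<in> names A" "x = name xs" by (auto simp: build_def)
    from D1[OF xs(1)] obtain D where D: "fset D \<subseteq> univ A" "fcard D \<le> m" "nvars xs |\<subseteq>| D"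
      "\<forall>h. compatible A B' {} D h \<longrightarrow> nval xs h \<in> univ B" by blast
    then show "\<exists>D. fset D \<subseteq> univ A \<and> fcard D \<le> m \<and> nvars (unname x) |\<subseteq>| D \<and>
      (\<forall>h. compatible A B' {} D h \<longrightarrow> nval (unname x) h \<in> univ B)" using xs(2) by auto
    show "fset (nvars (unname x)) \<subseteq> univ A" using D xs(2) by (auto simp: less_eq_fset.rep_eq)
    show "fcard (nvars (unname x)) \<le> m" using D xs(2) fcard_mono[OF D(3)] by simp
  next
    fix x and h h' :: "nat \<Rightarrow> nat" assume "\<forall>a. a |\<in>| nvars (unname x) \<longrightarrow> h a = h' a"
    then show "nval (unname x) h = nval (unname x) h'" by (intro nval_cong) blast
  next
    fix S t assume "t \<in> rel (build A) S"
    then obtain ns where ns: "(S, ns) \<in> atoms A" "t = map name ns" by (auto simp: build_def)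
    from D2[OF ns(1)] show "\<exists>D. fset D \<subseteq> univ A \<and> fcard D \<le> m \<and> (\<forall>x\<in>set t. nvars (unname x) |\<subseteq>| D) \<and>
      (\<forall>h. compatible A B' {} D h \<longrightarrow> map (\<lambda>x. nval (unname x) h) t \<in> rel B S)"
      by (simp add: ns(2) comp_def)
  qed
qed

lemma transfer_build:
  assumes E: "encoding_scheme L B E" "local_scheme L E" and E': "encoding_scheme L' B' E'" "local_scheme L' E'"
  shows "refutation_transfer L' E E' build"
proof -
  define m where "m = Max (insert 1 (ran L \<union> ran L'))"
  have fin: "finite (ran L \<union> ran L')"
    using finite_ran fin_struct_finite(1)[OF B] fin_struct_finite(1)[OF B'] by blast
  have m: "n \<le> m" if "n \<in> insert 1 (ran L \<union> ran L')" for n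
    unfolding m_def using that fin by (intro Max_ge) auto
  have ar: "\<forall>R n. L R = Some n \<longrightarrow> n \<le> m" using m by (auto intro: ranI)
  have ar': "n \<le> m" if "L' R = Some n" for R n using m that by (auto intro: ranI)
  have m1: "1 \<le> m" using m by blast
  obtain c b where c: "1 \<le> c" and tr: "\<forall>As A \<Delta> N val \<rho>0 t k s \<pi>.
    fin_struct L As \<and> fin_struct L' A \<and> local_simulation B B' m As A \<Delta> N val \<and> 1 \<le> k \<and>
    bounded_refutation (E As) (Suc t) k s \<pi> \<and> frege_proof (clause_fm ` E' A) \<rho>0 \<and>
    (\<forall>G\<in>set \<rho>0. Sigma_fm (Suc t) 1 G) \<and> proof_size \<rho>0 \<le> (1 * (struct_size L' A + 1)) ^ 1 \<and>
    clause_fm ` \<Delta> \<subseteq> set \<rho>0 \<longrightarrow>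
    (\<exists>\<pi>' s'. bounded_refutation (E' A) (Suc t) (c * k) s' \<pi>' \<and> s' \<le> size_bound b k s (struct_size L' A))"
    using local_simulation_transfer[OF E E' B fin_struct_finite(2)[OF B'] ar, where a = 1] by (elim exE conjE) (rule that; assumption)
  have "\<exists>\<pi>' s'. bounded_refutation (E' A) t (c * k) s' \<pi>' \<and> s' \<le> size_bound b k s (struct_size L' A)"
    if A: "fin_struct L' A" and t: "1 \<le> t" and k: "1 \<le> k" and \<pi>: "bounded_refutation (E (build A)) t k s \<pi>" for A t k s \<pi>
  proof -
    obtain t' where t': "t = Suc t'" using t by (cases t) auto
    have "frege_proof (clause_fm ` E' A) []" "\<forall>G\<in>set []. Sigma_fm (Suc t') 1 G" "proof_size [] \<le> (1 * (struct_size L' A + 1)) ^ 1"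
      "clause_fm ` {} \<subseteq> set []" by (simp_all add: frege_proof_def proof_size_def)
    note triv = this
    show ?thesis unfolding t'
      by (rule tr[THEN spec[of _ "build A"], THEN spec[of _ A], THEN spec[of _ "{}"], THEN spec[of _ "\<lambda>x. nvars (unname x)"],
          THEN spec[of _ "\<lambda>x. nval (unname x)"], THEN spec[of _ "[]"], THEN spec[of _ t'], THEN spec[of _ k], THEN spec[of _ s], THEN spec[of _ \<pi>], THEN mp])
        (intro conjI fin_build[OF A] A local_simulation_build[OF A ar' m1] k \<pi>[unfolded t'] triv)
  qed
  with c show ?thesis unfolding refutation_transfer_def by (intro exI[of _ c] conjI exI[of _ b]) blast+
qed

lemma reduces_build:
  assumes "pt_map L' L build" shows "reduces (L', B') (L, B)"
  unfolding reduces_def prod.case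
proof (intro exI[of _ build] conjI allI impI assms)
  show "\<exists>c d. \<forall>A. fin_struct L' A \<longrightarrow> struct_size L (build A) \<le> c * struct_size L' A + d"
    using size_build by blast
qed (use fin_build maps_to_build transfer_build in auto)

end

section \<open>Computing with codes of structures\<close>

type_synonym listing = "symb list list \<times> (symb list \<times> symb list list) list"

definition unparse :: "listing \<Rightarrow> symb list" where
  "unparse z = concat (map (\<lambda>a. Elt # a) (fst z)) @
     concat (map (\<lambda>y. Tup # fst y @ concat (map (\<lambda>a. Arg # a) (snd y))) (snd z))"

lemma ptime_unparse [ptime_intros]: "ptime f \<Longrightarrow> ptime (\<lambda>x. unparse (f x))"
  by (rule ptime_comp[where f = unparse]) (unfold unparse_def, intro ptime_intros, assumption)

text \<open>
  Words are parsed from the right. The state consists of the current number, the current arguments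
  and the elements and tuples read so far.
\<close>

definition parse_step :: "symb list \<times> symb list list \<times> listing \<Rightarrow> symb \<Rightarrow> symb list \<times> symb list list \<times> listing" where
  "parse_step s y =
    (if y = Elt then ([], [], fst s # fst (snd (snd s)), snd (snd (snd s)))
     else if y = Tup then ([], [], fst (snd (snd s)), (fst s, fst (snd s)) # snd (snd (snd s)))
     else if y = Arg then ([], fst s # fst (snd s), snd (snd s))
     else (y # fst s, snd s))"

definition parse :: "symb list \<Rightarrow> listing" where
  "parse w = snd (snd (foldl parse_step ([], [], [], []) (rev w)))"

lemma ptime_parse [ptime_intros]: "ptime l \<Longrightarrow> ptime (\<lambda>x. parse (l x))"
proof (rule ptime_comp[where f = parse])
  show "ptime parse" unfolding parse_def
  proof (intro ptime_intros ptime_foldl_add[where r = "[:8:]"])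
    show "ptime (\<lambda>p. parse_step (fst (snd p)) (snd (snd p)))"
      unfolding parse_step_def by (intro ptime_intros)
    show "esz (parse_step c y) \<le> esz c + poly [:8:] (esz w)" for c y and w :: "symb list"
      using esz_symb[of y] by (cases c) (auto simp: parse_step_def)
  qed
qed

definition bits_tuple :: "nat \<times> nat list \<Rightarrow> symb list \<times> symb list list" where
  "bits_tuple y = (bits (fst y), map bits (snd y))"

lemma inj_bits: "inj bits"
  by (simp add: inj_def)

lemma inj_bits_tuple: "inj bits_tuple"
  by (auto simp: inj_def bits_tuple_def prod_eq_iff dest: inj_map_eq_map[OF inj_bits, THEN iffD1])

lemma unparse_code:
  "concat (map code_elt es) @ concat (map code_tuple ts) = unparse (map bits es, map bits_tuple ts)"
  by (simp add: unparse_def code_elt_def[abs_def] code_tuple_def bits_tuple_def comp_def case_prod_unfold)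

lemma parse_unparse:
  assumes "\<And>a. a \<in> set es \<Longrightarrow> set a \<subseteq> {Zero, One}"
    and "\<And>R t. (R, t) \<in> set ts \<Longrightarrow> set R \<subseteq> {Zero, One} \<and> (\<forall>a\<in>set t. set a \<subseteq> {Zero, One})"
  shows "parse (unparse (es, ts)) = (es, ts)"
proof -
  let ?P = "\<lambda>w. foldr (\<lambda>y s. parse_step s y) w ([], [], [], [])"
  have number: "?P (a @ w) = (a @ c, s)" if "?P w = (c, s)" "set a \<subseteq> {Zero, One}" for a w c s
    using that by (induction a) (auto simp: parse_step_def)
  have args: "?P (concat (map (\<lambda>a. Arg # a) t) @ w) = ([], t, z)"
    if "?P w = ([], [], z)" "\<forall>a\<in>set t. set a \<subseteq> {Zero, One}" for t w z
    using that(2)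
  proof (induction t)
    case Nil
    then show ?case using that(1) by simp
  next
    case (Cons a t)
    then have "?P (concat (map (\<lambda>a. Arg # a) t) @ w) = ([], t, z)" by simp
    from number[OF this, of a] Cons.prems show ?case by (simp add: parse_step_def)
  qed
  have tuples: "?P (concat (map (\<lambda>y. Tup # fst y @ concat (map (\<lambda>a. Arg # a) (snd y))) ts)) = ([], [], [], ts)"
    using assms(2)
  proof (induction ts)
    case (Cons y ts)
    have "?P (concat (map (\<lambda>y. Tup # fst y @ concat (map (\<lambda>a. Arg # a) (snd y))) ts)) = ([], [], [], ts)"
      by (intro Cons.IH Cons.prems) simp
    from number[OF args[OF this, of "snd y"], of "fst y"] Cons.prems[of "fst y" "snd y"]
    show ?case by (simp add: parse_step_def)
  qed simp
  have "?P (unparse (es, ts)) = ([], [], es, ts)" unfolding unparse_def fst_conv snd_conv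
    using assms(1)
  proof (induction es)
    case Nil
    then show ?case using tuples by simp
  next
    case (Cons a es)
    from number[OF Cons.IH, of a] Cons.prems show ?case by (simp add: parse_step_def)
  qed
  then show ?thesis by (simp add: parse_def foldl_conv_foldr)
qed

definition tuple_set :: "vocabulary \<Rightarrow> nat struct \<Rightarrow> (nat \<times> nat list) set" where
  "tuple_set L A = {(R, t). R \<in> dom L \<and> t \<in> rel A R}"

text \<open>The lists that \<open>G\<close> returns have to be right as sets only: repetitions are
  removed afterwards, and the order is free in \<open>encodes\<close>.\<close>

lemma pt_mapI:
  fixes G :: "listing \<Rightarrow> listing"
  assumes G: "ptime G"
    and sem: "\<And>A es ts. fin_struct L A \<Longrightarrow> set es = bits ` univ A \<Longrightarrow> set ts = bits_tuple ` tuple_set L A \<Longrightarrow>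
      set (fst (G (es, ts))) = bits ` univ (F A) \<and> set (snd (G (es, ts))) = bits_tuple ` tuple_set L' (F A)"
  shows "pt_map L L' F"
proof -
  have inj: "\<exists>xs. distinct xs \<and> set xs = S \<and> dedup ys = map f xs" if "inj f" "set ys = f ` S" for f :: "'a \<Rightarrow> 'b" and S ys
  proof -
    have "dedup ys = map f (map (inv f) (dedup ys))"
      unfolding map_map by (rule map_idI[symmetric]) (use that in auto)
    moreover have "inj_on (inv f) (set (dedup ys))"
      using that by (auto intro!: inj_onI)
    ultimately show ?thesis using that
      by (intro exI[of _ "map (inv f) (dedup ys)"]) (auto simp: distinct_map image_image)
  qed
  define g where "g w = unparse (dedup (fst (G (parse w))), dedup (snd (G (parse w))))" for w
  have "ptime g" unfolding g_def
    by (intro ptime_intros ptime_comp[OF G])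
  moreover have "encodes L' (F A) (g w)" if A: "fin_struct L A" and w: "encodes L A w" for A w
  proof -
    obtain es ts where es: "set es = univ A" "set ts = tuple_set L A" "w = unparse (map bits es, map bits_tuple ts)"
      using w unfolding encodes_def tuple_set_def unparse_code by blast
    have p: "parse w = (map bits es, map bits_tuple ts)" unfolding es(3)
      by (rule parse_unparse) (auto simp: bits_tuple_def subset_iff dest: set_bits[THEN subsetD])
    have "set (fst (G (parse w))) = bits ` univ (F A) \<and> set (snd (G (parse w))) = bits_tuple ` tuple_set L' (F A)"
      unfolding p by (rule sem[OF A]) (use es in auto)
    note s = conjunct1[OF this] conjunct2[OF this]
    from inj[OF inj_bits s(1)] inj[OF inj_bits_tuple s(2)]
    obtain es' ts' where "distinct es'" "set es' = univ (F A)" "dedup (fst (G (parse w))) = map bits es'"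
      "distinct ts'" "set ts' = tuple_set L' (F A)" "dedup (snd (G (parse w))) = map bits_tuple ts'" by blast
    then show ?thesis unfolding encodes_def g_def unparse_code tuple_set_def by metis
  qed
  ultimately show ?thesis unfolding pt_map_def by blast
qed

lemma ptime_escape [ptime_intros]: "ptime l \<Longrightarrow> ptime (\<lambda>x. escape (l x))"
  by (rule ptime_comp[where f = escape]) (unfold escape_def, intro ptime_intros, assumption)

lemma ptime_name_bits [ptime_intros]: "ptime l \<Longrightarrow> ptime (\<lambda>x. name_bits (l x))"
  by (rule ptime_comp[where f = name_bits]) (unfold name_bits_def, intro ptime_intros, assumption)

lemma ptime_map_const:
  "(\<And>i. i \<in> set is \<Longrightarrow> ptime (f i)) \<Longrightarrow> ptime (\<lambda>x. map (\<lambda>i. f i x) is)"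
  by (induction "is") (auto intro!: ptime_intros)

lemma ptime_concat_map_const:
  "(\<And>i. i \<in> set is \<Longrightarrow> ptime (f i)) \<Longrightarrow> ptime (\<lambda>x. concat (map (\<lambda>i. f i x) is))"
  by (intro ptime_concat ptime_map_const)

definition hnth :: "'a \<Rightarrow> 'a list \<Rightarrow> nat \<Rightarrow> 'a" where "hnth d xs j = hdd d ((tl ^^ j) xs)"

lemma hnth_nth: "j < length xs \<Longrightarrow> hnth d xs j = xs ! j"
  by (induction j arbitrary: xs) (auto simp: hnth_def funpow_Suc_right nth_tl simp del: funpow.simps split: list.splits,
      (case_tac xs; simp add: hnth_def)+)

lemma ptime_hnth [ptime_intros]: "ptime l \<Longrightarrow> ptime (\<lambda>x. hnth d (l x) j)"
proof -
  have "ptime l \<Longrightarrow> ptime (\<lambda>x. (tl ^^ j) (l x))"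
    by (induction j) (auto intro: ptime_intros)
  then show "ptime l \<Longrightarrow> ptime (\<lambda>x. hnth d (l x) j)" unfolding hnth_def by (intro ptime_intros)
qed

primrec garg_bits :: "nat \<Rightarrow> symb list list \<Rightarrow> garg \<Rightarrow> symb list" where
  "garg_bits R t (GC c) = name_bits [bits 0, bits c]"
| "garg_bits R t (GE k j) = name_bits [bits 1, bits k, hnth [] t j]"
| "garg_bits R t (GW k) = name_bits (bits 2 # bits k # bits R # t)"

lemma ptime_garg_bits [ptime_intros]: "ptime l \<Longrightarrow> ptime (\<lambda>x. garg_bits R (l x) g)"
  by (cases g) (auto intro!: ptime_intros)

lemma garg_bits: "(\<And>k j. g = GE k j \<Longrightarrow> j < length t) \<Longrightarrow> garg_bits R (map bits t) g = bits (name (gname R t g))"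
  by (cases g) (auto simp: bits_name hnth_nth)

definition gatom_bits :: "nat \<Rightarrow> symb list list \<Rightarrow> nat \<times> garg list \<Rightarrow> symb list \<times> symb list list" where
  "gatom_bits R t y = (bits (fst y), map (garg_bits R t) (snd y))"

lemma ptime_gatom_bits [ptime_intros]: "ptime l \<Longrightarrow> ptime (\<lambda>x. gatom_bits R (l x) y)"
  unfolding gatom_bits_def by (intro ptime_intros ptime_map_const)

lemma gatom_bits: "(\<And>k j. GE k j \<in> set args \<Longrightarrow> j < length t) \<Longrightarrow>
    gatom_bits R (map bits t) (S, args) = bits_tuple (S, map name (map (gname R t) args))"
  unfolding gatom_bits_def bits_tuple_def by (auto intro!: garg_bits)

context gadget
begin

definition tuples_of :: "nat \<Rightarrow> listing \<Rightarrow> symb list list list" where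
  "tuples_of R z = map snd (filter (\<lambda>y. fst y = bits R) (snd z))"

lemma ptime_tuples_of: "ptime (tuples_of R)"
  unfolding tuples_of_def by (intro ptime_intros)

lemma set_tuples_of:
  "set (snd z) = bits_tuple ` tuple_set L' A \<Longrightarrow> R \<in> dom L' \<Longrightarrow> set (tuples_of R z) = map bits ` rel A R"
  by (force simp: tuples_of_def tuple_set_def bits_tuple_def image_iff)

definition names_listing :: "nat list \<Rightarrow> listing \<Rightarrow> symb list list" where
  "names_listing Rs z = map (\<lambda>c. name_bits [bits 0, bits c]) cs @
     concat (map (\<lambda>k. map (\<lambda>a. name_bits [bits 1, bits k, a]) (fst z)) [0..<ne]) @
     concat (map (\<lambda>R. concat (map (\<lambda>k. map (\<lambda>t. name_bits (bits 2 # bits k # bits R # t)) (tuples_of R z)) [0..<nw R])) Rs)"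

definition atoms_listing :: "nat list \<Rightarrow> listing \<Rightarrow> (symb list \<times> symb list list) list" where
  "atoms_listing Rs z = map (gatom_bits 0 []) ca @
     concat (map (\<lambda>y. map (\<lambda>a. gatom_bits 0 [a] y) (fst z)) ea) @
     concat (map (\<lambda>R. concat (map (\<lambda>y. map (\<lambda>t. gatom_bits R t y) (tuples_of R z)) (ta R))) Rs)"

lemma pt_map_build:
  assumes finL': "finite (dom L')" shows "pt_map L' L build"
proof -
  obtain Rs where Rs: "set Rs = dom L'" using finite_list[OF finL'] by blast
  show ?thesis
  proof (rule pt_mapI[where G = "\<lambda>z. (names_listing Rs z, atoms_listing Rs z)"])
    show "ptime (\<lambda>z. (names_listing Rs z, atoms_listing Rs z))"
      unfolding names_listing_def atoms_listing_def
      by (intro ptime_pair ptime_append ptime_const ptime_concat_map_const)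
        (intro ptime_intros ptime_tuples_of)+
  next
    fix A es ts
    assume A: "fin_struct L' A" and es: "set es = bits ` univ A" and ts: "set ts = bits_tuple ` tuple_set L' A"
    have tu: "set (tuples_of R (es, ts)) = map bits ` rel A R" if "R \<in> dom L'" for R
      using set_tuples_of[of "(es, ts)" A R] ts that by simp
    have "set (names_listing Rs (es, ts)) = (\<lambda>xs. bits (name xs)) ` names A"
    proof -
      have "(\<lambda>xs. bits (name xs)) ` names A = (\<lambda>c. name_bits [bits 0, bits c]) ` set cs \<union>
        (\<Union>k\<in>{..<ne}. (\<lambda>a. name_bits [bits 1, bits k, a]) ` bits ` univ A) \<union>
        (\<Union>R\<in>dom L'. \<Union>k\<in>{..<nw R}. (\<lambda>t. name_bits (bits 2 # bits k # bits R # t)) ` map bits ` rel A R)"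
        unfolding names_def image_Un by (intro arg_cong2[of _ _ _ _ "(\<union>)"]) (force simp: bits_name)+
      then show ?thesis using tu by (simp add: names_listing_def Rs es atLeast0LessThan Un_assoc)
    qed
    moreover have "set (atoms_listing Rs (es, ts)) = (\<lambda>(S, ns). bits_tuple (S, map name ns)) ` atoms A"
    proof -
      have 1: "set (map (gatom_bits 0 []) ca) = (\<lambda>(S, ns). bits_tuple (S, map name ns)) ` {(S, map (gname 0 []) args) |S args. (S, args) \<in> set ca}"
      proof -
        have "gatom_bits 0 [] (S, args) = bits_tuple (S, map name (map (gname 0 []) args))" if "(S, args) \<in> set ca" for S args
          using gatom_bits[of args "[]" 0 S] ca[OF that] by auto
        then show ?thesis by (force simp: image_iff)
      qed
      have 2: "(\<Union>y\<in>set ea. (\<lambda>a. gatom_bits 0 [a] y) ` bits ` univ A) = (\<lambda>(S, ns). bits_tuple (S, map name ns)) ` {(S, map (gname 0 [a]) args) |S args a. a \<in> univ A \<and> (S, args) \<in> set ea}"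
      proof -
        have "gatom_bits 0 [bits a] (S, args) = bits_tuple (S, map name (map (gname 0 [a]) args))" if "(S, args) \<in> set ea" for S args a
          using gatom_bits[of args "[a]" 0 S] ea[OF that] by auto
        then show ?thesis by (force simp: image_iff)
      qed
      have 3: "(\<Union>R\<in>dom L'. \<Union>y\<in>set (ta R). (\<lambda>t. gatom_bits R t y) ` map bits ` rel A R) =
        (\<lambda>(S, ns). bits_tuple (S, map name ns)) ` {(S, map (gname R t) args) |S args R t. R \<in> dom L' \<and> t \<in> rel A R \<and> (S, args) \<in> set (ta R)}"
      proof -
        have e: "gatom_bits R (map bits t) (S, args) = bits_tuple (S, map name (map (gname R t) args))"
          if "t \<in> rel A R" "(S, args) \<in> set (ta R)" for S args R t
        proof (rule gatom_bits)
          fix k j assume "GE k j \<in> set args"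
          moreover have "L' R = Some (length t)" using fin_struct_relD[OF A that(1)] by simp
          ultimately show "j < length t" using ta[OF _ that(2)] by force
        qed
        show ?thesis
        proof (intro equalityI subsetI)
          fix z assume "z \<in> (\<Union>R\<in>dom L'. \<Union>y\<in>set (ta R). (\<lambda>t. gatom_bits R t y) ` map bits ` rel A R)"
          then obtain R y t where "R \<in> dom L'" "y \<in> set (ta R)" "t \<in> rel A R" "z = gatom_bits R (map bits t) y" by blast
          moreover obtain S args where "y = (S, args)" by (cases y)
          ultimately have "R \<in> dom L'" "(S, args) \<in> set (ta R)" "t \<in> rel A R" "z = gatom_bits R (map bits t) (S, args)" by simp_all
          then show "z \<in> (\<lambda>(S, ns). bits_tuple (S, map name ns)) ` {(S, map (gname R t) args) |S args R t. R \<in> dom L' \<and> t \<in> rel A R \<and> (S, args) \<in> set (ta R)}"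
            by (intro image_eqI[of _ _ "(S, map (gname R t) args)"]) (auto simp: e)
        next
          fix z assume "z \<in> (\<lambda>(S, ns). bits_tuple (S, map name ns)) ` {(S, map (gname R t) args) |S args R t. R \<in> dom L' \<and> t \<in> rel A R \<and> (S, args) \<in> set (ta R)}"
          then obtain x where x: "x \<in> {(S, map (gname R t) args) |S args R t. R \<in> dom L' \<and> t \<in> rel A R \<and> (S, args) \<in> set (ta R)}"
            "z = (\<lambda>(S, ns). bits_tuple (S, map name ns)) x" by blast
          from x(1) obtain R S args t where "x = (S, map (gname R t) args)" and z': "R \<in> dom L'" "(S, args) \<in> set (ta R)" "t \<in> rel A R"
            unfolding mem_Collect_eq by (elim exE conjE) (rule that; assumption)
          with x(2) have z: "R \<in> dom L'" "(S, args) \<in> set (ta R)" "t \<in> rel A R" "z = bits_tuple (S, map name (map (gname R t) args))"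
            by simp_all
          then have "z = gatom_bits R (map bits t) (S, args)" using e[OF z(3,2)] by simp
          then show "z \<in> (\<Union>R\<in>dom L'. \<Union>y\<in>set (ta R). (\<lambda>t. gatom_bits R t y) ` map bits ` rel A R)"
            using z(1-3) by blast
        qed
      qed
      have "set (atoms_listing Rs (es, ts)) = set (map (gatom_bits 0 []) ca) \<union>
        ((\<Union>y\<in>set ea. (\<lambda>a. gatom_bits 0 [a] y) ` bits ` univ A) \<union>
         (\<Union>R\<in>dom L'. \<Union>y\<in>set (ta R). (\<lambda>t. gatom_bits R t y) ` map bits ` rel A R))"
        using tu by (simp add: atoms_listing_def Rs es)
      then show ?thesis unfolding atoms_def image_Un 1 2 3 by (simp only: Un_assoc)
    qed
    moreover have "(\<lambda>(S, ns). bits_tuple (S, map name ns)) ` atoms A = bits_tuple ` tuple_set L (build A)"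
    proof -
      have "tuple_set L (build A) = (\<lambda>(S, ns). (S, map name ns)) ` atoms A"
        using atoms_wf[OF A] by (force simp: tuple_set_def build_def image_iff)
      then show ?thesis by (simp add: image_image case_prod_unfold)
    qed
    ultimately show "set (fst (names_listing Rs (es, ts), atoms_listing Rs (es, ts))) = bits ` univ (build A) \<and>
      set (snd (names_listing Rs (es, ts), atoms_listing Rs (es, ts))) = bits_tuple ` tuple_set L (build A)"
      by (simp add: build_def image_image)
  qed
qed

end

section \<open>Computing identifications\<close>

text \<open>Comparison from the least significant bit on. The second component is the verdict for
  the bits read so far, overridden by every later difference. If the bits of the right-hand number
  run out first, the left-hand number is larger, since its last bit is \<open>One\<close>.\<close>

definition le_step :: "symb list \<times> bool \<Rightarrow> symb \<Rightarrow> symb list \<times> bool" where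
  "le_step s x = (if fst s = [] then ([], False) else (tl (fst s), if x = hdd Zero (fst s) then snd s else x = Zero))"

definition le_bits :: "symb list \<Rightarrow> symb list \<Rightarrow> bool" where
  "le_bits v w = (let s = foldl le_step (w, True) v in fst s \<noteq> [] \<or> snd s)"

lemma ptime_le_bits [ptime_intros]:
  assumes "ptime f" "ptime g" shows "ptime (\<lambda>x. le_bits (f x) (g x))"
proof -
  have esz_tl: "esz (tl w) \<le> esz w" for w :: "symb list" by (cases w) auto
  have esz_b: "esz b \<le> 3" for b :: bool by (cases b) (auto simp: enc_bool_def)
  have "ptime (\<lambda>p. le_step (fst (snd p)) (snd (snd p)))"
    unfolding le_step_def by (intro ptime_intros)
  then have "ptime (\<lambda>x. foldl le_step (g x, True) (f x))"
  proof (intro ptime_foldl_add[where r = "[:5:]"] ptime_intros assms)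
    show "esz (le_step c y) \<le> esz c + poly [:5:] (esz x)" for c y and x :: 'a
      using esz_tl[of "fst c"] esz_b[of "y = Zero"] esz_b[of False] by (cases c) (auto simp: le_step_def)
  qed
  then show ?thesis unfolding le_bits_def Let_def by (intro ptime_intros)
qed

lemma le_bits: "le_bits (bits m) (bits n) \<longleftrightarrow> m \<le> n"
proof -
  have nil: "foldl le_step ([], False) v = ([], False)" for v
    by (induction v) (auto simp: le_step_def)
  have stuck: "le_step ([], b) x = ([], False)" for b x
    by (simp add: le_step_def)
  have "(let s = foldl le_step (bits n, b) (bits m) in fst s \<noteq> [] \<or> snd s) \<longleftrightarrow> m < n \<or> m = n \<and> b" for b
  proof (induction m arbitrary: n b rule: less_induct)
    case (less m)
    show ?case
    proof (cases "m = 0 \<or> n = 0")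
      case True
      then show ?thesis using nil
        by (cases "m = 0"; cases "n = 0") (auto simp: Let_def bits.simps[of 0] bits.simps[of m] bits.simps[of n] stuck)
    next
      case False
      \<comment> \<open>The verdict after the lowest bits, with which the comparison of the halves
        starts.\<close>
      define b' where "b' = (if odd m = odd n then b else \<not> odd m)"
      have "foldl le_step (bits n, b) (bits m) = foldl le_step (bits (n div 2), b') (bits (m div 2))"
        using False by (subst (1 2) bits.simps) (auto simp: le_step_def b'_def)
      moreover have "m div 2 < n div 2 \<or> m div 2 = n div 2 \<and> b' \<longleftrightarrow> m < n \<or> m = n \<and> b"
      proof -
        have e: "2 * (k div 2) + of_bool (odd k) = k" for k :: nat by (cases "odd k") simp_all
        have "i < j \<or> i = j \<and> (if P = Q then b else \<not> P) \<longleftrightarrow>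
          2 * i + of_bool P < 2 * j + of_bool Q \<or> 2 * i + of_bool P = 2 * j + of_bool Q \<and> b" for i j :: nat and P Q
          by (cases P; cases Q; cases b; simp; presburger?)
        from this[of "m div 2" "n div 2" "odd m" "odd n"] show ?thesis unfolding b'_def e .
      qed
      ultimately show ?thesis using less[of "m div 2" "n div 2" b'] False by simp
    qed
  qed
  from this[of True] show ?thesis unfolding le_bits_def by auto
qed

lemma class_rel_insert:
  "(v, u) \<in> class_rel (insert (x, y) E) \<longleftrightarrow> (v, u) \<in> class_rel E \<or>
    ((v, x) \<in> class_rel E \<or> (v, y) \<in> class_rel E) \<and> ((u, x) \<in> class_rel E \<or> (u, y) \<in> class_rel E)" (is "?l \<longleftrightarrow> ?r v u")
proof
  assume ?l
  then show "?r v u" unfolding class_rel_def[of "insert (x, y) E"]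
  proof (induction rule: rtrancl_induct)
    case (step u w)
    then have "(u, w) \<in> class_rel E \<or> (u = x \<and> w = y) \<or> (u = y \<and> w = x)"
      by (auto simp: class_rel_def)
    with step.IH show ?case
      using class_rel_trans[of _ _ E] class_rel_sym[of _ _ E] class_rel_refl[of _ E] by metis
  qed simp
next
  have mono: "(a, b) \<in> class_rel (insert (x, y) E)" if "(a, b) \<in> class_rel E" for a b
    using that unfolding class_rel_def by (rule rtrancl_mono[THEN subsetD, rotated]) auto
  have xy: "(x, y) \<in> class_rel (insert (x, y) E)" unfolding class_rel_def by auto
  assume "?r v u"
  then show ?l using mono xy class_rel_trans[of _ _ "insert (x, y) E"] class_rel_sym[of _ _ "insert (x, y) E"] by metis
qed

lemma rep_eq_iff: "rep E x = rep E y \<longleftrightarrow> (x, y) \<in> class_rel E"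
  using rep_rel class_rel_sym class_rel_trans rep_cong by metis

text \<open>The least element of a union of two classes is the smaller of their least elements, so a
  table of representatives can be updated without knowing the classes.\<close>

lemma rep_insert:
  "rep (insert (x, y) E) v = (if rep E v = rep E x \<or> rep E v = rep E y then min (rep E x) (rep E y) else rep E v)"
proof (cases "rep E v = rep E x \<or> rep E v = rep E y")
  case True
  then have "(v, u) \<in> class_rel (insert (x, y) E) \<longleftrightarrow> (x, u) \<in> class_rel E \<or> (y, u) \<in> class_rel E" for u
    unfolding class_rel_insert rep_eq_iff
    using class_rel_sym[of _ _ E] class_rel_trans[of _ _ E] by metis
  moreover have "(LEAST u. (x, u) \<in> class_rel E \<or> (y, u) \<in> class_rel E) = min (rep E x) (rep E y)"
  proof (rule Least_equality)
    show "(x, min (rep E x) (rep E y)) \<in> class_rel E \<or> (y, min (rep E x) (rep E y)) \<in> class_rel E"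
      using rep_rel[of x E] rep_rel[of y E] by (auto simp: min_def)
    show "min (rep E x) (rep E y) \<le> u" if "(x, u) \<in> class_rel E \<or> (y, u) \<in> class_rel E" for u
      using that unfolding rep_def by (auto intro: min.coboundedI1 min.coboundedI2 Least_le)
  qed
  ultimately show ?thesis using True by (simp add: rep_def[of "insert (x, y) E"])
next
  case False
  then have "(v, u) \<in> class_rel (insert (x, y) E) \<longleftrightarrow> (v, u) \<in> class_rel E" for u
    unfolding class_rel_insert rep_eq_iff by blast
  then show ?thesis using False by (auto simp: rep_def)
qed

section \<open>Computing representatives with a table\<close>

type_synonym table = "(symb list \<times> symb list) list"

definition look :: "table \<Rightarrow> symb list \<Rightarrow> symb list" where
  "look T v = foldl (\<lambda>d y. if fst y = v then snd y else d) [] T"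

lemma look_in: "look T v \<in> insert [] (snd ` set T)"
proof -
  have "foldl (\<lambda>d y. if fst y = v then snd y else d) d T \<in> insert d (snd ` set T)" for d
    by (induction T arbitrary: d) (fastforce simp: image_iff)+
  then show ?thesis unfolding look_def .
qed

lemma look_map: "inj f \<Longrightarrow> v \<in> set vs \<Longrightarrow> look (map (\<lambda>v. (f v, g v)) vs) (f v) = g v"
proof -
  assume f: "inj f"
  have "foldl (\<lambda>d y. if fst y = f v then snd y else d) d (map (\<lambda>v. (f v, g v)) vs) = (if v \<in> set vs then g v else d)" for d
    using f by (induction vs arbitrary: d) (auto simp: inj_eq)
  then show "v \<in> set vs \<Longrightarrow> look (map (\<lambda>v. (f v, g v)) vs) (f v) = g v" by (simp add: look_def)
qed

lemma ptime_look [ptime_intros]: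
  assumes "ptime f" "ptime g" shows "ptime (\<lambda>x. look (f x) (g x))"
proof -
  have "ptime (\<lambda>p. look (fst p) (snd p))" unfolding look_def
  proof (rule ptime_foldl[where q = "[:1, 1:]"])
    fix p :: "table \<times> symb list" and i
    let ?T = "take i (fst p)"
    have "esz d \<le> 1 + esz (fst p)" if d: "d \<in> insert [] (snd ` set ?T)" for d
    proof (cases "d = []")
      case False
      then obtain y where "y \<in> set ?T" "d = snd y" using d by auto
      then have "y \<in> set (fst p)" by (meson in_set_takeD)
      from esz_list(2)[OF this] show ?thesis using \<open>d = snd y\<close> by (cases y) auto
    qed simp
    from this[OF look_in[of ?T "snd p", unfolded look_def]]
    show "esz (foldl (\<lambda>d y. if fst y = snd p then snd y else d) [] ?T) \<le> poly [:1, 1:] (esz p)"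
      by (cases p) auto
  qed (intro ptime_intros)+
  from ptime_comp[OF this ptime_pair[OF assms]] show ?thesis by simp
qed

definition min_bits :: "symb list \<Rightarrow> symb list \<Rightarrow> symb list" where
  "min_bits v w = (if le_bits v w then v else w)"

definition merge :: "table \<Rightarrow> symb list \<times> symb list \<Rightarrow> table" where
  "merge T y = map (\<lambda>z. (fst z, if snd z = look T (fst y) \<or> snd z = look T (snd y)
     then min_bits (look T (fst y)) (look T (snd y)) else snd z)) T"

lemma merge_values: "fst ` set (merge T y) = fst ` set T" "snd ` set (merge T y) \<subseteq> insert [] (snd ` set T)" "length (merge T y) = length T"
  using look_in[of T "fst y"] look_in[of T "snd y"] by (auto simp: merge_def min_bits_def image_image)

definition merge_all :: "symb list list \<Rightarrow> (symb list \<times> symb list) list \<Rightarrow> table" where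
  "merge_all vs ys = foldl merge (map (\<lambda>v. (v, v)) vs) ys"

lemma esz_bound: "(\<And>y. y \<in> set xs \<Longrightarrow> esz y \<le> b) \<Longrightarrow> esz xs \<le> 1 + length xs * (1 + b)"
proof (induction xs)
  case (Cons y xs)
  then have "esz xs \<le> 1 + length xs * (1 + b)" by simp
  then show ?case using Cons.prems[of y] by simp
qed simp

text \<open>The entries of the table are always members of \<open>vs\<close> or \<open>[]\<close>.
  Merging therefore cannot make them longer, and this bounds all intermediate tables of the
  fold.\<close>

lemma esz_merge_all: "esz (merge_all vs ys) \<le> poly [:1, 4, 2:] (esz vs)"
proof -
  let ?S = "insert [] (set vs)"
  have "fst ` set (foldl merge T ys) \<subseteq> ?S \<and> snd ` set (foldl merge T ys) \<subseteq> ?S \<and> length (foldl merge T ys) = length T"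
    if "fst ` set T \<subseteq> ?S" "snd ` set T \<subseteq> ?S" for T
    using that
  proof (induction ys arbitrary: T)
    case (Cons y ys)
    have "snd ` set (merge T y) \<subseteq> ?S" using merge_values(2)[of T y] Cons.prems by blast
    with Cons.IH[of "merge T y"] Cons.prems show ?case by (simp add: merge_values)
  qed simp
  from this[of "map (\<lambda>v. (v, v)) vs"]
  have m: "fst ` set (merge_all vs ys) \<subseteq> ?S" "snd ` set (merge_all vs ys) \<subseteq> ?S" "length (merge_all vs ys) = length vs"
    unfolding merge_all_def by (auto simp: image_image)
  have v: "esz v \<le> esz vs" if "v \<in> ?S" for v
  proof (cases "v = []")
    case True
    then show ?thesis using esz_list(1)[of vs] by simp
  qed (use that esz_list(2)[of v vs] in auto)
  have "esz (merge_all vs ys) \<le> 1 + length vs * (1 + (1 + 2 * esz vs))"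
    unfolding m(3)[symmetric]
  proof (rule esz_bound)
    fix y assume "y \<in> set (merge_all vs ys)"
    then have "fst y \<in> ?S" "snd y \<in> ?S" using m by auto
    from v[OF this(1)] v[OF this(2)] show "esz y \<le> 1 + 2 * esz vs" by (cases y) auto
  qed
  also have "\<dots> \<le> 1 + esz vs * (1 + (1 + 2 * esz vs))"
    using esz_list(1)[of vs] by (intro add_left_mono mult_right_mono) auto
  also have "\<dots> \<le> poly [:1, 4, 2:] (esz vs)" by (simp add: algebra_simps)
  finally show ?thesis .
qed

lemma ptime_merge_all [ptime_intros]:
  assumes "ptime f" "ptime g" shows "ptime (\<lambda>x. merge_all (f x) (g x))"
proof -
  have "ptime (\<lambda>p. merge (fst (snd p)) (snd (snd p)))"
    unfolding merge_def min_bits_def by (intro ptime_intros)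
  then have "ptime (\<lambda>p. merge_all (fst p) (snd p))" unfolding merge_all_def
  proof (rule ptime_foldl[where q = "[:1, 4, 2:]"])
    fix p :: "symb list list \<times> (symb list \<times> symb list) list" and i
    have "esz (merge_all (fst p) (take i (snd p))) \<le> poly [:1, 4, 2:] (esz (fst p))" by (rule esz_merge_all)
    also have "\<dots> \<le> poly [:1, 4, 2:] (esz p)" by (rule poly_nat_mono) (cases p, simp)
    finally show "esz (foldl merge (map (\<lambda>v. (v, v)) (fst p)) (take i (snd p))) \<le> poly [:1, 4, 2:] (esz p)"
      by (simp only: merge_all_def)
  qed (intro ptime_intros)+
  from ptime_comp[OF this ptime_pair[OF assms]] show ?thesis by simp
qed

lemma rep_empty [simp]: "rep {} x = x"
  by (auto simp: rep_def class_rel_def intro: Least_equality)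

lemma merge_all_rep:
  assumes "set ys \<subseteq> set vs \<times> set vs"
  shows "merge_all (map bits vs) (map (\<lambda>(x, y). (bits x, bits y)) ys) = map (\<lambda>v. (bits v, bits (rep (set ys) v))) vs"
  using assms
proof (induction ys rule: rev_induct)
  case Nil
  show ?case by (simp add: merge_all_def)
next
  case (snoc y ys)
  obtain a b where y: "y = (a, b)" by (cases y)
  let ?T = "map (\<lambda>v. (bits v, bits (rep (set ys) v))) vs"
  have "look ?T (bits a) = bits (rep (set ys) a)" "look ?T (bits b) = bits (rep (set ys) b)"
    using snoc.prems y by (auto intro!: look_map inj_bits)
  moreover have "min_bits (bits m) (bits n) = bits (min m n)" for m n
    by (simp add: min_bits_def le_bits min_def)
  moreover have "merge_all (map bits vs) (map (\<lambda>(x, y). (bits x, bits y)) (ys @ [y])) = merge ?T (bits a, bits b)"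
    using snoc by (simp add: merge_all_def y)
  ultimately show ?case by (auto simp: merge_def y rep_insert)
qed

definition edge_listing :: "nat \<Rightarrow> listing \<Rightarrow> (symb list \<times> symb list) list" where
  "edge_listing q z = map (\<lambda>y. (hnth [] (snd y) 0, hnth [] (snd y) 1)) (filter (\<lambda>y. fst y = bits q) (snd z))"

definition rep_table :: "nat \<Rightarrow> listing \<Rightarrow> table" where
  "rep_table q z = merge_all (fst z) (edge_listing q z)"

definition identify_listing :: "nat \<Rightarrow> listing \<Rightarrow> listing" where
  "identify_listing q z = (map snd (rep_table q z),
     map (\<lambda>y. (fst y, map (look (rep_table q z)) (snd y))) (filter (\<lambda>y. fst y \<noteq> bits q) (snd z)))"

lemma pt_map_identify:
  assumes q: "q \<notin> dom L" shows "pt_map (L(q \<mapsto> 2)) L (identify q)"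
proof (rule pt_mapI[where G = "identify_listing q"])
  show "ptime (identify_listing q)"
    unfolding identify_listing_def rep_table_def edge_listing_def by (intro ptime_intros)
next
  fix A es ts
  assume A: "fin_struct (L(q \<mapsto> 2)) A" and es: "set es = bits ` univ A" and ts: "set ts = bits_tuple ` tuple_set (L(q \<mapsto> 2)) A"
  let ?E = "eq_edges q A" and ?L = "L(q \<mapsto> 2)"
  obtain vs where vs: "es = map bits vs" "set vs = univ A"
  proof
    show "es = map bits (map unbits es)" unfolding map_map by (rule map_idI[symmetric]) (use es in auto)
    show "set (map unbits es) = univ A" by (auto simp: es image_image)
  qed
  obtain us where us: "ts = map bits_tuple us" "set us = tuple_set ?L A"
  proof
    show "ts = map bits_tuple (map (inv bits_tuple) ts)" unfolding map_map
      by (rule map_idI[symmetric]) (use ts in \<open>auto simp: inv_f_f[OF inj_bits_tuple]\<close>)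
    show "set (map (inv bits_tuple) ts) = tuple_set ?L A" by (simp add: ts image_image inv_f_f[OF inj_bits_tuple])
  qed
  define ys where "ys = map (\<lambda>(R, t). (t ! 0, t ! 1)) (filter (\<lambda>(R, t). R = q) us)"
  have len: "length t = 2 \<and> set t \<subseteq> univ A" if "(q, t) \<in> set us" for t
    using fin_struct_relD[OF A, of t q] that us(2) by (auto simp: tuple_set_def)
  have E: "edge_listing q (es, ts) = map (\<lambda>(x, y). (bits x, bits y)) ys"
    unfolding edge_listing_def ys_def us(1)
    by (auto simp: filter_map comp_def bits_tuple_def case_prod_unfold hnth_nth dest!: len intro!: map_cong)
  have ys: "set ys = ?E"
  proof -
    have "set ys = {(t ! 0, t ! 1) |t. (q, t) \<in> set us}" by (force simp: ys_def)
    also have "\<dots> = {(t ! 0, t ! 1) |t. t \<in> rel A q}" by (simp add: us(2) tuple_set_def)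
    also have "\<dots> = ?E"
    proof -
      have "\<exists>x y. t = [x, y]" if "t \<in> rel A q" for t
      proof -
        have "length t = Suc (Suc 0)" using fin_struct_relD[OF A that] by simp
        then show ?thesis by (auto simp: length_Suc_conv)
      qed
      then show ?thesis unfolding eq_edges_def by force
    qed
    finally show ?thesis .
  qed
  have yv: "set ys \<subseteq> set vs \<times> set vs"
    using len by (force simp: ys_def vs(2) subset_iff)
  have T: "rep_table q (es, ts) = map (\<lambda>v. (bits v, bits (rep ?E v))) vs"
    unfolding rep_table_def E using merge_all_rep[OF yv] by (simp add: vs(1) ys)
  have look: "look (rep_table q (es, ts)) (bits v) = bits (rep ?E v)" if "v \<in> univ A" for v
    unfolding T using that vs(2) by (auto intro!: look_map inj_bits)
  have "set (fst (identify_listing q (es, ts))) = bits ` univ (identify q A)"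
    by (simp add: identify_listing_def T identify_def image_image vs(2))
  moreover have "set (snd (identify_listing q (es, ts))) = bits_tuple ` tuple_set L (identify q A)"
  proof -
    have "set (snd (identify_listing q (es, ts))) =
      (\<lambda>y. (bits (fst y), map (look (rep_table q (es, ts))) (map bits (snd y)))) ` {y \<in> set us. fst y \<noteq> q}"
      by (force simp: identify_listing_def us(1) bits_tuple_def)
    also have "\<dots> = (\<lambda>y. bits_tuple (fst y, map (rep ?E) (snd y))) ` {y \<in> set us. fst y \<noteq> q}"
    proof (rule image_cong[OF refl])
      fix y assume "y \<in> {y \<in> set us. fst y \<noteq> q}"
      then have "set (snd y) \<subseteq> univ A" using fin_struct_relD[OF A, of "snd y" "fst y"] us(2) by (auto simp: tuple_set_def)
      then show "(bits (fst y), map (look (rep_table q (es, ts))) (map bits (snd y))) = bits_tuple (fst y, map (rep ?E) (snd y))"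
        by (auto simp: bits_tuple_def look)
    qed
    also have "\<dots> = bits_tuple ` (\<lambda>y. (fst y, map (rep ?E) (snd y))) ` {y \<in> set us. fst y \<noteq> q}" by (simp add: image_image)
    also have "(\<lambda>y. (fst y, map (rep ?E) (snd y))) ` {y \<in> set us. fst y \<noteq> q} = tuple_set L (identify q A)"
    proof -
      have "{y \<in> set us. fst y \<noteq> q} = (SIGMA R:dom L. rel A R)"
        using q unfolding us(2) tuple_set_def by (auto split: if_splits)
      moreover have "tuple_set L (identify q A) = (SIGMA R:dom L. map (rep ?E) ` rel A R)"
        using q unfolding tuple_set_def identify_def by (auto split: if_splits)
      ultimately show ?thesis by (auto simp: image_iff intro!: bexI[rotated])
    qed
    finally show ?thesis .
  qed
  ultimately show "set (fst (identify_listing q (es, ts))) = bits ` univ (identify q A) \<and>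
    set (snd (identify_listing q (es, ts))) = bits_tuple ` tuple_set L (identify q A)" by blast
qed

lemma with_eq_rel [simp]: "rel (with_eq q B) q = {[b, b] |b. b \<in> univ B}" "R \<noteq> q \<Longrightarrow> rel (with_eq q B) R = rel B R"
  "univ (with_eq q B) = univ B"
  by (auto simp: with_eq_def)

lemma fin_with_eq: "fin_struct L B \<Longrightarrow> q \<notin> dom L \<Longrightarrow> fin_struct (L(q \<mapsto> 2)) (with_eq q B)"
proof (rule fin_structI)
  assume B: "fin_struct L B"
  show "finite (dom (L(q \<mapsto> 2)))" "finite (univ (with_eq q B))" using fin_struct_finite[OF B] by auto
  show "(L(q \<mapsto> 2)) R = Some (length t) \<and> set t \<subseteq> univ (with_eq q B)" if "t \<in> rel (with_eq q B) R" for R t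
    using that fin_struct_relD[OF B, of t R] by (cases "R = q") auto
qed

lemma reduces_gadget:
  assumes g: "gadget_reduction (L(q \<mapsto> 2)) L' cs ca ne ea nw ta (with_eq q B) B' vc ve vw"
    and B: "fin_struct L B" and q: "q \<notin> dom L"
  shows "reduces (L', B') (L, B)"
proof -
  interpret gadget_reduction "L(q \<mapsto> 2)" L' cs ca ne ea nw ta "with_eq q B" B' vc ve vw by (rule g)
  have "reduces (L', B') (L(q \<mapsto> 2), with_eq q B)"
    by (rule reduces_build[OF pt_map_build[OF fin_struct_finite(1)[OF B']]])
  moreover have "reduces (L(q \<mapsto> 2), with_eq q B) (L, B)"
    by (rule identification.reduces_identify[OF identification.intro[OF assms(2) q] pt_map_identify[OF q]])
  ultimately show ?thesis by (rule reduces_trans) (simp add: fin_struct_finite[OF assms(2)])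
qed

section \<open>Homomorphisms from a structure built by a gadget\<close>

context gadget
begin

lemma atomsI:
  "(S, args) \<in> set ca \<Longrightarrow> (S, map (gname 0 []) args) \<in> atoms A"
  "(S, args) \<in> set ea \<Longrightarrow> a \<in> univ A \<Longrightarrow> (S, map (gname 0 [a]) args) \<in> atoms A"
  "(S, args) \<in> set (ta R) \<Longrightarrow> R \<in> dom L' \<Longrightarrow> t \<in> rel A R \<Longrightarrow> (S, map (gname R t) args) \<in> atoms A"
  unfolding atoms_def by blast+

context
  fixes A :: "nat struct" and D :: "nat struct" and H
  assumes H: "is_hom H (build A) D"
begin

lemma hom_names: "xs \<in> names A \<Longrightarrow> H (name xs) \<in> univ D"
  using H by (auto simp: is_hom_def build_def)

lemma hom_atoms: "(S, ns) \<in> atoms A \<Longrightarrow> map (\<lambda>xs. H (name xs)) ns \<in> rel D S"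
proof -
  assume "(S, ns) \<in> atoms A"
  then have "map name ns \<in> rel (build A) S" by (auto simp: build_def)
  then have "map H (map name ns) \<in> rel D S" using H unfolding is_hom_def by blast
  then show ?thesis by (simp add: comp_def)
qed

lemma hom_const: "c \<in> set cs \<Longrightarrow> H (name [0, c]) \<in> univ D"
  by (rule hom_names) (auto simp: names_def)

lemma hom_copy: "k < ne \<Longrightarrow> a \<in> univ A \<Longrightarrow> H (name [1, k, a]) \<in> univ D"
  by (rule hom_names) (auto simp: names_def)

lemma hom_ca: "(S, args) \<in> set ca \<Longrightarrow> map (\<lambda>g. H (name (gname 0 [] g))) args \<in> rel D S"
  using hom_atoms[OF atomsI(1)] by (simp add: comp_def)

lemma hom_ea: "(S, args) \<in> set ea \<Longrightarrow> a \<in> univ A \<Longrightarrow> map (\<lambda>g. H (name (gname 0 [a] g))) args \<in> rel D S"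
  using hom_atoms[OF atomsI(2)] by (simp add: comp_def)

lemma hom_ta: "(S, args) \<in> set (ta R) \<Longrightarrow> R \<in> dom L' \<Longrightarrow> t \<in> rel A R \<Longrightarrow> map (\<lambda>g. H (name (gname R t g))) args \<in> rel D S"
  using hom_atoms[OF atomsI(3)] by (simp add: comp_def)

end

end

lemma fresh_symbol: assumes "fin_struct L A" obtains q where "q \<notin> dom L"
  using ex_new_if_finite[OF infinite_UNIV_nat fin_struct_finite(1)[OF assms]] by blast

lemma map_GE:
  "length bs = r \<Longrightarrow> map (gsem vc ve vw R bs) (map (GE k) [0..<r]) = map (ve k) bs"
  "length t = r \<Longrightarrow> map (\<lambda>g. H (name (gname R t g))) (map (GE k) [0..<r]) = map (\<lambda>a. H (name [1, k, a])) t"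
  by (auto intro!: nth_equalityI)

section \<open>The constructions\<close>

text \<open>The gadget only renames \<open>A\<close>: one copy of each element and one atom for each
  tuple. A homomorphism to \<open>B'\<close> is composed with \<open>g\<close>, and one to
  \<open>B\<close> with \<open>g'\<close>.\<close>

lemma reduces_hom_equiv:
  assumes B: "fin_struct L B" and B': "fin_struct L B'" and e: "hom_equiv B B'"
  shows "reduces (L, B') (L, B)"
proof -
  obtain g g' where g: "is_hom g B' B" and g': "is_hom g' B B'" using e by (auto simp: hom_equiv_def maps_to_def)
  obtain q where q: "q \<notin> dom L" using fresh_symbol[OF B] .
  define ta where "ta R = [(R, map (GE 0) [0..<the (L R)])]" for R :: nat
  interpret gadget "L(q \<mapsto> 2)" L "[]" "[]" 1 "[]" "\<lambda>_. 0" ta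
    by unfold_locales (use fin_struct_finite(1)[OF B] q in \<open>auto simp: ta_def\<close>)
  have "gadget_reduction (L(q \<mapsto> 2)) L [] [] 1 [] (\<lambda>_. 0) ta (with_eq q B) B' id (\<lambda>_. g) (\<lambda>_ _ _. 0)"
  proof unfold_locales
    show "fin_struct (L(q \<mapsto> 2)) (with_eq q B)" by (rule fin_with_eq[OF B q])
    show "fin_struct L B'" by (rule B')
    show "g b \<in> univ (with_eq q B)" if "b \<in> univ B'" for b using g that by (auto simp: is_hom_def)
    show "map (gsem id (\<lambda>_. g) (\<lambda>_ _ _. 0) R bs) args \<in> rel (with_eq q B) S" if "(S, args) \<in> set (ta R)" "bs \<in> rel B' R" for S args R bs
    proof -
      have r: "L R = Some (length bs)" using fin_struct_relD[OF B' that(2)] by simp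
      then have "R \<noteq> q" using q by auto
      moreover have "map g bs \<in> rel B R" using g that(2) by (auto simp: is_hom_def)
      ultimately show ?thesis using that(1) r by (simp add: ta_def map_GE(1) del: map_map)
    qed
    show "maps_to A B'" if A: "fin_struct L A" and m: "maps_to (build A) (with_eq q B)" for A
    proof -
      obtain H where H: "is_hom H (build A) (with_eq q B)" using m by (auto simp: maps_to_def)
      have "is_hom (\<lambda>a. g' (H (name [1, 0, a]))) A B'" unfolding is_hom_def
      proof (intro conjI allI ballI)
        show "(\<lambda>a. g' (H (name [1, 0, a]))) ` univ A \<subseteq> univ B'"
          using hom_copy[OF H, of 0] g' by (auto simp: is_hom_def)
        fix R t assume t: "t \<in> rel A R"
        have r: "L R = Some (length t)" using fin_struct_relD[OF A t] by simp
        then have "R \<noteq> q" using q by auto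
        moreover have "(R, map (GE 0) [0..<length t]) \<in> set (ta R)" using r by (simp add: ta_def)
        from hom_ta[OF H this _ t] r have "map (\<lambda>a. H (name [1, 0, a])) t \<in> rel (with_eq q B) R"
          unfolding map_GE(2)[OF refl] by auto
        ultimately have "map (\<lambda>a. H (name [1, 0, a])) t \<in> rel B R" by simp
        then have "map g' (map (\<lambda>a. H (name [1, 0, a])) t) \<in> rel B' R"
          using g' unfolding is_hom_def by blast
        then show "map (\<lambda>a. g' (H (name [1, 0, a]))) t \<in> rel B' R" by (simp add: comp_def)
      qed
      then show ?thesis by (auto simp: maps_to_def)
    qed
  qed simp_all
  from reduces_gadget[OF this B q] show ?thesis .
qed

lemma fin_expand:
  assumes C: "fin_struct L C" and p: "inj_on p (univ C)" "p ` univ C \<inter> dom L = {}"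
  shows "fin_struct (expand_voc p C L) (expand_struct p C)"
proof (rule fin_structI)
  have "dom (expand_voc p C L) \<subseteq> p ` univ C \<union> dom L" by (auto simp: expand_voc_def split: if_splits)
  then show "finite (dom (expand_voc p C L))" by (rule finite_subset) (simp add: fin_struct_finite[OF C])
  show "finite (univ (expand_struct p C))" by (simp add: expand_struct_def fin_struct_finite[OF C])
  fix R t assume "t \<in> rel (expand_struct p C) R"
  then consider "t \<in> rel C R" | c where "t = [c]" "c \<in> univ C" "p c = R" by (auto simp: expand_struct_def)
  then show "expand_voc p C L R = Some (length t) \<and> set t \<subseteq> univ (expand_struct p C)"
  proof cases
    case 1
    have "L R = Some (length t)" "set t \<subseteq> univ C" using fin_struct_relD[OF C 1] by simp_all
    moreover have "R \<notin> p ` univ C" using calculation(1) p(2) by auto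
    ultimately show ?thesis by (simp add: expand_voc_def expand_struct_def)
  qed (auto simp: expand_voc_def expand_struct_def)
qed

text \<open>A surjective endomorphism of a finite structure is injective. It then acts injectively,
  hence surjectively, on each finite relation, so that its inverse preserves the relation
  too.\<close>

lemma core_inverse:
  assumes C: "fin_struct L C" and core: "is_core C" and h: "is_hom h C C"
  shows "inj_on h (univ C)" and "is_hom (inv_into (univ C) h) C C"
proof -
  have s: "h ` univ C = univ C" using core h by (auto simp: is_core_def)
  then show i: "inj_on h (univ C)" using fin_struct_finite(2)[OF C] by (simp add: finite_surj_inj)
  let ?g = "inv_into (univ C) h"
  show "is_hom ?g C C" unfolding is_hom_def
  proof (intro conjI allI ballI)
    show "?g ` univ C \<subseteq> univ C" using s by (auto intro: inv_into_into)
    fix R t assume t: "t \<in> rel C R"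
    have u: "set u \<subseteq> univ C" if "u \<in> rel C R" for u using fin_struct_relD[OF C that] by simp
    have gh: "map ?g (map h u) = u" if "u \<in> rel C R" for u
      unfolding map_map by (rule map_idI) (use u[OF that] i in auto)
    have "inj_on (map h) (rel C R)" by (rule inj_onI) (metis gh)
    moreover have "map h ` rel C R \<subseteq> rel C R" using h by (auto simp: is_hom_def)
    ultimately have "map h ` rel C R = rel C R" using finite_rel[OF C] by (intro endo_inj_surj)
    then obtain u where "u \<in> rel C R" "t = map h u" using t by auto
    then show "map ?g t \<in> rel C R" using gh by simp
  qed
qed

text \<open>A tuple of the new symbol \<open>p c\<close> becomes an equality between the copy of its
  entry and the element \<open>c\<close> of the added copy of \<open>C\<close>, whose relations are
  imposed by \<open>ca\<close>. In the local direction all values are kept: constants and copies are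
  interpreted by identities.\<close>

lemma reduces_constants:
  assumes C: "fin_struct L C" and core: "is_core C" and p: "inj_on p (univ C)" "p ` univ C \<inter> dom L = {}"
  shows "reduces (expand_voc p C L, expand_struct p C) (L, C)"
proof -
  let ?L' = "expand_voc p C L" and ?C' = "expand_struct p C"
  note C' = fin_expand[OF C p]
  obtain q where q: "q \<notin> dom L" using fresh_symbol[OF C] .
  obtain cs where cs: "set cs = univ C" using finite_list[OF fin_struct_finite(2)[OF C]] by blast
  have "finite ((\<lambda>(R, t). (R, map GC t)) ` (SIGMA R:dom L. rel C R))"
    using fin_struct_finite(1)[OF C] finite_rel[OF C] by blast
  then obtain ca where set_ca: "set ca = (\<lambda>(R, t). (R, map GC t)) ` (SIGMA R:dom L. rel C R)" using finite_list by metis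
  define ta where "ta R = (if R \<in> p ` univ C then [(q, [GE 0 0, GC (inv_into (univ C) p R)])] else [(R, map (GE 0) [0..<the (L R)])])" for R :: nat
  have ta_new: "ta (p c) = [(q, [GE 0 0, GC c])]" if "c \<in> univ C" for c using that p(1) by (auto simp: ta_def)
  have new: "rel ?C' (p c) = {[c]}" "?L' (p c) = Some 1" if c: "c \<in> univ C" for c
  proof -
    have "rel C (p c) = {}" using fin_struct_relD[OF C] p(2) c by blast
    then show "rel ?C' (p c) = {[c]}" using c p(1) by (auto simp: expand_struct_def inj_on_def)
    show "?L' (p c) = Some 1" using c by (simp add: expand_voc_def)
  qed
  have old: "rel ?C' R = rel C R" "?L' R = L R" "ta R = [(R, map (GE 0) [0..<the (L R)])]" if "R \<notin> p ` univ C" for R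
    using that by (auto simp: expand_struct_def expand_voc_def ta_def)
  interpret gadget "L(q \<mapsto> 2)" ?L' cs ca 1 "[]" "\<lambda>_. 0" ta
  proof unfold_locales
    show "finite (dom (L(q \<mapsto> 2)))" using fin_struct_finite[OF C] by simp
    show "(L(q \<mapsto> 2)) S = Some (length args) \<and> set args \<subseteq> GC ` set cs" if prem: "(S, args) \<in> set ca" for S args
    proof -
      obtain t where t: "S \<in> dom L" "t \<in> rel C S" "args = map GC t" using prem unfolding set_ca by auto
      then show ?thesis using fin_struct_relD[OF C t(2)] q cs by auto
    qed
    show "(L(q \<mapsto> 2)) S = Some (length args) \<and> set args \<subseteq> GC ` set cs \<union> {GE k j |k j. k < 1 \<and> j < r} \<union> GW ` {..<0}"
      if "?L' R = Some r" "(S, args) \<in> set (ta R)" for R r S args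
    proof (cases "R \<in> p ` univ C")
      case True
      then obtain c where "c \<in> univ C" "R = p c" by blast
      then show ?thesis using that new ta_new cs by auto
    next
      case False
      then have "L R = Some r" "R \<noteq> q" using that q old by auto
      then show ?thesis using that(2) old(3)[OF False] by auto
    qed
  qed simp
  have "gadget_reduction (L(q \<mapsto> 2)) ?L' cs ca 1 [] (\<lambda>_. 0) ta (with_eq q C) ?C' id (\<lambda>_. id) (\<lambda>_ _ _. 0)"
  proof unfold_locales
    show "fin_struct (L(q \<mapsto> 2)) (with_eq q C)" by (rule fin_with_eq[OF C q])
    show "fin_struct ?L' ?C'" by (rule C')
    show "id c \<in> univ (with_eq q C)" if "c \<in> set cs" for c using that cs by simp
    show "id b \<in> univ (with_eq q C)" if "b \<in> univ ?C'" for b using that by (simp add: expand_struct_def)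
    show "map (gsem id (\<lambda>_. id) (\<lambda>_ _ _. 0) 0 []) args \<in> rel (with_eq q C) S" if prem: "(S, args) \<in> set ca" for S args
    proof -
      obtain t where t: "S \<in> dom L" "t \<in> rel C S" "args = map GC t" using prem unfolding set_ca by auto
      moreover have "S \<noteq> q" using t(1) q by auto
      ultimately show ?thesis by (simp add: comp_def)
    qed
    show "map (gsem id (\<lambda>_. id) (\<lambda>_ _ _. 0) R bs) args \<in> rel (with_eq q C) S" if "(S, args) \<in> set (ta R)" "bs \<in> rel ?C' R" for S args R bs
    proof (cases "R \<in> p ` univ C")
      case True
      then obtain c where "c \<in> univ C" "R = p c" by blast
      then show ?thesis using that new ta_new by auto
    next
      case False
      then have bs: "bs \<in> rel C R" "L R = Some (length bs)" using that(2) old fin_struct_relD[OF C] by auto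
      then have "R \<noteq> q" using q by auto
      then show ?thesis using that(1) bs old(3)[OF False] by (simp add: map_GE(1) del: map_map)
    qed
    show "maps_to A ?C'" if A: "fin_struct ?L' A" and m: "maps_to (build A) (with_eq q C)" for A
    proof -
      obtain H where H: "is_hom H (build A) (with_eq q C)" using m by (auto simp: maps_to_def)
      define \<sigma> where "\<sigma> c = H (name [0, c])" for c
      have \<sigma>: "is_hom \<sigma> C C" unfolding is_hom_def
      proof (intro conjI allI ballI)
        show "\<sigma> ` univ C \<subseteq> univ C" using hom_const[OF H] cs by (auto simp: \<sigma>_def)
        fix R t assume t: "t \<in> rel C R"
        have R: "R \<in> dom L" using fin_struct_relD[OF C t] by auto
        then have "(R, map GC t) \<in> set ca" using t set_ca by auto
        from hom_ca[OF H this] have "map \<sigma> t \<in> rel (with_eq q C) R" by (simp add: \<sigma>_def[abs_def] comp_def)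
        moreover have "R \<noteq> q" using R q by auto
        ultimately show "map \<sigma> t \<in> rel C R" by simp
      qed
      note inj = core_inverse(1)[OF C core \<sigma>] and inv = core_inverse(2)[OF C core \<sigma>]
      \<comment> \<open>Composition with the inverse of \<open>\<sigma>\<close> normalises
        \<open>H\<close> to the identity on the copy of \<open>C\<close>, so an entry that was
        equated with the constant \<open>c\<close> is sent to \<open>c\<close> itself.\<close>
      let ?\<tau> = "inv_into (univ C) \<sigma>"
      have "is_hom (\<lambda>a. ?\<tau> (H (name [1, 0, a]))) A ?C'" unfolding is_hom_def
      proof (intro conjI allI ballI)
        show "(\<lambda>a. ?\<tau> (H (name [1, 0, a]))) ` univ A \<subseteq> univ ?C'"
          using hom_copy[OF H, of 0] inv by (auto simp: is_hom_def expand_struct_def)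
        fix R t assume t: "t \<in> rel A R"
        have r: "?L' R = Some (length t)" using fin_struct_relD[OF A t] by simp
        show "map (\<lambda>a. ?\<tau> (H (name [1, 0, a]))) t \<in> rel ?C' R"
        proof (cases "R \<in> p ` univ C")
          case True
          then obtain c where c: "c \<in> univ C" "R = p c" by blast
          then obtain a where a: "t = [a]" using r new(2)[OF c(1)] by (cases t) auto
          have "(q, [GE 0 0, GC c]) \<in> set (ta R)" using c ta_new by simp
          from hom_ta[OF H this domI[of ?L' R, OF r] t] have "H (name [1, 0, a]) = \<sigma> c" by (auto simp: a \<sigma>_def)
          then show ?thesis using c new(1) inj by (simp add: a)
        next
          case False
          have L: "L R = Some (length t)" using r old False by simp
          then have "R \<noteq> q" using q by auto
          moreover have "(R, map (GE 0) [0..<length t]) \<in> set (ta R)" using old(3)[OF False] L by simp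
          from hom_ta[OF H this _ t] r have "map (\<lambda>a. H (name [1, 0, a])) t \<in> rel (with_eq q C) R"
            unfolding map_GE(2)[OF refl] by auto
          ultimately have "map (\<lambda>a. H (name [1, 0, a])) t \<in> rel C R" by simp
          then have "map ?\<tau> (map (\<lambda>a. H (name [1, 0, a])) t) \<in> rel C R"
            using inv unfolding is_hom_def by blast
          then show ?thesis using old(1)[OF False] by (simp add: comp_def)
        qed
      qed
      then show ?thesis by (auto simp: maps_to_def)
    qed
  qed simp_all
  from reduces_gadget[OF this C q] show ?thesis .
qed


subsection \<open>Primitive positive interpretations\<close>

text \<open>
  The conjuncts of the prenex form of a formula, over the variables \<open>k\<close>, \<open>k + 1\<close>, and so on for the quantifiers;
  the symbol \<open>q\<close> stands for equality.
\<close>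

primrec flat :: "nat \<Rightarrow> pp \<Rightarrow> (nat \<Rightarrow> nat) \<Rightarrow> nat \<Rightarrow> nat \<times> (nat \<times> nat list) list" where
  "flat q (PAtom R xs) e k = (k, [(R, map e xs)])"
| "flat q (PEq x y) e k = (k, [(q, [e x, e y])])"
| "flat q (PAnd \<phi> \<psi>) e k = (fst (flat q \<psi> e (fst (flat q \<phi> e k))), snd (flat q \<phi> e k) @ snd (flat q \<psi> e (fst (flat q \<phi> e k))))"
| "flat q (PEx x \<phi>) e k = flat q \<phi> (e(x := k)) (Suc k)"

lemma flat_mono: "k \<le> fst (flat q \<phi> e k)"
proof (induction \<phi> arbitrary: e k)
  case (PAnd \<phi> \<psi>)
  then show ?case by (simp add: le_trans[OF PAnd.IH(1) PAnd.IH(2)])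
next
  case (PEx x \<phi>)
  from this[of "Suc k" "e(x := k)"] show ?case by (simp del: fun_upd_apply)
qed simp_all

lemma flat_wf:
  assumes "pp_wf L \<phi>" "q \<notin> dom L" "\<And>x. x \<in> pp_fv \<phi> \<Longrightarrow> e x < k" "(S, xs) \<in> set (snd (flat q \<phi> e k))"
  shows "(L(q \<mapsto> 2)) S = Some (length xs) \<and> set xs \<subseteq> {..<fst (flat q \<phi> e k)}"
  using assms
proof (induction \<phi> arbitrary: e k)
  case (PAnd \<phi> \<psi>)
  show ?case
  proof (cases "(S, xs) \<in> set (snd (flat q \<phi> e k))")
    case True
    with PAnd.IH(1)[of e k] PAnd.prems show ?thesis
      using flat_mono[of "fst (flat q \<phi> e k)" q \<psi> e] by fastforce
  next
    case False
    have "e x < fst (flat q \<phi> e k)" if "x \<in> pp_fv \<psi>" for x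
      using PAnd.prems(3)[of x] that flat_mono[of k q \<phi> e] by simp
    with False PAnd.IH(2)[of e "fst (flat q \<phi> e k)"] PAnd.prems show ?thesis by simp
  qed
next
  case (PEx x \<phi>)
  have upd: "(e(x := k)) y < Suc k" if "y \<in> pp_fv \<phi>" for y
    using PEx.prems(3)[of y] that by (auto simp: less_Suc_eq)
  from PEx.IH[of "e(x := k)" "Suc k", OF _ PEx.prems(2) upd] PEx.prems(1,4) show ?case by (simp del: fun_upd_apply)
qed auto

lemma pp_sat_cong: "(\<And>x. x \<in> pp_fv \<phi> \<Longrightarrow> v x = w x) \<Longrightarrow> pp_sat B v \<phi> \<longleftrightarrow> pp_sat B w \<phi>"
proof (induction \<phi> arbitrary: v w)
  case (PAtom R xs)
  then have "map v xs = map w xs" by simp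
  then show ?case by (simp only: pp_sat.simps)
next
  case (PAnd \<phi> \<psi>)
  from PAnd.IH(1)[of v w] PAnd.IH(2)[of v w] PAnd.prems show ?case by simp
next
  case (PEx x \<phi>)
  have "pp_sat B (v(x := b)) \<phi> \<longleftrightarrow> pp_sat B (w(x := b)) \<phi>" for b
    by (rule PEx.IH) (use PEx.prems in auto)
  then show ?case by simp
qed simp

definition holds :: "nat struct \<Rightarrow> (nat \<Rightarrow> nat) \<Rightarrow> (nat \<times> nat list) list \<Rightarrow> bool" where
  "holds D v as \<longleftrightarrow> (\<forall>(S, xs)\<in>set as. map v xs \<in> rel D S)"

lemma holds_append: "holds D v (as @ bs) \<longleftrightarrow> holds D v as \<and> holds D v bs"
  by (auto simp: holds_def)

lemma flat_sound:
  assumes "pp_wf L \<phi>" "q \<notin> dom L" "holds (with_eq q B) v (snd (flat q \<phi> e k))"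
    "\<And>i. k \<le> i \<Longrightarrow> i < fst (flat q \<phi> e k) \<Longrightarrow> v i \<in> univ B"
  shows "pp_sat B (v \<circ> e) \<phi>"
  using assms
proof (induction \<phi> arbitrary: e k)
  case (PAtom R xs)
  then have "R \<noteq> q" by auto
  then show ?case using PAtom by (simp add: holds_def comp_def)
next
  case (PEq x y)
  then show ?case by (auto simp: holds_def)
next
  case (PAnd \<phi> \<psi>)
  let ?k = "fst (flat q \<phi> e k)"
  have le: "k \<le> ?k" "?k \<le> fst (flat q \<psi> e ?k)" by (rule flat_mono)+
  have "pp_sat B (v \<circ> e) \<phi>" by (rule PAnd.IH(1)[of e k]) (use PAnd.prems le in \<open>auto simp: holds_append\<close>)
  moreover have "pp_sat B (v \<circ> e) \<psi>" by (rule PAnd.IH(2)[of e ?k]) (use PAnd.prems le in \<open>auto simp: holds_append\<close>)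
  ultimately show ?case by (simp only: pp_sat.simps)
next
  case (PEx x \<phi>)
  have "pp_sat B (v \<circ> e(x := k)) \<phi>"
    by (rule PEx.IH[of "e(x := k)" "Suc k"]) (use PEx.prems in \<open>auto simp del: fun_upd_apply\<close>)
  moreover have "v \<circ> e(x := k) = (v \<circ> e)(x := v k)" by auto
  moreover have "v k \<in> univ B" using PEx.prems(4)[of k] flat_mono[of "Suc k" q \<phi> "e(x := k)"] by simp
  ultimately show ?case unfolding pp_sat.simps by metis
qed

text \<open>The new variables of the second conjunct are numbered from where those of the first end.
  Its witnesses can thus be chosen without disturbing the values that satisfy the first.\<close>

lemma flat_complete:
  assumes "pp_wf L \<phi>" "q \<notin> dom L" "\<And>x. x \<in> pp_fv \<phi> \<Longrightarrow> e x < k \<and> v (e x) \<in> univ B" "pp_sat B (v \<circ> e) \<phi>"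
  shows "\<exists>v'. (\<forall>i<k. v' i = v i) \<and> (\<forall>i. k \<le> i \<and> i < fst (flat q \<phi> e k) \<longrightarrow> v' i \<in> univ B) \<and>
    holds (with_eq q B) v' (snd (flat q \<phi> e k))"
  using assms
proof (induction \<phi> arbitrary: e k v)
  case (PAtom R xs)
  then have "R \<noteq> q" by auto
  then show ?case using PAtom by (intro exI[of _ v]) (auto simp: holds_def comp_def)
next
  case (PEq x y)
  then show ?case by (intro exI[of _ v]) (auto simp: holds_def)
next
  case (PAnd \<phi> \<psi>)
  let ?k = "fst (flat q \<phi> e k)"
  have le: "k \<le> ?k" by (rule flat_mono)
  have fv: "e x < k \<and> v (e x) \<in> univ B" if "x \<in> pp_fv \<phi> \<union> pp_fv \<psi>" for x using PAnd.prems(3)[of x] that by simp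
  have wf: "pp_wf L \<phi>" "pp_wf L \<psi>" using PAnd.prems(1) by simp_all
  have sat: "pp_sat B (v \<circ> e) \<phi>" "pp_sat B (v \<circ> e) \<psi>" using PAnd.prems(4) by (simp_all only: pp_sat.simps)
  obtain v1 where v1: "\<forall>i<k. v1 i = v i" "\<forall>i. k \<le> i \<and> i < ?k \<longrightarrow> v1 i \<in> univ B" "holds (with_eq q B) v1 (snd (flat q \<phi> e k))"
    using PAnd.IH(1)[of e k v, OF wf(1) PAnd.prems(2) _ sat(1)] fv by auto
  have "pp_sat B (v1 \<circ> e) \<psi> \<longleftrightarrow> pp_sat B (v \<circ> e) \<psi>" by (rule pp_sat_cong) (use fv v1 in auto)
  then have sat1: "pp_sat B (v1 \<circ> e) \<psi>" using sat by simp
  have fv1: "e x < ?k \<and> v1 (e x) \<in> univ B" if "x \<in> pp_fv \<psi>" for x using fv[of x] that le v1(1) by auto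
  obtain v2 where v2: "\<forall>i<?k. v2 i = v1 i" "\<forall>i. ?k \<le> i \<and> i < fst (flat q \<psi> e ?k) \<longrightarrow> v2 i \<in> univ B"
    "holds (with_eq q B) v2 (snd (flat q \<psi> e ?k))"
    using PAnd.IH(2)[of e ?k v1, OF wf(2) PAnd.prems(2) fv1 sat1] by auto
  have v21: "map v2 xs = map v1 xs" if "(S, xs) \<in> set (snd (flat q \<phi> e k))" for S xs
    using flat_wf[of L \<phi> q e k S xs] PAnd.prems fv that v2(1) by (auto intro!: map_cong)
  have "holds (with_eq q B) v2 (snd (flat q \<phi> e k))" unfolding holds_def
  proof clarify
    fix S xs assume a: "(S, xs) \<in> set (snd (flat q \<phi> e k))"
    then show "map v2 xs \<in> rel (with_eq q B) S" using v1(3) v21[OF a] by (auto simp: holds_def simp del: map_eq_conv)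
  qed
  moreover have "v2 i = v i" if "i < k" for i using that le v1 v2 by auto
  moreover have "v2 i \<in> univ B" if "k \<le> i" "i < fst (flat q \<psi> e ?k)" for i
    using that v1(2) v2 by (cases "i < ?k") auto
  ultimately show ?case using v2(3) by (intro exI[of _ v2]) (simp add: holds_append)
next
  case (PEx x \<phi>)
  from PEx.prems(4) obtain b where b: "b \<in> univ B" "pp_sat B ((v \<circ> e)(x := b)) \<phi>"
    unfolding pp_sat.simps by blast
  have fv: "e y < k \<and> v (e y) \<in> univ B" if "y \<in> pp_fv \<phi>" "y \<noteq> x" for y using PEx.prems(3)[of y] that by simp
  have "pp_sat B (v(k := b) \<circ> e(x := k)) \<phi> \<longleftrightarrow> pp_sat B ((v \<circ> e)(x := b)) \<phi>"
    by (rule pp_sat_cong) (use fv in auto)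
  then have sat: "pp_sat B (v(k := b) \<circ> e(x := k)) \<phi>" using b(2) by blast
  have wf: "pp_wf L \<phi>" using PEx.prems(1) by simp
  have fv': "(e(x := k)) y < Suc k \<and> (v(k := b)) ((e(x := k)) y) \<in> univ B" if "y \<in> pp_fv \<phi>" for y
    using fv[OF that] b by (auto simp: less_Suc_eq)
  obtain v' where v': "\<forall>i<Suc k. v' i = (v(k := b)) i"
    "\<forall>i. Suc k \<le> i \<and> i < fst (flat q \<phi> (e(x := k)) (Suc k)) \<longrightarrow> v' i \<in> univ B"
    "holds (with_eq q B) v' (snd (flat q \<phi> (e(x := k)) (Suc k)))"
    using PEx.IH[of "e(x := k)" "Suc k" "v(k := b)", OF wf PEx.prems(2) fv' sat] by (auto simp del: fun_upd_apply)
  have "v' i \<in> univ B" if "k \<le> i" "i < fst (flat q \<phi> (e(x := k)) (Suc k))" for i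
    using that v'(1,2) b(1) by (cases "i = k") auto
  then show ?case using v' by (intro exI[of _ v']) simp
qed

text \<open>A prenex definition of \<open>D\<close>: the free variables are those below
  \<open>m\<close>, \<open>fst y\<close> is the number of quantified variables, numbered from
  \<open>m\<close> on, and \<open>snd y\<close> lists the conjuncts, with \<open>q\<close> for
  equality.\<close>

definition presents :: "vocabulary \<Rightarrow> nat \<Rightarrow> nat struct \<Rightarrow> nat \<Rightarrow> nat list set \<Rightarrow> nat \<times> (nat \<times> nat list) list \<Rightarrow> bool" where
  "presents L q B m D y \<longleftrightarrow>
     (\<forall>(S, xs)\<in>set (snd y). (L(q \<mapsto> 2)) S = Some (length xs) \<and> set xs \<subseteq> {..<m + fst y}) \<and>
     (\<forall>v. (\<forall>i<m + fst y. v i \<in> univ B) \<and> holds (with_eq q B) v (snd y) \<longrightarrow> map v [0..<m] \<in> D) \<and>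
     (\<forall>t\<in>D. \<exists>v. (\<forall>i<m. v i = t ! i) \<and> (\<forall>i<m + fst y. v i \<in> univ B) \<and> holds (with_eq q B) v (snd y))"

lemma presentable:
  assumes "pp_definable L B m D" and q: "q \<notin> dom L"
  shows "\<exists>y. presents L q B m D y"
proof -
  obtain \<phi> where \<phi>: "pp_wf L \<phi>" "pp_fv \<phi> \<subseteq> {..<m}" and D: "D = {t \<in> tuples m (univ B). pp_sat B ((!) t) \<phi>}"
    using assms(1) unfolding pp_definable_def by blast
  let ?k = "fst (flat q \<phi> id m)" and ?as = "snd (flat q \<phi> id m)"
  have le: "m + (?k - m) = ?k" using flat_mono[of m q \<phi> id] by simp
  have "presents L q B m D (?k - m, ?as)" unfolding presents_def fst_conv snd_conv le
  proof (intro conjI allI impI ballI)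
    fix z assume "z \<in> set ?as"
    then show "case z of (S, xs) \<Rightarrow> (L(q \<mapsto> 2)) S = Some (length xs) \<and> set xs \<subseteq> {..<?k}"
      using flat_wf[of L \<phi> q id m] \<phi> q by (cases z) auto
  next
    fix v assume v: "(\<forall>i<?k. v i \<in> univ B) \<and> holds (with_eq q B) v ?as"
    have "pp_sat B (v \<circ> id) \<phi>" by (rule flat_sound[OF \<phi>(1) q]) (use v in auto)
    moreover have "pp_sat B ((!) (map v [0..<m])) \<phi> \<longleftrightarrow> pp_sat B v \<phi>"
      by (rule pp_sat_cong) (use \<phi>(2) in auto)
    moreover have "m \<le> ?k" by (rule flat_mono)
    ultimately show "map v [0..<m] \<in> D" using v by (auto simp: D tuples_def)
  next
    fix t assume t: "t \<in> D"
    then have "x < m \<and> t ! x \<in> univ B" if "x \<in> pp_fv \<phi>" for x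
      using that \<phi>(2) by (auto simp: D tuples_def subset_iff)
    then obtain v where v: "\<forall>i<m. v i = t ! i" "\<forall>i. m \<le> i \<and> i < ?k \<longrightarrow> v i \<in> univ B" "holds (with_eq q B) v ?as"
      using flat_complete[of L \<phi> q id m "(!) t" B] \<phi> q t by (auto simp: D)
    moreover have "v i \<in> univ B" if "i < ?k" for i
      using that v t by (cases "i < m") (auto simp: D tuples_def subset_iff)
    ultimately show "\<exists>v. (\<forall>i<m. v i = t ! i) \<and> (\<forall>i<?k. v i \<in> univ B) \<and> holds (with_eq q B) v ?as" by blast
  qed
  then show ?thesis by blast
qed

lemma presentsD:
  assumes "presents L q B m D y"
  shows "(S, xs) \<in> set (snd y) \<Longrightarrow> (L(q \<mapsto> 2)) S = Some (length xs) \<and> set xs \<subseteq> {..<m + fst y}"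
    and "(\<And>i. i < m + fst y \<Longrightarrow> v i \<in> univ B) \<Longrightarrow> holds (with_eq q B) v (snd y) \<Longrightarrow> map v [0..<m] \<in> D"
    and "t \<in> D \<Longrightarrow> \<exists>v. (\<forall>i<m. v i = t ! i) \<and> (\<forall>i<m + fst y. v i \<in> univ B) \<and> holds (with_eq q B) v (snd y)"
  using assms unfolding presents_def by blast+

lemma concat_equal_length:
  assumes "\<forall>xs\<in>set xss. length xs = n"
  shows "length (concat xss) = length xss * n" and "i < length xss * n \<Longrightarrow> concat xss ! i = xss ! (i div n) ! (i mod n)"
proof -
  show "length (concat xss) = length xss * n" using assms by (induction xss) auto
  show "concat xss ! i = xss ! (i div n) ! (i mod n)" if "i < length xss * n" using assms that
  proof (induction xss arbitrary: i)
    case (Cons xs xss)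
    show ?case
    proof (cases "i < n")
      case False
      moreover have "0 < n" using Cons.prems(2) by (cases n) auto
      ultimately have "i div n = Suc ((i - n) div n)" "i mod n = (i - n) mod n"
        by (auto simp: le_div_geq le_mod_geq)
      moreover have "i - n < length xss * n" using Cons.prems(2) False by simp
      ultimately show ?thesis using Cons.IH[of "i - n"] Cons.prems(1) False by (simp add: nth_append)
    qed (use Cons.prems in \<open>simp add: nth_append\<close>)
  qed simp
qed

text \<open>Position \<open>i\<close> of a flattened tuple is coordinate \<open>i mod n\<close> of
  entry \<open>i div n\<close>; positions from \<open>r * n\<close> on belong to quantified
  variables.\<close>

definition tuple_garg :: "nat \<Rightarrow> nat \<Rightarrow> nat \<Rightarrow> garg" where
  "tuple_garg n r i = (if i < r * n then GE (i mod n) (i div n) else GW (i - r * n))"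

text \<open>The first \<open>n\<close> copies of an element are the coordinates of a tuple of
  \<open>B\<close>, and the remaining ones witness that this tuple lies in \<open>dom f\<close>. A
  tuple of \<open>R\<close> imposes the definition of the preimage of \<open>R\<close> on the
  coordinates of its entries. Applying \<open>f\<close> to the coordinates leads back to
  \<open>B'\<close>.\<close>

lemma reduces_pp_interpretation:
  assumes B: "fin_struct L B" and B': "fin_struct L' B'" and pp: "pp_interpretable L B L' B'"
  shows "reduces (L', B') (L, B)"
proof -
  obtain n f where n: "n \<ge> 1" and f: "dom f \<subseteq> tuples n (univ B)" "ran f = univ B'" "pp_definable L B n (dom f)"
    and fR: "\<And>R r. L' R = Some r \<Longrightarrow> pp_definable L B (r * n) (preimage f (rel B' R))"
    using pp unfolding pp_interpretable_def by blast
  obtain q where q: "q \<notin> dom L" using fresh_symbol[OF B] .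
  obtain y where y: "presents L q B n (dom f) y" using presentable[OF f(3) q] by blast
  have "\<forall>R. \<exists>z. R \<in> dom L' \<longrightarrow> presents L q B (the (L' R) * n) (preimage f (rel B' R)) z"
    using presentable[OF fR q] by (metis domD option.sel)
  then obtain z where z: "\<And>R. R \<in> dom L' \<Longrightarrow> presents L q B (the (L' R) * n) (preimage f (rel B' R)) (z R)" by metis
  define ne where "ne = n + fst y"
  define ea where "ea = map (\<lambda>(S, xs). (S, map (\<lambda>i. GE i 0) xs)) (snd y)"
  define ta where "ta R = map (\<lambda>(S, xs). (S, map (tuple_garg n (the (L' R))) xs)) (snd (z R))" for R
  let ?D = "with_eq q B"
  have garg: "tuple_garg n r i \<in> {GE k j |k j. k < ne \<and> j < r} \<union> GW ` {..<w}" if "i < r * n + w" for i r w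
    using that n by (auto simp: tuple_garg_def ne_def div_less_iff_less_mult intro: trans_less_add1)
  interpret gadget "L(q \<mapsto> 2)" L' "[]" "[]" ne ea "\<lambda>R. fst (z R)" ta
  proof unfold_locales
    show "finite (dom (L(q \<mapsto> 2)))" using fin_struct_finite[OF B] by simp
    show "(L(q \<mapsto> 2)) S = Some (length args) \<and> set args \<subseteq> GC ` set [] \<union> {GE k 0 |k. k < ne}" if prem: "(S, args) \<in> set ea" for S args
    proof -
      obtain xs where xs: "(S, xs) \<in> set (snd y)" "args = map (\<lambda>i. GE i 0) xs" using prem by (auto simp: ea_def)
      then show ?thesis using presentsD(1)[OF y xs(1)] by (auto simp: ne_def)
    qed
    show "(L(q \<mapsto> 2)) S = Some (length args) \<and> set args \<subseteq> GC ` set [] \<union> {GE k j |k j. k < ne \<and> j < r} \<union> GW ` {..<fst (z R)}"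
      if prem: "L' R = Some r" "(S, args) \<in> set (ta R)" for R r S args
    proof -
      obtain xs where xs: "(S, xs) \<in> set (snd (z R))" "args = map (tuple_garg n r) xs" using prem by (auto simp: ta_def)
      have S: "(L(q \<mapsto> 2)) S = Some (length xs) \<and> set xs \<subseteq> {..<r * n + fst (z R)}"
        using presentsD(1)[OF z[OF domI[of L' R r, OF prem(1)]] xs(1)] prem(1) by auto
      have sub: "set args \<subseteq> {GE k j |k j. k < ne \<and> j < r} \<union> GW ` {..<fst (z R)}" unfolding xs(2) set_map
      proof (rule image_subsetI)
        fix i assume "i \<in> set xs"
        then have "i < r * n + fst (z R)" using S by auto
        then show "tuple_garg n r i \<in> {GE k j |k j. k < ne \<and> j < r} \<union> GW ` {..<fst (z R)}" by (rule garg)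
      qed
      have "(L(q \<mapsto> 2)) S = Some (length args)" unfolding xs(2) length_map using S by (rule conjunct1)
      moreover have "set args \<subseteq> GC ` set [] \<union> {GE k j |k j. k < ne \<and> j < r} \<union> GW ` {..<fst (z R)}"
        using sub by (simp only: list.set image_empty Un_empty_left)
      ultimately show ?thesis by (rule conjI)
    qed
  qed simp
  \<comment> \<open>One preimage is fixed for each element of \<open>B'\<close>. This makes the
    coordinates at an element of \<open>A\<close> a function of the value there, as locality
    demands.\<close>
  define pre where "pre b = (SOME xs. f xs = Some b)" for b
  have pre: "f (pre b) = Some b" if "b \<in> univ B'" for b
  proof -
    have "\<exists>xs. f xs = Some b" using that f(2) by (auto simp: ran_def)
    then show ?thesis unfolding pre_def by (rule someI_ex)
  qed
  have pre_len: "length (pre b) = n" if "b \<in> univ B'" for b using pre[OF that] f(1) by (auto simp: tuples_def)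
  \<comment> \<open>The coordinates of the chosen preimage are extended by witnesses for its
    membership in \<open>dom f\<close>.\<close>
  have "\<forall>b. \<exists>v. b \<in> univ B' \<longrightarrow> (\<forall>i<n. v i = pre b ! i) \<and> (\<forall>i<ne. v i \<in> univ B) \<and> holds ?D v (snd y)"
    unfolding ne_def using presentsD(3)[OF y] pre by blast
  then obtain vd where vd: "\<And>b. b \<in> univ B' \<Longrightarrow> (\<forall>i<n. vd b i = pre b ! i) \<and> (\<forall>i<ne. vd b i \<in> univ B) \<and> holds ?D (vd b) (snd y)"
    by metis
  have con: "concat (map pre bs) \<in> preimage f (rel B' R)" if "bs \<in> rel B' R" for R bs
  proof -
    have "set bs \<subseteq> univ B'" using fin_struct_relD[OF B' that] by simp
    then have "map f (map pre bs) = map Some bs" using pre by auto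
    then show ?thesis using that unfolding preimage_def by blast
  qed
  have dom: "R \<in> dom L' \<and> the (L' R) = length bs \<and> set bs \<subseteq> univ B'" if "bs \<in> rel B' R" for R bs using fin_struct_relD[OF B' that] by auto
  \<comment> \<open>These witnesses depend on the values at all entries of a tuple, which is why the
    name of a witness contains the whole tuple.\<close>
  define vt where "vt R bs = (SOME v. (\<forall>i<length bs * n. v i = concat (map pre bs) ! i) \<and>
    (\<forall>i<length bs * n + fst (z R). v i \<in> univ B) \<and> holds ?D v (snd (z R)))" for R bs
  have vt: "(\<forall>i<length bs * n. vt R bs i = concat (map pre bs) ! i) \<and>
    (\<forall>i<length bs * n + fst (z R). vt R bs i \<in> univ B) \<and> holds ?D (vt R bs) (snd (z R))"
    if bs: "bs \<in> rel B' R" for R bs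
  proof -
    have "\<exists>v. (\<forall>i<length bs * n. v i = concat (map pre bs) ! i) \<and>
      (\<forall>i<length bs * n + fst (z R). v i \<in> univ B) \<and> holds ?D v (snd (z R))"
      using presentsD(3)[OF z[OF conjunct1[OF dom[OF bs]]] con[OF bs]] dom[OF bs] by simp
    from someI_ex[OF this] show ?thesis unfolding vt_def .
  qed
  have "gadget_reduction (L(q \<mapsto> 2)) L' [] [] ne ea (\<lambda>R. fst (z R)) ta ?D B' id (\<lambda>k b. vd b k) (\<lambda>R k bs. vt R bs (length bs * n + k))"
    (is "gadget_reduction _ _ _ _ _ _ _ _ _ _ _ ?ve ?vw")
  proof unfold_locales
    show "fin_struct (L(q \<mapsto> 2)) ?D" by (rule fin_with_eq[OF B q])
    show "fin_struct L' B'" by (rule B')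
    show "vd b k \<in> univ ?D" if "k < ne" "b \<in> univ B'" for k b using vd[OF that(2)] that(1) by simp
    show "vt R bs (length bs * n + k) \<in> univ ?D" if "k < fst (z R)" "bs \<in> rel B' R" for R k bs
      using vt[OF that(2)] that(1) by simp
    show "map (gsem id ?ve ?vw 0 [b]) args \<in> rel ?D S" if prem: "(S, args) \<in> set ea" "b \<in> univ B'" for S args b
    proof -
      obtain xs where xs: "(S, xs) \<in> set (snd y)" "args = map (\<lambda>i. GE i 0) xs" using prem(1) by (auto simp: ea_def)
      have "map (vd b) xs \<in> rel ?D S" using vd[OF prem(2)] xs(1) by (auto simp: holds_def)
      then show ?thesis by (simp add: xs(2) comp_def)
    qed
    show "map (gsem id ?ve ?vw R bs) args \<in> rel ?D S" if prem: "(S, args) \<in> set (ta R)" "bs \<in> rel B' R" for S args R bs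
    proof -
      note r = dom[OF prem(2)]
      obtain xs where xs: "(S, xs) \<in> set (snd (z R))" "args = map (tuple_garg n (length bs)) xs"
        using prem(1) r by (auto simp: ta_def)
      have lt: "set xs \<subseteq> {..<length bs * n + fst (z R)}" using presentsD(1)[OF z xs(1)] r by auto
      have "gsem id ?ve ?vw R bs (tuple_garg n (length bs) i) = vt R bs i" if i: "i < length bs * n + fst (z R)" for i
      proof (cases "i < length bs * n")
        case True
        then have j: "i div n < length bs" using n by (simp add: div_less_iff_less_mult)
        then have b: "bs ! (i div n) \<in> univ B'" using r by auto
        have "concat (map pre bs) ! i = pre (bs ! (i div n)) ! (i mod n)"
          using concat_equal_length(2)[of "map pre bs" n i] True j r pre_len by auto
        then show ?thesis using True vt[OF prem(2)] vd[OF b] n by (simp add: tuple_garg_def)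
      next
        case False
        then show ?thesis by (simp add: tuple_garg_def)
      qed
      then have "map (gsem id ?ve ?vw R bs) args = map (vt R bs) xs" using lt by (auto simp: xs(2))
      moreover have "map (vt R bs) xs \<in> rel ?D S" using vt[OF prem(2)] xs(1) by (auto simp: holds_def)
      ultimately show ?thesis by simp
    qed
    show "maps_to A B'" if A: "fin_struct L' A" and m: "maps_to (build A) ?D" for A
    proof -
      obtain H where H: "is_hom H (build A) ?D" using m by (auto simp: maps_to_def)
      define tp where "tp a = map (\<lambda>i. H (name [1, i, a])) [0..<n]" for a
      have tp: "tp a \<in> dom f" if a: "a \<in> univ A" for a unfolding tp_def
      proof (rule presentsD(2)[OF y])
        show "H (name [1, i, a]) \<in> univ B" if "i < n + fst y" for i using hom_copy[OF H, of i a] that a by (simp add: ne_def)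
        show "holds ?D (\<lambda>i. H (name [1, i, a])) (snd y)" unfolding holds_def
        proof (clarify)
          fix S xs assume "(S, xs) \<in> set (snd y)"
          then have "(S, map (\<lambda>i. GE i 0) xs) \<in> set ea" by (force simp: ea_def)
          from hom_ea[OF H this a] show "map (\<lambda>i. H (name [1, i, a])) xs \<in> rel ?D S" by (simp add: comp_def)
        qed
      qed
      define h where "h a = the (f (tp a))" for a
      have fh: "f (tp a) = Some (h a)" if "a \<in> univ A" for a using tp[OF that] by (auto simp: h_def)
      have "is_hom h A B'" unfolding is_hom_def
      proof (intro conjI allI ballI)
        show "h ` univ A \<subseteq> univ B'" using fh f(2) by (auto intro: ranI)
        fix R t assume t: "t \<in> rel A R"
        have r: "L' R = Some (length t)" "R \<in> dom L'" "set t \<subseteq> univ A" using fin_struct_relD[OF A t] by auto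
        let ?v = "\<lambda>i. H (name (gname R t (tuple_garg n (length t) i)))"
        have "map ?v [0..<the (L' R) * n] \<in> preimage f (rel B' R)"
        proof (rule presentsD(2)[OF z[OF r(2)]])
          show "?v i \<in> univ B" if i: "i < the (L' R) * n + fst (z R)" for i
          proof (cases "i < length t * n")
            case True
            then have j: "i div n < length t" "i mod n < ne" using n by (auto simp: div_less_iff_less_mult ne_def intro: trans_less_add1)
            then have "t ! (i div n) \<in> univ A" using r by auto
            then show ?thesis using hom_copy[OF H j(2)] True by (simp add: tuple_garg_def)
          next
            case False
            then have "2 # (i - length t * n) # R # t \<in> names A" using i r t by (auto simp: names_def)
            from hom_names[OF H this] show ?thesis using False by (simp add: tuple_garg_def)
          qed
          show "holds ?D ?v (snd (z R))" unfolding holds_def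
          proof (clarify)
            fix S xs assume "(S, xs) \<in> set (snd (z R))"
            then have "(S, map (tuple_garg n (length t)) xs) \<in> set (ta R)" using r by (force simp: ta_def)
            from hom_ta[OF H this r(2) t] show "map ?v xs \<in> rel ?D S" by (simp add: comp_def)
          qed
        qed
        moreover have "map ?v [0..<length t * n] = concat (map tp t)"
        proof (rule nth_equalityI)
          have len: "\<forall>xs\<in>set (map tp t). length xs = n" by (auto simp: tp_def)
          show l: "length (map ?v [0..<length t * n]) = length (concat (map tp t))" using concat_equal_length(1)[OF len] by simp
          fix i assume "i < length (map ?v [0..<length t * n])"
          then have i: "i < length t * n" by simp
          then have "i div n < length t" using n by (simp add: div_less_iff_less_mult)
          then show "map ?v [0..<length t * n] ! i = concat (map tp t) ! i"
            using concat_equal_length(2)[OF len, of i] i n by (simp add: tuple_garg_def tp_def)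
        qed
        ultimately have "concat (map tp t) \<in> preimage f (rel B' R)" using r(1) by simp
        then obtain xss s where xss: "concat (map tp t) = concat xss" "s \<in> rel B' R" "map f xss = map Some s"
          unfolding preimage_def by blast
        have "length s = length t" using dom[OF xss(2)] r(1) by simp
        moreover have "length xss = length s" using arg_cong[OF xss(3), of length] by simp
        moreover have "length xs = n" if "xs \<in> set xss" for xs
        proof -
          have "f xs \<in> set (map Some s)" using that unfolding xss(3)[symmetric] by simp
          then have "xs \<in> dom f" by auto
          then show ?thesis using f(1) by (auto simp: tuples_def)
        qed
        \<comment> \<open>The preimage relates concatenations only. As all blocks have length
          \<open>n\<close>, a concatenation can be split in just one way.\<close>
        ultimately have "xss = map tp t"
        proof -
          assume a: "length s = length t" "length xss = length s" "\<And>xs. xs \<in> set xss \<Longrightarrow> length xs = n"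
          have "\<forall>(x, w)\<in>set (zip (map tp t) xss). length x = length w"
          proof clarify
            fix x w assume "(x, w) \<in> set (zip (map tp t) xss)"
            then have "x \<in> set (map tp t)" "w \<in> set xss" by (auto dest: set_zip_leftD set_zip_rightD)
            then show "length x = length w" using a(3) by (auto simp: tp_def)
          qed
          then show ?thesis using xss(1) a concat_eq_concat_iff[of "map tp t" xss] by simp
        qed
        moreover have "map f (map tp t) = map Some (map h t)" using fh r(3) by auto
        ultimately have "map Some s = map Some (map h t)" using xss(3) by (simp only:)
        then have "s = map h t" by (rule map_injective) simp
        then show "map h t \<in> rel B' R" using xss(2) by simp
      qed
      then show ?thesis by (auto simp: maps_to_def)
    qed
  qed simp_all
  from reduces_gadget[OF this B q] show ?thesis .
qed

section \<open>Sequences of constructions\<close>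

lemma reduces_construction:
  assumes "construction (M, D) (L', B')" and D: "fin_struct M D"
  shows "fin_struct L' B' \<and> reduces (L', B') (M, D)"
  using assms(1)
proof (cases rule: construction.cases)
  case pp_interpretation
  then show ?thesis using reduces_pp_interpretation[OF D] by blast
next
  case hom_equivalence
  then show ?thesis using reduces_hom_equiv[OF D] by blast
next
  case (constants p)
  then show ?thesis using reduces_constants[OF D] fin_expand[OF D] by blast
qed

lemma reduces_constructions:
  assumes "construction\<^sup>*\<^sup>* (L, B) X" and B: "fin_struct L B"
  shows "fin_struct (fst X) (snd X) \<and> reduces X (L, B)"
  using assms(1)
proof (induction rule: rtranclp_induct)
  case base
  \<comment> \<open>Even the empty sequence needs a transfer of refutations, since the two encodings
    of the same problem may differ. The homomorphic equivalence of \<open>B\<close> with itself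
    provides it.\<close>
  have "is_hom (\<lambda>x. x) B B" by (auto simp: is_hom_def)
  then have "hom_equiv B B" by (auto simp: hom_equiv_def maps_to_def)
  then show ?case using reduces_hom_equiv[OF B B] B by simp
next
  case (step Y Z)
  obtain M D L' B' where YZ: "Y = (M, D)" "Z = (L', B')" by (cases Y, cases Z)
  have D: "fin_struct M D" "reduces (M, D) (L, B)" using step.IH YZ by auto
  have "fin_struct L' B'" "reduces (L', B') (M, D)" using reduces_construction[OF step.hyps(2)[unfolded YZ] D(1)] by auto
  then show ?case using reduces_trans[OF _ D(2) fin_struct_finite(2)[OF D(1)]] YZ by auto
qed

text \<open>Only the factor \<open>(n + 1) ^ b\<close> has to be expanded, by the binomial theorem;
  the other two variables occur with exponent \<open>b\<close> alone.\<close>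

lemma size_bound_poly3: "\<exists>q. \<forall>k s n. size_bound b k s n = poly3 b q (2 ^ k) s n"
proof -
  let ?q = "\<lambda>i j l. if i = b \<and> j = b then b ^ b * (b choose l) else 0"
  have "size_bound b k s n = poly3 b ?q (2 ^ k) s n" for k s n
  proof -
    let ?X = "b ^ b * (2 ^ k) ^ b * s ^ b * (\<Sum>l\<le>b. (b choose l) * n ^ l)"
    have "(\<Sum>l\<le>b. ?q i j l * (2 ^ k) ^ i * s ^ j * n ^ l) = (if i = b then if j = b then ?X else 0 else 0)" for i j
      by (auto simp: sum_distrib_left algebra_simps)
    then have "poly3 b ?q (2 ^ k) s n = (\<Sum>i\<le>b. \<Sum>j\<le>b. if i = b then if j = b then ?X else 0 else 0)"
      unfolding poly3_def by simp
    also have "\<dots> = (\<Sum>i\<le>b. if i = b then ?X else 0)" by (intro sum.cong refl) simp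
    also have "\<dots> = ?X" by simp
    also have "(\<Sum>l\<le>b. (b choose l) * n ^ l) = (n + 1) ^ b" using binomial_ring[of n 1 b] by simp
    finally show ?thesis by (simp only: size_bound_def power_mult_distrib)
  qed
  then show ?thesis by blast
qed

theorem theorem4p1:
  fixes L L' :: vocabulary and B B' :: "nat struct"
  assumes "fin_struct L B" and "fin_struct L' B'"
    and "construction\<^sup>*\<^sup>* (L, B) (L', B')"
  shows "\<exists>F :: nat struct \<Rightarrow> nat struct.
    poly_time_map L' L F \<and>
    (\<forall>A. fin_struct L' A \<longrightarrow> fin_struct L (F A)) \<and>
    (\<exists>c d. \<forall>A. fin_struct L' A \<longrightarrow> struct_size L (F A) \<le> c * struct_size L' A + d) \<and>
    (\<forall>A. fin_struct L' A \<longrightarrow> (maps_to (F A) B \<longleftrightarrow> maps_to A B')) \<and>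
    (\<forall>E E'. encoding_scheme L B E \<and> local_scheme L E \<and>
            encoding_scheme L' B' E' \<and> local_scheme L' E' \<longrightarrow>
      (\<exists>p :: nat poly. \<exists>d q. \<forall>t k s A.
         t \<ge> 1 \<and> k \<ge> 1 \<and> s \<ge> 1 \<and> fin_struct L' A \<and>
         (\<exists>\<pi>. bounded_refutation (E (F A)) t k s \<pi>) \<longrightarrow>
         (\<exists>\<pi>' s'. s' \<le> poly3 d q (2 ^ k) s (struct_size L' A) \<and>
                  bounded_refutation (E' A) t (poly p k) s' \<pi>')))"
proof -
  have "reduces (L', B') (L, B)" using reduces_constructions[OF assms(3,1)] by simp
  then obtain F where FF: "pt_map L' L F \<and> (\<forall>A. fin_struct L' A \<longrightarrow> fin_struct L (F A)) \<and>
    (\<exists>c d. \<forall>A. fin_struct L' A \<longrightarrow> struct_size L (F A) \<le> c * struct_size L' A + d) \<and>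
    (\<forall>A. fin_struct L' A \<longrightarrow> (maps_to (F A) B \<longleftrightarrow> maps_to A B')) \<and>
    (\<forall>E E'. encoding_scheme L B E \<and> local_scheme L E \<and> encoding_scheme L' B' E' \<and> local_scheme L' E' \<longrightarrow>
        refutation_transfer L' E E' F)"
    unfolding reduces_def prod.case by (elim exE) (rule that)
  note F = conjunct1[OF FF] conjunct2[OF FF]
  note F = F(1) conjunct1[OF F(2)] conjunct2[OF F(2)]
  note F = F(1,2) conjunct1[OF F(3)] conjunct2[OF F(3)]
  note tr = conjunct2[OF F(4)]
  note F = F(1-3) conjunct1[OF F(4)]
  show ?thesis
  proof (intro exI[of _ F] conjI allI impI)
    fix E E' :: "nat struct \<Rightarrow> (nat \<times> nat) clause set"
    assume "encoding_scheme L B E \<and> local_scheme L E \<and> encoding_scheme L' B' E' \<and> local_scheme L' E'"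
    then have "refutation_transfer L' E E' F" using tr by blast
    then obtain c b where cb: "\<forall>A t k s \<pi>. fin_struct L' A \<and> 1 \<le> t \<and> 1 \<le> k \<and> bounded_refutation (E (F A)) t k s \<pi> \<longrightarrow>
      (\<exists>\<pi>' s'. bounded_refutation (E' A) t (c * k) s' \<pi>' \<and> s' \<le> size_bound b k s (struct_size L' A))"
      unfolding refutation_transfer_def by blast
    obtain q where q: "\<forall>k s n. size_bound b k s n = poly3 b q (2 ^ k) s n" using size_bound_poly3 by blast
    \<comment> \<open>The new bottom fan-in is even linear in \<open>k\<close>, namely
      \<open>c * k\<close>.\<close>
    have pc: "poly [:0, c:] k = c * k" for k by simp
    show "\<exists>p :: nat poly. \<exists>d q. \<forall>t k s A.
         t \<ge> 1 \<and> k \<ge> 1 \<and> s \<ge> 1 \<and> fin_struct L' A \<and> (\<exists>\<pi>. bounded_refutation (E (F A)) t k s \<pi>) \<longrightarrow>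
         (\<exists>\<pi>' s'. s' \<le> poly3 d q (2 ^ k) s (struct_size L' A) \<and> bounded_refutation (E' A) t (poly p k) s' \<pi>')"
    proof (intro exI[of _ "[:0, c:]"] exI[of _ b] exI[of _ q] allI impI, elim conjE exE)
      fix t k s A \<pi>
      assume "1 \<le> t" "1 \<le> k" "fin_struct L' A" "bounded_refutation (E (F A)) t k s \<pi>"
      then have "\<exists>\<pi>' s'. bounded_refutation (E' A) t (c * k) s' \<pi>' \<and> s' \<le> size_bound b k s (struct_size L' A)"
        using cb by blast
      then show "\<exists>\<pi>' s'. s' \<le> poly3 b q (2 ^ k) s (struct_size L' A) \<and> bounded_refutation (E' A) t (poly [:0, c:] k) s' \<pi>'"
        unfolding pc q[rule_format, symmetric] by blast
    qed
  qed (use F pt_map_poly_time in blast)+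
qed

end
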